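(* Fix $m>1$ and $\alpha\in\mathbb{R}$. Then any eigenvalue $\lambda$ of $\mathcal{L}-\alpha\Lambda$ in $L^2_0(m)$ satisfies $$\mathrm{Re}(\lambda)\le\max\Big(-\frac12,\ \frac{1-m}{2}\Big).$$ If moreover $m>2$, then any eigenvalue $\lambda$ of $\mathcal{L}-\alpha\Lambda$ in $L^2_1(m)$ satisfies $$\mathrm{Re}(\lambda)\le\max\Big(-1,\ \frac{1-m}{2}\Big).$$
   Context: Functions are complex-valued here. For $m\ge0$, $L^2(m)=\{f\in L^2(\mathbb{R}^2):\|f\|_m<\infty\}$ with $\|f\|_m=\big(\int_{\mathbb{R}^2}(1+|\xi|^2)^m|f(\xi)|^2\,d\xi\big)^{1/2}$. For $m>1$, $L^2_0(m)=\{w\in L^2(m):\int_{\mathbb{R}^2}w\,d\xi=0\}$; for $m>2$, $L^2_1(m)=\{w\in L^2_0(m):\int_{\mathbb{R}^2}\xi_jw(\xi)\,d\xi=0,\ j=1,2\}$. $\mathcal{L}w=\Delta w+\frac12\xi\cdot\nabla w+w$, with domain $\mathcal{D}_m(\mathcal{L})=\{w\in L^2(m):\Delta w+\frac12\xi\cdot\nabla w\in L^2(m)\}$ in $L^2(m)$. With $\xi^\perp=(-\xi_2,\xi_1)$, $$G(\xi)=\frac{1}{4\pi}e^{-|\xi|^2/4},\quad \mathbf{v}^G(\xi)=\frac{1}{2\pi}\frac{\xi^\perp}{|\xi|^2}\big(1-e^{-|\xi|^2/4}\big),\quad \Lambda w=\mathbf{v}^G\cdot\nabla w+\mathbf{v}\cdot\nabla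 G,$$ where $\mathbf{v}(\xi)=\frac{1}{2\pi}\int_{\mathbb{R}^2}\frac{(\xi-\eta)^\perp}{|\xi-\eta|^2}w(\eta)\,d\eta$ is the velocity field associated with $w$. An eigenvalue of $\mathcal{L}-\alpha\Lambda$ in $L^2_i(m)$ ($i=0,1$) is a $\lambda\in\mathbb{C}$ for which there exists a nonzero $w\in\mathcal{D}_m(\mathcal{L})\cap L^2_i(m)$ with $(\mathcal{L}-\alpha\Lambda)w=\lambda w$. *)

theory Defs
  imports "HOL-Analysis.Analysis"
begin

text \<open>
  Elements of \<open>L\<^sup>2(m)\<close> are represented by Lebesgue measurable functions; they are identified when equal
  almost everywhere, so ``nonzero'' means not almost everywhere zero.  Since functions in \<open>L\<^sup>2(m)\<close>
  need not be differentiable, all derivatives of such functions are taken in the sense of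
  distributions.
\<close>

definition L2 :: "real \<Rightarrow> (real^2 \<Rightarrow> complex) set" where
  "L2 m = {f. f \<in> borel_measurable lebesgue \<and>
              integrable lebesgue (\<lambda>\<xi>. (cmod (f \<xi>))\<^sup>2) \<and>
              integrable lebesgue (\<lambda>\<xi>. (1 + (norm \<xi>)\<^sup>2) powr m * (cmod (f \<xi>))\<^sup>2)}"

definition L2_0 :: "real \<Rightarrow> (real^2 \<Rightarrow> complex) set" where
  "L2_0 m = {w \<in> L2 m. (LINT \<xi>|lebesgue. w \<xi>) = 0}"

definition L2_1 :: "real \<Rightarrow> (real^2 \<Rightarrow> complex) set" where
  "L2_1 m = {w \<in> L2_0 m. \<forall>j. (LINT \<xi>|lebesgue. complex_of_real (\<xi> $ j) * w \<xi>) = 0}"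

definition pderiv_at :: "2 \<Rightarrow> (real^2 \<Rightarrow> 'a::real_normed_vector) \<Rightarrow> real^2 \<Rightarrow> 'a" where
  "pderiv_at j f \<xi> = frechet_derivative f (at \<xi>) (axis j 1)"

primrec iter_pderiv :: "2 list \<Rightarrow> (real^2 \<Rightarrow> complex) \<Rightarrow> real^2 \<Rightarrow> complex" where
  "iter_pderiv [] f = f"
| "iter_pderiv (j # js) f = pderiv_at j (iter_pderiv js f)"

text \<open>
  Requiring every iterated partial derivative to be (Frechet) differentiable everywhere, hence
  continuous, is the same as being of class \<open>C\<^sup>\<infinity>\<close>.
\<close>

definition smooth :: "(real^2 \<Rightarrow> complex) \<Rightarrow> bool" where
  "smooth f \<longleftrightarrow> (\<forall>js \<xi>. iter_pderiv js f differentiable (at \<xi>))"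

definition test_function :: "(real^2 \<Rightarrow> complex) \<Rightarrow> bool" where
  "test_function \<phi> \<longleftrightarrow> smooth \<phi> \<and> compact (closure {\<xi>. \<phi> \<xi> \<noteq> 0})"

text \<open>
  A distribution is represented by its action on test functions (values elsewhere are irrelevant,
  see \<open>distr_eq\<close>).  The pairing is bilinear: no complex conjugation is involved.
\<close>

type_synonym distr = "(real^2 \<Rightarrow> complex) \<Rightarrow> complex"

definition distr_eq :: "distr \<Rightarrow> distr \<Rightarrow> bool" where
  "distr_eq S T \<longleftrightarrow> (\<forall>\<phi>. test_function \<phi> \<longrightarrow> S \<phi> = T \<phi>)"

definition distr_of :: "(real^2 \<Rightarrow> complex) \<Rightarrow> distr" where
  "distr_of f \<phi> = (LINT \<xi>|lebesgue. f \<xi> * \<phi> \<xi>)"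

definition distr_pderiv :: "2 \<Rightarrow> distr \<Rightarrow> distr" where
  "distr_pderiv j T \<phi> = - T (pderiv_at j \<phi>)"

text \<open>Multiplication by a real function \<open>a\<close>; it is only used for \<open>a\<close> of class \<open>C\<^sup>\<infinity>\<close>.\<close>

definition distr_mult :: "(real^2 \<Rightarrow> real) \<Rightarrow> distr \<Rightarrow> distr" where
  "distr_mult a T \<phi> = T (\<lambda>\<xi>. complex_of_real (a \<xi>) * \<phi> \<xi>)"

definition distr_laplacian :: "distr \<Rightarrow> distr" where
  "distr_laplacian T \<phi> = (\<Sum>j\<in>UNIV. distr_pderiv j (distr_pderiv j T) \<phi>)"

text \<open>The first-order term \<open>b \<cdot> \<nabla>T\<close> for a smooth real vector field \<open>b\<close>.\<close>

definition distr_advect :: "(real^2 \<Rightarrow> real^2) \<Rightarrow> distr \<Rightarrow> distr" where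
  "distr_advect b T \<phi> = (\<Sum>j\<in>UNIV. distr_mult (\<lambda>\<xi>. b \<xi> $ j) (distr_pderiv j T) \<phi>)"

definition perp :: "real^2 \<Rightarrow> real^2" where
  "perp \<xi> = vector [- (\<xi> $ 2), \<xi> $ 1]"

definition gauss :: "real^2 \<Rightarrow> real" where
  "gauss \<xi> = 1 / (4 * pi) * exp (- (norm \<xi>)\<^sup>2 / 4)"

text \<open>
  At the origin division by zero yields the value \<open>0\<close>.  This is immaterial for the convolution
  defining the velocity, and for \<open>v_gauss\<close> it is the value of the smooth extension.
\<close>

definition biot_savart_kernel :: "real^2 \<Rightarrow> real^2" where
  "biot_savart_kernel \<xi> = (1 / (2 * pi)) *\<^sub>R (perp \<xi> /\<^sub>R (norm \<xi>)\<^sup>2)"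

definition v_gauss :: "real^2 \<Rightarrow> real^2" where
  "v_gauss \<xi> = (1 - exp (- (norm \<xi>)\<^sup>2 / 4)) *\<^sub>R biot_savart_kernel \<xi>"

definition velocity :: "(real^2 \<Rightarrow> complex) \<Rightarrow> real^2 \<Rightarrow> complex^2" where
  "velocity w \<xi> =
     (\<chi> j. LINT \<eta>|lebesgue. complex_of_real (biot_savart_kernel (\<xi> - \<eta>) $ j) * w \<eta>)"

text \<open>\<open>\<Delta>w + (1/2) \<xi> \<cdot> \<nabla>w\<close>\<close>

definition diffusion_drift :: "(real^2 \<Rightarrow> complex) \<Rightarrow> distr" where
  "diffusion_drift w \<phi> =
     distr_laplacian (distr_of w) \<phi> + 1 / 2 * distr_advect (\<lambda>\<xi>. \<xi>) (distr_of w) \<phi>"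

definition op_L :: "(real^2 \<Rightarrow> complex) \<Rightarrow> distr" where
  "op_L w \<phi> = diffusion_drift w \<phi> + distr_of w \<phi>"

definition dom_L :: "real \<Rightarrow> (real^2 \<Rightarrow> complex) set" where
  "dom_L m = {w \<in> L2 m. \<exists>g \<in> L2 m. distr_eq (diffusion_drift w) (distr_of g)}"

definition op_Lambda :: "(real^2 \<Rightarrow> complex) \<Rightarrow> distr" where
  "op_Lambda w \<phi> =
     distr_advect v_gauss (distr_of w) \<phi> +
     distr_of (\<lambda>\<xi>. \<Sum>j\<in>UNIV. velocity w \<xi> $ j * complex_of_real (pderiv_at j gauss \<xi>)) \<phi>"

definition is_eigenvalue ::
    "real \<Rightarrow> real \<Rightarrow> (real^2 \<Rightarrow> complex) set \<Rightarrow> complex \<Rightarrow> bool" where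
  "is_eigenvalue m \<alpha> X \<mu> \<longleftrightarrow>
     (\<exists>w \<in> dom_L m \<inter> X. \<not> (AE \<xi> in lebesgue. w \<xi> = 0) \<and>
        distr_eq (\<lambda>\<phi>. op_L w \<phi> - complex_of_real \<alpha> * op_Lambda w \<phi>)
                 (\<lambda>\<phi>. \<mu> * distr_of w \<phi>))"

end

theory Submission
  imports Defs "HOL-Real_Asymp.Real_Asymp"
begin

text \<open>
  Let \<open>w\<close> be an eigenfunction with \<open>Re \<mu> > (1 - m) / 2\<close>.  Energy estimates for the mollified
  equation with radial weights that truncate \<open>(1 + |x|\<^sup>2) powr (m / 2) exp (|x|\<^sup>2 / 8)\<close> improve the decay of
  \<open>w\<close> up to that full weight; the nonlocal term is
  harmless because it carries a Gaussian factor.  Hence \<open>W = w / sqrt gauss\<close> lies in \<open>L\<^sup>2\<close>, the space in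
  which \<open>\<L>\<close> is self-adjoint with the Hermite functions as eigenvectors (eigenvalue
  \<open>- (\<nu>\<^sub>1 + \<nu>\<^sub>2) / 2\<close>), while both terms of \<open>\<Lambda>\<close> are antisymmetric: the advection because the vortex
  field is divergence free and tangential to circles, the nonlocal one because \<open>x \<cdot> K(x - y)\<close> is an
  antisymmetric kernel for the Biot--Savart kernel \<open>K\<close>.  The vanishing moments remove the Hermite
  functions of degree \<open>< k\<close> (with \<open>k = 1\<close> or \<open>k = 2\<close>), so the real part of the pairing of the equation
  with \<open>W\<close> gives \<open>Re \<mu> \<le> - k / 2\<close>.  The pairing is carried out with Hermite partial sums, which
  avoids any regularity of \<open>w\<close>.
\<close>

section \<open>Functions with continuous gradient, and bump functions\<close>

text \<open>With s = |x|^2 and a radial weight F of gradient x F y, the energy inequality has the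
  zeroth-order coefficient s y (y - 1/2) + 1/2, free of \<alpha>. For F = (1 + s) powr (m / 2) it
  tends to (1 - m) / 2 at infinity, the second entry of the maximum: above this value the far field
  is controlled by the mass in a disc. For F = exp (c s) the rate is y = 2 c, and c = 1/8 gives y =
  1/4, where the coefficient is smallest; it is also the exponent of 1 / sqrt gauss, so the weight
  reached is the one that puts W into L2.

  In the last stage the obstacle is that nothing is known about the gradient of W. The advection is
  antisymmetric on a partial sum S, but the equation pairs W with the advection of S. This leaves an
  error of order d sqrt (2 D), with d the L2 distance from S to W and D the Dirichlet energy of S.
  No bound on D is available in advance; the term - D on the same side of the inequality absorbs the
  error once d < 1. The nonlocal form vanishes on W itself, and there the error is a constant times
  d.\<close>

definition has_gradient ::
    "(real^2 \<Rightarrow> 'a::real_normed_field) \<Rightarrow> (2 \<Rightarrow> real^2 \<Rightarrow> 'a) \<Rightarrow> bool" where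
  "has_gradient f f' \<longleftrightarrow>
     (\<forall>x. (f has_derivative (\<lambda>h. \<Sum>j\<in>UNIV. h $ j *\<^sub>R f' j x)) (at x)) \<and>
     (\<forall>j. continuous_on UNIV (f' j))"

lemma has_gradientD:
  assumes "has_gradient f f'"
  shows "(f has_derivative (\<lambda>h. \<Sum>j\<in>UNIV. h $ j *\<^sub>R f' j x)) (at x)"
    and "continuous_on UNIV (f' j)" and "continuous_on UNIV f"
  using assms
  by (auto simp: has_gradient_def continuous_on_eq_continuous_at intro!: has_derivative_continuous)

lemma has_gradient_cong:
  assumes "has_gradient f f'" "\<And>x. f x = g x" "\<And>j x. f' j x = g' j x"
  shows "has_gradient g g'"
proof -
  have "f = g" "f' = g'" using assms(2,3) by (auto simp: fun_eq_iff)
  with assms(1) show ?thesis by simp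
qed

lemma has_gradient_borel [measurable]:
  assumes "has_gradient f f'"
  shows "f \<in> borel_measurable borel" "f' j \<in> borel_measurable borel"
  using has_gradientD(2,3)[OF assms] by (auto intro: borel_measurable_continuous_onI)

lemma axis_1_nth: "axis j 1 $ i = (if i = j then 1 else (0::real))"
  by (auto simp: axis_def)

text \<open>Frechet derivatives are unique, so an explicitly computed gradient is the one that
  \<open>pderiv_at\<close> selects. This is how the distributional definitions get evaluated on
  concrete test functions.\<close>

lemma has_gradient_pderiv_at:
  assumes "has_gradient f f'"
  shows "pderiv_at j f = f' j"
proof
  fix x
  have "frechet_derivative f (at x) = (\<lambda>h. \<Sum>j\<in>UNIV. h $ j *\<^sub>R f' j x)"
    using frechet_derivative_at[OF has_gradientD(1)[OF assms]] by simp
  then show "pderiv_at j f x = f' j x"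
    by (simp add: pderiv_at_def axis_1_nth if_distrib if_distribR sum.delta cong: if_cong)
qed

lemma has_gradient_const [intro]: "has_gradient (\<lambda>x. c) (\<lambda>j x. 0)"
  by (auto simp: has_gradient_def)

lemma has_gradient_coord [intro]:
  "has_gradient (\<lambda>x. of_real (x $ i)) (\<lambda>j x. if j = i then 1 else 0)"
proof -
  have "((\<lambda>x::real^2. of_real (x $ i) :: 'a) has_derivative (\<lambda>h. of_real (h $ i))) (at x)" for x
    by (rule bounded_linear.has_derivative[OF bounded_linear_of_real])
      (rule bounded_linear_imp_has_derivative, rule bounded_linear_vec_nth)
  moreover have "(\<Sum>j\<in>UNIV. h $ j *\<^sub>R (if j = i then 1 else 0)) = (of_real (h $ i) :: 'a)" for h :: "real^2"
    by (simp add: if_distrib sum.delta of_real_def cong: if_cong)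
  ultimately show ?thesis
    by (auto simp: has_gradient_def)
qed

lemma has_gradient_add [intro]:
  assumes "has_gradient f f'" "has_gradient g g'"
  shows "has_gradient (\<lambda>x. f x + g x) (\<lambda>j x. f' j x + g' j x)"
proof -
  have "((\<lambda>x. f x + g x) has_derivative (\<lambda>h. \<Sum>j\<in>UNIV. h $ j *\<^sub>R (f' j x + g' j x))) (at x)" for x
    using has_derivative_add[OF has_gradientD(1)[OF assms(1)] has_gradientD(1)[OF assms(2)], of x]
    by (simp add: scaleR_add_right sum.distrib)
  then show ?thesis
    using assms by (auto simp: has_gradient_def intro!: continuous_intros)
qed

lemma has_gradient_mult [intro]:
  assumes "has_gradient f f'" "has_gradient g g'"
  shows "has_gradient (\<lambda>x. f x * g x) (\<lambda>j x. f' j x * g x + f x * g' j x)"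
proof -
  have "((\<lambda>x. f x * g x) has_derivative
      (\<lambda>h. \<Sum>j\<in>UNIV. h $ j *\<^sub>R (f' j x * g x + f x * g' j x))) (at x)" for x
    using has_derivative_mult[OF has_gradientD(1)[OF assms(1)] has_gradientD(1)[OF assms(2)], of x]
    by (simp add: scaleR_add_right sum.distrib sum_distrib_left sum_distrib_right add.commute)
  then show ?thesis
    using assms has_gradientD(3)[OF assms(1)] has_gradientD(3)[OF assms(2)]
    by (auto simp: has_gradient_def intro!: continuous_intros)
qed

lemma has_gradient_cmult:
  assumes "has_gradient f f'"
  shows "has_gradient (\<lambda>x. c * f x) (\<lambda>j x. c * f' j x)"
  using has_gradient_mult[OF has_gradient_const assms, of c] by simp

lemma has_gradient_minus:
  assumes "has_gradient f f'"
  shows "has_gradient (\<lambda>x. - f x) (\<lambda>j x. - f' j x)"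
  using has_gradient_cmult[OF assms, of "-1"] by simp

lemma has_gradient_diff:
  assumes "has_gradient f f'" "has_gradient g g'"
  shows "has_gradient (\<lambda>x. f x - g x) (\<lambda>j x. f' j x - g' j x)"
  using has_gradient_add[OF assms(1) has_gradient_minus[OF assms(2)]] by simp

lemma has_gradient_sum:
  assumes "\<And>i. i \<in> I \<Longrightarrow> has_gradient (f i) (f' i)"
  shows "has_gradient (\<lambda>x. \<Sum>i\<in>I. f i x) (\<lambda>j x. \<Sum>i\<in>I. f' i j x)"
  using assms by (induction I rule: infinite_finite_induct) auto

lemma has_gradient_bounded_linear:
  assumes "has_gradient f f'" "bounded_linear T"
  shows "has_gradient (\<lambda>x. T (f x)) (\<lambda>j x. T (f' j x))"
proof -
  interpret bounded_linear T by fact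
  have "((\<lambda>x. T (f x)) has_derivative (\<lambda>h. \<Sum>j\<in>UNIV. h $ j *\<^sub>R T (f' j x))) (at x)" for x
    using has_derivative[OF has_gradientD(1)[OF assms(1)], of x] by (simp add: sum scaleR)
  then show ?thesis
    using assms(1) by (auto simp: has_gradient_def intro!: continuous_on)
qed

lemmas has_gradient_cnj = has_gradient_bounded_linear[OF _ bounded_linear_cnj]
lemmas has_gradient_of_real = has_gradient_bounded_linear[OF _ bounded_linear_of_real]

lemma has_gradient_compose:
  fixes f :: "real^2 \<Rightarrow> real" and g :: "real \<Rightarrow> real"
  assumes f: "has_gradient f f'" and g: "\<And>t. (g has_real_derivative g' t) (at t)"
    and g': "continuous_on UNIV g'"
  shows "has_gradient (\<lambda>x. g (f x)) (\<lambda>j x. g' (f x) * f' j x)"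
proof -
  have "((\<lambda>x. g (f x)) has_derivative (\<lambda>h. \<Sum>j\<in>UNIV. h $ j *\<^sub>R (g' (f x) * f' j x))) (at x)" for x
    using has_derivative_compose[OF has_gradientD(1)[OF f] g[unfolded has_field_derivative_def], of x]
    by (simp add: sum_distrib_left algebra_simps)
  moreover have "continuous_on UNIV (\<lambda>x. g' (f x))"
    using continuous_on_compose[OF has_gradientD(3)[OF f] continuous_on_subset[OF g']]
    by (simp add: comp_def)
  ultimately show ?thesis
    using f by (auto simp: has_gradient_def intro!: continuous_intros)
qed

lemma norm2_sq: "(norm (x::real^2))\<^sup>2 = (x $ 1)\<^sup>2 + (x $ 2)\<^sup>2"
  unfolding power2_norm_eq_inner by (simp add: inner_vec_def sum_2 power2_eq_square)

lemma has_gradient_norm_sq: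
  "has_gradient (\<lambda>x::real^2. (norm x)\<^sup>2) (\<lambda>j x. 2 * x $ j)"
proof -
  have "has_gradient (\<lambda>x::real^2. x $ 1 * x $ 1 + x $ 2 * x $ 2)
     (\<lambda>j x. (if j = 1 then 1 else 0) * x $ 1 + x $ 1 * (if j = 1 then 1 else 0) +
        ((if j = 2 then 1 else 0) * x $ 2 + x $ 2 * (if j = 2 then 1 else 0)))"
    using has_gradient_coord[where 'a=real] by (intro has_gradient_add has_gradient_mult) auto
  then show ?thesis
    by (rule has_gradient_cong) (auto simp: norm2_sq power2_eq_square[where 'a=real, of "_ $ _"], metis exhaust_2)
qed

lemma has_gradient_affine:
  fixes f :: "real^2 \<Rightarrow> 'a::real_normed_field"
  assumes "has_gradient f f'"
  shows "has_gradient (\<lambda>x. f (z + a *\<^sub>R x)) (\<lambda>j x. a *\<^sub>R f' j (z + a *\<^sub>R x))"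
proof -
  have "((\<lambda>x. f (z + a *\<^sub>R x)) has_derivative
     (\<lambda>h. \<Sum>j\<in>UNIV. h $ j *\<^sub>R a *\<^sub>R f' j (z + a *\<^sub>R x))) (at x)" for x
  proof -
    have "((\<lambda>x. z + a *\<^sub>R x) has_derivative (\<lambda>h. a *\<^sub>R h)) (at x)"
      by (auto intro!: derivative_eq_intros)
    from has_derivative_compose[OF this has_gradientD(1)[OF assms]] show ?thesis
      by (simp add: algebra_simps)
  qed
  moreover have "continuous_on UNIV (\<lambda>x. f' j (z + a *\<^sub>R x))" for j
    by (rule continuous_on_compose2[OF has_gradientD(2)[OF assms]]) (auto intro!: continuous_intros)
  ultimately show ?thesis
    by (auto simp: has_gradient_def intro!: continuous_intros)
qed

section \<open>Smooth compactly supported test functions\<close>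

definition bump :: "nat \<Rightarrow> real \<Rightarrow> real" where
  "bump k t = (if t > 0 then exp (- 1 / t) / t ^ k else 0)"

lemma bump_nonneg [simp]: "bump k t \<ge> 0"
  by (simp add: bump_def)



lemma power_le_fact_exp: "(x::real) \<ge> 0 \<Longrightarrow> x ^ n \<le> fact n * exp x"
proof -
  assume x: "x \<ge> 0"
  have "(\<Sum>k\<in>{n}. x ^ k /\<^sub>R fact k) \<le> (\<Sum>k. x ^ k /\<^sub>R fact k)"
    using x by (intro sum_le_suminf summable_exp_generic) auto
  then show ?thesis
    by (simp add: exp_def field_simps)
qed

text \<open>With \<open>x = 1 / t\<close> and \<open>n = k + 2\<close>, the bound
  \<open>x ^ n \<le> fact n * exp x\<close> gains two powers of t beyond those lost to
  \<open>1 / t ^ k\<close>. Quadratic smallness is more than enough for differentiability at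
  0.\<close>

lemma bump_le: "t > 0 \<Longrightarrow> bump k t \<le> fact (k + 2) * t ^ 2"
proof -
  assume t: "t > 0"
  have "(1 / t) ^ (k + 2) \<le> fact (k + 2) * exp (1 / t)"
    using t by (intro power_le_fact_exp) auto
  from mult_right_mono[OF this, of "exp (- (1 / t))"]
  have "exp (- (1 / t)) * (1 / t) ^ (k + 2) \<le> fact (k + 2) * (exp (1 / t) * exp (- (1 / t)))"
    by (simp only: mult_ac exp_ge_zero)
  then have "exp (- (1 / t)) * (1 / t) ^ (k + 2) * t\<^sup>2 \<le> fact (k + 2) * t\<^sup>2"
    by (intro mult_right_mono) (auto simp flip: exp_add)
  moreover have "exp (- (1 / t)) * (1 / t) ^ (k + 2) * t\<^sup>2 = bump k t"
    using t by (simp add: bump_def power_add field_simps power2_eq_square)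
  ultimately show ?thesis by simp
qed

text \<open>The factor \<open>1 / t ^ k\<close> in \<open>bump\<close> is there to close the family
  under differentiation: one derivative, computed for every k, then yields all orders. At the origin
  the difference quotient is at most linear in h by the quadratic bound.\<close>

lemma bump_deriv:
  "(bump k has_real_derivative (bump (k + 2) t - of_nat k * bump (k + 1) t)) (at t)"
proof (cases "t = 0")
  case False
  show ?thesis
  proof (cases "t > 0")
    case True
    have "((\<lambda>t. exp (- 1 / t) / t ^ k) has_real_derivative
       (bump (k + 2) t - of_nat k * bump (k + 1) t)) (at t)"
      using True
      by (auto intro!: derivative_eq_intros simp: bump_def field_simps power2_eq_square)
        (cases k; simp add: field_simps)
    then show ?thesis
      by (rule has_field_derivative_transform_within_open[of _ _ _ "{0<..}"])
        (use True in \<open>auto simp: bump_def\<close>)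
  next
    case False
    with \<open>t \<noteq> 0\<close> have t: "t < 0" by simp
    have "((\<lambda>t. 0) has_real_derivative (bump (k + 2) t - of_nat k * bump (k + 1) t)) (at t)"
      using t by (simp add: bump_def)
    then show ?thesis
      by (rule has_field_derivative_transform_within_open[of _ _ _ "{..<0}"])
        (use t in \<open>auto simp: bump_def\<close>)
  qed
next
  case True
  have "((\<lambda>h. bump k h / h) \<longlongrightarrow> 0) (at 0)"
  proof (rule Lim_null_comparison)
    have "norm (bump k h / h) \<le> fact (k + 2) * \<bar>h\<bar>" for h
    proof (cases "h > 0")
      case True
      then show ?thesis
        using bump_le[OF True, of k] by (simp add: field_simps power2_eq_square)
    next
      case False
      then have "bump k h = 0" by (simp add: bump_def)
      then show ?thesis by simp
    qed
    then show "\<forall>\<^sub>F h in at 0. norm (bump k h / h) \<le> fact (k + 2) * \<bar>h\<bar>"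
      by (rule always_eventually[OF allI])
    show "((\<lambda>h::real. fact (k + 2) * \<bar>h\<bar>) \<longlongrightarrow> 0) (at 0)"
      by (auto intro!: tendsto_eq_intros)
  qed
  then show ?thesis
    using True by (simp add: DERIV_def bump_def)
qed

lemma continuous_on_bump: "continuous_on A (bump k)"
  by (rule DERIV_continuous_on[OF DERIV_subset[OF bump_deriv]]) auto

text \<open>\<open>smooth\<close> quantifies over all iterated partial derivatives, so smoothness is
  read off from an algebra closed under gradients. The affine argument
  \<open>z + a *\<^sub>R x\<close> makes it contain dilated bumps and also their reflections
  \<open>rho_scaled e (x - y)\<close> in y, the test functions that turn a weak equation into one
  for a mollification.\<close>

inductive bump_poly :: "(real^2 \<Rightarrow> complex) \<Rightarrow> bool" where
  const: "bump_poly (\<lambda>x. c)"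
| coord: "bump_poly (\<lambda>x. of_real (x $ i))"
| bump: "bump_poly (\<lambda>x. of_real (bump k (1 - (norm (z + a *\<^sub>R x))\<^sup>2)))"
| add: "bump_poly f \<Longrightarrow> bump_poly g \<Longrightarrow> bump_poly (\<lambda>x. f x + g x)"
| mult: "bump_poly f \<Longrightarrow> bump_poly g \<Longrightarrow> bump_poly (\<lambda>x. f x * g x)"

lemma has_gradient_bump:
  "has_gradient (\<lambda>x. of_real (bump k (1 - (norm (z + a *\<^sub>R x))\<^sup>2)) :: complex)
     (\<lambda>j x. of_real ((bump (k + 2) (1 - (norm (z + a *\<^sub>R x))\<^sup>2)
        - of_nat k * bump (k + 1) (1 - (norm (z + a *\<^sub>R x))\<^sup>2)) * (- (2 * a * (z + a *\<^sub>R x) $ j))))"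
proof -
  have "has_gradient (\<lambda>x. 1 + (- 1) * (norm (z + a *\<^sub>R x))\<^sup>2)
      (\<lambda>j x. 0 + (- 1) * (a *\<^sub>R (2 * (z + a *\<^sub>R x) $ j)))"
    by (intro has_gradient_add has_gradient_const has_gradient_cmult
          has_gradient_affine[OF has_gradient_norm_sq])
  then have *: "has_gradient (\<lambda>x. 1 - (norm (z + a *\<^sub>R x))\<^sup>2) (\<lambda>j x. - (2 * a * (z + a *\<^sub>R x) $ j))"
    by (rule has_gradient_cong) auto
  show ?thesis
    by (intro has_gradient_of_real has_gradient_compose[OF * bump_deriv])
      (auto intro!: continuous_intros continuous_on_bump)
qed

lemma bump_poly_gradient:
  assumes "bump_poly f"
  obtains f' where "has_gradient f f'" "\<And>j. bump_poly (f' j)"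
proof -
  have "\<exists>f'. has_gradient f f' \<and> (\<forall>j. bump_poly (f' j))"
    using assms
  proof induction
    case (const c)
    show ?case by (intro exI[of _ "\<lambda>j x. 0"] conjI) (auto intro: bump_poly.intros)
  next
    case (coord i)
    show ?case
      by (intro exI[of _ "\<lambda>j x. if j = i then 1 else 0"] conjI has_gradient_coord allI)
         (rule bump_poly.const)
  next
    case (bump k z a)
    have "bump_poly (\<lambda>x. (of_real (bump (k + 2) (1 - (norm (z + a *\<^sub>R x))\<^sup>2))
        + (- of_nat k) * of_real (bump (k + 1) (1 - (norm (z + a *\<^sub>R x))\<^sup>2))) *
          ((- 2 * of_real a) * (of_real (z $ j) + of_real a * of_real (x $ j))))" for j
      by (intro bump_poly.intros)
    then have "bump_poly (\<lambda>x. of_real ((bump (k + 2) (1 - (norm (z + a *\<^sub>R x))\<^sup>2)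
        - of_nat k * bump (k + 1) (1 - (norm (z + a *\<^sub>R x))\<^sup>2)) * (- (2 * a * (z + a *\<^sub>R x) $ j))))" for j
      by (simp add: algebra_simps)
    then show ?case
      using has_gradient_bump by blast
  next
    case (add f g)
    then obtain f' g' where "has_gradient f f'" "has_gradient g g'"
      "\<And>j. bump_poly (f' j)" "\<And>j. bump_poly (g' j)" by auto
    then show ?case
      by (intro exI[of _ "\<lambda>j x. f' j x + g' j x"]) (auto intro: bump_poly.intros)
  next
    case (mult f g)
    then obtain f' g' where "has_gradient f f'" "has_gradient g g'"
      "\<And>j. bump_poly (f' j)" "\<And>j. bump_poly (g' j)" by auto
    with mult show ?case
      by (intro exI[of _ "\<lambda>j x. f' j x * g x + f x * g' j x"] conjI has_gradient_mult allI
            bump_poly.add bump_poly.mult)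
  qed
  then show ?thesis using that by blast
qed

lemma bump_poly_smooth:
  assumes "bump_poly f"
  shows "smooth f"
proof -
  have *: "bump_poly (iter_pderiv js f)" for js
  proof (induction js)
    case (Cons j js)
    obtain f' where f': "has_gradient (iter_pderiv js f) f'" "\<And>j. bump_poly (f' j)"
      using bump_poly_gradient[OF Cons.IH] by blast
    then show ?case by (simp add: has_gradient_pderiv_at[OF f'(1)])
  qed (use assms in simp)
  have "iter_pderiv js f differentiable (at x)" for js x
  proof -
    obtain f' where "has_gradient (iter_pderiv js f) f'"
      using bump_poly_gradient[OF *[of js]] by blast
    from has_gradientD(1)[OF this] show ?thesis
      by (auto simp: differentiable_def)
  qed
  then show ?thesis by (simp add: smooth_def)
qed

lemma bump_poly_test_function:
  assumes "bump_poly f" "\<And>x. norm (x - z) > r \<Longrightarrow> f x = 0"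
  shows "test_function f"
proof -
  have "{x. f x \<noteq> 0} \<subseteq> cball z r"
    using assms(2) by (force simp: dist_norm norm_minus_commute)
  then have "bounded (closure {x. f x \<noteq> 0})"
    by (meson bounded_cball bounded_closure bounded_subset)
  then show ?thesis
    using bump_poly_smooth[OF assms(1)] by (auto simp: test_function_def compact_eq_bounded_closed)
qed

section \<open>Square integrable functions on the plane\<close>

lemma nn_integral_affine:
  fixes f :: "real^2 \<Rightarrow> ennreal"
  assumes [measurable]: "f \<in> borel_measurable borel" and c: "c \<noteq> 0"
  shows "(\<integral>\<^sup>+x. f x \<partial>lborel) = ennreal (c\<^sup>2) * (\<integral>\<^sup>+x. f (t + c *\<^sub>R x) \<partial>lborel)"
proof -
  have "(\<integral>\<^sup>+x. f x \<partial>lborel) =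
      (\<integral>\<^sup>+x. f x \<partial>density (distr lborel borel (\<lambda>x. t + c *\<^sub>R x)) (\<lambda>_. ennreal (\<bar>c\<bar> ^ DIM(real^2))))"
    using lborel_affine[OF c, of t] by simp
  also have "\<dots> = (\<integral>\<^sup>+x. ennreal (\<bar>c\<bar> ^ DIM(real^2)) * f (t + c *\<^sub>R x) \<partial>lborel)"
    by (simp add: nn_integral_density nn_integral_distr)
  finally show ?thesis
    by (simp add: nn_integral_cmult)
qed

lemma integrable_affine:
  fixes f :: "real^2 \<Rightarrow> 'b::{banach, second_countable_topology}"
  assumes f: "integrable lborel f" and c: "c \<noteq> 0"
  shows "integrable lborel (\<lambda>x. f (t + c *\<^sub>R x))"
proof -
  have [measurable]: "f \<in> borel_measurable borel" using f by auto
  show ?thesis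
    using f c nn_integral_affine[of "\<lambda>x. ennreal (norm (f x))" c t]
    by (auto simp: integrable_iff_bounded ennreal_mult_less_top)
qed

lemma integrable_affine_iff:
  fixes f :: "real^2 \<Rightarrow> 'b::{banach, second_countable_topology}"
  assumes c: "c \<noteq> 0"
  shows "integrable lborel (\<lambda>x. f (t + c *\<^sub>R x)) \<longleftrightarrow> integrable lborel f"
  using integrable_affine[of f c t] integrable_affine[of "\<lambda>x. f (t + c *\<^sub>R x)" "1/c" "- (1/c) *\<^sub>R t"] c
  by (auto simp: algebra_simps)

lemma integral_affine:
  fixes f :: "real^2 \<Rightarrow> 'b::{banach, second_countable_topology}"
  assumes c: "c \<noteq> 0"
  shows "(\<integral>x. f x \<partial>lborel) = c\<^sup>2 *\<^sub>R (\<integral>x. f (t + c *\<^sub>R x) \<partial>lborel)"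
proof (cases "integrable lborel f")
  case True
  then have [measurable]: "f \<in> borel_measurable borel" by auto
  have "(\<integral>x. f x \<partial>lborel) =
      (\<integral>x. f x \<partial>density (distr lborel borel (\<lambda>x. t + c *\<^sub>R x)) (\<lambda>_. ennreal (\<bar>c\<bar> ^ DIM(real^2))))"
    using lborel_affine[OF c, of t] by simp
  also have "\<dots> = (\<integral>x. f x \<partial>density (distr lborel borel (\<lambda>x. t + c *\<^sub>R x)) (\<lambda>_. ennreal (c\<^sup>2)))"
    by simp
  also have "\<dots> = (\<integral>x. c\<^sup>2 *\<^sub>R f (t + c *\<^sub>R x) \<partial>lborel)"
    by (subst integral_density) (auto simp: integral_distr)
  finally show ?thesis by simp
next
  case False
  then show ?thesis
    using integrable_affine_iff[OF c, of f t] by (simp add: not_integrable_integral_eq)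
qed

lemma nn_integral_reflect:
  fixes f :: "real^2 \<Rightarrow> ennreal"
  assumes "f \<in> borel_measurable borel"
  shows "(\<integral>\<^sup>+x. f (z - x) \<partial>lborel) = (\<integral>\<^sup>+x. f x \<partial>lborel)"
  using nn_integral_affine[OF assms, of "-1" z] by simp

lemma nn_integral_translate:
  fixes f :: "real^2 \<Rightarrow> ennreal"
  assumes "f \<in> borel_measurable borel"
  shows "(\<integral>\<^sup>+x. f (z + x) \<partial>lborel) = (\<integral>\<^sup>+x. f x \<partial>lborel)"
  using nn_integral_affine[OF assms, of 1 z] by simp

lemma integral_translate:
  fixes f :: "real^2 \<Rightarrow> 'b::{banach, second_countable_topology}"
  shows "(\<integral>x. f (z + x) \<partial>lborel) = (\<integral>x. f x \<partial>lborel)"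
  using integral_affine[of 1 f z] by simp

lemma integrable_translate:
  fixes f :: "real^2 \<Rightarrow> 'b::{banach, second_countable_topology}"
  shows "integrable lborel (\<lambda>x. f (z + x)) \<longleftrightarrow> integrable lborel f"
  using integrable_affine_iff[of 1 f z] by simp

section \<open>Dyadic estimates at infinity and at the origin\<close>

lemma emeasure_disc:
  "r \<ge> 0 \<Longrightarrow> emeasure lborel (cball (c::real^2) r) = ennreal (unit_ball_vol 2 * r\<^sup>2)"
  by (simp add: emeasure_cball)

text \<open>A function is majorised by the sum of heights times indicators of discs, whose integrals
  are height times area. The discs need not be disjoint, since one of them suffices at each point.
  Growing radii handle decay at infinity, shrinking radii a singularity at 0.\<close>

lemma nn_integral_dyadic_finite:
  fixes g :: "real^2 \<Rightarrow> ennreal" and a r :: "nat \<Rightarrow> real"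
  assumes g: "AE x in lborel. g x = 0 \<or> (\<exists>k. x \<in> cball (0::real^2) (r k) \<and> g x \<le> ennreal (a k))"
    and r: "\<And>k. r k \<ge> 0" and a: "\<And>k. a k \<ge> 0" and sm: "summable (\<lambda>k. a k * (r k)\<^sup>2)"
  shows "(\<integral>\<^sup>+x. g x \<partial>lborel) < \<infinity>"
proof -
  have "AE x in lborel. g x \<le> (\<Sum>k. ennreal (a k) * indicator (cball (0::real^2) (r k)) x)"
    using g
  proof eventually_elim
    case (elim x)
    show ?case
    proof (cases "g x = 0")
      case False
    then obtain k where k: "x \<in> cball (0::real^2) (r k)" "g x \<le> ennreal (a k)" using elim by auto
    have "g x \<le> (\<Sum>k\<in>{k}. ennreal (a k) * indicator (cball (0::real^2) (r k)) x)" using k by simp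
    also have "\<dots> \<le> (\<Sum>k. ennreal (a k) * indicator (cball (0::real^2) (r k)) x)"
      by (intro sum_le_suminf) auto
    finally show ?thesis .
    qed simp
  qed
  have [measurable]: "cball (0::real^2) (r k) \<in> sets borel" for k by simp
  from \<open>AE x in lborel. g x \<le> _\<close>
  have "(\<integral>\<^sup>+x. g x \<partial>lborel) \<le> (\<integral>\<^sup>+x. (\<Sum>k. ennreal (a k) * indicator (cball (0::real^2) (r k)) x) \<partial>lborel)"
    by (intro nn_integral_mono_AE) auto
  also have "\<dots> = (\<Sum>k. \<integral>\<^sup>+x. ennreal (a k) * indicator (cball (0::real^2) (r k)) x \<partial>lborel)"
    by (rule nn_integral_suminf) measurable
  also have "\<dots> = (\<Sum>k. ennreal (unit_ball_vol 2 * (a k * (r k)\<^sup>2)))"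
    using r a by (intro suminf_cong) (simp add: nn_integral_cmult_indicator emeasure_disc mult_ac flip: ennreal_mult')
  also have "\<dots> < \<infinity>"
    using summable_mult[OF sm, of "unit_ball_vol 2"] a r
    by (subst suminf_ennreal2) (auto intro!: mult_nonneg_nonneg)
  finally show ?thesis .
qed

text \<open>Height \<open>(4 powr - m) ^ k\<close> on the disc of radius \<open>2 ^ (k + 1)\<close>
  gives a geometric series of ratio \<open>4 powr (1 - m)\<close>, which is less than 1 because
  \<open>m > 1\<close>.\<close>

lemma integrable_weight:
  assumes m: "m > 1"
  shows "integrable lborel (\<lambda>x::real^2. (1 + (norm x)\<^sup>2) powr (- m))"
proof -
  have "(\<integral>\<^sup>+x. ennreal ((1 + (norm (x::real^2))\<^sup>2) powr (- m)) \<partial>lborel) < \<infinity>"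
  proof (rule nn_integral_dyadic_finite[where a="\<lambda>k. (4 powr (-m)) ^ k" and r="\<lambda>k. 2 ^ (k + 1)"])
    show "AE x in lborel. ennreal ((1 + (norm x)\<^sup>2) powr - m) = 0 \<or>
        (\<exists>k. x \<in> cball (0::real^2) (2 ^ (k + 1)) \<and>
        ennreal ((1 + (norm x)\<^sup>2) powr - m) \<le> ennreal ((4 powr - m) ^ k))"
    proof (rule AE_I2)
      fix x :: "real^2"
      obtain n where n: "1 + (norm x)\<^sup>2 < 4 ^ n" using real_arch_pow[of 4] by auto
      \<comment> \<open>The least such \<open>k\<close> is positive because
        \<open>1 + (norm x)\<^sup>2\<close> is at least 1; minimality at its predecessor
        \<open>j\<close> supplies the lower bound \<open>4 ^ j\<close>.\<close>
      define k where "k = (LEAST n. 1 + (norm x)\<^sup>2 < 4 ^ n)"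
      have k: "1 + (norm x)\<^sup>2 < 4 ^ k" unfolding k_def using n by (rule LeastI)
      then obtain j where j: "k = Suc j" by (cases k) (auto simp: add_nonneg_pos not_less[symmetric])
      have j4: "4 ^ j \<le> 1 + (norm x)\<^sup>2"
        using not_less_Least[of j "\<lambda>n. 1 + (norm x)\<^sup>2 < 4 ^ n"] j by (auto simp: k_def not_less)
      have "(norm x)\<^sup>2 \<le> (2 ^ (j + 1))\<^sup>2"
      proof -
        have "(2 ^ (j + 1))\<^sup>2 = (4::real) ^ (j + 1)"
          by (simp add: power2_eq_square flip: power_mult_distrib)
        then show ?thesis using k j by simp
      qed
      then have "norm x \<le> 2 ^ (j + 1)" by (rule power2_le_imp_le) simp
      moreover have "(1 + (norm x)\<^sup>2) powr - m \<le> (4 ^ j) powr (- m)"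
        using j4 m by (intro powr_mono2') auto
      moreover have "(4 ^ j) powr (- m) = (4 powr (- m)) ^ j"
        by (simp add: powr_realpow[symmetric] powr_powr mult.commute)
      ultimately show "ennreal ((1 + (norm x)\<^sup>2) powr - m) = 0 \<or> (\<exists>k. x \<in> cball 0 (2 ^ (k + 1)) \<and>
        ennreal ((1 + (norm x)\<^sup>2) powr - m) \<le> ennreal ((4 powr - m) ^ k))"
        by (intro disjI2 exI[of _ j]) (auto intro!: ennreal_leI)
    qed
    have "4 powr (- m) * 4 < (4::real) powr (-1) * 4"
      using m by (intro mult_strict_right_mono powr_less_mono) auto
    then have "summable (\<lambda>k. 4 * (4 powr (- m) * 4) ^ k :: real)"
      by (intro summable_mult summable_geometric) (auto simp: powr_minus)
    moreover have "(\<lambda>k. (4 powr (- m)) ^ k * (2 ^ (k + 1))\<^sup>2) = (\<lambda>k. 4 * (4 powr (- m) * 4) ^ k)"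
    proof
      fix k
      have "(2 ^ (k + 1))\<^sup>2 = (4::real) * 4 ^ k"
        by (simp add: power2_eq_square flip: power_mult_distrib)
      then show "(4 powr (- m)) ^ k * (2 ^ (k + 1))\<^sup>2 = 4 * (4 powr (- m) * 4) ^ k"
        by (simp only: power_mult_distrib mult_ac)
    qed
    ultimately show "summable (\<lambda>k. (4 powr - m) ^ k * (2 ^ (k + 1))\<^sup>2)" by (simp only:)
  qed auto
  then show ?thesis
    by (simp add: integrable_iff_bounded)
qed

text \<open>In two dimensions \<open>1 / norm x\<close> is integrable at the origin: height
  \<open>2 ^ (k + 1)\<close> on a disc of area proportional to \<open>4 ^ (- k)\<close> leaves a
  series of ratio 1/2. This is the singularity of the Biot-Savart kernel.\<close>

lemma nn_integral_near_kernel: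
  "(\<integral>\<^sup>+x. ennreal (indicator (ball 0 1) (x::real^2) / norm x) \<partial>lborel) < \<infinity>"
proof (rule nn_integral_dyadic_finite[where a="\<lambda>k. 2 ^ (k + 1)" and r="\<lambda>k. (1/2) ^ k"])
  show "AE x in lborel. ennreal (indicator (ball 0 1) x / norm x) = 0 \<or>
       (\<exists>k. x \<in> cball (0::real^2) ((1 / 2) ^ k) \<and>
       ennreal (indicator (ball 0 1) x / norm x) \<le> ennreal (2 ^ (k + 1)))"
    using AE_lborel_singleton[of "0::real^2"]
  proof eventually_elim
    case (elim x)
    show ?case
    proof (cases "x \<in> ball 0 1")
      case True
      then have x: "norm x > 0" "norm x < 1" using elim by auto
      obtain n where n: "(1/2) ^ n < norm x" using real_arch_pow_inv[of "norm x" "1/2"] x by auto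
      define k where "k = (LEAST n. (1/2) ^ n < norm x)"
      have k: "(1/2) ^ k < norm x" unfolding k_def using n by (rule LeastI)
      then obtain j where j: "k = Suc j" using x by (cases k) auto
      have j2: "norm x \<le> (1/2) ^ j"
        using not_less_Least[of j "\<lambda>n. (1/2) ^ n < norm x"] j by (auto simp: k_def not_less)
      have "1 / norm x \<le> 1 / (1/2) ^ k" using k x by (intro divide_left_mono) auto
      also have "\<dots> = 2 ^ (j + 1)" by (simp add: j field_simps power_divide)
      finally show ?thesis using j2 True by (intro disjI2 exI[of _ j]) (auto intro!: ennreal_leI)
    qed simp
  qed
  have "(\<lambda>k. 2 ^ (k + 1) * ((1/2) ^ k)\<^sup>2) = (\<lambda>k. 2 * (1/2 :: real) ^ k)"
    by (rule ext) (simp add: power2_eq_square power_divide field_simps)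
  moreover have "summable (\<lambda>k. 2 * (1/2 :: real) ^ k)"
    by (intro summable_mult summable_geometric) auto
  ultimately show "summable (\<lambda>k. 2 ^ (k + 1) * ((1 / 2 :: real) ^ k)\<^sup>2)"
    by (simp only:)
qed auto


section \<open>Square integrability and the Cauchy-Schwarz inequality\<close>

lemma integrable_dominated:
  fixes g :: "'b \<Rightarrow> real" and f :: "'b \<Rightarrow> 'c::{banach, second_countable_topology}"
  assumes "integrable M g" "f \<in> borel_measurable M" "AE x in M. norm (f x) \<le> g x"
  shows "integrable M f"
  by (rule Bochner_Integration.integrable_bound[OF assms(1,2)])
    (use assms(3) in \<open>eventually_elim, auto\<close>)

lemma integrable_dominated':
  fixes g :: "'b \<Rightarrow> real" and f :: "'b \<Rightarrow> 'c::{banach, second_countable_topology}"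
  assumes "integrable M g" "\<And>x. norm (f x) \<le> g x" "f \<in> borel_measurable M"
  shows "integrable M f"
  using integrable_dominated[OF assms(1,3)] assms(2) by simp

definition square_integrable :: "(real^2 \<Rightarrow> complex) \<Rightarrow> bool" where
  "square_integrable f \<longleftrightarrow>
     f \<in> borel_measurable borel \<and> integrable lborel (\<lambda>x. (cmod (f x))\<^sup>2)"

lemma square_integrableI_nn:
  assumes "f \<in> borel_measurable borel" "(\<integral>\<^sup>+x. ennreal ((cmod (f x))\<^sup>2) \<partial>lborel) < \<infinity>"
  shows "square_integrable f"
  using assms by (auto simp: square_integrable_def integrable_iff_bounded)

lemma square_integrableD [dest]:
  assumes "square_integrable f"
  shows "f \<in> borel_measurable borel" "integrable lborel (\<lambda>x. (cmod (f x))\<^sup>2)"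
  using assms by (auto simp: square_integrable_def)

lemma nn_square_integrable:
  assumes "square_integrable f"
  shows "(\<integral>\<^sup>+x. ennreal ((cmod (f x))\<^sup>2) \<partial>lborel) = ennreal (\<integral>x. (cmod (f x))\<^sup>2 \<partial>lborel)"
  using assms by (intro nn_integral_eq_integral) auto

lemma square_integrable_bound:
  assumes "square_integrable g" "f \<in> borel_measurable borel"
    and "AE x in lborel. cmod (f x) \<le> C * cmod (g x)"
  shows "square_integrable f"
proof -
  have [measurable]: "f \<in> borel_measurable borel" by fact
  have "integrable lborel (\<lambda>x. C\<^sup>2 * (cmod (g x))\<^sup>2)"
    using assms(1) by auto
  then have "integrable lborel (\<lambda>x. (cmod (f x))\<^sup>2)"
  proof (rule integrable_dominated)
    show "AE x in lborel. norm ((cmod (f x))\<^sup>2) \<le> C\<^sup>2 * (cmod (g x))\<^sup>2"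
      using assms(3) by eventually_elim (auto simp flip: power_mult_distrib intro!: power_mono)
  qed simp
  then show ?thesis
    using assms(2) by (auto simp: square_integrable_def)
qed

lemma square_integrable_add:
  assumes "square_integrable f" "square_integrable g"
  shows "square_integrable (\<lambda>x. f x + g x)"
proof -
  have [measurable]: "f \<in> borel_measurable borel" "g \<in> borel_measurable borel" using assms by auto
  have "integrable lborel (\<lambda>x. 2 * (cmod (f x))\<^sup>2 + 2 * (cmod (g x))\<^sup>2)"
    using assms by (intro Bochner_Integration.integrable_add integrable_mult_right) auto
  moreover have "(cmod (f x + g x))\<^sup>2 \<le> 2 * (cmod (f x))\<^sup>2 + 2 * (cmod (g x))\<^sup>2" for x
  proof -
    have "(cmod (f x + g x))\<^sup>2 \<le> (cmod (f x) + cmod (g x))\<^sup>2"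
      by (intro power_mono norm_triangle_ineq) auto
    also have "\<dots> \<le> 2 * (cmod (f x))\<^sup>2 + 2 * (cmod (g x))\<^sup>2"
      using sum_squares_bound[of "cmod (f x)" "cmod (g x)"] by (simp add: power2_sum)
    finally show ?thesis .
  qed
  ultimately have "integrable lborel (\<lambda>x. (cmod (f x + g x))\<^sup>2)"
    by (auto intro: integrable_dominated)
  then show ?thesis by (simp add: square_integrable_def)
qed

lemma square_integrable_mult_bounded:
  assumes "square_integrable f" "b \<in> borel_measurable borel" "\<And>x. cmod (b x) \<le> C"
  shows "square_integrable (\<lambda>x. b x * f x)"
  by (rule square_integrable_bound[OF assms(1), of _ C])
    (use assms in \<open>auto simp: norm_mult intro!: mult_right_mono borel_measurable_times\<close>)

lemma square_integrable_cmult: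
  "square_integrable f \<Longrightarrow> square_integrable (\<lambda>x. c * f x)"
  using square_integrable_mult_bounded[of f "\<lambda>x. c" "cmod c"] by auto

lemma square_integrable_diff:
  assumes "square_integrable f" "square_integrable g"
  shows "square_integrable (\<lambda>x. f x - g x)"
  using square_integrable_add[OF assms(1) square_integrable_cmult[OF assms(2), of "-1"]] by simp

lemma borel_measurable_cnj [measurable]:
  "f \<in> borel_measurable M \<Longrightarrow> (\<lambda>x. cnj (f x)) \<in> borel_measurable M"
  by (rule borel_measurable_continuous_on[of cnj]) (auto intro: continuous_intros)

lemma square_integrable_cnj:
  "square_integrable f \<Longrightarrow> square_integrable (\<lambda>x. cnj (f x))"
  by (rule square_integrable_bound[of f _ 1]) auto

lemma square_integrable_sum:
  assumes "\<And>i. i \<in> I \<Longrightarrow> square_integrable (f i)"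
  shows "square_integrable (\<lambda>x. \<Sum>i\<in>I. f i x)"
  using assms
  by (induction I rule: infinite_finite_induct)
     (simp_all add: square_integrable_add, simp_all add: square_integrable_def)

lemma square_integrable_cauchy_schwarz:
  assumes "square_integrable f" "square_integrable g"
  shows "integrable lborel (\<lambda>x. f x * g x)" (is ?int)
    and "(\<integral>x. cmod (f x) * cmod (g x) \<partial>lborel) \<le>
           sqrt (\<integral>x. (cmod (f x))\<^sup>2 \<partial>lborel) * sqrt (\<integral>x. (cmod (g x))\<^sup>2 \<partial>lborel)" (is ?cs)
    and "cmod (\<integral>x. f x * g x \<partial>lborel) \<le>
           sqrt (\<integral>x. (cmod (f x))\<^sup>2 \<partial>lborel) * sqrt (\<integral>x. (cmod (g x))\<^sup>2 \<partial>lborel)" (is ?cs2)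
proof -
  have [measurable]: "f \<in> borel_measurable borel" "g \<in> borel_measurable borel" using assms by auto
  have "integrable lborel (\<lambda>x. (cmod (f x))\<^sup>2 + (cmod (g x))\<^sup>2)"
    using assms by auto
  moreover have "cmod (f x * g x) \<le> (cmod (f x))\<^sup>2 + (cmod (g x))\<^sup>2" for x
  proof -
    have "0 \<le> cmod (f x) * cmod (g x)" by simp
    with sum_squares_bound[of "cmod (f x)" "cmod (g x)"] show ?thesis
      unfolding norm_mult by linarith
  qed
  ultimately show int: ?int
    by (auto intro: integrable_dominated)
  have int': "integrable lborel (\<lambda>x. cmod (f x) * cmod (g x))"
    using integrable_norm[OF int] by (simp add: norm_mult)
  let ?I = "\<integral>x. cmod (f x) * cmod (g x) \<partial>lborel"
  let ?A = "\<integral>x. (cmod (f x))\<^sup>2 \<partial>lborel" and ?B = "\<integral>x. (cmod (g x))\<^sup>2 \<partial>lborel"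
  have "(ennreal ?I)\<^sup>2 = (\<integral>\<^sup>+x. ennreal (cmod (f x)) * ennreal (cmod (g x)) \<partial>lborel)\<^sup>2"
    using int' by (subst nn_integral_eq_integral[symmetric]) (auto simp: ennreal_mult)
  also have "\<dots> \<le> (\<integral>\<^sup>+x. ennreal (cmod (f x)) ^ 2 \<partial>lborel) * (\<integral>\<^sup>+x. ennreal (cmod (g x)) ^ 2 \<partial>lborel)"
    by (rule Cauchy_Schwarz_nn_integral) auto
  also have "\<dots> = ennreal ?A * ennreal ?B"
    using nn_square_integrable[OF assms(1)] nn_square_integrable[OF assms(2)]
    by (simp add: ennreal_power)
  finally have "ennreal (?I\<^sup>2) \<le> ennreal (?A * ?B)"
    by (simp add: ennreal_mult ennreal_power integral_nonneg_AE)
  then have "?I\<^sup>2 \<le> ?A * ?B"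
    by (subst (asm) ennreal_le_iff) (auto intro!: mult_nonneg_nonneg integral_nonneg_AE)
  then have "?I \<le> sqrt (?A * ?B)" by (rule real_le_rsqrt)
  then show cs: ?cs by (simp add: real_sqrt_mult)
  have "cmod (\<integral>x. f x * g x \<partial>lborel) \<le> ?I"
    using integral_norm_bound[of lborel "\<lambda>x. f x * g x"] by (simp add: norm_mult)
  with cs show ?cs2 by simp
qed

text \<open>Young's inequality for L1 convolved with L2. The kernel is split as the product of two
  square roots, Cauchy-Schwarz is applied for each x, and Tonelli with translation invariance
  evaluates the remaining double integral. Working with nonnegative extended integrals avoids any
  prior integrability.\<close>

lemma young_nn:
  fixes k f :: "real^2 \<Rightarrow> real"
  assumes [measurable]: "k \<in> borel_measurable borel" "f \<in> borel_measurable borel"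
    and k: "\<And>x. k x \<ge> 0" and f: "\<And>x. f x \<ge> 0"
  shows "(\<integral>\<^sup>+x. (\<integral>\<^sup>+y. ennreal (k (x - y) * f y) \<partial>lborel)\<^sup>2 \<partial>lborel)
     \<le> (\<integral>\<^sup>+x. ennreal (k x) \<partial>lborel)\<^sup>2 * (\<integral>\<^sup>+x. ennreal ((f x)\<^sup>2) \<partial>lborel)"
proof -
  let ?K = "\<integral>\<^sup>+x. ennreal (k x) \<partial>lborel"
  have K: "(\<integral>\<^sup>+y. ennreal (k (x - y)) \<partial>lborel) = ?K" for x
    by (rule nn_integral_reflect) measurable
  have "(\<integral>\<^sup>+y. ennreal (k (x - y) * f y) \<partial>lborel)\<^sup>2 \<le>
      ?K * (\<integral>\<^sup>+y. ennreal (k (x - y)) * ennreal ((f y)\<^sup>2) \<partial>lborel)" for x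
  proof -
    have "(\<integral>\<^sup>+y. ennreal (k (x - y) * f y) \<partial>lborel)\<^sup>2 =
       (\<integral>\<^sup>+y. ennreal (sqrt (k (x - y))) * ennreal (sqrt (k (x - y)) * f y) \<partial>lborel)\<^sup>2"
      using k f by (intro arg_cong[where f="\<lambda>x. x\<^sup>2"] nn_integral_cong)
        (simp flip: ennreal_mult mult.assoc)
    also have "\<dots> \<le> (\<integral>\<^sup>+y. (ennreal (sqrt (k (x - y))))\<^sup>2 \<partial>lborel) *
        (\<integral>\<^sup>+y. (ennreal (sqrt (k (x - y)) * f y))\<^sup>2 \<partial>lborel)"
      by (rule Cauchy_Schwarz_nn_integral) measurable
    also have "\<dots> = ?K * (\<integral>\<^sup>+y. ennreal (k (x - y)) * ennreal ((f y)\<^sup>2) \<partial>lborel)"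
      using k f K[of x] by (simp add: ennreal_power power_mult_distrib ennreal_mult)
    finally show ?thesis .
  qed
  then have "(\<integral>\<^sup>+x. (\<integral>\<^sup>+y. ennreal (k (x - y) * f y) \<partial>lborel)\<^sup>2 \<partial>lborel)
     \<le> (\<integral>\<^sup>+x. ?K * (\<integral>\<^sup>+y. ennreal (k (x - y)) * ennreal ((f y)\<^sup>2) \<partial>lborel) \<partial>lborel)"
    by (intro nn_integral_mono) auto
  also have "\<dots> = ?K * (\<integral>\<^sup>+x. \<integral>\<^sup>+y. ennreal (k (x - y)) * ennreal ((f y)\<^sup>2) \<partial>lborel \<partial>lborel)"
    by (rule nn_integral_cmult) measurable
  also have "(\<integral>\<^sup>+x. \<integral>\<^sup>+y. ennreal (k (x - y)) * ennreal ((f y)\<^sup>2) \<partial>lborel \<partial>lborel) =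
      (\<integral>\<^sup>+y. \<integral>\<^sup>+x. ennreal (k (x - y)) * ennreal ((f y)\<^sup>2) \<partial>lborel \<partial>lborel)"
    by (rule lborel_pair.Fubini') measurable
  also have "\<dots> = (\<integral>\<^sup>+y. ?K * ennreal ((f y)\<^sup>2) \<partial>lborel)"
  proof (intro nn_integral_cong)
    fix y
    have "(\<integral>\<^sup>+x. ennreal (k (x - y)) * ennreal ((f y)\<^sup>2) \<partial>lborel) =
      (\<integral>\<^sup>+x. ennreal (k (- y + x)) \<partial>lborel) * ennreal ((f y)\<^sup>2)"
      by (subst nn_integral_multc) auto
    also have "(\<integral>\<^sup>+x. ennreal (k (- y + x)) \<partial>lborel) = ?K"
      by (rule nn_integral_translate) measurable
    finally show "(\<integral>\<^sup>+x. ennreal (k (x - y)) * ennreal ((f y)\<^sup>2) \<partial>lborel) = ?K * ennreal ((f y)\<^sup>2)" .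
  qed
  also have "\<dots> = ?K * (\<integral>\<^sup>+x. ennreal ((f x)\<^sup>2) \<partial>lborel)"
    by (rule nn_integral_cmult) measurable
  finally show ?thesis by (simp add: power2_eq_square mult.assoc)
qed


section \<open>Convergence in L2 and continuity of translations\<close>

lemma tendsto_null_squeeze:
  fixes a b :: "nat \<Rightarrow> real"
  assumes "b \<longlonglongrightarrow> c" "\<And>n. a n \<le> b n" "c = 0" "\<And>n. 0 \<le> a n"
  shows "a \<longlonglongrightarrow> 0"
  by (rule tendsto_sandwich[OF _ _ tendsto_const assms(1)[unfolded assms(3)]]) (use assms(2,4) in auto)

text \<open>Square integrability of every term and of the limit is part of the notion: the integral
  of a nonintegrable function is 0 by default, so the limit condition alone could hold for the wrong
  reason.\<close>

definition L2_tendsto :: "(nat \<Rightarrow> real^2 \<Rightarrow> complex) \<Rightarrow> (real^2 \<Rightarrow> complex) \<Rightarrow> bool" where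
  "L2_tendsto u f \<longleftrightarrow> (\<forall>n. square_integrable (u n)) \<and> square_integrable f \<and>
     (\<lambda>n. \<integral>x. (cmod (u n x - f x))\<^sup>2 \<partial>lborel) \<longlonglongrightarrow> 0"

lemma L2_tendsto_square_integrable:
  assumes "L2_tendsto u f"
  shows "square_integrable (u n)" "square_integrable f"
  using assms by (auto simp: L2_tendsto_def)

lemma L2_tendsto_bound:
  assumes u: "L2_tendsto u f" and v: "\<And>n. square_integrable (v n)" and g: "square_integrable g"
    and le: "\<And>n x. cmod (v n x - g x) \<le> C * cmod (u n x - f x)"
  shows "L2_tendsto v g"
proof -
  have lim: "(\<lambda>n. C\<^sup>2 * (\<integral>x. (cmod (u n x - f x))\<^sup>2 \<partial>lborel)) \<longlonglongrightarrow> C\<^sup>2 * 0"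
    using u by (intro tendsto_intros) (auto simp: L2_tendsto_def)
  have "(\<integral>x. (cmod (v n x - g x))\<^sup>2 \<partial>lborel) \<le> C\<^sup>2 * (\<integral>x. (cmod (u n x - f x))\<^sup>2 \<partial>lborel)" for n
  proof -
    have "(\<integral>x. (cmod (v n x - g x))\<^sup>2 \<partial>lborel) \<le> (\<integral>x. C\<^sup>2 * (cmod (u n x - f x))\<^sup>2 \<partial>lborel)"
    proof (rule integral_mono)
      show "(cmod (v n x - g x))\<^sup>2 \<le> C\<^sup>2 * (cmod (u n x - f x))\<^sup>2" for x
        using le[of n x] by (auto simp flip: power_mult_distrib intro!: power_mono)
    qed (use square_integrable_diff[OF v g] square_integrable_diff[OF L2_tendsto_square_integrable[OF u]]
        in \<open>auto\<close>)
    then show ?thesis by simp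
  qed
  from lim this have "(\<lambda>n. \<integral>x. (cmod (v n x - g x))\<^sup>2 \<partial>lborel) \<longlonglongrightarrow> 0"
    by (rule tendsto_null_squeeze) auto
  then show ?thesis using v g by (simp add: L2_tendsto_def)
qed

lemma L2_tendsto_cnj:
  assumes "L2_tendsto u f"
  shows "L2_tendsto (\<lambda>n x. cnj (u n x)) (\<lambda>x. cnj (f x))"
proof (rule L2_tendsto_bound[OF assms, of _ _ 1])
  show "cmod (cnj (u n x) - cnj (f x)) \<le> 1 * cmod (u n x - f x)" for n x
    by (metis complex_cnj_diff complex_mod_cnj mult_1 order_refl)
qed (use L2_tendsto_square_integrable[OF assms] in \<open>auto intro: square_integrable_cnj\<close>)

lemma L2_tendsto_mult_bounded:
  assumes "L2_tendsto u f" "b \<in> borel_measurable borel" "\<And>x. cmod (b x) \<le> C"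
  shows "L2_tendsto (\<lambda>n x. b x * u n x) (\<lambda>x. b x * f x)"
proof (rule L2_tendsto_bound[OF assms(1), of _ _ C])
  show "cmod (b x * u n x - b x * f x) \<le> C * cmod (u n x - f x)" for n x
    using assms(3)[of x] by (auto simp flip: right_diff_distrib simp: norm_mult intro!: mult_right_mono)
qed (use L2_tendsto_square_integrable[OF assms(1)] assms(2,3)
      in \<open>auto intro: square_integrable_mult_bounded\<close>)

lemma L2_tendsto_add:
  assumes "L2_tendsto u f" "L2_tendsto v g"
  shows "L2_tendsto (\<lambda>n x. u n x + v n x) (\<lambda>x. f x + g x)"
proof -
  note si = L2_tendsto_square_integrable[OF assms(1)] L2_tendsto_square_integrable[OF assms(2)]
  have "(\<lambda>n. 2 * (\<integral>x. (cmod (u n x - f x))\<^sup>2 \<partial>lborel) + 2 * (\<integral>x. (cmod (v n x - g x))\<^sup>2 \<partial>lborel))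
      \<longlonglongrightarrow> 2 * 0 + 2 * 0"
    using assms by (intro tendsto_intros) (auto simp: L2_tendsto_def)
  moreover have "(\<integral>x. (cmod (u n x + v n x - (f x + g x)))\<^sup>2 \<partial>lborel) \<le>
      2 * (\<integral>x. (cmod (u n x - f x))\<^sup>2 \<partial>lborel) + 2 * (\<integral>x. (cmod (v n x - g x))\<^sup>2 \<partial>lborel)" for n
  proof -
    have i: "integrable lborel (\<lambda>x. (cmod (u n x - f x))\<^sup>2)" "integrable lborel (\<lambda>x. (cmod (v n x - g x))\<^sup>2)"
      "integrable lborel (\<lambda>x. (cmod (u n x + v n x - (f x + g x)))\<^sup>2)"
      using si by (auto intro!: square_integrableD(2) square_integrable_diff square_integrable_add)
    have "(\<integral>x. (cmod (u n x + v n x - (f x + g x)))\<^sup>2 \<partial>lborel) \<le>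
      (\<integral>x. 2 * (cmod (u n x - f x))\<^sup>2 + 2 * (cmod (v n x - g x))\<^sup>2 \<partial>lborel)"
    proof (rule integral_mono)
      fix x
      have "(cmod (u n x + v n x - (f x + g x)))\<^sup>2 \<le> (cmod (u n x - f x) + cmod (v n x - g x))\<^sup>2"
        using norm_triangle_ineq[of "u n x - f x" "v n x - g x"] by (intro power_mono) (auto simp: algebra_simps)
      also have "\<dots> \<le> 2 * (cmod (u n x - f x))\<^sup>2 + 2 * (cmod (v n x - g x))\<^sup>2"
        using sum_squares_bound[of "cmod (u n x - f x)" "cmod (v n x - g x)"] by (simp add: power2_sum)
      finally show "(cmod (u n x + v n x - (f x + g x)))\<^sup>2 \<le> 2 * (cmod (u n x - f x))\<^sup>2 + 2 * (cmod (v n x - g x))\<^sup>2" .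
    qed (use i in auto)
    then show ?thesis using i by simp
  qed
  ultimately have "(\<lambda>n. \<integral>x. (cmod (u n x + v n x - (f x + g x)))\<^sup>2 \<partial>lborel) \<longlonglongrightarrow> 0"
    by (rule tendsto_null_squeeze) auto
  then show ?thesis using si by (simp add: L2_tendsto_def square_integrable_add)
qed

lemma L2_tendsto_diff:
  assumes "L2_tendsto u f" "L2_tendsto v g"
  shows "L2_tendsto (\<lambda>n x. u n x - v n x) (\<lambda>x. f x - g x)"
  using L2_tendsto_add[OF assms(1) L2_tendsto_mult_bounded[OF assms(2), of "\<lambda>x. -1" 1]] by simp

text \<open>The difference of the products is (u - f)(v - g) + (u - f) g + f (v - g), and
  Cauchy-Schwarz bounds each of the three integrals by a null sequence.\<close>

lemma L2_tendsto_integral_mult: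
  assumes u: "L2_tendsto u f" and v: "L2_tendsto v g"
  shows "(\<lambda>n. \<integral>x. u n x * v n x \<partial>lborel) \<longlonglongrightarrow> (\<integral>x. f x * g x \<partial>lborel)"
proof -
  note si = L2_tendsto_square_integrable[OF u] L2_tendsto_square_integrable[OF v]
  define N where "N h = sqrt (\<integral>x. (cmod (h x))\<^sup>2 \<partial>lborel)" for h :: "real^2 \<Rightarrow> complex"
  define a b where "a n = N (\<lambda>x. u n x - f x)" and "b n = N (\<lambda>x. v n x - g x)" for n
  have "(\<lambda>n. sqrt (\<integral>x. (cmod (u n x - f x))\<^sup>2 \<partial>lborel)) \<longlonglongrightarrow> sqrt 0"
    using u by (intro tendsto_real_sqrt) (simp add: L2_tendsto_def)
  then have a0: "a \<longlonglongrightarrow> 0"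
    by (simp add: a_def[abs_def] N_def)
  have "(\<lambda>n. sqrt (\<integral>x. (cmod (v n x - g x))\<^sup>2 \<partial>lborel)) \<longlonglongrightarrow> sqrt 0"
    using v by (intro tendsto_real_sqrt) (simp add: L2_tendsto_def)
  then have b0: "b \<longlonglongrightarrow> 0"
    by (simp add: b_def[abs_def] N_def)
  have "(\<lambda>n. a n * b n + a n * N g + N f * b n) \<longlonglongrightarrow> 0 * 0 + 0 * N g + N f * 0"
    by (rule tendsto_add[OF tendsto_add[OF tendsto_mult[OF a0 b0] tendsto_mult[OF a0 tendsto_const]]
          tendsto_mult[OF tendsto_const b0]])
  moreover have "cmod ((\<integral>x. u n x * v n x \<partial>lborel) - (\<integral>x. f x * g x \<partial>lborel)) \<le> a n * b n + a n * N g + N f * b n" for n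
  proof -
    have d: "square_integrable (\<lambda>x. u n x - f x)" "square_integrable (\<lambda>x. v n x - g x)"
      by (rule square_integrable_diff[OF si(1) si(2)], rule square_integrable_diff[OF si(3) si(4)])
    note int = square_integrable_cauchy_schwarz(1)
    have "(\<integral>x. u n x * v n x \<partial>lborel) - (\<integral>x. f x * g x \<partial>lborel) =
       (\<integral>x. u n x * v n x - f x * g x \<partial>lborel)"
      by (rule Bochner_Integration.integral_diff[symmetric]) (intro int si)+
    also have "\<dots> = (\<integral>x. (u n x - f x) * (v n x - g x) + (u n x - f x) * g x + f x * (v n x - g x) \<partial>lborel)"
      by (rule Bochner_Integration.integral_cong[OF refl]) (simp add: algebra_simps)
    also have "\<dots> = (\<integral>x. (u n x - f x) * (v n x - g x) \<partial>lborel) +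
       (\<integral>x. (u n x - f x) * g x \<partial>lborel) + (\<integral>x. f x * (v n x - g x) \<partial>lborel)"
      by (simp only: Bochner_Integration.integral_add[OF Bochner_Integration.integrable_add[OF
            int[OF d] int[OF d(1) si(4)]] int[OF si(2) d(2)]]
          Bochner_Integration.integral_add[OF int[OF d] int[OF d(1) si(4)]])
    finally have eq: "(\<integral>x. u n x * v n x \<partial>lborel) - (\<integral>x. f x * g x \<partial>lborel) =
       (\<integral>x. (u n x - f x) * (v n x - g x) \<partial>lborel) +
       (\<integral>x. (u n x - f x) * g x \<partial>lborel) + (\<integral>x. f x * (v n x - g x) \<partial>lborel)" .
    have "cmod ((\<integral>x. u n x * v n x \<partial>lborel) - (\<integral>x. f x * g x \<partial>lborel)) \<le>
       cmod (\<integral>x. (u n x - f x) * (v n x - g x) \<partial>lborel) +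
       cmod (\<integral>x. (u n x - f x) * g x \<partial>lborel) + cmod (\<integral>x. f x * (v n x - g x) \<partial>lborel)"
      unfolding eq by (rule order_trans[OF norm_triangle_ineq add_right_mono[OF norm_triangle_ineq]])
    also have "\<dots> \<le> a n * b n + a n * N g + N f * b n"
      unfolding a_def b_def N_def
      by (rule add_mono[OF add_mono[OF square_integrable_cauchy_schwarz(3)[OF d]
            square_integrable_cauchy_schwarz(3)[OF d(1) si(4)]]
            square_integrable_cauchy_schwarz(3)[OF si(2) d(2)]])
    finally show ?thesis .
  qed
  ultimately have "(\<lambda>n. cmod ((\<integral>x. u n x * v n x \<partial>lborel) - (\<integral>x. f x * g x \<partial>lborel))) \<longlonglongrightarrow> 0"
    by (rule tendsto_null_squeeze) auto
  then have "(\<lambda>n. (\<integral>x. u n x * v n x \<partial>lborel) - (\<integral>x. f x * g x \<partial>lborel)) \<longlonglongrightarrow> 0"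
    by (simp add: tendsto_norm_zero_iff)
  then show ?thesis by (simp add: LIM_zero_iff)
qed

text \<open>Induction over integrable functions reduces the claim to the indicator of a set of
  finite measure, which is approximated from outside by an open set U. For open U, points of U stay
  in U under small shifts, so the overlap of U with its translates converges to the full measure by
  dominated convergence. Sequences of shifts are used because dominated convergence is a statement
  about sequences.\<close>

lemma translation_L1:
  fixes f :: "real^2 \<Rightarrow> real"
  assumes f: "integrable lborel f" and H: "H \<longlonglongrightarrow> 0"
  shows "(\<lambda>n. \<integral>x. \<bar>f (H n + x) - f x\<bar> \<partial>lborel) \<longlonglongrightarrow> 0"
  using f
proof (induction rule: integrable_induct)
  case (base A c)
  have [measurable]: "A \<in> sets borel" using base(1) by simp
  have "(\<lambda>n. \<integral>x. \<bar>indicator A (H n + x) - indicator A x\<bar> \<partial>lborel) \<longlonglongrightarrow> (0::real)"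
  proof (rule LIMSEQ_I)
    fix e :: real assume e: "e > 0"
    obtain U where U: "open U" "A \<subseteq> U" "emeasure lborel (U - A) < ennreal (e / 4)"
      using outer_regular_lborel[of A "e/4"] e by auto
    have [measurable]: "U \<in> sets borel" using U(1) by auto
    have "emeasure lborel U = emeasure lborel (A \<union> (U - A))"
      using U(2) by (intro arg_cong[where f="emeasure lborel"]) auto
    also have "\<dots> \<le> emeasure lborel A + emeasure lborel (U - A)"
      by (intro emeasure_subadditive) auto
    also have "\<dots> < \<infinity>"
      using base(2) U(3) by (auto simp: less_top[symmetric] ennreal_add_eq_top)
    finally have Ufin: "emeasure lborel U < \<infinity>" .
    have iU: "integrable lborel (indicator U :: real^2 \<Rightarrow> real)" using Ufin by simp
    have iA: "integrable lborel (indicator A :: real^2 \<Rightarrow> real)" using base by simp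
    have iUt: "integrable lborel (\<lambda>x. indicator U (h + x) :: real)" for h
      using iU integrable_translate[of "indicator U :: real^2 \<Rightarrow> real" h] by simp
    have iAt: "integrable lborel (\<lambda>x. indicator A (h + x) :: real)" for h
      using iA integrable_translate[of "indicator A :: real^2 \<Rightarrow> real" h] by simp
    have iUU: "integrable lborel (\<lambda>x. indicator U (h + x) * indicator U x :: real)" for h
      by (rule integrable_dominated[OF iU]) (auto simp: indicator_def)
    have "(\<lambda>n. \<integral>x. indicator U (H n + x) * indicator U x \<partial>lborel) \<longlonglongrightarrow> (\<integral>x. indicator U x \<partial>lborel :: real)"
    proof (rule integral_dominated_convergence[OF _ _ iU])
      show "AE x in lborel. (\<lambda>n. indicator U (H n + x) * indicator U x :: real) \<longlonglongrightarrow> indicator U x"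
      proof (rule AE_I2)
        fix x :: "real^2"
        show "(\<lambda>n. indicator U (H n + x) * indicator U x :: real) \<longlonglongrightarrow> indicator U x"
        proof (cases "x \<in> U")
          case True
          have "(\<lambda>n. H n + x) \<longlonglongrightarrow> 0 + x" by (intro tendsto_intros H)
          then have "\<forall>\<^sub>F n in sequentially. H n + x \<in> U"
            using U(1) True by (intro topological_tendstoD) auto
          then have "\<forall>\<^sub>F n in sequentially. indicator U (H n + x) * indicator U x = (1::real)"
            by eventually_elim (use True in auto)
          then show ?thesis using True by (auto intro: tendsto_eventually)
        qed simp
      qed
    qed (auto simp: indicator_def)
    then have "(\<lambda>n. 2 * (\<integral>x. indicator U x \<partial>lborel) - 2 * (\<integral>x. indicator U (H n + x) * indicator U x \<partial>lborel))
        \<longlonglongrightarrow> 2 * (\<integral>x. indicator U x \<partial>lborel) - 2 * (\<integral>x. indicator U x \<partial>lborel :: real)"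
      by (intro tendsto_intros)
    then have "\<forall>\<^sub>F n in sequentially.
      2 * (\<integral>x. indicator U x \<partial>lborel) - 2 * (\<integral>x. indicator U (H n + x) * indicator U x \<partial>lborel) < e / 2"
      using e by (intro order_tendstoD(2)) auto
    then obtain n0 where n0: "\<And>n. n \<ge> n0 \<Longrightarrow>
      2 * (\<integral>x. indicator U x \<partial>lborel) - 2 * (\<integral>x. indicator U (H n + x) * indicator U x \<partial>lborel) < e / 2"
      by (auto simp: eventually_sequentially)
    have "emeasure lborel (U - A) = ennreal (measure lborel (U - A))"
      using U(3) by (intro emeasure_eq_ennreal_measure) auto
    then have mUA: "measure lborel (U - A) < e / 4"
      using U(3) e by (simp add: ennreal_less_iff)
    have iUA: "(\<integral>x. indicator U x - indicator A x \<partial>lborel) = measure lborel (U - A)"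
    proof -
      have "(\<integral>x. indicator U x - indicator A x \<partial>lborel :: real) = (\<integral>x. indicator (U - A) x \<partial>lborel)"
        using U(2) by (intro Bochner_Integration.integral_cong) (auto simp: indicator_def)
      then show ?thesis by simp
    qed
    have "norm ((\<integral>x. \<bar>indicator A (H n + x) - indicator A x\<bar> \<partial>lborel) - (0::real)) < e" if "n \<ge> n0" for n
    proof -
      \<comment> \<open>The three groups of terms are the two defects U - A, at the shifted and at
        the original point, and the change of the indicator of U, written as a sum minus twice a
        product. They contribute e/4, e/4 and e/2.\<close>
      have "(\<integral>x. \<bar>indicator A (H n + x) - indicator A x\<bar> \<partial>lborel) \<le>
        (\<integral>x. (indicator U (H n + x) - indicator A (H n + x)) + (indicator U x - indicator A x) +
           (indicator U (H n + x) + indicator U x - 2 * (indicator U (H n + x) * indicator U x)) \<partial>lborel :: real)"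
        using U(2) by (intro integral_mono integrable_abs Bochner_Integration.integrable_add
            Bochner_Integration.integrable_diff integrable_mult_right iU iA iUt iAt iUU)
          (auto simp: indicator_def)
      also have "\<dots> = (\<integral>x. indicator U (H n + x) - indicator A (H n + x) \<partial>lborel) +
         (\<integral>x. indicator U x - indicator A x \<partial>lborel) +
         ((\<integral>x. indicator U (H n + x) \<partial>lborel) + (\<integral>x. indicator U x \<partial>lborel) -
           2 * (\<integral>x. indicator U (H n + x) * indicator U x \<partial>lborel))"
        using iU iA iUt[of "H n"] iAt[of "H n"] iUU[of "H n"] by simp
      also have "(\<integral>x. indicator U (H n + x) - indicator A (H n + x) \<partial>lborel) = (\<integral>x. indicator U x - indicator A x \<partial>lborel :: real)"
        by (rule integral_translate)
      also have "(\<integral>x. indicator U (H n + x) \<partial>lborel) = (\<integral>x. indicator U x \<partial>lborel :: real)"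
        by (rule integral_translate)
      also have "(\<integral>x. indicator U x - indicator A x \<partial>lborel) + (\<integral>x. indicator U x - indicator A x \<partial>lborel) +
         ((\<integral>x. indicator U x \<partial>lborel) + (\<integral>x. indicator U x \<partial>lborel) -
           2 * (\<integral>x. indicator U (H n + x) * indicator U x \<partial>lborel)) < e"
        using n0[OF that] mUA iUA by simp
      finally show ?thesis by simp
    qed
    then show "\<exists>no. \<forall>n\<ge>no. norm ((\<integral>x. \<bar>indicator A (H n + x) - indicator A x\<bar> \<partial>lborel) - (0::real)) < e"
      by blast
  qed
  from tendsto_mult_right[OF this, of "\<bar>c\<bar>"] show ?case
    by (simp add: abs_mult flip: left_diff_distrib)
next
  case (add f g)
  have "(\<lambda>n. (\<integral>x. \<bar>f (H n + x) - f x\<bar> \<partial>lborel) + (\<integral>x. \<bar>g (H n + x) - g x\<bar> \<partial>lborel)) \<longlonglongrightarrow> 0 + 0"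
    by (intro tendsto_add add)
  moreover have "(\<integral>x. \<bar>f (H n + x) + g (H n + x) - (f x + g x)\<bar> \<partial>lborel) \<le>
     (\<integral>x. \<bar>f (H n + x) - f x\<bar> \<partial>lborel) + (\<integral>x. \<bar>g (H n + x) - g x\<bar> \<partial>lborel)" for n
  proof -
    have i: "integrable lborel (\<lambda>x. f (H n + x) - f x)" "integrable lborel (\<lambda>x. g (H n + x) - g x)"
      using add integrable_translate[of f "H n"] integrable_translate[of g "H n"] by auto
    have "(\<integral>x. \<bar>f (H n + x) + g (H n + x) - (f x + g x)\<bar> \<partial>lborel) =
       (\<integral>x. \<bar>(f (H n + x) - f x) + (g (H n + x) - g x)\<bar> \<partial>lborel)"
      by (simp add: algebra_simps)
    also have "\<dots> \<le> (\<integral>x. \<bar>f (H n + x) - f x\<bar> + \<bar>g (H n + x) - g x\<bar> \<partial>lborel)"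
      using i by (intro integral_mono integrable_abs Bochner_Integration.integrable_add) auto
    finally show ?thesis using i by simp
  qed
  ultimately show ?case
    by (rule tendsto_null_squeeze) auto
next
  case (lim f s)
  show ?case
  proof (rule LIMSEQ_I)
    fix e :: real assume e: "e > 0"
    have "(\<lambda>i. \<integral>x. \<bar>s i x - f x\<bar> \<partial>lborel) \<longlonglongrightarrow> (\<integral>x. (0::real) \<partial>(lborel :: (real^2) measure))"
    proof (rule integral_dominated_convergence)
      show "integrable lborel (\<lambda>x. 3 * norm (f x))" using lim.hyps by auto
      show "AE x in lborel. norm \<bar>s i x - f x\<bar> \<le> 3 * norm (f x)" for i
      proof (rule AE_I2)
        fix x
        show "norm \<bar>s i x - f x\<bar> \<le> 3 * norm (f x)" using lim.hyps(3)[of x i] by auto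
      qed
      show "AE x in lborel. (\<lambda>i. \<bar>s i x - f x\<bar>) \<longlonglongrightarrow> 0"
        using lim.hyps(2) by (auto simp: tendsto_rabs_zero_iff LIM_zero_iff)
    qed (use lim.hyps in auto)
    then have "\<forall>\<^sub>F i in sequentially. (\<integral>x. \<bar>s i x - f x\<bar> \<partial>lborel) < e / 3"
      using e by (intro order_tendstoD(2)) auto
    then obtain i where i: "(\<integral>x. \<bar>s i x - f x\<bar> \<partial>lborel) < e / 3"
      by (auto simp: eventually_sequentially)
    from LIMSEQ_D[OF lim.IH[of i], of "e/3"] e obtain n0 where
      n0: "\<And>n. n \<ge> n0 \<Longrightarrow> (\<integral>x. \<bar>s i (H n + x) - s i x\<bar> \<partial>lborel) < e / 3" by (auto simp: abs_less_iff)
    have "norm ((\<integral>x. \<bar>f (H n + x) - f x\<bar> \<partial>lborel) - 0) < e" if "n \<ge> n0" for n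
    proof -
      have int: "integrable lborel f" "integrable lborel (s i)" "integrable lborel (\<lambda>x. f (H n + x))"
        "integrable lborel (\<lambda>x. s i (H n + x))"
        using lim.hyps integrable_translate[of f "H n"] integrable_translate[of "s i" "H n"] by auto
      have "(\<integral>x. \<bar>f (H n + x) - f x\<bar> \<partial>lborel) \<le>
         (\<integral>x. \<bar>s i (H n + x) - f (H n + x)\<bar> + \<bar>s i (H n + x) - s i x\<bar> + \<bar>s i x - f x\<bar> \<partial>lborel)"
        using int by (intro integral_mono integrable_abs Bochner_Integration.integrable_add
            Bochner_Integration.integrable_diff) auto
      also have "\<dots> = (\<integral>x. \<bar>s i (H n + x) - f (H n + x)\<bar> \<partial>lborel) +
          (\<integral>x. \<bar>s i (H n + x) - s i x\<bar> \<partial>lborel) + (\<integral>x. \<bar>s i x - f x\<bar> \<partial>lborel)"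
        using int by simp
      also have "(\<integral>x. \<bar>s i (H n + x) - f (H n + x)\<bar> \<partial>lborel) = (\<integral>x. \<bar>s i x - f x\<bar> \<partial>lborel)"
        by (rule integral_translate)
      finally show ?thesis using i n0[OF that] by simp
    qed
    then show "\<exists>no. \<forall>n\<ge>no. norm ((\<integral>x. \<bar>f (H n + x) - f x\<bar> \<partial>lborel) - 0) < e" by blast
  qed
qed

section \<open>Mollification\<close>

text \<open>Transfers continuity of translations from L1 to L2. The squared positive and negative
  parts of Re and Im are integrable real functions, and
  \<open>(a - b)\<^sup>2 \<le> \<bar>a\<^sup>2 - b\<^sup>2\<bar>\<close> for nonnegative a, b
  returns from their differences to the square of the difference.\<close>

lemma cmod_sq_le_parts:
  fixes z w :: complex
  defines "p \<equiv> \<lambda>t::real. (max 0 t)\<^sup>2"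
  shows "(cmod (z - w))\<^sup>2 \<le> 2 * (\<bar>p (Re z) - p (Re w)\<bar> + \<bar>p (- Re z) - p (- Re w)\<bar>
           + \<bar>p (Im z) - p (Im w)\<bar> + \<bar>p (- Im z) - p (- Im w)\<bar>)"
proof -
  have q: "(a - b)\<^sup>2 \<le> \<bar>a\<^sup>2 - b\<^sup>2\<bar>" if "a \<ge> 0" "b \<ge> 0" for a b :: real
  proof -
    have "\<bar>a - b\<bar> * \<bar>a - b\<bar> \<le> \<bar>a - b\<bar> * \<bar>a + b\<bar>"
      using that by (intro mult_left_mono) auto
    then show ?thesis
      by (metis abs_mult abs_mult_self_eq mult.commute power2_eq_square square_diff_square_factored)
  qed
  have *: "(s - t)\<^sup>2 \<le> 2 * (\<bar>p s - p t\<bar> + \<bar>p (- s) - p (- t)\<bar>)" for s t :: real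
  proof -
    have "s - t = (max 0 s - max 0 t) - (max 0 (- s) - max 0 (- t))" by (auto simp: max_def)
    then have "(s - t)\<^sup>2 = ((max 0 s - max 0 t) - (max 0 (- s) - max 0 (- t)))\<^sup>2" by simp
    also have "\<dots> \<le> 2 * ((max 0 s - max 0 t)\<^sup>2 + (max 0 (- s) - max 0 (- t))\<^sup>2)"
      using zero_le_power2[of "(max 0 s - max 0 t) + (max 0 (- s) - max 0 (- t))"]
      by (simp add: power2_sum power2_diff)
    also have "\<dots> \<le> 2 * (\<bar>p s - p t\<bar> + \<bar>p (- s) - p (- t)\<bar>)"
      unfolding p_def by (intro mult_left_mono add_mono q) auto
    finally show ?thesis .
  qed
  have "(cmod (z - w))\<^sup>2 = (Re z - Re w)\<^sup>2 + (Im z - Im w)\<^sup>2"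
    by (simp add: cmod_power2)
  then show ?thesis using *[of "Re z" "Re w"] *[of "Im z" "Im w"] by simp
qed

lemma translation_L2:
  assumes f: "square_integrable f" and H: "H \<longlonglongrightarrow> 0"
  shows "(\<lambda>n. \<integral>x. (cmod (f (H n + x) - f x))\<^sup>2 \<partial>lborel) \<longlonglongrightarrow> 0"
proof -
  have [measurable]: "f \<in> borel_measurable borel" using f by auto
  define p where "p = (\<lambda>t::real. (max 0 t)\<^sup>2)"
  have pm [measurable]: "p \<in> borel_measurable borel" unfolding p_def by measurable
  have ple: "\<bar>p t\<bar> \<le> t\<^sup>2" for t by (auto simp: p_def max_def)
  have iRe: "integrable lborel (\<lambda>x. p (s * Re (f x)))" "integrable lborel (\<lambda>x. p (s * Im (f x)))"
    if "\<bar>s\<bar> = 1" for s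
  proof -
    have s2: "s\<^sup>2 = 1" using that by (metis power2_abs one_power2)
    have "norm (p (s * Re (f x))) \<le> (cmod (f x))\<^sup>2" "norm (p (s * Im (f x))) \<le> (cmod (f x))\<^sup>2" for x
      using ple[of "s * Re (f x)"] ple[of "s * Im (f x)"] s2 by (auto simp: cmod_power2 power_mult_distrib intro: order_trans)
    then show "integrable lborel (\<lambda>x. p (s * Re (f x)))" "integrable lborel (\<lambda>x. p (s * Im (f x)))"
      using square_integrableD(2)[OF f] by (auto intro!: integrable_dominated[OF square_integrableD(2)[OF f]])
  qed
  have i: "integrable lborel (\<lambda>x. p (Re (f x)))" "integrable lborel (\<lambda>x. p (- Re (f x)))"
     "integrable lborel (\<lambda>x. p (Im (f x)))" "integrable lborel (\<lambda>x. p (- Im (f x)))"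
    using iRe[of 1] iRe[of "-1"] by auto
  let ?d = "\<lambda>g n. \<integral>x. \<bar>p (g (f (H n + x))) - p (g (f x))\<bar> \<partial>lborel"
  note lims = translation_L1[OF i(1) H] translation_L1[OF i(2) H] translation_L1[OF i(3) H] translation_L1[OF i(4) H]
  have "(\<lambda>n. 2 * (?d Re n + ?d (\<lambda>z. - Re z) n + ?d Im n + ?d (\<lambda>z. - Im z) n)) \<longlonglongrightarrow> 2 * (0 + 0 + 0 + 0)"
    by (intro tendsto_mult tendsto_add tendsto_const lims)
  moreover have "(\<integral>x. (cmod (f (H n + x) - f x))\<^sup>2 \<partial>lborel) \<le>
      2 * (?d Re n + ?d (\<lambda>z. - Re z) n + ?d Im n + ?d (\<lambda>z. - Im z) n)" for n
  proof -
    have i': "integrable lborel (\<lambda>x. \<bar>p (g (f (H n + x))) - p (g (f x))\<bar>)"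
      if "integrable lborel (\<lambda>x. p (g (f x)))" for g
      using that integrable_translate[of "\<lambda>x. p (g (f x))" "H n"] by auto
    note ii = i'[OF i(1)] i'[OF i(2)] i'[OF i(3)] i'[OF i(4)]
    have "(\<integral>x. (cmod (f (H n + x) - f x))\<^sup>2 \<partial>lborel) \<le>
       (\<integral>x. 2 * (\<bar>p (Re (f (H n + x))) - p (Re (f x))\<bar> + \<bar>p (- Re (f (H n + x))) - p (- Re (f x))\<bar>
         + \<bar>p (Im (f (H n + x))) - p (Im (f x))\<bar> + \<bar>p (- Im (f (H n + x))) - p (- Im (f x))\<bar>) \<partial>lborel)"
    proof (rule integral_mono')
      show "integrable lborel (\<lambda>x. 2 * (\<bar>p (Re (f (H n + x))) - p (Re (f x))\<bar> + \<bar>p (- Re (f (H n + x))) - p (- Re (f x))\<bar>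
         + \<bar>p (Im (f (H n + x))) - p (Im (f x))\<bar> + \<bar>p (- Im (f (H n + x))) - p (- Im (f x))\<bar>))"
        by (intro integrable_mult_right Bochner_Integration.integrable_add ii)
    qed (use cmod_sq_le_parts in \<open>auto simp: p_def\<close>)
    also have "\<dots> = 2 * (?d Re n + ?d (\<lambda>z. - Re z) n + ?d Im n + ?d (\<lambda>z. - Im z) n)"
      using ii by simp
    finally show ?thesis .
  qed
  ultimately show ?thesis by (rule tendsto_null_squeeze) auto
qed

definition mollify :: "(real^2 \<Rightarrow> real) \<Rightarrow> real \<Rightarrow> (real^2 \<Rightarrow> complex) \<Rightarrow> real^2 \<Rightarrow> complex" where
  "mollify k e f x = (\<integral>y. k y *\<^sub>R f (x - e *\<^sub>R y) \<partial>lborel)"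

text \<open>Only a bounded probability density is asked for, neither smooth nor compactly supported,
  because two kernels are used: the bump \<open>rho\<close> for regularisation and the normalised
  Gaussian for completeness of the Hermite functions. The bound M makes the mollification of an L2
  function a convergent integral at every point.\<close>

locale mollifier =
  fixes k :: "real^2 \<Rightarrow> real" and M :: real
  assumes k_borel [measurable]: "k \<in> borel_measurable borel"
    and k_nonneg: "\<And>x. k x \<ge> 0" and k_le: "\<And>x. k x \<le> M"
    and k_integrable: "integrable lborel k" and k_integral: "(\<integral>x. k x \<partial>lborel) = 1"
begin

lemma k_nn: "(\<integral>\<^sup>+x. ennreal (k x) \<partial>lborel) = 1"
  using k_integrable k_integral k_nonneg by (subst nn_integral_eq_integral) auto

lemma mollify_integrable:
  assumes f: "square_integrable f" and e: "e > 0"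
  shows "integrable lborel (\<lambda>y. k y *\<^sub>R f (x - e *\<^sub>R y))"
proof -
  have [measurable]: "f \<in> borel_measurable borel" using f by auto
  have "integrable lborel (\<lambda>y. (cmod (f (x + (- e) *\<^sub>R y)))\<^sup>2)"
    using square_integrableD(2)[OF f] e by (rule_tac integrable_affine) auto
  then have "integrable lborel (\<lambda>y. k y + M * (cmod (f (x - e *\<^sub>R y)))\<^sup>2)"
    using k_integrable by simp
  moreover have "norm (k y *\<^sub>R f (x - e *\<^sub>R y)) \<le> k y + M * (cmod (f (x - e *\<^sub>R y)))\<^sup>2" for y
  proof -
    let ?a = "cmod (f (x - e *\<^sub>R y))"
    have "0 \<le> (?a - 1)\<^sup>2" "0 \<le> ?a" by auto
    then have "?a \<le> 1 + ?a\<^sup>2" unfolding power2_diff one_power2 mult_1_right by linarith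
    then have "k y * ?a \<le> k y * (1 + ?a\<^sup>2)" using k_nonneg by (rule mult_left_mono)
    also have "k y * ?a\<^sup>2 \<le> M * ?a\<^sup>2" by (intro mult_right_mono k_le) auto
    then have "k y * (1 + ?a\<^sup>2) \<le> k y + M * ?a\<^sup>2" by (simp add: algebra_simps)
    finally show ?thesis using k_nonneg by simp
  qed
  ultimately show ?thesis
    by (rule integrable_dominated') auto
qed

lemma mollify_borel [measurable]:
  assumes [measurable]: "f \<in> borel_measurable borel"
  shows "mollify k e f \<in> borel_measurable borel"
  unfolding mollify_def[abs_def] by measurable

text \<open>Jensen's inequality for the probability density k, obtained from Cauchy-Schwarz with k
  split into square roots; Tonelli then leaves an average of squared translation errors.\<close>

lemma mollify_diff_le:
  assumes f: "square_integrable f" and e: "e > 0"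
  shows "(\<integral>\<^sup>+x. ennreal ((cmod (mollify k e f x - f x))\<^sup>2) \<partial>lborel) \<le>
     (\<integral>\<^sup>+y. ennreal (k y * (\<integral>x. (cmod (f ((- e) *\<^sub>R y + x) - f x))\<^sup>2 \<partial>lborel)) \<partial>lborel)"
proof -
  have [measurable]: "f \<in> borel_measurable borel" using f by auto
  have "ennreal ((cmod (mollify k e f x - f x))\<^sup>2) \<le>
     (\<integral>\<^sup>+y. ennreal (k y) * ennreal ((cmod (f ((- e) *\<^sub>R y + x) - f x))\<^sup>2) \<partial>lborel)" for x
  proof -
    have "mollify k e f x - f x = (\<integral>y. k y *\<^sub>R f (x - e *\<^sub>R y) \<partial>lborel) - (\<integral>y. k y *\<^sub>R f x \<partial>lborel)"
      using k_integrable k_integral by (simp add: mollify_def)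
    also have "\<dots> = (\<integral>y. k y *\<^sub>R f (x - e *\<^sub>R y) - k y *\<^sub>R f x \<partial>lborel)"
      by (rule Bochner_Integration.integral_diff[symmetric])
        (use mollify_integrable[OF assms] k_integrable in auto)
    also have "\<dots> = (\<integral>y. k y *\<^sub>R (f ((- e) *\<^sub>R y + x) - f x) \<partial>lborel)"
      by (simp add: scaleR_diff_right)
    finally have eq: "mollify k e f x - f x = (\<integral>y. k y *\<^sub>R (f ((- e) *\<^sub>R y + x) - f x) \<partial>lborel)" .
    have "ennreal (cmod (mollify k e f x - f x)) \<le> (\<integral>\<^sup>+y. ennreal (norm (k y *\<^sub>R (f ((- e) *\<^sub>R y + x) - f x))) \<partial>lborel)"
      unfolding eq by (rule integral_norm_bound_ennreal)
        (use mollify_integrable[OF assms, of x] k_integrable in \<open>auto simp: scaleR_diff_right\<close>)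
    also have "\<dots> = (\<integral>\<^sup>+y. ennreal (sqrt (k y)) * ennreal (sqrt (k y) * cmod (f ((- e) *\<^sub>R y + x) - f x)) \<partial>lborel)"
      using k_nonneg by (intro nn_integral_cong) (simp flip: ennreal_mult mult.assoc)
    finally have "(ennreal (cmod (mollify k e f x - f x)))\<^sup>2 \<le>
       (\<integral>\<^sup>+y. ennreal (sqrt (k y)) * ennreal (sqrt (k y) * cmod (f ((- e) *\<^sub>R y + x) - f x)) \<partial>lborel)\<^sup>2"
      by (rule power_mono) simp
    also have "\<dots> \<le> (\<integral>\<^sup>+y. (ennreal (sqrt (k y)))\<^sup>2 \<partial>lborel) *
        (\<integral>\<^sup>+y. (ennreal (sqrt (k y) * cmod (f ((- e) *\<^sub>R y + x) - f x)))\<^sup>2 \<partial>lborel)"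
      by (rule Cauchy_Schwarz_nn_integral) measurable
    also have "\<dots> = (\<integral>\<^sup>+y. ennreal (k y) * ennreal ((cmod (f ((- e) *\<^sub>R y + x) - f x))\<^sup>2) \<partial>lborel)"
      using k_nonneg k_nn by (simp add: ennreal_power power_mult_distrib ennreal_mult)
    finally show ?thesis by (simp add: ennreal_power)
  qed
  then have "(\<integral>\<^sup>+x. ennreal ((cmod (mollify k e f x - f x))\<^sup>2) \<partial>lborel) \<le>
     (\<integral>\<^sup>+x. \<integral>\<^sup>+y. ennreal (k y) * ennreal ((cmod (f ((- e) *\<^sub>R y + x) - f x))\<^sup>2) \<partial>lborel \<partial>lborel)"
    by (intro nn_integral_mono) auto
  also have "\<dots> = (\<integral>\<^sup>+y. \<integral>\<^sup>+x. ennreal (k y) * ennreal ((cmod (f ((- e) *\<^sub>R y + x) - f x))\<^sup>2) \<partial>lborel \<partial>lborel)"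
    by (rule lborel_pair.Fubini') measurable
  also have "\<dots> = (\<integral>\<^sup>+y. ennreal (k y * (\<integral>x. (cmod (f ((- e) *\<^sub>R y + x) - f x))\<^sup>2 \<partial>lborel)) \<partial>lborel)"
  proof (intro nn_integral_cong)
    fix y
    have tr: "square_integrable (\<lambda>x. f ((- e) *\<^sub>R y + x))"
      using f integrable_translate[of "\<lambda>x. (cmod (f x))\<^sup>2" "(- e) *\<^sub>R y"] by (auto simp: square_integrable_def)
    have "(\<integral>\<^sup>+x. ennreal (k y) * ennreal ((cmod (f ((- e) *\<^sub>R y + x) - f x))\<^sup>2) \<partial>lborel) =
      ennreal (k y) * (\<integral>\<^sup>+x. ennreal ((cmod (f ((- e) *\<^sub>R y + x) - f x))\<^sup>2) \<partial>lborel)"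
      by (rule nn_integral_cmult) measurable
    also have "\<dots> = ennreal (k y) * ennreal (\<integral>x. (cmod (f ((- e) *\<^sub>R y + x) - f x))\<^sup>2 \<partial>lborel)"
      using nn_square_integrable[OF square_integrable_diff[OF tr f]] by simp
    finally show "(\<integral>\<^sup>+x. ennreal (k y) * ennreal ((cmod (f ((- e) *\<^sub>R y + x) - f x))\<^sup>2) \<partial>lborel) =
       ennreal (k y * (\<integral>x. (cmod (f ((- e) *\<^sub>R y + x) - f x))\<^sup>2 \<partial>lborel))"
      using k_nonneg by (simp add: ennreal_mult)
  qed
  finally show ?thesis .
qed

lemma translation_bound:
  assumes f: "square_integrable f"
  shows "(\<integral>x. (cmod (f (h + x) - f x))\<^sup>2 \<partial>lborel) \<le> 4 * (\<integral>x. (cmod (f x))\<^sup>2 \<partial>lborel)"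
proof -
  have i: "integrable lborel (\<lambda>x. (cmod (f (h + x)))\<^sup>2)" "integrable lborel (\<lambda>x. (cmod (f x))\<^sup>2)"
    using f integrable_translate[of "\<lambda>x. (cmod (f x))\<^sup>2" h] by auto
  have "(\<integral>x. (cmod (f (h + x) - f x))\<^sup>2 \<partial>lborel) \<le>
      (\<integral>x. 2 * (cmod (f (h + x)))\<^sup>2 + 2 * (cmod (f x))\<^sup>2 \<partial>lborel)"
  proof (rule integral_mono')
    fix x
    have "(cmod (f (h + x) - f x))\<^sup>2 \<le> (cmod (f (h + x)) + cmod (f x))\<^sup>2"
      by (intro power_mono norm_triangle_ineq4) auto
    then show "(cmod (f (h + x) - f x))\<^sup>2 \<le> 2 * (cmod (f (h + x)))\<^sup>2 + 2 * (cmod (f x))\<^sup>2"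
      using sum_squares_bound[of "cmod (f (h + x))" "cmod (f x)"] by (simp add: power2_sum)
  qed (use i in auto)
  also have "\<dots> = 2 * (\<integral>x. (cmod (f (h + x)))\<^sup>2 \<partial>lborel) + 2 * (\<integral>x. (cmod (f x))\<^sup>2 \<partial>lborel)"
    using i by simp
  also have "(\<integral>x. (cmod (f (h + x)))\<^sup>2 \<partial>lborel) = (\<integral>x. (cmod (f x))\<^sup>2 \<partial>lborel)"
    by (rule integral_translate)
  finally show ?thesis by simp
qed

text \<open>The averaged translation error tends to 0 for every y by continuity of translations and
  is at most four times the squared norm of f, so dominated convergence in y applies with a multiple
  of k as majorant.\<close>

lemma mollify_tendsto:
  assumes f: "square_integrable f" and e: "\<And>n. e n > 0" "e \<longlonglongrightarrow> 0"
  shows "L2_tendsto (\<lambda>n. mollify k (e n) f) f"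
proof -
  have [measurable]: "f \<in> borel_measurable borel" using f by auto
  let ?T = "\<lambda>h. \<integral>x. (cmod (f (h + x) - f x))\<^sup>2 \<partial>lborel"
  let ?C = "4 * (\<integral>x. (cmod (f x))\<^sup>2 \<partial>lborel)"
  have T0: "?T h \<ge> 0" for h by (intro integral_nonneg_AE) auto
  have bnd: "norm (k y * ?T h) \<le> k y * ?C" for y h
    unfolding real_norm_def abs_mult abs_of_nonneg[OF k_nonneg] abs_of_nonneg[OF T0]
    by (intro mult_left_mono translation_bound f k_nonneg)
  have iT: "integrable lborel (\<lambda>y. k y * ?T ((- e n) *\<^sub>R y))" for n
    by (rule integrable_dominated'[OF integrable_mult_left[OF k_integrable, of ?C] bnd]) measurable
  have le: "(\<integral>\<^sup>+x. ennreal ((cmod (mollify k (e n) f x - f x))\<^sup>2) \<partial>lborel) \<le>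
     ennreal (\<integral>y. k y * ?T ((- e n) *\<^sub>R y) \<partial>lborel)" for n
    using mollify_diff_le[OF f e(1)[of n]] iT[of n] k_nonneg T0
    by (subst (asm) (2) nn_integral_eq_integral) auto
  have fin: "square_integrable (\<lambda>x. mollify k (e n) f x - f x)" for n
    by (rule square_integrableI_nn) (use le[of n] in \<open>auto simp: less_top[symmetric] top_unique\<close>)
  have "(\<lambda>n. \<integral>y. k y * ?T ((- e n) *\<^sub>R y) \<partial>lborel) \<longlonglongrightarrow> (\<integral>y. (0::real) \<partial>(lborel :: (real^2) measure))"
  proof (rule integral_dominated_convergence)
    show "integrable lborel (\<lambda>y. k y * ?C)" using k_integrable by simp
    show "AE y in lborel. (\<lambda>n. k y * ?T ((- e n) *\<^sub>R y)) \<longlonglongrightarrow> 0"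
    proof (rule AE_I2)
      fix y :: "real^2"
      have "(\<lambda>n. (- e n) *\<^sub>R y) \<longlonglongrightarrow> (- 0) *\<^sub>R y"
        by (rule tendsto_scaleR[OF tendsto_minus[OF e(2)] tendsto_const])
      then have "(\<lambda>n. ?T ((- e n) *\<^sub>R y)) \<longlonglongrightarrow> 0" by (intro translation_L2 f) simp
      then show "(\<lambda>n. k y * ?T ((- e n) *\<^sub>R y)) \<longlonglongrightarrow> 0" by (rule tendsto_mult_right_zero)
    qed
    show "AE y in lborel. norm (k y * ?T ((- e n) *\<^sub>R y)) \<le> k y * ?C" for n
      by (intro AE_I2 bnd)
  qed auto
  then have lim: "(\<lambda>n. \<integral>y. k y * ?T ((- e n) *\<^sub>R y) \<partial>lborel) \<longlonglongrightarrow> 0" by simp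
  have "(\<integral>x. (cmod (mollify k (e n) f x - f x))\<^sup>2 \<partial>lborel) \<le> (\<integral>y. k y * ?T ((- e n) *\<^sub>R y) \<partial>lborel)" for n
    using le[of n] k_nonneg T0 unfolding nn_square_integrable[OF fin]
    by (subst (asm) ennreal_le_iff) (auto intro!: integral_nonneg_AE AE_I2)
  with lim have "(\<lambda>n. \<integral>x. (cmod (mollify k (e n) f x - f x))\<^sup>2 \<partial>lborel) \<longlonglongrightarrow> 0"
    by (rule tendsto_null_squeeze) auto
  moreover have "square_integrable (mollify k (e n) f)" for n
    using square_integrable_add[OF fin[of n] f] by simp
  ultimately show ?thesis using f by (simp add: L2_tendsto_def)
qed

end


section \<open>Regularity of convolutions and integration by parts\<close>

lemma norm_integral_le:
  fixes f :: "'b \<Rightarrow> 'c::{banach, second_countable_topology}" and g :: "'b \<Rightarrow> real"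
  assumes g: "integrable M g" and le: "\<And>x. norm (f x) \<le> g x"
  shows "norm (integral\<^sup>L M f) \<le> integral\<^sup>L M g"
proof -
  have "norm (integral\<^sup>L M f) \<le> (\<integral>x. norm (f x) \<partial>M)" by (rule integral_norm_bound)
  also have "\<dots> \<le> integral\<^sup>L M g"
    by (rule integral_mono'[OF g le]) (use order_trans[OF norm_ge_zero le] in auto)
  finally show ?thesis .
qed

definition locally_integrable :: "(real^2 \<Rightarrow> complex) \<Rightarrow> bool" where
  "locally_integrable f \<longleftrightarrow> f \<in> borel_measurable borel \<and>
     (\<forall>z r. integrable lborel (\<lambda>y. indicator (cball z r) y *\<^sub>R f y))"

lemma locally_integrableD:
  assumes "locally_integrable f"
  shows "f \<in> borel_measurable borel" "integrable lborel (\<lambda>y. indicator (cball z r) y *\<^sub>R f y)"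
  using assms by (auto simp: locally_integrable_def)

lemma integrable_indicator_cball: "integrable lborel (\<lambda>y. indicator (cball (z::real^2) r) y :: real)"
proof (cases "r \<ge> 0")
  case True
  then show ?thesis by (simp add: emeasure_disc less_top[symmetric])
next
  case False
  then have "cball z r = {}" by auto
  then show ?thesis by simp
qed

lemma square_integrable_locally_integrable:
  assumes "square_integrable f"
  shows "locally_integrable f"
proof -
  have [measurable]: "f \<in> borel_measurable borel" using assms by auto
  have "integrable lborel (\<lambda>y. indicator (cball z r) y *\<^sub>R f y)" for z r
  proof (rule integrable_dominated')
    have [measurable]: "cball z r \<in> sets borel" by simp
    show "(\<lambda>y. indicator (cball z r) y *\<^sub>R f y) \<in> borel_measurable lborel" by measurable
    show "integrable lborel (\<lambda>y. indicator (cball z r) y + (cmod (f y))\<^sup>2)"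
      using integrable_indicator_cball[of z r] assms by auto
    fix y
    have "0 \<le> (cmod (f y) - 1)\<^sup>2" "0 \<le> cmod (f y)" by auto
    then have "cmod (f y) \<le> 1 + (cmod (f y))\<^sup>2"
      unfolding power2_diff one_power2 mult_1_right by linarith
    then show "norm (indicator (cball z r) y *\<^sub>R f y) \<le> indicator (cball z r) y + (cmod (f y))\<^sup>2"
      by (auto simp: indicator_def)
  qed
  then show ?thesis by (auto simp: locally_integrable_def)
qed

text \<open>The kernel carries the variable z, so that derivatives in z fall on the smooth kernel
  and f is only ever integrated.\<close>

definition convolve :: "(real^2 \<Rightarrow> complex) \<Rightarrow> (real^2 \<Rightarrow> complex) \<Rightarrow> real^2 \<Rightarrow> complex" where
  "convolve k f z = (\<integral>y. f y * k (z - y) \<partial>lborel)"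

lemma convolve_integrable:
  assumes f: "locally_integrable f" and k: "continuous_on UNIV k" and r: "\<And>x. norm x > r \<Longrightarrow> k x = 0"
  shows "integrable lborel (\<lambda>y. f y * k (z - y))"
proof -
  note [measurable] = locally_integrableD(1)[OF f] borel_measurable_continuous_onI[OF k]
  have "bounded (k ` cball 0 r)"
    by (intro compact_imp_bounded compact_continuous_image continuous_on_subset[OF k]) auto
  then obtain C where C: "\<And>x. x \<in> cball 0 r \<Longrightarrow> norm (k x) \<le> C"
    by (metis bounded_iff imageI)
  have "norm (k x) \<le> \<bar>C\<bar> * indicator (cball 0 r) x" for x
    using C[of x] r[of x] by (cases "norm x > r") (auto simp: indicator_def)
  note kb = this
  show ?thesis
  proof (rule integrable_dominated')
    show "integrable lborel (\<lambda>y. \<bar>C\<bar> * norm (indicator (cball z r) y *\<^sub>R f y))"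
      by (rule integrable_mult_right[OF integrable_norm[OF locally_integrableD(2)[OF f]]])
    fix y
    have "norm (f y) * norm (k (z - y)) \<le> norm (f y) * (\<bar>C\<bar> * indicator (cball 0 r) (z - y))"
      by (intro mult_left_mono kb) auto
    also have "indicator (cball 0 r) (z - y) = (indicator (cball z r) y :: real)"
      by (auto simp: indicator_def dist_norm norm_minus_commute[of z y])
    finally show "norm (f y * k (z - y)) \<le> \<bar>C\<bar> * norm (indicator (cball z r) y *\<^sub>R f y)"
      by (simp add: norm_mult mult_ac)
  qed measurable
qed

lemma continuous_support_bound:
  fixes k :: "real^2 \<Rightarrow> complex"
  assumes k: "continuous_on UNIV k" and r: "\<And>x. norm x > r \<Longrightarrow> k x = 0"
  obtains C where "C \<ge> 0" "\<And>x. norm (k x) \<le> C"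
proof -
  have "bounded (k ` cball 0 r)"
    by (intro compact_imp_bounded compact_continuous_image continuous_on_subset[OF k]) auto
  then obtain C where C: "\<And>x. x \<in> cball 0 r \<Longrightarrow> norm (k x) \<le> C"
    by (metis bounded_iff imageI)
  have "norm (k x) \<le> \<bar>C\<bar>" for x
    using C[of x] r[of x] by (cases "norm x > r") auto
  then show ?thesis using that[of "\<bar>C\<bar>"] by auto
qed

lemma has_gradient_lipschitz:
  fixes k :: "real^2 \<Rightarrow> complex"
  assumes k: "has_gradient k k'" and C: "\<And>j x. norm (k' j x) \<le> C"
  shows "norm (k x - k y) \<le> 2 * C * norm (x - y)"
proof -
  have "norm (k x - k y) \<le> (2 * C) * norm (x - y)"
  proof (rule differentiable_bound[of UNIV])
    show "(k has_derivative (\<lambda>h. \<Sum>j\<in>UNIV. h $ j *\<^sub>R k' j x)) (at x within UNIV)" for x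
      using has_gradientD(1)[OF k] by simp
    show "onorm (\<lambda>h. \<Sum>j\<in>UNIV. h $ j *\<^sub>R k' j x) \<le> 2 * C" for x
    proof (rule onorm_le)
      fix h :: "real^2"
      have "norm (\<Sum>j\<in>UNIV. h $ j *\<^sub>R k' j x) \<le> (\<Sum>j\<in>(UNIV :: 2 set). norm h * C)"
        using C by (intro sum_norm_le) (auto intro!: mult_mono component_le_norm_cart)
      then show "norm (\<Sum>j\<in>UNIV. h $ j *\<^sub>R k' j x) \<le> 2 * C * norm h"
        by (simp add: mult_ac)
    qed
  qed auto
  then show ?thesis .
qed

text \<open>The mean value inequality applied to k minus its linearisation at x, whose gradient is
  at most L |h| componentwise on the ball of radius |h|. The factor 2 counts the two
  coordinates.\<close>

lemma has_gradient_taylor: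
  fixes k :: "real^2 \<Rightarrow> complex"
  assumes k: "has_gradient k k'" and k': "\<And>j x y. norm (k' j x - k' j y) \<le> L * norm (x - y)"
  shows "norm (k (x + h) - k x - (\<Sum>j\<in>UNIV. h $ j *\<^sub>R k' j x)) \<le> 2 * L * (norm h)\<^sup>2"
proof -
  define g where "g y = k y - (\<Sum>j\<in>UNIV. y $ j *\<^sub>R k' j x)" for y
  have dg: "(g has_derivative (\<lambda>h. \<Sum>j\<in>UNIV. h $ j *\<^sub>R (k' j y - k' j x))) (at y within cball x (norm h))" for y
  proof -
    have "((\<lambda>y. \<Sum>j\<in>UNIV. y $ j *\<^sub>R k' j x) has_derivative (\<lambda>h. \<Sum>j\<in>UNIV. h $ j *\<^sub>R k' j x)) (at y)"
      by (intro bounded_linear_imp_has_derivative bounded_linear_sum bounded_linear_scaleR_const bounded_linear_vec_nth)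
    from has_derivative_diff[OF has_gradientD(1)[OF k] this]
    have "(g has_derivative (\<lambda>h. \<Sum>j\<in>UNIV. h $ j *\<^sub>R (k' j y - k' j x))) (at y)"
      by (simp add: g_def[abs_def] scaleR_diff_right sum_subtractf)
    then show ?thesis by (rule has_derivative_at_withinI)
  qed
  have "norm (g (x + h) - g x) \<le> (2 * L * norm h) * norm ((x + h) - x)"
  proof (rule differentiable_bound[OF _ dg])
    fix y assume y: "y \<in> cball x (norm h)"
    show "onorm (\<lambda>h. \<Sum>j\<in>UNIV. h $ j *\<^sub>R (k' j y - k' j x)) \<le> 2 * L * norm h"
    proof (rule onorm_le)
      fix v :: "real^2"
      have L: "L \<ge> 0" using order_trans[OF norm_ge_zero k'[of undefined "axis 1 1" 0]] by (simp add: norm_axis_1)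
      have "norm (k' j y - k' j x) \<le> L * norm h" for j
        using order_trans[OF k'[of j y x] mult_left_mono[of "norm (y - x)" "norm h" L]] y L
        by (auto simp: dist_norm norm_minus_commute)
      then have "norm (\<Sum>j\<in>UNIV. v $ j *\<^sub>R (k' j y - k' j x)) \<le> (\<Sum>j\<in>(UNIV :: 2 set). norm v * (L * norm h))"
        by (intro sum_norm_le) (auto intro!: mult_mono component_le_norm_cart)
      then show "norm (\<Sum>j\<in>UNIV. v $ j *\<^sub>R (k' j y - k' j x)) \<le> 2 * L * norm h * norm v"
        by (simp add: mult_ac)
    qed
  qed (auto simp: dist_norm)
  moreover have "g (x + h) - g x = k (x + h) - k x - (\<Sum>j\<in>UNIV. h $ j *\<^sub>R k' j x)"
    by (simp add: g_def scaleR_left_distrib sum.distrib)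
  ultimately show ?thesis by (simp add: power2_eq_square mult_ac)
qed

text \<open>Second derivatives of the kernel are demanded because they make the Taylor remainder
  quadratic uniformly in y, so that differentiation under the integral becomes a direct estimate.
  For |h| at most 1 all integrands vanish outside the disc of radius r + 1 around z, where f is
  integrable.\<close>

lemma has_gradient_convolve:
  assumes f: "locally_integrable f" and k: "has_gradient k k'" and k': "\<And>j. has_gradient (k' j) (k'' j)"
    and r: "\<And>x. norm x > r \<Longrightarrow> k x = 0" "\<And>j x. norm x > r \<Longrightarrow> k' j x = 0"
      "\<And>i j x. norm x > r \<Longrightarrow> k'' i j x = 0"
  shows "has_gradient (convolve k f) (\<lambda>j. convolve (k' j) f)"
proof -
  note kc = has_gradientD(3)[OF k] has_gradientD(3)[OF k'] has_gradientD(2)[OF k']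
  note [measurable] = locally_integrableD(1)[OF f] has_gradient_borel[OF k] has_gradient_borel(1)[OF k']
  have bounds: "\<exists>C\<ge>0. \<forall>x. norm (k'' i j x) \<le> C" for i j
    by (rule continuous_support_bound[OF kc(3)[of i j] r(3)]) blast+
  then obtain C2 where C2: "\<And>i j x. norm (k'' i j x) \<le> C2 i j" by metis
  define C where "C = (\<Sum>i\<in>UNIV. \<Sum>j\<in>UNIV. \<bar>C2 i j\<bar>)"
  have C2': "norm (k'' i j x) \<le> C" for i j x
  proof -
    have "\<bar>C2 i j\<bar> \<le> (\<Sum>j\<in>UNIV. \<bar>C2 i j\<bar>)" by (rule member_le_sum) auto
    also have "\<dots> \<le> C" unfolding C_def by (rule member_le_sum[of i UNIV "\<lambda>i. \<Sum>j\<in>UNIV. \<bar>C2 i j\<bar>"]) (auto intro!: sum_nonneg)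
    finally show ?thesis using C2[of i j x] by linarith
  qed
  have lip: "norm (k' j x - k' j y) \<le> (2 * C) * norm (x - y)" for j x y
    by (rule has_gradient_lipschitz[OF k' C2'])
  have C0: "C \<ge> 0" unfolding C_def by (auto intro!: sum_nonneg)
  note taylor = has_gradient_taylor[OF k lip]
  define I where "I z = (\<integral>y. norm (indicator (cball z (r + 1)) y *\<^sub>R f y) \<partial>lborel)" for z
  note int = convolve_integrable[OF f kc(1) r(1)] convolve_integrable[OF f kc(2) r(2)]
  have est: "norm (convolve k f (z + h) - convolve k f z - (\<Sum>j\<in>UNIV. h $ j *\<^sub>R convolve (k' j) f z))
       \<le> 4 * C * (norm h)\<^sup>2 * I z" if h: "norm h \<le> 1" for z h
  proof -
    have sum: "(\<integral>y. (\<Sum>j\<in>UNIV. h $ j *\<^sub>R (f y * k' j (z - y))) \<partial>lborel) = (\<Sum>j\<in>UNIV. h $ j *\<^sub>R convolve (k' j) f z)"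
      unfolding convolve_def using int(2) by (subst Bochner_Integration.integral_sum) auto
    have intS: "integrable lborel (\<lambda>y. \<Sum>j\<in>UNIV. h $ j *\<^sub>R (f y * k' j (z - y)))"
      using int(2) by auto
    have "convolve k f (z + h) - convolve k f z - (\<Sum>j\<in>UNIV. h $ j *\<^sub>R convolve (k' j) f z) =
      (\<integral>y. f y * k (z + h - y) - f y * k (z - y) - (\<Sum>j\<in>UNIV. h $ j *\<^sub>R (f y * k' j (z - y))) \<partial>lborel)"
      unfolding sum[symmetric] unfolding convolve_def
      using int(1)[where z="z + h"] int(1)[where z=z] intS by simp
    also have "\<dots> = (\<integral>y. f y * (k (z - y + h) - k (z - y) - (\<Sum>j\<in>UNIV. h $ j *\<^sub>R k' j (z - y))) \<partial>lborel)"
      by (intro Bochner_Integration.integral_cong) (auto simp: algebra_simps sum_distrib_left)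
    finally have eq: "convolve k f (z + h) - convolve k f z - (\<Sum>j\<in>UNIV. h $ j *\<^sub>R convolve (k' j) f z) =
      (\<integral>y. f y * (k (z - y + h) - k (z - y) - (\<Sum>j\<in>UNIV. h $ j *\<^sub>R k' j (z - y))) \<partial>lborel)" .
    have "norm (\<integral>y. f y * (k (z - y + h) - k (z - y) - (\<Sum>j\<in>UNIV. h $ j *\<^sub>R k' j (z - y))) \<partial>lborel) \<le>
      (\<integral>y. (4 * C * (norm h)\<^sup>2) * norm (indicator (cball z (r + 1)) y *\<^sub>R f y) \<partial>lborel)"
    proof (rule norm_integral_le)
      show "integrable lborel (\<lambda>y. (4 * C * (norm h)\<^sup>2) * norm (indicator (cball z (r + 1)) y *\<^sub>R f y))"
        by (rule integrable_mult_right[OF integrable_norm[OF locally_integrableD(2)[OF f]]])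
      fix y
      show "norm (f y * (k (z - y + h) - k (z - y) - (\<Sum>j\<in>UNIV. h $ j *\<^sub>R k' j (z - y)))) \<le>
        (4 * C * (norm h)\<^sup>2) * norm (indicator (cball z (r + 1)) y *\<^sub>R f y)"
      proof (cases "y \<in> cball z (r + 1)")
        case True
        have "norm (f y) * norm (k (z - y + h) - k (z - y) - (\<Sum>j\<in>UNIV. h $ j *\<^sub>R k' j (z - y))) \<le>
          norm (f y) * (2 * (2 * C) * (norm h)\<^sup>2)"
          by (intro mult_left_mono taylor) auto
        then show ?thesis using True by (simp add: norm_mult mult_ac)
      next
        case False
        then have n: "norm (z - y) > r + 1" by (simp add: dist_norm)
        have "norm (z - y + h) > r" using n h norm_triangle_ineq4[of "z - y + h" h] by simp
        then have "k (z - y + h) = 0" "k (z - y) = 0" "k' j (z - y) = 0" for j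
          using n r by auto
        then show ?thesis using C0 by simp
      qed
    qed
    then show ?thesis unfolding eq I_def by simp
  qed
  have "(convolve k f has_derivative (\<lambda>h. \<Sum>j\<in>UNIV. h $ j *\<^sub>R convolve (k' j) f z)) (at z)" for z
    unfolding has_derivative_at
  proof
    show "bounded_linear (\<lambda>h. \<Sum>j\<in>UNIV. h $ j *\<^sub>R convolve (k' j) f z)"
      by (intro bounded_linear_sum bounded_linear_scaleR_const bounded_linear_vec_nth)
    show "(\<lambda>h. norm (convolve k f (z + h) - convolve k f z - (\<Sum>j\<in>UNIV. h $ j *\<^sub>R convolve (k' j) f z)) / norm h)
       \<midarrow>0\<rightarrow> 0"
    proof (rule Lim_null_comparison)
      have "\<forall>\<^sub>F h in at 0. norm (h :: real^2) < 1"
        by (rule order_tendstoD(2)[of _ 0]) (auto intro!: tendsto_eq_intros)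
      then show "\<forall>\<^sub>F h in at 0. norm (norm (convolve k f (z + h) - convolve k f z -
           (\<Sum>j\<in>UNIV. h $ j *\<^sub>R convolve (k' j) f z)) / norm h) \<le> 4 * C * I z * norm h"
      proof eventually_elim
        case (elim h)
        then show ?case
          using est[of h z] by (cases "h = 0") (auto simp: field_simps power2_eq_square)
      qed
      show "((\<lambda>h. 4 * C * I z * norm h) \<longlongrightarrow> 0) (at 0)"
        by (auto intro!: tendsto_eq_intros)
    qed
  qed
  moreover have "continuous_on UNIV (convolve (k' j) f)" for j
  proof -
    have lipc: "norm (convolve (k' j) f (z + h) - convolve (k' j) f z) \<le> 2 * C * norm h * I z"
      if h: "norm h \<le> 1" for z h
    proof -
      have eq: "convolve (k' j) f (z + h) - convolve (k' j) f z = (\<integral>y. f y * (k' j (z + h - y) - k' j (z - y)) \<partial>lborel)"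
        unfolding convolve_def using int(2)[where z="z + h"] int(2)[where z=z]
        by (simp add: right_diff_distrib)
      have "norm (\<integral>y. f y * (k' j (z + h - y) - k' j (z - y)) \<partial>lborel) \<le>
        (\<integral>y. (2 * C * norm h) * norm (indicator (cball z (r + 1)) y *\<^sub>R f y) \<partial>lborel)"
      proof (rule norm_integral_le)
        show "integrable lborel (\<lambda>y. (2 * C * norm h) * norm (indicator (cball z (r + 1)) y *\<^sub>R f y))"
          by (rule integrable_mult_right[OF integrable_norm[OF locally_integrableD(2)[OF f]]])
        fix y
        show "norm (f y * (k' j (z + h - y) - k' j (z - y))) \<le>
          (2 * C * norm h) * norm (indicator (cball z (r + 1)) y *\<^sub>R f y)"
        proof (cases "y \<in> cball z (r + 1)")
          case True
          have "norm (f y) * norm (k' j (z + h - y) - k' j (z - y)) \<le> norm (f y) * ((2 * C) * norm ((z + h - y) - (z - y)))"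
            by (intro mult_left_mono lip) auto
          then show ?thesis using True by (simp add: norm_mult mult_ac)
        next
          case False
          then have n: "norm (z - y) > r + 1" by (simp add: dist_norm)
          have "norm (z + h - y) > r" using n h norm_triangle_ineq4[of "z + h - y" h] by simp
          then have "k' j (z + h - y) = 0" "k' j (z - y) = 0" using n r by auto
          then show ?thesis using C0 by simp
        qed
      qed
      then show ?thesis unfolding eq I_def by simp
    qed
    show ?thesis
      unfolding continuous_on_eq_continuous_at[OF open_UNIV]
    proof
      fix z :: "real^2"
      have "((\<lambda>h. convolve (k' j) f (z + h) - convolve (k' j) f z) \<longlongrightarrow> 0) (at 0)"
      proof (rule Lim_null_comparison)
        have "\<forall>\<^sub>F h in at 0. norm (h :: real^2) < 1"
          by (rule order_tendstoD(2)[of _ 0]) (auto intro!: tendsto_eq_intros)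
        then show "\<forall>\<^sub>F h in at 0. norm (convolve (k' j) f (z + h) - convolve (k' j) f z) \<le> 2 * C * norm h * I z"
          by eventually_elim (use lipc in auto)
        show "((\<lambda>h. 2 * C * norm h * I z) \<longlongrightarrow> 0) (at 0)"
          by (auto intro!: tendsto_eq_intros)
      qed
      then show "isCont (convolve (k' j) f) z"
        by (simp add: isCont_iff LIM_zero_iff)
    qed
  qed
  ultimately show ?thesis by (auto simp: has_gradient_def)
qed

text \<open>F(x + e) - F(x) is the integral of the partial derivative along the unit segment in
  direction e. Integrating over the plane, translation invariance turns the left side into 0 and,
  after Fubini, the right side into the integral sought. Asking only for integrability of F and of
  one partial derivative covers compactly supported functions and polynomials times Gaussians
  alike.\<close>

lemma integral_gradient_zero:
  fixes F :: "real^2 \<Rightarrow> complex"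
  assumes F: "has_gradient F F'" and iF: "integrable lborel F" and iF': "integrable lborel (F' j)"
  shows "(\<integral>x. F' j x \<partial>lborel) = 0"
proof -
  let ?e = "axis j 1 :: real^2"
  note [measurable] = has_gradient_borel[OF F]
  have ftc: "(\<integral>t. indicator {0..1} t *\<^sub>R F' j (t *\<^sub>R ?e + x) \<partial>lborel) = F (?e + x) - F x" for x
  proof -
    have "(\<integral>t. indicator {0..1} t *\<^sub>R F' j (t *\<^sub>R ?e + x) \<partial>lborel) = F (1 *\<^sub>R ?e + x) - F (0 *\<^sub>R ?e + x)"
    proof (rule integral_FTC_atLeastAtMost)
      fix t :: real
      have "((\<lambda>t. t *\<^sub>R ?e + x) has_derivative (\<lambda>h. h *\<^sub>R ?e)) (at t)"
        by (auto intro!: derivative_eq_intros)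
      from has_derivative_compose[OF this has_gradientD(1)[OF F]]
      have "((\<lambda>t. F (t *\<^sub>R ?e + x)) has_derivative (\<lambda>h. h *\<^sub>R F' j (t *\<^sub>R ?e + x))) (at t)"
        by (simp add: axis_1_nth if_distrib if_distribR sum.delta cong: if_cong)
      then show "((\<lambda>t. F (t *\<^sub>R ?e + x)) has_vector_derivative F' j (t *\<^sub>R ?e + x)) (at t within {0..1})"
        by (auto simp: has_vector_derivative_def intro: has_derivative_at_withinI)
      show "continuous_on {0..1} (\<lambda>t. F' j (t *\<^sub>R ?e + x))"
        by (rule continuous_on_compose2[OF has_gradientD(2)[OF F]]) (auto intro!: continuous_intros)
    qed auto
    then show ?thesis by simp
  qed
  define H where "H = (\<lambda>(t::real, x::real^2). indicator {0..1} t *\<^sub>R F' j (t *\<^sub>R ?e + x))"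
  have [measurable]: "H \<in> borel_measurable (lborel \<Otimes>\<^sub>M lborel)"
    unfolding H_def by measurable
  have intH: "integrable (lborel \<Otimes>\<^sub>M lborel) H"
  proof (rule lborel_pair.Fubini_integrable)
    have "(\<integral>x. norm (H (t, x)) \<partial>lborel) = indicator {0..1} t * (\<integral>x. norm (F' j x) \<partial>lborel)" for t
      using integral_translate[of "\<lambda>x. norm (F' j x)" "t *\<^sub>R ?e"] by (simp add: H_def)
    then show "integrable lborel (\<lambda>t. \<integral>x. norm (H (t, x)) \<partial>lborel)"
      by simp
    show "AE t in lborel. integrable lborel (\<lambda>x. H (t, x))"
      using iF' integrable_translate[of "F' j"] by (auto simp: H_def)
  qed measurable
  have "(\<integral>x. F' j x \<partial>lborel) = (\<integral>t. indicator {0..1} t *\<^sub>R (\<integral>x. F' j x \<partial>lborel) \<partial>(lborel :: real measure))"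
    by simp
  also have "\<dots> = (\<integral>t. \<integral>x. H (t, x) \<partial>lborel \<partial>lborel)"
    using integral_translate[of "F' j"] by (simp add: H_def)
  also have "\<dots> = (\<integral>x. \<integral>t. H (t, x) \<partial>lborel \<partial>lborel)"
    using lborel_pair.Fubini_integral[of "\<lambda>x t. H (t, x)"] lborel_pair.integrable_product_swap[OF intH]
    by (simp add: case_prod_beta')
  also have "\<dots> = (\<integral>x. F (?e + x) - F x \<partial>lborel)"
    using ftc by (simp add: H_def)
  also have "\<dots> = 0"
    using iF integrable_translate[of F ?e] integral_translate[of F ?e] by simp
  finally show ?thesis .
qed

section \<open>Energy inequality\<close>

lemma integrable_continuous_support:
  fixes f :: "real^2 \<Rightarrow> 'b::{banach, second_countable_topology}"
  assumes f: "continuous_on UNIV f" and r: "\<And>x. norm x > r \<Longrightarrow> f x = 0"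
  shows "integrable lborel f"
proof -
  have "integrable lborel (\<lambda>x. indicator (cball 0 r) x *\<^sub>R f x)"
    by (rule borel_integrable_compact[OF compact_cball]) (rule continuous_on_subset[OF f], simp)
  moreover have "(\<lambda>x. indicator (cball 0 r) x *\<^sub>R f x) = f"
    using r by (force simp: indicator_def fun_eq_iff)
  ultimately show ?thesis by simp
qed

lemma has_gradient_zero_outside:
  assumes f: "has_gradient f f'" and r: "\<And>x. norm x > r \<Longrightarrow> f x = 0" and x: "norm x > r"
  shows "f' j x = 0"
proof -
  have "((\<lambda>_. 0) has_derivative (\<lambda>h. \<Sum>j\<in>UNIV. h $ j *\<^sub>R f' j x)) (at x)"
    by (rule has_derivative_transform_within_open[OF has_gradientD(1)[OF f], of "- cball 0 r"])
      (use r x in auto)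
  from has_derivative_unique[OF this has_derivative_const]
  have "(\<lambda>h. \<Sum>j\<in>UNIV. h $ j *\<^sub>R f' j x) = (\<lambda>h. 0)" .
  from fun_cong[OF this, of "axis j 1"] show ?thesis
    by (simp add: axis_1_nth if_distrib if_distribR sum.delta cong: if_cong)
qed

text \<open>In one coordinate direction X stands for \<psi> times the derivative of u and Y for
  \<psi>' u, so X + Y is the derivative of \<psi> u. Completing the square produces - |X + Y|^2, and
  this negative term pays for the part of the error Q that is paired with X + Y.\<close>

lemma absorb_gradient:
  fixes X Y Q :: complex
  shows "Re ((2 * cnj Y + cnj X) * (Q - X)) \<le> (cmod Y)\<^sup>2 + (cmod Q)\<^sup>2 / 4 + 3 * (cmod Q * cmod Y)"
proof -
  let ?t = "cmod (X + Y)"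
  have "Re ((2 * cnj Y + cnj X) * (Q - X)) = Re ((2 * cnj Y + cnj X) * Q) + (cmod Y)\<^sup>2 - ?t\<^sup>2"
    unfolding cmod_power2 by (simp add: algebra_simps power2_eq_square)
  also have "Re ((2 * cnj Y + cnj X) * Q) \<le> cmod ((2 * cnj Y + cnj X) * Q)"
    by (rule complex_Re_le_cmod)
  also have "cmod ((2 * cnj Y + cnj X) * Q) \<le> (?t + 3 * cmod Y) * cmod Q"
  proof -
    have "cmod (2 * cnj Y + cnj X) \<le> 2 * cmod Y + cmod X"
      using norm_triangle_ineq[of "2 * cnj Y" "cnj X"] by (simp add: norm_mult)
    also have "cmod X \<le> ?t + cmod Y" using norm_triangle_ineq4[of "X + Y" Y] by simp
    finally have "cmod (2 * cnj Y + cnj X) \<le> ?t + 3 * cmod Y" by simp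
    then show ?thesis by (simp add: norm_mult mult_right_mono)
  qed
  also have "(?t + 3 * cmod Y) * cmod Q + (cmod Y)\<^sup>2 - ?t\<^sup>2 \<le>
      (cmod Y)\<^sup>2 + (cmod Q)\<^sup>2 / 4 + 3 * (cmod Q * cmod Y)"
    using zero_le_power2[of "?t - cmod Q / 2"] by (simp add: power2_diff algebra_simps power_divide)
  finally show ?thesis by simp
qed

text \<open>The first summand arises when \<psi>^2 cnj u is paired with the divergence of U - B; the
  second is half of the derivative of \<psi>^2 \<beta> |u|^2, whose integral is 0. Subtracting it
  cancels the drift term that contains U, so no derivative of u remains on the right.\<close>

lemma energy_pointwise:
  fixes u U B :: complex and c c' b b' :: real
  defines "Q \<equiv> of_real c * (B - of_real b * u)"
  shows "- Re (((of_real c' * of_real c + of_real c * of_real c') * cnj u + of_real c * of_real c * cnj U) * (U - B))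
     - Re (((of_real c' * of_real c + of_real c * of_real c') * of_real b + of_real c * of_real c * of_real b') * (u * cnj u)
         + of_real c * of_real c * of_real b * (U * cnj u + u * cnj U)) / 2
    \<le> (c'\<^sup>2 + c * c' * b - c\<^sup>2 * b' / 2) * (cmod u)\<^sup>2 + (cmod Q)\<^sup>2 / 4 + 3 * (cmod Q * cmod (of_real c' * u))"
proof -
  define X Y where "X = of_real c * U" and "Y = of_real c' * u"
  have "- Re (((of_real c' * of_real c + of_real c * of_real c') * cnj u + of_real c * of_real c * cnj U) * (U - B))
     - Re (((of_real c' * of_real c + of_real c * of_real c') * of_real b + of_real c * of_real c * of_real b') * (u * cnj u)
         + of_real c * of_real c * of_real b * (U * cnj u + u * cnj U)) / 2
    = Re ((2 * cnj Y + cnj X) * (Q - X)) + (c * c' * b - c\<^sup>2 * b' / 2) * (cmod u)\<^sup>2"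
    unfolding Q_def X_def Y_def cmod_power2
    by (simp add: field_simps power2_eq_square)
  also have "\<dots> \<le> (cmod Y)\<^sup>2 + (cmod Q)\<^sup>2 / 4 + 3 * (cmod Q * cmod Y) + (c * c' * b - c\<^sup>2 * b' / 2) * (cmod u)\<^sup>2"
    using absorb_gradient by (rule add_right_mono)
  also have "(cmod Y)\<^sup>2 = c'\<^sup>2 * (cmod u)\<^sup>2" by (simp add: Y_def norm_mult power_mult_distrib)
  finally show ?thesis unfolding Y_def by (simp add: algebra_simps)
qed

text \<open>\<open>B\<close> is meant to be the mollification of \<beta> w, which differs from
  \<beta> times the mollification u of w. \<open>Q\<close> records this discrepancy, localised by
  \<psi>; it appears without derivatives, so that convergence of Q to 0 in L2 will be
  enough.\<close>

lemma energy_smooth: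
  fixes \<psi> :: "real^2 \<Rightarrow> real" and u g :: "real^2 \<Rightarrow> complex"
    and \<beta> :: "2 \<Rightarrow> real^2 \<Rightarrow> real" and B U :: "2 \<Rightarrow> real^2 \<Rightarrow> complex"
  assumes \<psi>: "has_gradient \<psi> \<psi>'" and supp: "\<And>x. norm x > r \<Longrightarrow> \<psi> x = 0"
    and u: "has_gradient u U" and U: "\<And>j. has_gradient (U j) (U' j)"
    and \<beta>: "\<And>j. has_gradient (\<beta> j) (\<beta>' j)" and B: "\<And>j. has_gradient (B j) (B' j)"
    and g: "continuous_on UNIV g"
    and eq: "\<And>x. \<mu> * u x = (\<Sum>j\<in>UNIV. U' j j x - B' j j x) + g x"
  defines "Q \<equiv> \<lambda>j x. of_real (\<psi> x) * (B j x - of_real (\<beta> j x) * u x)"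
  shows "Re \<mu> * (\<integral>x. (\<psi> x)\<^sup>2 * (cmod (u x))\<^sup>2 \<partial>lborel) \<le>
     (\<Sum>j\<in>UNIV. \<integral>x. ((\<psi>' j x)\<^sup>2 + \<psi> x * \<psi>' j x * \<beta> j x - (\<psi> x)\<^sup>2 * \<beta>' j j x / 2) * (cmod (u x))\<^sup>2
        + (cmod (Q j x))\<^sup>2 / 4 + 3 * (cmod (Q j x) * cmod (of_real (\<psi>' j x) * u x)) \<partial>lborel)
     + Re (\<integral>x. (of_real (\<psi> x))\<^sup>2 * cnj (u x) * g x \<partial>lborel)"
proof -
  define c c' where "c x = complex_of_real (\<psi> x)" and "c' j x = complex_of_real (\<psi>' j x)" for j x
  have hc: "has_gradient c c'"
    unfolding c_def[abs_def] c'_def[abs_def] by (rule has_gradient_of_real[OF \<psi>])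
  have h\<beta>: "has_gradient (\<lambda>x. complex_of_real (\<beta> j x)) (\<lambda>i x. of_real (\<beta>' j i x))" for j
    by (rule has_gradient_of_real[OF \<beta>])
  note cont = has_gradientD(2,3)[OF hc] has_gradientD(2,3)[OF u] has_gradientD(2,3)[OF U]
    has_gradientD(2,3)[OF h\<beta>] has_gradientD(2,3)[OF B] g has_gradientD(2,3)[OF \<psi>] has_gradientD(2,3)[OF \<beta>]
  have c0: "c x = 0" "\<psi> x = 0" "\<psi>' j x = 0" if "norm x > r" for x j
    using that supp has_gradient_zero_outside[OF \<psi> supp] by (auto simp: c_def)
  define E where "E j x = ((c' j x * c x + c x * c' j x) * cnj (u x) + c x * c x * cnj (U j x)) * (U j x - B j x)" for j x
  define T where "T j x = c x * c x * cnj (u x) * (U' j j x - B' j j x)" for j x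
  define G where "G j x = ((c' j x * c x + c x * c' j x) * of_real (\<beta> j x) + c x * c x * of_real (\<beta>' j j x)) * (u x * cnj (u x))
         + c x * c x * of_real (\<beta> j x) * (U j x * cnj (u x) + u x * cnj (U j x))" for j x
  define R where "R j x = ((\<psi>' j x)\<^sup>2 + \<psi> x * \<psi>' j x * \<beta> j x - (\<psi> x)\<^sup>2 * \<beta>' j j x / 2) * (cmod (u x))\<^sup>2
        + (cmod (Q j x))\<^sup>2 / 4 + 3 * (cmod (Q j x) * cmod (of_real (\<psi>' j x) * u x))" for j x
  have iE: "integrable lborel (E j)" and iT: "integrable lborel (T j)" and iG: "integrable lborel (G j)"
    and iR: "integrable lborel (R j)" for j
    unfolding E_def[abs_def] T_def[abs_def] G_def[abs_def] R_def[abs_def] Q_def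
    by (rule integrable_continuous_support[of _ r]; (intro continuous_intros cont)?; simp add: c0)+
  have ET: "(\<integral>x. E j x \<partial>lborel) + (\<integral>x. T j x \<partial>lborel) = 0" for j
  proof -
    have hF: "has_gradient (\<lambda>x. c x * c x * cnj (u x) * (U j x - B j x))
      (\<lambda>i x. ((c' i x * c x + c x * c' i x) * cnj (u x) + c x * c x * cnj (U i x)) * (U j x - B j x)
         + c x * c x * cnj (u x) * (U' j i x - B' j i x))"
      by (intro has_gradient_mult has_gradient_cnj has_gradient_diff hc u U B)
    have "(\<integral>x. E j x + T j x \<partial>lborel) = 0"
      unfolding E_def T_def
      by (rule integral_gradient_zero[OF hF, where j=j]; rule integrable_continuous_support[of _ r];
          (intro continuous_intros cont)?; simp add: c0)
    then show ?thesis using iE iT by simp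
  qed
  \<comment> \<open>A total derivative, hence of integral 0: half of it can be subtracted below
    without changing the value.\<close>
  have G0: "(\<integral>x. G j x \<partial>lborel) = 0" for j
  proof -
    have hF: "has_gradient (\<lambda>x. c x * c x * of_real (\<beta> j x) * (u x * cnj (u x)))
      (\<lambda>i x. ((c' i x * c x + c x * c' i x) * of_real (\<beta> j x) + c x * c x * of_real (\<beta>' j i x)) * (u x * cnj (u x))
         + c x * c x * of_real (\<beta> j x) * (U i x * cnj (u x) + u x * cnj (U i x)))"
      by (intro has_gradient_mult has_gradient_cnj has_gradient_diff hc u U B h\<beta>)
    show ?thesis
      unfolding G_def
      by (rule integral_gradient_zero[OF hF, where j=j]; rule integrable_continuous_support[of _ r];
          (intro continuous_intros cont)?; simp add: c0)
  qed
  have TR: "Re (\<integral>x. T j x \<partial>lborel) \<le> (\<integral>x. R j x \<partial>lborel)" for j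
  proof -
    have "Re (\<integral>x. T j x \<partial>lborel) = - Re (\<integral>x. E j x \<partial>lborel)"
      using ET[of j] by (simp add: complex_eq_iff)
    also have "\<dots> = - Re (\<integral>x. E j x \<partial>lborel) - Re (\<integral>x. G j x \<partial>lborel) / 2"
      by (simp add: G0)
    also have "\<dots> = (\<integral>x. - Re (E j x) - Re (G j x) / 2 \<partial>lborel)"
      using iE[of j] iG[of j] by (simp add: integral_Re)
    also have "\<dots> \<le> (\<integral>x. R j x \<partial>lborel)"
    proof (rule integral_mono)
      show "- Re (E j x) - Re (G j x) / 2 \<le> R j x" for x
        unfolding E_def G_def R_def Q_def c_def c'_def by (rule energy_pointwise)
    qed (use iE[of j] iG[of j] iR[of j] in auto)
    finally show ?thesis .
  qed
  have ig: "integrable lborel (\<lambda>x. c x * c x * cnj (u x) * g x)"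
    by (rule integrable_continuous_support[of _ r]; (intro continuous_intros cont)?; simp add: c0)
  have "Re \<mu> * (\<integral>x. (\<psi> x)\<^sup>2 * (cmod (u x))\<^sup>2 \<partial>lborel) = Re (\<mu> * of_real (\<integral>x. (\<psi> x)\<^sup>2 * (cmod (u x))\<^sup>2 \<partial>lborel))"
    by simp
  also have "\<mu> * of_real (\<integral>x. (\<psi> x)\<^sup>2 * (cmod (u x))\<^sup>2 \<partial>lborel) = (\<integral>x. \<mu> * of_real ((\<psi> x)\<^sup>2 * (cmod (u x))\<^sup>2) \<partial>lborel)"
    by (simp only: integral_mult_right_zero integral_complex_of_real)
  also have "\<dots> = (\<integral>x. (\<Sum>j\<in>UNIV. T j x) + c x * c x * cnj (u x) * g x \<partial>lborel)"
  proof (rule Bochner_Integration.integral_cong[OF refl])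
    fix x
    have "\<mu> * of_real ((\<psi> x)\<^sup>2 * (cmod (u x))\<^sup>2) = c x * c x * cnj (u x) * (\<mu> * u x)"
      using complex_norm_square[of "u x"] by (simp add: c_def power2_eq_square mult_ac)
    also have "\<dots> = c x * c x * cnj (u x) * ((\<Sum>j\<in>UNIV. U' j j x - B' j j x) + g x)"
      by (simp only: eq)
    finally show "\<mu> * of_real ((\<psi> x)\<^sup>2 * (cmod (u x))\<^sup>2) = (\<Sum>j\<in>UNIV. T j x) + c x * c x * cnj (u x) * g x"
      by (simp add: T_def algebra_simps sum_distrib_left sum_subtractf)
  qed
  also have "\<dots> = (\<Sum>j\<in>UNIV. \<integral>x. T j x \<partial>lborel) + (\<integral>x. c x * c x * cnj (u x) * g x \<partial>lborel)"
    using iT ig by simp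
  also have "Re \<dots> \<le> (\<Sum>j\<in>UNIV. \<integral>x. R j x \<partial>lborel) + Re (\<integral>x. c x * c x * cnj (u x) * g x \<partial>lborel)"
    using TR by (simp add: sum_mono)
  finally show ?thesis
    by (simp add: R_def c_def power2_eq_square mult_ac)
qed

section \<open>The normalised bump as a mollifier\<close>

definition bump_mass :: real where
  "bump_mass = (\<integral>x. bump 0 (1 - (norm (x::real^2))\<^sup>2) \<partial>lborel)"

definition rho :: "real^2 \<Rightarrow> real" where
  "rho x = bump 0 (1 - (norm x)\<^sup>2) / bump_mass"

lemma bump_outside: "norm (x::real^2) > 1 \<Longrightarrow> bump k (1 - (norm x)\<^sup>2) = 0"
  using power_strict_mono[of 1 "norm x" 2] by (auto simp: bump_def not_less)

lemma continuous_bump_norm: "continuous_on UNIV (\<lambda>x::real^2. bump k (1 - (norm x)\<^sup>2))"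
  by (rule continuous_on_compose2[OF continuous_on_bump[of UNIV]]) (auto intro!: continuous_intros)

lemma integrable_bump: "integrable lborel (\<lambda>x::real^2. bump k (1 - (norm x)\<^sup>2))"
  by (rule integrable_continuous_support[OF continuous_bump_norm, of 1]) (rule bump_outside)

lemma bump_mass_pos: "bump_mass > 0"
proof -
  have "(\<integral>x. exp (- 4 / 3) * indicator (cball (0::real^2) (1/2)) x \<partial>lborel) \<le> bump_mass"
    unfolding bump_mass_def
  proof (rule integral_mono[OF _ integrable_bump])
    show "integrable lborel (\<lambda>x::real^2. exp (- 4 / 3) * indicator (cball 0 (1/2)) x :: real)"
      using integrable_indicator_cball by (rule integrable_mult_right)
    fix x :: "real^2"
    show "exp (- 4 / 3) * indicator (cball 0 (1/2)) x \<le> bump 0 (1 - (norm x)\<^sup>2)"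
    proof (cases "norm x \<le> 1/2")
      case True
      then have "(norm x)\<^sup>2 \<le> (1/2)\<^sup>2" by (intro power_mono) auto
      then have *: "(norm x)\<^sup>2 \<le> 1/4" by (simp add: power2_eq_square)
      then have "1 / (1 - (norm x)\<^sup>2) \<le> 4 / 3" by (simp add: field_simps)
      then show ?thesis using * True by (simp add: bump_def)
    qed simp
  qed
  moreover have "measure lborel (cball (0::real^2) (1/2)) > 0"
    by (simp add: measure_def emeasure_disc)
  then have "exp (- 4 / 3) * measure lborel (cball (0::real^2) (1/2)) > (0::real)"
    by (intro mult_pos_pos) auto
  then have "(\<integral>x. exp (- 4 / 3) * indicator (cball (0::real^2) (1/2)) x \<partial>lborel) > (0::real)"
    by simp
  ultimately show ?thesis by linarith
qed

lemma bump_0_le: "bump 0 t \<le> 1"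
  by (simp add: bump_def)

interpretation rho: mollifier rho "1 / bump_mass"
proof
  show "rho \<in> borel_measurable borel"
    unfolding rho_def[abs_def] using borel_measurable_continuous_onI[OF continuous_bump_norm[of 0]] by simp
  show "integrable lborel rho" unfolding rho_def[abs_def] using integrable_bump[of 0] by simp
  show "(\<integral>x. rho x \<partial>lborel) = 1"
    unfolding rho_def using bump_mass_pos by (simp flip: bump_mass_def)
  show "0 \<le> rho x" "rho x \<le> 1 / bump_mass" for x
    using bump_mass_pos bump_0_le by (auto simp: rho_def divide_right_mono)
qed

definition rho_scaled :: "real \<Rightarrow> real^2 \<Rightarrow> complex" where
  "rho_scaled e x = of_real (rho ((1 / e) *\<^sub>R x) / e\<^sup>2)"

lemma bump_poly_rho_scaled: "bump_poly (\<lambda>y. rho_scaled e (z + a *\<^sub>R y))"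
proof -
  have "bump_poly (\<lambda>y. of_real (1 / (bump_mass * e\<^sup>2)) *
      of_real (bump 0 (1 - (norm ((1 / e) *\<^sub>R z + (a / e) *\<^sub>R y))\<^sup>2)))"
    by (intro bump_poly.intros)
  then show ?thesis
    by (simp add: rho_scaled_def rho_def scaleR_add_right mult.commute)
qed

lemma rho_scaled_outside:
  assumes "e > 0" "norm x > e"
  shows "rho_scaled e x = 0"
proof -
  have "norm ((1 / e) *\<^sub>R x) > 1" using assms by (simp add: field_simps)
  from bump_outside[OF this] show ?thesis unfolding rho_scaled_def rho_def by simp
qed

lemma convolve_rho_scaled:
  assumes "e > 0"
  shows "convolve (rho_scaled e) f = mollify rho e f"
proof
  fix z
  have "convolve (rho_scaled e) f z = (- e)\<^sup>2 *\<^sub>R (\<integral>y. f (z + (- e) *\<^sub>R y) * rho_scaled e (z - (z + (- e) *\<^sub>R y)) \<partial>lborel)"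
    unfolding convolve_def using assms by (intro integral_affine) auto
  also have "\<dots> = (\<integral>y. (- e)\<^sup>2 *\<^sub>R (f (z + (- e) *\<^sub>R y) * rho_scaled e (z - (z + (- e) *\<^sub>R y))) \<partial>lborel)"
    by simp
  also have "\<dots> = mollify rho e f z"
    unfolding mollify_def
  proof (rule Bochner_Integration.integral_cong[OF refl])
    fix y
    have "rho_scaled e (z - (z + (- e) *\<^sub>R y)) = of_real (rho y / e\<^sup>2)"
      using assms by (simp add: rho_scaled_def)
    then show "(- e)\<^sup>2 *\<^sub>R (f (z + (- e) *\<^sub>R y) * rho_scaled e (z - (z + (- e) *\<^sub>R y))) =
        rho y *\<^sub>R f (z - e *\<^sub>R y)"
      using assms by (simp add: scaleR_conv_of_real[where 'a=complex])
  qed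
  finally show "convolve (rho_scaled e) f z = mollify rho e f z" .
qed

lemma L2_tendsto_integral_weight:
  fixes b :: "real^2 \<Rightarrow> real"
  assumes u: "L2_tendsto u f" and b: "b \<in> borel_measurable borel" "\<And>x. \<bar>b x\<bar> \<le> C"
  shows "(\<lambda>n. \<integral>x. b x * (cmod (u n x))\<^sup>2 \<partial>lborel) \<longlonglongrightarrow> (\<integral>x. b x * (cmod (f x))\<^sup>2 \<partial>lborel)"
proof -
  have "(\<lambda>n. \<integral>x. of_real (b x) * u n x * cnj (u n x) \<partial>lborel) \<longlonglongrightarrow> (\<integral>x. of_real (b x) * f x * cnj (f x) \<partial>lborel)"
    by (rule L2_tendsto_integral_mult[OF L2_tendsto_mult_bounded[OF u, of _ C] L2_tendsto_cnj[OF u]])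
      (use b in auto)
  moreover have "(\<integral>x. of_real (b x) * g x * cnj (g x) \<partial>lborel) = of_real (\<integral>x. b x * (cmod (g x))\<^sup>2 \<partial>lborel)"
    for g :: "real^2 \<Rightarrow> complex"
    by (subst integral_complex_of_real[symmetric], rule Bochner_Integration.integral_cong[OF refl])
      (simp only: of_real_mult complex_norm_square mult.assoc)
  ultimately show ?thesis by (simp add: tendsto_of_real_iff)
qed

lemma L2_tendsto_norm:
  assumes u: "L2_tendsto u f"
  shows "L2_tendsto (\<lambda>n x. of_real (cmod (u n x))) (\<lambda>x. of_real (cmod (f x)))"
proof (rule L2_tendsto_bound[OF u, of _ _ 1])
  have [measurable]: "f \<in> borel_measurable borel" "u n \<in> borel_measurable borel" for n
    using L2_tendsto_square_integrable[OF u] by auto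
  show "square_integrable (\<lambda>x. of_real (cmod (u n x)))" for n
    by (rule square_integrable_bound[OF L2_tendsto_square_integrable(1)[OF u], of _ 1 n]) auto
  show "square_integrable (\<lambda>x. of_real (cmod (f x)))"
    by (rule square_integrable_bound[OF L2_tendsto_square_integrable(2)[OF u], of _ 1]) auto
  show "cmod (of_real (cmod (u n x)) - of_real (cmod (f x))) \<le> 1 * cmod (u n x - f x)" for n x
    using norm_triangle_ineq3[of "u n x" "f x"] by (simp flip: of_real_diff)
qed

lemma continuous_support_bound_real:
  fixes k :: "real^2 \<Rightarrow> real"
  assumes k: "continuous_on UNIV k" and r: "\<And>x. norm x > r \<Longrightarrow> k x = 0"
  obtains C where "\<And>x. \<bar>k x\<bar> \<le> C"
proof -
  obtain C where "\<And>x. norm (complex_of_real (k x)) \<le> C"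
    by (rule continuous_support_bound[of "\<lambda>x. complex_of_real (k x)" r]) (auto intro!: continuous_intros k r)
  then show ?thesis using that by auto
qed

text \<open>The weak form of \<Delta>w - div (\<beta> w) + g = \<mu> w with all derivatives moved to
  the test function. The gradient and the second derivatives of \<phi> are quantified along with it,
  so instances are given by explicit formulas; the nonlocal term is treated as a source g.\<close>

definition weak_equation ::
    "(2 \<Rightarrow> real^2 \<Rightarrow> real) \<Rightarrow> (real^2 \<Rightarrow> complex) \<Rightarrow> complex \<Rightarrow> (real^2 \<Rightarrow> complex) \<Rightarrow> bool" where
  "weak_equation \<beta> g \<mu> w \<longleftrightarrow>
     (\<forall>\<phi> \<phi>' \<phi>'' r. bump_poly \<phi> \<and> has_gradient \<phi> \<phi>' \<and> (\<forall>j. has_gradient (\<phi>' j) (\<phi>'' j)) \<and>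
        (\<forall>x. norm x > r \<longrightarrow> \<phi> x = 0) \<longrightarrow>
        (\<integral>x. w x * (\<Sum>j\<in>UNIV. \<phi>'' j j x + of_real (\<beta> j x) * \<phi>' j x) \<partial>lborel)
          + (\<integral>x. g x * \<phi> x \<partial>lborel) = \<mu> * (\<integral>x. w x * \<phi> x \<partial>lborel))"

lemma weak_equationD:
  assumes "weak_equation \<beta> g \<mu> w" "bump_poly \<phi>" "has_gradient \<phi> \<phi>'" "\<And>j. has_gradient (\<phi>' j) (\<phi>'' j)"
    and "\<And>x. norm x > r \<Longrightarrow> \<phi> x = 0"
  shows "(\<integral>x. w x * (\<Sum>j\<in>UNIV. \<phi>'' j j x + of_real (\<beta> j x) * \<phi>' j x) \<partial>lborel)
          + (\<integral>x. g x * \<phi> x \<partial>lborel) = \<mu> * (\<integral>x. w x * \<phi> x \<partial>lborel)"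
  using assms(1)[unfolded weak_equation_def, rule_format, of \<phi> \<phi>' \<phi>'' r] assms(2-) by simp

text \<open>The weak equation tested with a reflected bump says that the mollification of w solves
  the equation pointwise, with \<beta> w mollified as a whole. \<open>energy_smooth\<close> applies
  to it, and every integral converges because \<psi> has bounded support. No derivative of w enters
  the conclusion.\<close>

lemma energy_inequality:
  fixes \<psi> :: "real^2 \<Rightarrow> real"
  assumes weak: "weak_equation \<beta> g \<mu> w"
    and w: "square_integrable w" and \<beta>w: "\<And>j. square_integrable (\<lambda>x. of_real (\<beta> j x) * w x)"
    and g: "square_integrable g" and \<beta>: "\<And>j. has_gradient (\<beta> j) (\<beta>' j)"
    and \<psi>: "has_gradient \<psi> \<psi>'" and supp: "\<And>x. norm x > r \<Longrightarrow> \<psi> x = 0"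
  shows "Re \<mu> * (\<integral>x. (\<psi> x)\<^sup>2 * (cmod (w x))\<^sup>2 \<partial>lborel) \<le>
     (\<Sum>j\<in>UNIV. \<integral>x. ((\<psi>' j x)\<^sup>2 + \<psi> x * \<psi>' j x * \<beta> j x - (\<psi> x)\<^sup>2 * \<beta>' j j x / 2) * (cmod (w x))\<^sup>2 \<partial>lborel)
     + Re (\<integral>x. (of_real (\<psi> x))\<^sup>2 * cnj (w x) * g x \<partial>lborel)"
proof -
  define e where "e n = 1 / real (Suc n)" for n
  have e: "\<And>n. e n > 0" "e \<longlonglongrightarrow> 0"
    using LIMSEQ_inverse_real_of_nat by (auto simp: e_def[abs_def] inverse_eq_divide)
  define u where "u n = mollify rho (e n) w" for n
  define B where "B j n = mollify rho (e n) (\<lambda>x. of_real (\<beta> j x) * w x)" for j n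
  define h where "h n = mollify rho (e n) g" for n
  have Lu: "L2_tendsto u w" unfolding u_def[abs_def] by (rule rho.mollify_tendsto[OF w e])
  have LB: "L2_tendsto (B j) (\<lambda>x. of_real (\<beta> j x) * w x)" for j
    unfolding B_def[abs_def] by (rule rho.mollify_tendsto[OF \<beta>w e])
  have Lh: "L2_tendsto h g" unfolding h_def[abs_def] by (rule rho.mollify_tendsto[OF g e])
  note c\<psi> = has_gradientD(2,3)[OF \<psi>] and c\<beta> = has_gradientD(2,3)[OF \<beta>]
  note [measurable] = has_gradient_borel[OF \<psi>] has_gradient_borel[OF \<beta>]
  have \<psi>0: "\<psi> x = 0" "\<psi>' j x = 0" if "norm x > r" for j x
    using that supp has_gradient_zero_outside[OF \<psi> supp] by auto
  define Q where "Q j n x = of_real (\<psi> x) * (B j n x - of_real (\<beta> j x) * u n x)" for j n x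
  \<comment> \<open>Both the localised mollification of \<beta> w and the localised product of
    \<beta> with the mollification of w tend to \<psi> \<beta> w, so the commutator vanishes in the
    limit without any rate.\<close>
  have LQ: "L2_tendsto (Q j) (\<lambda>x. 0)" for j
  proof -
    obtain C1 where C1: "\<And>x. \<bar>\<psi> x\<bar> \<le> C1"
      by (rule continuous_support_bound_real[OF c\<psi>(2) \<psi>0(1)]) blast+
    have "continuous_on UNIV (\<lambda>x. \<psi> x * \<beta> j x)" by (intro continuous_intros c\<psi> c\<beta>)
    then obtain C2 where C2: "\<And>x. \<bar>\<psi> x * \<beta> j x\<bar> \<le> C2"
      by (rule continuous_support_bound_real[of _ r]) (use \<psi>0 in auto)
    have "L2_tendsto (\<lambda>n x. of_real (\<psi> x) * B j n x - of_real (\<psi> x * \<beta> j x) * u n x)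
        (\<lambda>x. of_real (\<psi> x) * (of_real (\<beta> j x) * w x) - of_real (\<psi> x * \<beta> j x) * w x)"
      by (intro L2_tendsto_diff L2_tendsto_mult_bounded[OF LB, of _ C1] L2_tendsto_mult_bounded[OF Lu, of _ C2])
        (use C1 C2 in \<open>auto simp del: of_real_mult\<close>)
    then show ?thesis by (simp add: Q_def[abs_def] algebra_simps)
  qed
  define P where "P j x = (\<psi>' j x)\<^sup>2 + \<psi> x * \<psi>' j x * \<beta> j x - (\<psi> x)\<^sup>2 * \<beta>' j j x / 2" for j x
  have main: "Re \<mu> * (\<integral>x. (\<psi> x)\<^sup>2 * (cmod (u n x))\<^sup>2 \<partial>lborel) \<le>
     (\<Sum>j\<in>UNIV. \<integral>x. P j x * (cmod (u n x))\<^sup>2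
        + (cmod (Q j n x))\<^sup>2 / 4 + 3 * (cmod (Q j n x) * cmod (of_real (\<psi>' j x) * u n x)) \<partial>lborel)
     + Re (\<integral>x. (of_real (\<psi> x))\<^sup>2 * cnj (u n x) * h n x \<partial>lborel)" for n
  proof -
    have "bump_poly (rho_scaled (e n))"
      using bump_poly_rho_scaled[of "e n" 0 1] by simp
    then obtain d' where d': "has_gradient (rho_scaled (e n)) d'" "\<And>j. bump_poly (d' j)"
      using bump_poly_gradient by blast
    have "\<exists>d''. has_gradient (d' j) d''" for j
      using bump_poly_gradient[OF d'(2)[of j]] by blast
    then obtain d'' where d'': "\<And>j. has_gradient (d' j) (d'' j)" by metis
    \<comment> \<open>Third derivatives of the kernel enter because differentiating a convolution
      uses two further derivatives of its kernel, and here the kernel may already be a first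
      derivative of the bump.\<close>
    have "\<exists>f. has_gradient (d'' i j) f" for i j
    proof -
      obtain f' where "has_gradient (d' i) f'" "\<And>j. bump_poly (f' j)"
        using bump_poly_gradient[OF d'(2)[of i]] by blast
      moreover have "f' j = d'' i j" for j
        using has_gradient_pderiv_at[OF \<open>has_gradient (d' i) f'\<close>] has_gradient_pderiv_at[OF d''] by metis
      ultimately show ?thesis using bump_poly_gradient by metis
    qed
    then obtain d3 where d3: "\<And>i j. has_gradient (d'' i j) (d3 i j)" by metis
    have z: "rho_scaled (e n) x = 0" "d' j x = 0" "d'' i j x = 0" "d3 k i j x = 0" if "norm x > e n" for i j k x
    proof -
      note z0 = rho_scaled_outside[OF e(1)]
      note z1 = has_gradient_zero_outside[OF d'(1) z0]
      note z2 = has_gradient_zero_outside[OF d'' z1]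
      note z3 = has_gradient_zero_outside[OF d3 z2]
      show "rho_scaled (e n) x = 0" "d' j x = 0" "d'' i j x = 0" "d3 k i j x = 0"
        using that by (auto intro: z0 z1 z2 z3)
    qed
    note li = square_integrable_locally_integrable
    have hu: "has_gradient (u n) (\<lambda>j. convolve (d' j) w)"
      unfolding u_def convolve_rho_scaled[OF e(1), symmetric]
      by (rule has_gradient_convolve[OF li[OF w] d'(1) d'']) (auto intro: z)
    have hU: "has_gradient (convolve (d' j) w) (\<lambda>i. convolve (d'' j i) w)" for j
      by (rule has_gradient_convolve[OF li[OF w] d'' d3]) (auto intro: z)
    have hB: "has_gradient (B j n) (\<lambda>i. convolve (d' i) (\<lambda>x. of_real (\<beta> j x) * w x))" for j
      unfolding B_def convolve_rho_scaled[OF e(1), symmetric]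
      by (rule has_gradient_convolve[OF li[OF \<beta>w] d'(1) d'']) (auto intro: z)
    have hh: "continuous_on UNIV (h n)"
      unfolding h_def convolve_rho_scaled[OF e(1), symmetric]
      by (rule has_gradientD(3)[OF has_gradient_convolve[OF li[OF g] d'(1) d'']]) (auto intro: z)
    have eq: "\<mu> * u n x = (\<Sum>j\<in>UNIV. convolve (d'' j j) w x - convolve (d' j) (\<lambda>x. of_real (\<beta> j x) * w x) x) + h n x" for x
    proof -
      \<comment> \<open>Reflection about x makes the pairings with this test function equal to
        convolutions evaluated at x; its gradient changes sign, its second derivatives do
        not.\<close>
      let ?\<phi> = "\<lambda>y. rho_scaled (e n) (x - y)"
      have "bump_poly ?\<phi>" using bump_poly_rho_scaled[of "e n" x "-1"] by simp
      moreover have "has_gradient ?\<phi> (\<lambda>j y. - d' j (x - y))"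
        using has_gradient_affine[OF d'(1), of x "-1"] by simp
      moreover have "has_gradient (\<lambda>y. - d' j (x - y)) (\<lambda>i y. d'' j i (x - y))" for j
        using has_gradient_minus[OF has_gradient_affine[OF d'', where z=x and a="-1"]] by simp
      moreover have "?\<phi> y = 0" if "norm y > norm x + e n" for y
        using that norm_triangle_ineq4[of x "x - y"] by (intro z(1)) simp
      ultimately have "(\<integral>y. w y * (\<Sum>j\<in>UNIV. d'' j j (x - y) + of_real (\<beta> j y) * (- d' j (x - y))) \<partial>lborel)
          + (\<integral>y. g y * ?\<phi> y \<partial>lborel) = \<mu> * (\<integral>y. w y * ?\<phi> y \<partial>lborel)"
        by (rule weak_equationD[OF weak])
      moreover have "(\<integral>y. w y * ?\<phi> y \<partial>lborel) = u n x" "(\<integral>y. g y * ?\<phi> y \<partial>lborel) = h n x"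
        unfolding u_def h_def convolve_rho_scaled[OF e(1), symmetric] convolve_def by simp_all
      moreover have "(\<integral>y. w y * (\<Sum>j\<in>UNIV. d'' j j (x - y) + of_real (\<beta> j y) * (- d' j (x - y))) \<partial>lborel) =
        (\<integral>y. (\<Sum>j\<in>UNIV. w y * d'' j j (x - y) - (of_real (\<beta> j y) * w y) * d' j (x - y)) \<partial>lborel)"
        by (intro Bochner_Integration.integral_cong refl) (auto simp: sum_distrib_left algebra_simps intro!: sum.cong)
      moreover have "(\<integral>y. (\<Sum>j\<in>UNIV. w y * d'' j j (x - y) - (of_real (\<beta> j y) * w y) * d' j (x - y)) \<partial>lborel) =
        (\<Sum>j\<in>UNIV. convolve (d'' j j) w x - convolve (d' j) (\<lambda>x. of_real (\<beta> j x) * w x) x)"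
      proof -
        have i: "integrable lborel (\<lambda>y. w y * d'' j j (x - y))"
          "integrable lborel (\<lambda>y. (of_real (\<beta> j y) * w y) * d' j (x - y))" for j
          using convolve_integrable[OF li[OF w] has_gradientD(2)[OF d''] z(3)]
            convolve_integrable[OF li[OF \<beta>w] has_gradientD(2)[OF d'(1)] z(2)] by auto
        show ?thesis
          unfolding convolve_def
          by (subst Bochner_Integration.integral_sum)
            (auto intro!: sum.cong Bochner_Integration.integrable_diff Bochner_Integration.integral_diff i)
      qed
      ultimately show ?thesis by simp
    qed
    show ?thesis
      unfolding P_def Q_def by (rule energy_smooth[OF \<psi> supp hu hU \<beta> hB hh eq])
  qed
  have lim1: "(\<lambda>n. \<integral>x. (\<psi> x)\<^sup>2 * (cmod (u n x))\<^sup>2 \<partial>lborel) \<longlonglongrightarrow> (\<integral>x. (\<psi> x)\<^sup>2 * (cmod (w x))\<^sup>2 \<partial>lborel)"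
  proof -
    have "continuous_on UNIV (\<lambda>x. (\<psi> x)\<^sup>2)" by (intro continuous_intros c\<psi>)
    then obtain C where "\<And>x. \<bar>(\<psi> x)\<^sup>2\<bar> \<le> C"
      by (rule continuous_support_bound_real[of _ r]) (use \<psi>0 in auto)
    then show ?thesis by (intro L2_tendsto_integral_weight[OF Lu]) auto
  qed
  have lim2: "(\<lambda>n. \<integral>x. P j x * (cmod (u n x))\<^sup>2
        + (cmod (Q j n x))\<^sup>2 / 4 + 3 * (cmod (Q j n x) * cmod (of_real (\<psi>' j x) * u n x)) \<partial>lborel)
     \<longlonglongrightarrow> (\<integral>x. P j x * (cmod (w x))\<^sup>2 \<partial>lborel)" for j
  proof -
    have "continuous_on UNIV (P j)" unfolding P_def[abs_def] by (intro continuous_intros c\<psi> c\<beta>) auto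
    then obtain C where C: "\<And>x. \<bar>P j x\<bar> \<le> C"
      by (rule continuous_support_bound_real[of _ r]) (use \<psi>0 in \<open>auto simp: P_def\<close>)
    obtain C1 where C1: "\<And>x. \<bar>\<psi>' j x\<bar> \<le> C1"
      by (rule continuous_support_bound_real[OF c\<psi>(1)[of j] \<psi>0(2)]) blast+
    have [measurable]: "P j \<in> borel_measurable borel" unfolding P_def[abs_def] by measurable
    have Lv: "L2_tendsto (\<lambda>n x. of_real (\<psi>' j x) * u n x) (\<lambda>x. of_real (\<psi>' j x) * w x)"
      by (rule L2_tendsto_mult_bounded[OF Lu, of _ C1]) (use C1 in auto)
    note l1 = L2_tendsto_integral_weight[OF Lu _ C]
    note l2 = L2_tendsto_integral_weight[OF LQ[of j], of "\<lambda>x. 1/4" "1/4"]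
    note l3 = L2_tendsto_integral_mult[OF L2_tendsto_norm[OF LQ[of j]] L2_tendsto_norm[OF Lv]]
    have l3': "(\<lambda>n. \<integral>x. cmod (Q j n x) * cmod (of_real (\<psi>' j x) * u n x) \<partial>lborel) \<longlonglongrightarrow> 0"
    proof -
      have "(\<lambda>n. complex_of_real (\<integral>x. cmod (Q j n x) * cmod (of_real (\<psi>' j x) * u n x) \<partial>lborel)) \<longlonglongrightarrow> of_real 0"
        using l3 unfolding of_real_mult[symmetric] integral_complex_of_real by simp
      then show ?thesis by (simp only: tendsto_of_real_iff)
    qed
    have i1: "integrable lborel (\<lambda>x. P j x * (cmod (u n x))\<^sup>2)" for n
    proof (rule integrable_dominated')
      show "integrable lborel (\<lambda>x. C * (cmod (u n x))\<^sup>2)"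
        using L2_tendsto_square_integrable(1)[OF Lu] by auto
      show "norm (P j x * (cmod (u n x))\<^sup>2) \<le> C * (cmod (u n x))\<^sup>2" for x
        using C by (auto simp: abs_mult intro!: mult_right_mono)
    qed (use L2_tendsto_square_integrable(1)[OF Lu, THEN square_integrableD(1), measurable] in measurable)
    have i2: "integrable lborel (\<lambda>x. (cmod (Q j n x))\<^sup>2)" for n
      using L2_tendsto_square_integrable(1)[OF LQ] by auto
    have i3: "integrable lborel (\<lambda>x. cmod (Q j n x) * cmod (of_real (\<psi>' j x) * u n x))" for n
      using integrable_norm[OF square_integrable_cauchy_schwarz(1)[OF
          L2_tendsto_square_integrable(1)[OF LQ[of j]] L2_tendsto_square_integrable(1)[OF Lv]], of n n]
      by (simp add: norm_mult)
    have "(\<lambda>n. (\<integral>x. P j x * (cmod (u n x))\<^sup>2 \<partial>lborel) + (\<integral>x. 1/4 * (cmod (Q j n x))\<^sup>2 \<partial>lborel)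
        + 3 * (\<integral>x. cmod (Q j n x) * cmod (of_real (\<psi>' j x) * u n x) \<partial>lborel))
      \<longlonglongrightarrow> (\<integral>x. P j x * (cmod (w x))\<^sup>2 \<partial>lborel) + (\<integral>x. 1/4 * (cmod (0::complex))\<^sup>2 \<partial>(lborel :: (real^2) measure)) + 3 * 0"
      by (intro tendsto_add tendsto_mult tendsto_const l1 l2 l3') auto
    then show ?thesis using i1 i2 i3 by simp
  qed
  have lim3: "(\<lambda>n. \<integral>x. (of_real (\<psi> x))\<^sup>2 * cnj (u n x) * h n x \<partial>lborel) \<longlonglongrightarrow>
      (\<integral>x. (of_real (\<psi> x))\<^sup>2 * cnj (w x) * g x \<partial>lborel)"
  proof -
    have "continuous_on UNIV (\<lambda>x. (\<psi> x)\<^sup>2)" by (intro continuous_intros c\<psi>)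
    then obtain C where C: "\<And>x. \<bar>(\<psi> x)\<^sup>2\<bar> \<le> C"
      by (rule continuous_support_bound_real[of _ r]) (use \<psi>0 in auto)
    show ?thesis
      by (rule L2_tendsto_integral_mult[OF L2_tendsto_mult_bounded[OF L2_tendsto_cnj[OF Lu], of _ C] Lh])
        (use C in \<open>auto simp: norm_power\<close>)
  qed
  show ?thesis
    unfolding P_def[symmetric]
    by (rule LIMSEQ_le[OF tendsto_mult[OF tendsto_const lim1]
          tendsto_add[OF tendsto_sum[OF lim2] tendsto_Re[OF lim3]]])
       (use main in auto)
qed

section \<open>The velocity field and the nonlocal term\<close>

lemma biot_savart_nth:
  "biot_savart_kernel x $ 1 = - (x $ 2) / (2 * pi * (norm x)\<^sup>2)"
  "biot_savart_kernel x $ 2 = x $ 1 / (2 * pi * (norm x)\<^sup>2)"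
  by (simp_all add: biot_savart_kernel_def perp_def vector_2 field_simps)

lemma biot_savart_borel [measurable]: "(\<lambda>x. biot_savart_kernel x $ j) \<in> borel_measurable borel"
proof -
  have "(\<lambda>x. biot_savart_kernel x $ 1) \<in> borel_measurable borel"
       "(\<lambda>x. biot_savart_kernel x $ 2) \<in> borel_measurable borel"
    unfolding biot_savart_nth by measurable
  then show ?thesis using exhaust_2[of j] by auto
qed

lemma biot_savart_le: "\<bar>biot_savart_kernel x $ j\<bar> \<le> 1 / norm x"
proof (cases "x = 0")
  case False
  have "\<bar>biot_savart_kernel x $ j\<bar> \<le> norm x / (2 * pi * (norm x)\<^sup>2)"
    using exhaust_2[of j] component_le_norm_cart[of x]
    by (auto simp: biot_savart_nth abs_mult abs_divide intro!: divide_right_mono)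
  also have "\<dots> = 1 / (2 * pi) * (1 / norm x)"
    using False by (simp add: power2_eq_square)
  also have "\<dots> \<le> 1 * (1 / norm x)"
    using pi_gt3 by (intro mult_right_mono) auto
  finally show ?thesis by simp
next
  case True
  then show ?thesis using exhaust_2[of j] by (auto simp: biot_savart_nth)
qed

text \<open>The Riesz potential of order one of |w|, up to normalisation. Being extended-valued it
  is defined without integrability; it dominates every component of the velocity pointwise.\<close>

definition riesz :: "(real^2 \<Rightarrow> complex) \<Rightarrow> real^2 \<Rightarrow> ennreal" where
  "riesz w \<xi> = (\<integral>\<^sup>+\<eta>. ennreal (cmod (w \<eta>) / norm (\<xi> - \<eta>)) \<partial>lborel)"

definition vel :: "(real^2 \<Rightarrow> complex) \<Rightarrow> 2 \<Rightarrow> real^2 \<Rightarrow> complex" where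
  "vel w j \<xi> = (\<integral>\<eta>. of_real (biot_savart_kernel (\<xi> - \<eta>) $ j) * w \<eta> \<partial>lborel)"

text \<open>Since the gradient of \<open>gauss\<close> is - x/2 times \<open>gauss\<close>, the term
  v . grad G of the operator is - 1/2 times this function. Keeping x . v together isolates the
  kernel that is antisymmetric.\<close>

definition nonlocal :: "(real^2 \<Rightarrow> complex) \<Rightarrow> real^2 \<Rightarrow> complex" where
  "nonlocal w \<xi> = of_real (gauss \<xi>) * (\<Sum>j\<in>UNIV. of_real (\<xi> $ j) * vel w j \<xi>)"

lemma gauss_borel [measurable]: "gauss \<in> borel_measurable borel"
  unfolding gauss_def[abs_def] by measurable

lemma gauss_pos: "gauss x > 0"
  by (simp add: gauss_def)

context
  fixes w :: "real^2 \<Rightarrow> complex"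
  assumes w [measurable]: "w \<in> borel_measurable borel"
begin

lemma riesz_borel [measurable]: "riesz w \<in> borel_measurable borel"
  unfolding riesz_def[abs_def] by measurable

lemma vel_borel [measurable]: "vel w j \<in> borel_measurable borel"
  unfolding vel_def[abs_def] by measurable

lemma nonlocal_borel [measurable]: "nonlocal w \<in> borel_measurable borel"
  unfolding nonlocal_def[abs_def] by measurable

lemma vel_le_riesz: "ennreal (cmod (vel w j \<xi>)) \<le> riesz w \<xi>"
proof -
  have bnd: "cmod (of_real (biot_savart_kernel (\<xi> - \<eta>) $ j) * w \<eta>) \<le> cmod (w \<eta>) / norm (\<xi> - \<eta>)" for \<eta>
    using mult_right_mono[OF biot_savart_le[of "\<xi> - \<eta>" j], of "cmod (w \<eta>)"] by (simp add: norm_mult)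
  show ?thesis
  proof (cases "integrable lborel (\<lambda>\<eta>. of_real (biot_savart_kernel (\<xi> - \<eta>) $ j) * w \<eta>)")
    case True
    then have "ennreal (cmod (vel w j \<xi>)) \<le> (\<integral>\<^sup>+\<eta>. ennreal (cmod (of_real (biot_savart_kernel (\<xi> - \<eta>) $ j) * w \<eta>)) \<partial>lborel)"
      unfolding vel_def by (rule integral_norm_bound_ennreal)
    also have "\<dots> \<le> riesz w \<xi>"
      unfolding riesz_def using bnd by (intro nn_integral_mono ennreal_leI) auto
    finally show ?thesis .
  next
    case False
    then show ?thesis by (simp add: vel_def not_integrable_integral_eq)
  qed
qed

lemma nonlocal_le: "ennreal (cmod (nonlocal w \<xi>)) \<le> ennreal (2 * norm \<xi> * gauss \<xi>) * riesz w \<xi>"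
proof -
  have "cmod (nonlocal w \<xi>) \<le> gauss \<xi> * (\<Sum>j\<in>UNIV. norm \<xi> * cmod (vel w j \<xi>))"
    unfolding nonlocal_def norm_mult
    using gauss_pos[of \<xi>] component_le_norm_cart[of \<xi>]
    by (auto intro!: mult_left_mono sum_norm_le mult_right_mono simp: norm_mult)
  also have "\<dots> = gauss \<xi> * norm \<xi> * (cmod (vel w 1 \<xi>) + cmod (vel w 2 \<xi>))"
    by (simp add: sum_2 algebra_simps)
  finally have "ennreal (cmod (nonlocal w \<xi>)) \<le> ennreal (gauss \<xi> * norm \<xi>) * (ennreal (cmod (vel w 1 \<xi>)) + ennreal (cmod (vel w 2 \<xi>)))"
    using gauss_pos[of \<xi>] by (simp add: ennreal_leI less_imp_le flip: ennreal_mult ennreal_plus)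
  also have "\<dots> \<le> ennreal (gauss \<xi> * norm \<xi>) * (riesz w \<xi> + riesz w \<xi>)"
    by (intro mult_left_mono add_mono vel_le_riesz) auto
  also have "\<dots> = ennreal (2 * norm \<xi> * gauss \<xi>) * riesz w \<xi>"
  proof -
    have "ennreal (2 * norm \<xi> * gauss \<xi>) = ennreal (gauss \<xi> * norm \<xi>) + ennreal (gauss \<xi> * norm \<xi>)"
      using gauss_pos[of \<xi>] by (simp add: less_imp_le mult.commute flip: ennreal_plus)
    then show ?thesis by (simp only: distrib_left distrib_right)
  qed
  finally show ?thesis .
qed

text \<open>The kernel 1 / |z| is split at |z| = 1. The near part is in L1, so Young's inequality
  puts its convolution with w into L2, where the bounded weight is harmless; the far part is at most
  1, so its convolution is bounded by the L1 norm of w and the weight must itself be square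
  integrable.\<close>

lemma riesz_weighted:
  assumes w2: "square_integrable w" and w1: "integrable lborel w"
    and a [measurable]: "a \<in> borel_measurable borel" and a0: "\<And>x. 0 \<le> a x" "\<And>x. a x \<le> A"
    and a2: "integrable lborel (\<lambda>x. (a x)\<^sup>2)"
  shows "(\<integral>\<^sup>+x. (ennreal (a x) * riesz w x)\<^sup>2 \<partial>lborel) < \<infinity>"
proof -
  define k1 where "k1 x = indicator (ball 0 1) x / norm x" for x :: "real^2"
  have [measurable]: "ball (0::real^2) 1 \<in> sets borel" by simp
  have [measurable]: "k1 \<in> borel_measurable borel" unfolding k1_def[abs_def] by measurable
  have k10: "k1 x \<ge> 0" for x by (simp add: k1_def)
  define near where "near x = (\<integral>\<^sup>+y. ennreal (k1 (x - y) * cmod (w y)) \<partial>lborel)" for x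
  have [measurable]: "near \<in> borel_measurable borel" unfolding near_def[abs_def] by measurable
  define N where "N = (\<integral>\<^sup>+y. ennreal (cmod (w y)) \<partial>lborel)"
  have N: "N < \<infinity>" using w1 by (simp add: N_def integrable_iff_bounded)
  have A0: "A \<ge> 0" using a0(1)[of 0] a0(2)[of 0] by linarith
  have riesz: "riesz w x \<le> near x + N" for x
  proof -
    have "riesz w x \<le> (\<integral>\<^sup>+y. ennreal (k1 (x - y) * cmod (w y)) + ennreal (cmod (w y)) \<partial>lborel)"
      unfolding riesz_def
    proof (rule nn_integral_mono)
      fix y
      have "cmod (w y) / norm (x - y) \<le> k1 (x - y) * cmod (w y) + cmod (w y)"
      proof (cases "x - y \<in> ball 0 1")
        case False
        then have "1 / norm (x - y) * cmod (w y) \<le> 1 * cmod (w y)"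
          by (intro mult_right_mono) (auto simp: divide_le_eq)
        then show ?thesis using k10[of "x - y"] by (simp add: add_increasing)
      qed (simp add: k1_def)
      then have "ennreal (cmod (w y) / norm (x - y)) \<le> ennreal (k1 (x - y) * cmod (w y) + cmod (w y))"
        by (rule ennreal_leI)
      then show "ennreal (cmod (w y) / norm (x - y)) \<le> ennreal (k1 (x - y) * cmod (w y)) + ennreal (cmod (w y))"
        using k10[of "x - y"] by (simp add: ennreal_plus)
    qed
    also have "\<dots> = near x + N"
      unfolding near_def N_def by (rule nn_integral_add) measurable
    finally show ?thesis .
  qed
  have sq: "(p + q)\<^sup>2 \<le> 4 * (p\<^sup>2 + q\<^sup>2)" for p q :: ennreal
  proof -
    have *: "(p + q)\<^sup>2 \<le> 4 * (p\<^sup>2 + q\<^sup>2)" if "p \<le> q" for p q :: ennreal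
    proof -
      have "p + q \<le> 2 * q" using that by (simp add: mult_2 add_right_mono)
      then have "(p + q)\<^sup>2 \<le> (2 * q)\<^sup>2" by (rule power_mono) simp
      also have "\<dots> = 4 * q\<^sup>2" by (simp add: power_mult_distrib)
      also have "\<dots> \<le> 4 * (p\<^sup>2 + q\<^sup>2)" by (intro mult_left_mono) auto
      finally show ?thesis .
    qed
    show ?thesis using *[of p q] *[of q p] by (cases "p \<le> q") (auto simp: add.commute not_le less_imp_le)
  qed
  have "(\<integral>\<^sup>+x. (ennreal (a x) * riesz w x)\<^sup>2 \<partial>lborel) \<le>
     (\<integral>\<^sup>+x. 4 * ennreal (A\<^sup>2) * (near x)\<^sup>2 + 4 * N\<^sup>2 * ennreal ((a x)\<^sup>2) \<partial>lborel)"
  proof (rule nn_integral_mono)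
    fix x
    have "(ennreal (a x) * riesz w x)\<^sup>2 = ennreal ((a x)\<^sup>2) * (riesz w x)\<^sup>2"
      using a0 by (simp add: power_mult_distrib ennreal_power)
    also have "\<dots> \<le> ennreal ((a x)\<^sup>2) * (near x + N)\<^sup>2"
      by (intro mult_left_mono power_mono riesz) auto
    also have "\<dots> \<le> ennreal ((a x)\<^sup>2) * (4 * ((near x)\<^sup>2 + N\<^sup>2))"
      by (intro mult_left_mono sq) auto
    also have "\<dots> = 4 * (ennreal ((a x)\<^sup>2) * (near x)\<^sup>2) + 4 * N\<^sup>2 * ennreal ((a x)\<^sup>2)"
      by (simp add: distrib_left mult_ac)
    also have "\<dots> \<le> 4 * (ennreal (A\<^sup>2) * (near x)\<^sup>2) + 4 * N\<^sup>2 * ennreal ((a x)\<^sup>2)"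
      using a0 by (intro add_right_mono mult_left_mono mult_right_mono ennreal_leI power_mono) auto
    finally show "(ennreal (a x) * riesz w x)\<^sup>2 \<le> 4 * ennreal (A\<^sup>2) * (near x)\<^sup>2 + 4 * N\<^sup>2 * ennreal ((a x)\<^sup>2)"
      by (simp add: mult.assoc)
  qed
  also have "\<dots> = 4 * ennreal (A\<^sup>2) * (\<integral>\<^sup>+x. (near x)\<^sup>2 \<partial>lborel) + 4 * N\<^sup>2 * (\<integral>\<^sup>+x. ennreal ((a x)\<^sup>2) \<partial>lborel)"
    by (simp add: nn_integral_add nn_integral_cmult)
  also have "\<dots> < \<infinity>"
  proof -
    have "(\<integral>\<^sup>+x. (near x)\<^sup>2 \<partial>lborel) \<le> (\<integral>\<^sup>+x. ennreal (k1 x) \<partial>lborel)\<^sup>2 * (\<integral>\<^sup>+x. ennreal ((cmod (w x))\<^sup>2) \<partial>lborel)"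
      unfolding near_def by (rule young_nn) (auto simp: k10)
    also have "\<dots> < \<infinity>"
      using nn_integral_near_kernel nn_square_integrable[OF w2]
      by (simp add: k1_def ennreal_mult_less_top power_less_top_ennreal)
    finally have "(\<integral>\<^sup>+x. (near x)\<^sup>2 \<partial>lborel) < \<infinity>" .
    moreover have "(\<integral>\<^sup>+x. ennreal ((a x)\<^sup>2) \<partial>lborel) < \<infinity>"
      using a2 by (simp add: integrable_iff_bounded)
    ultimately show ?thesis
      using N by (simp add: ennreal_mult_less_top power_less_top_ennreal)
  qed
  finally show ?thesis .
qed

text \<open>The point is the order of quantifiers: C is obtained before p, so a whole family of
  weights with the same majorant shares one bound. The regularised weights in the decay proof form
  such a family.\<close>

lemma nonlocal_weighted:
  assumes w2: "square_integrable w" and w1: "integrable lborel w"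
    and a [measurable]: "a \<in> borel_measurable borel" and a0: "\<And>x. 0 \<le> a x" "\<And>x. a x \<le> A"
    and a2: "integrable lborel (\<lambda>x. (a x)\<^sup>2)"
  obtains C where "\<And>p. p \<in> borel_measurable borel \<Longrightarrow> (\<And>x. 0 \<le> p x) \<Longrightarrow> (\<And>x. p x * (2 * norm x * gauss x) \<le> a x) \<Longrightarrow>
     square_integrable (\<lambda>x. of_real (p x) * nonlocal w x) \<and>
     (\<integral>x. (cmod (of_real (p x) * nonlocal w x))\<^sup>2 \<partial>lborel) \<le> C"
proof
  let ?J = "\<integral>\<^sup>+x. (ennreal (a x) * riesz w x)\<^sup>2 \<partial>lborel"
  have J: "?J < \<infinity>" by (rule riesz_weighted[OF assms])
  fix p :: "real^2 \<Rightarrow> real"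
  assume [measurable]: "p \<in> borel_measurable borel" and p0: "\<And>x. 0 \<le> p x"
    and pa: "\<And>x. p x * (2 * norm x * gauss x) \<le> a x"
  have "ennreal (cmod (of_real (p x) * nonlocal w x)) \<le> ennreal (a x) * riesz w x" for x
  proof -
    have "ennreal (cmod (of_real (p x) * nonlocal w x)) = ennreal (p x) * ennreal (cmod (nonlocal w x))"
      using p0 by (simp add: norm_mult ennreal_mult)
    also have "\<dots> \<le> ennreal (p x) * (ennreal (2 * norm x * gauss x) * riesz w x)"
      by (intro mult_left_mono nonlocal_le) auto
    also have "\<dots> = ennreal (p x * (2 * norm x * gauss x)) * riesz w x"
      using p0 gauss_pos[of x] by (simp add: ennreal_mult mult.assoc less_imp_le)
    also have "\<dots> \<le> ennreal (a x) * riesz w x"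
      by (intro mult_right_mono ennreal_leI pa) auto
    finally show ?thesis .
  qed
  then have "(ennreal (cmod (of_real (p x) * nonlocal w x)))\<^sup>2 \<le> (ennreal (a x) * riesz w x)\<^sup>2" for x
    by (rule power_mono) simp
  then have *: "(\<integral>\<^sup>+x. ennreal ((cmod (of_real (p x) * nonlocal w x))\<^sup>2) \<partial>lborel) \<le> ?J"
    by (intro nn_integral_mono) (simp add: ennreal_power)
  have sq: "square_integrable (\<lambda>x. of_real (p x) * nonlocal w x)"
    by (rule square_integrableI_nn) (use * J in \<open>auto intro: le_less_trans\<close>)
  moreover have "(\<integral>x. (cmod (of_real (p x) * nonlocal w x))\<^sup>2 \<partial>lborel) \<le> enn2real ?J"
  proof -
    let ?I = "\<integral>x. (cmod (of_real (p x) * nonlocal w x))\<^sup>2 \<partial>lborel"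
    have "ennreal ?I \<le> ?J" using * unfolding nn_square_integrable[OF sq] .
    then have "enn2real (ennreal ?I) \<le> enn2real ?J"
      using J by (intro enn2real_mono) auto
    moreover have "enn2real (ennreal ?I) = ?I"
      by (rule enn2real_ennreal) (auto intro!: integral_nonneg_AE)
    ultimately show ?thesis by linarith
  qed
  ultimately show "square_integrable (\<lambda>x. of_real (p x) * nonlocal w x) \<and>
     (\<integral>x. (cmod (of_real (p x) * nonlocal w x))\<^sup>2 \<partial>lborel) \<le> enn2real ?J" by simp
qed

end

section \<open>The velocity field of the Gaussian vortex\<close>

definition swirl :: "real \<Rightarrow> real" where
  "swirl s = (if s = 0 then 1 / 4 else (1 - exp (- s / 4)) / s)"

text \<open>\<open>v_gauss x\<close> is \<open>perp x * swirl s / (2 pi)\<close> with s = |x|^2, and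
  \<open>swirl\<close> is smooth across 0: its expansion starts with 1/4 - s/32, whence the two
  values at the origin. This removes the apparent singularity of the field.\<close>

definition swirl' :: "real \<Rightarrow> real" where
  "swirl' s = (if s = 0 then - 1 / 32 else (s * exp (- s / 4) / 4 - (1 - exp (- s / 4))) / s\<^sup>2)"

lemma swirl_deriv: "(swirl has_real_derivative swirl' s) (at s)"
proof (cases "s = 0")
  case False
  have "((\<lambda>s. (1 - exp (- s / 4)) / s) has_real_derivative swirl' s) (at s)"
    using False by (auto intro!: derivative_eq_intros simp: swirl'_def power2_eq_square field_simps)
  then show ?thesis
    by (rule has_field_derivative_transform_within_open[of _ _ _ "- {0}"]) (use False in \<open>auto simp: swirl_def\<close>)
next
  case True
  have "((\<lambda>h::real. ((1 - exp (- h / 4)) / h - 1 / 4) / h) \<longlongrightarrow> - 1 / 32) (at 0)"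
    by real_asymp
  then have "((\<lambda>h. (swirl h - swirl 0) / h) \<longlongrightarrow> - 1 / 32) (at 0)"
    by (rule Lim_transform_eventually) (auto simp: swirl_def eventually_at_filter)
  then show ?thesis using True by (simp add: DERIV_def swirl'_def)
qed

lemma continuous_swirl': "continuous_on UNIV swirl'"
proof -
  have "isCont swirl' s" for s
  proof (cases "s = 0")
    case False
    have "isCont (\<lambda>s. (s * exp (- s / 4) / 4 - (1 - exp (- s / 4))) / s\<^sup>2) s"
      using False by (intro continuous_intros) auto
    moreover have "\<forall>\<^sub>F x in nhds s. (x * exp (- x / 4) / 4 - (1 - exp (- x / 4))) / x\<^sup>2 = swirl' x"
      using t1_space_nhds[OF False] by eventually_elim (simp add: swirl'_def)
    ultimately show ?thesis using isCont_cong[of "\<lambda>s. (s * exp (- s / 4) / 4 - (1 - exp (- s / 4))) / s\<^sup>2" swirl' s] by simp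
  next
    case True
    have "((\<lambda>s::real. (s * exp (- s / 4) / 4 - (1 - exp (- s / 4))) / s\<^sup>2) \<longlongrightarrow> - 1 / 32) (at 0)"
      by real_asymp
    then have "(swirl' \<longlongrightarrow> - 1 / 32) (at 0)"
      by (rule Lim_transform_eventually) (auto simp: swirl'_def eventually_at_filter)
    then show ?thesis using True by (simp add: isCont_def swirl'_def)
  qed
  then show ?thesis by (simp add: continuous_on_eq_continuous_at)
qed

lemma v_gauss_nth:
  "v_gauss x $ 1 = - (x $ 2) * swirl ((norm x)\<^sup>2) / (2 * pi)"
  "v_gauss x $ 2 = x $ 1 * swirl ((norm x)\<^sup>2) / (2 * pi)"
proof -
  have "x $ 1 = 0 \<and> x $ 2 = 0" if "norm x = 0" using that by simp
  then show "v_gauss x $ 1 = - (x $ 2) * swirl ((norm x)\<^sup>2) / (2 * pi)"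
    "v_gauss x $ 2 = x $ 1 * swirl ((norm x)\<^sup>2) / (2 * pi)"
    by (auto simp: v_gauss_def biot_savart_nth swirl_def mult_ac)
qed

definition v_gauss' :: "2 \<Rightarrow> 2 \<Rightarrow> real^2 \<Rightarrow> real" where
  "v_gauss' j i x = (if j = 1
     then - ((if i = 2 then 1 else 0) * swirl ((norm x)\<^sup>2) + x $ 2 * (swirl' ((norm x)\<^sup>2) * (2 * x $ i))) / (2 * pi)
     else ((if i = 1 then 1 else 0) * swirl ((norm x)\<^sup>2) + x $ 1 * (swirl' ((norm x)\<^sup>2) * (2 * x $ i))) / (2 * pi))"

lemma has_gradient_v_gauss: "has_gradient (\<lambda>x. v_gauss x $ j) (v_gauss' j)"
proof -
  have q: "has_gradient (\<lambda>x::real^2. swirl ((norm x)\<^sup>2)) (\<lambda>i x. swirl' ((norm x)\<^sup>2) * (2 * x $ i))"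
    by (rule has_gradient_compose[OF has_gradient_norm_sq swirl_deriv continuous_swirl'])
  have c: "has_gradient (\<lambda>x::real^2. x $ i) (\<lambda>j x. if j = i then 1 else 0)" for i
    using has_gradient_coord[of i, where 'a=real] by simp
  have "has_gradient (\<lambda>x. (- 1 / (2 * pi)) * (x $ 2 * swirl ((norm x)\<^sup>2)))
    (\<lambda>i x. (- 1 / (2 * pi)) * ((if i = 2 then 1 else 0) * swirl ((norm x)\<^sup>2) + x $ 2 * (swirl' ((norm x)\<^sup>2) * (2 * x $ i))))"
    by (intro has_gradient_cmult has_gradient_mult c q)
  then have 1: "has_gradient (\<lambda>x. v_gauss x $ 1) (v_gauss' 1)"
    by (rule has_gradient_cong) (auto simp: v_gauss_nth v_gauss'_def field_simps)
  have "has_gradient (\<lambda>x. (1 / (2 * pi)) * (x $ 1 * swirl ((norm x)\<^sup>2)))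
    (\<lambda>i x. (1 / (2 * pi)) * ((if i = 1 then 1 else 0) * swirl ((norm x)\<^sup>2) + x $ 1 * (swirl' ((norm x)\<^sup>2) * (2 * x $ i))))"
    by (intro has_gradient_cmult has_gradient_mult c q)
  then have 2: "has_gradient (\<lambda>x. v_gauss x $ 2) (v_gauss' 2)"
    by (rule has_gradient_cong) (auto simp: v_gauss_nth v_gauss'_def)
  show ?thesis using 1 2 exhaust_2[of j] by auto
qed

lemma v_gauss_divergence_free: "(\<Sum>j\<in>UNIV. v_gauss' j j x) = 0"
  by (simp add: sum_2 v_gauss'_def field_simps)

lemma v_gauss_orthogonal: "(\<Sum>j\<in>UNIV. x $ j * v_gauss x $ j) = 0"
  by (simp add: sum_2 v_gauss_nth)

lemma v_gauss_bounded: "\<bar>v_gauss x $ j\<bar> \<le> 1"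
proof -
  define s where "s = (norm x)\<^sup>2"
  have n: "norm x * swirl s \<le> 1" "swirl s \<ge> 0"
  proof -
    have s0: "s \<ge> 0" by (simp add: s_def)
    show sw0: "swirl s \<ge> 0" using s0 by (auto simp: swirl_def)
    show "norm x * swirl s \<le> 1"
    proof (cases "norm x \<le> 1")
      case True
      have "swirl s \<le> 1"
      proof (cases "s = 0")
        case False
        have "1 - s / 4 \<le> exp (- s / 4)" using exp_ge_add_one_self[of "- s / 4"] by simp
        then have "1 - exp (- s / 4) \<le> s" using s0 by linarith
        then show ?thesis using False s0 by (simp add: swirl_def)
      qed (simp add: swirl_def)
      then show ?thesis using True sw0 mult_mono[of "norm x" 1 "swirl s" 1] by simp
    next
      case False
      then have "swirl s \<le> 1 / s" by (auto simp: swirl_def s_def intro!: divide_right_mono)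
      then have "norm x * swirl s \<le> norm x * (1 / s)" by (rule mult_left_mono) simp
      also have "\<dots> = 1 / norm x" using False by (simp add: s_def power2_eq_square)
      also have "\<dots> \<le> 1" using False by (auto simp: divide_le_eq)
      finally show ?thesis .
    qed
  qed
  have "\<bar>v_gauss x $ j\<bar> \<le> norm x * swirl s / (2 * pi)"
    using exhaust_2[of j] component_le_norm_cart[of x] n(2)
    by (auto simp: v_gauss_nth abs_mult abs_divide s_def[symmetric] intro!: divide_right_mono mult_right_mono)
  also have "\<dots> \<le> 1 / (2 * pi)" using n by (intro divide_right_mono) auto
  also have "\<dots> \<le> 1" using pi_gt3 by simp
  finally show ?thesis .
qed

lemma has_gradient_gauss: "has_gradient gauss (\<lambda>j x. - (x $ j) / 2 * gauss x)"
proof -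
  have "has_gradient (\<lambda>x::real^2. 1 / (4 * pi) * exp ((- 1 / 4) * (norm x)\<^sup>2))
    (\<lambda>j x. 1 / (4 * pi) * (exp ((- 1 / 4) * (norm x)\<^sup>2) * ((- 1 / 4) * (2 * x $ j))))"
    by (intro has_gradient_cmult has_gradient_compose[OF has_gradient_cmult[OF has_gradient_norm_sq] DERIV_exp])
      (auto intro!: continuous_intros)
  then show ?thesis
    by (rule has_gradient_cong) (auto simp: gauss_def field_simps)
qed

section \<open>Distributional eigenvalue equation in weak form\<close>

text \<open>Eigenfunctions are Lebesgue measurable, whereas Tonelli, Fubini and changes of variables
  are used for Borel functions and \<open>lborel\<close>. Replacing w by an almost everywhere equal
  Borel function, separately for Re and Im, moves the problem there once and for all.\<close>

lemma lebesgue_borel_representative: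
  fixes w :: "real^2 \<Rightarrow> complex"
  assumes "w \<in> borel_measurable lebesgue"
  obtains v where "v \<in> borel_measurable borel" "AE x in lborel. w x = v x"
proof -
  have Re: "(\<lambda>x. Re (w x)) \<in> borel_measurable lebesgue"
    by (rule measurable_compose[OF assms]) simp
  have Im: "(\<lambda>x. Im (w x)) \<in> borel_measurable lebesgue"
    by (rule measurable_compose[OF assms]) simp
  obtain a where a: "a \<in> borel_measurable lborel" "AE x in lborel. Re (w x) = a x"
    using completion_ex_borel_measurable_real[OF Re] by blast
  obtain b where b: "b \<in> borel_measurable lborel" "AE x in lborel. Im (w x) = b x"
    using completion_ex_borel_measurable_real[OF Im] by blast
  note ab = a b
  have [measurable]: "a \<in> borel_measurable borel" "b \<in> borel_measurable borel" using ab by auto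
  show ?thesis
  proof
    show "(\<lambda>x. of_real (a x) + \<i> * of_real (b x)) \<in> borel_measurable borel" by measurable
    show "AE x in lborel. w x = of_real (a x) + \<i> * of_real (b x)"
      using ab(2,4) by eventually_elim (simp add: complex_eq_iff)
  qed
qed

context
  fixes w v :: "real^2 \<Rightarrow> complex"
  assumes wm [measurable]: "w \<in> borel_measurable lebesgue"
    and v [measurable]: "v \<in> borel_measurable borel" and wv: "AE x in lborel. w x = v x"
begin

text \<open>Stated for a jointly measurable F of the value and the point, so that weighted norms,
  moments, pairings and the velocity integral are all instances.\<close>

lemma lebesgue_integral_representative:
  fixes F :: "complex \<Rightarrow> real^2 \<Rightarrow> 'b::{banach, second_countable_topology}"
  assumes [measurable]: "(\<lambda>(z, x). F z x) \<in> borel_measurable (borel \<Otimes>\<^sub>M borel)"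
  shows "integral\<^sup>L lebesgue (\<lambda>x. F (w x) x) = integral\<^sup>L lborel (\<lambda>x. F (v x) x)"
    and "integrable lebesgue (\<lambda>x. F (w x) x) \<longleftrightarrow> integrable lborel (\<lambda>x. F (v x) x)"
proof -
  have idm: "(\<lambda>x. x) \<in> measurable lebesgue (borel :: (real^2) measure)"
    by (rule measurable_completion) simp
  have wF: "(\<lambda>x. F (w x) x) \<in> borel_measurable lebesgue"
    using measurable_compose[OF measurable_Pair[OF wm idm] assms] by simp
  have vF: "(\<lambda>x. F (v x) x) \<in> borel_measurable lborel" by measurable
  have vF': "(\<lambda>x. F (v x) x) \<in> borel_measurable lebesgue" by (rule measurable_completion[OF vF])
  have ae: "AE x in lebesgue. F (w x) x = F (v x) x"
    using AE_completion[OF wv] by eventually_elim simp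
  show "integral\<^sup>L lebesgue (\<lambda>x. F (w x) x) = integral\<^sup>L lborel (\<lambda>x. F (v x) x)"
    using integral_cong_AE[OF wF vF' ae] integral_completion[OF vF] by simp
  show "integrable lebesgue (\<lambda>x. F (w x) x) \<longleftrightarrow> integrable lborel (\<lambda>x. F (v x) x)"
    using integrable_cong_AE[OF wF vF' ae] integrable_completion[OF vF] by simp
qed

lemma distr_of_representative:
  assumes [measurable]: "\<phi> \<in> borel_measurable borel"
  shows "distr_of w \<phi> = (\<integral>x. v x * \<phi> x \<partial>lborel)"
  unfolding distr_of_def by (rule lebesgue_integral_representative(1)) measurable

lemma velocity_representative: "velocity w \<xi> $ j = vel v j \<xi>"
  unfolding velocity_def vel_def vec_lambda_beta
  by (rule lebesgue_integral_representative(1)) measurable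

lemma distr_laplacian_representative:
  assumes \<phi>: "has_gradient \<phi> \<phi>'" "\<And>j. has_gradient (\<phi>' j) (\<phi>'' j)"
  shows "distr_laplacian (distr_of w) \<phi> = (\<Sum>j\<in>UNIV. \<integral>x. v x * \<phi>'' j j x \<partial>lborel)"
  using has_gradient_borel(2)[OF \<phi>(2)]
  by (simp add: distr_laplacian_def distr_pderiv_def has_gradient_pderiv_at[OF \<phi>(1)]
      has_gradient_pderiv_at[OF \<phi>(2)] distr_of_representative)

text \<open>By definition b . grad T acts on \<phi> as minus T applied to the divergence of b
  \<phi>; the product rule separates the divergence of b from the derivative of \<phi>.\<close>

lemma distr_advect_representative:
  assumes \<phi>: "has_gradient \<phi> \<phi>'" and b: "\<And>j. has_gradient (\<lambda>x. b x $ j) (b' j)"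
  shows "distr_advect b (distr_of w) \<phi> =
    - (\<Sum>j\<in>UNIV. \<integral>x. v x * (of_real (b' j j x) * \<phi> x + of_real (b x $ j) * \<phi>' j x) \<partial>lborel)"
proof -
  have g: "has_gradient (\<lambda>x. of_real (b x $ j) * \<phi> x)
     (\<lambda>i x. of_real (b' j i x) * \<phi> x + of_real (b x $ j) * \<phi>' i x)" for j
    by (intro has_gradient_mult has_gradient_of_real b \<phi>)
  show ?thesis
    using has_gradient_borel(2)[OF g]
    by (simp add: distr_advect_def distr_mult_def distr_pderiv_def has_gradient_pderiv_at[OF g]
        distr_of_representative sum_negf)
qed

text \<open>The identity field has divergence 2, so half of its advection contributes minus one copy
  of the pairing of w with \<phi>; it cancels the zeroth-order term of the operator. The vortex
  field is divergence free and contributes only to the drift. What remains is divergence form with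
  drift - x/2 + \<alpha> v and the nonlocal term as source.\<close>

lemma eigen_weak_equation:
  assumes eq: "distr_eq (\<lambda>\<phi>. op_L w \<phi> - complex_of_real \<alpha> * op_Lambda w \<phi>) (\<lambda>\<phi>. \<mu> * distr_of w \<phi>)"
    and v2: "square_integrable v" and h2: "square_integrable (nonlocal v)"
  shows "weak_equation (\<lambda>j x. - (x $ j) / 2 + \<alpha> * v_gauss x $ j) (\<lambda>x. of_real (\<alpha> / 2) * nonlocal v x) \<mu> v"
  unfolding weak_equation_def
proof (intro allI impI, elim conjE)
  fix \<phi> \<phi>' \<phi>'' r
  assume bp: "bump_poly \<phi>" and \<phi>: "has_gradient \<phi> \<phi>'" and "\<forall>j. has_gradient (\<phi>' j) (\<phi>'' j)"
    and "\<forall>x. norm x > r \<longrightarrow> \<phi> x = 0"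
  then have \<phi>': "\<And>j. has_gradient (\<phi>' j) (\<phi>'' j)" and r: "\<And>x. norm x > r \<Longrightarrow> \<phi> x = 0" by auto
  note cont = has_gradientD(2,3)[OF \<phi>] has_gradientD(2,3)[OF \<phi>']
  note [measurable] = has_gradient_borel[OF \<phi>] has_gradient_borel[OF \<phi>']
  have r': "\<phi>' j x = 0" "\<phi>'' j i x = 0" if "norm x > r" for i j x
    using that has_gradient_zero_outside[OF \<phi> r] has_gradient_zero_outside[OF \<phi>' has_gradient_zero_outside[OF \<phi> r]]
    by auto
  have test: "test_function \<phi>" by (rule bump_poly_test_function[OF bp, of r 0]) (use r in auto)
  have gi: "has_gradient (\<lambda>x::real^2. x $ j) (\<lambda>i x. if i = j then 1 else 0)" for j
    using has_gradient_coord[of j, where 'a=real] by simp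
  note cx = has_gradientD(3)[OF gi] and cv = has_gradientD(2,3)[OF has_gradient_v_gauss]
  \<comment> \<open>The integral is a convolution at the point 0 with the reflected kernel, for
    which integrability is known.\<close>
  have int: "integrable lborel (\<lambda>x. v x * k x)" if "continuous_on UNIV k" "\<And>x. norm x > r \<Longrightarrow> k x = 0" for k
  proof -
    have "integrable lborel (\<lambda>y. v y * k (- (0 - y)))"
      by (rule convolve_integrable[OF square_integrable_locally_integrable[OF v2], of "\<lambda>x. k (- x)" r])
        (use that in \<open>auto intro!: continuous_on_compose2[OF that(1)] continuous_intros\<close>)
    then show ?thesis by simp
  qed
  define A P X Y Z where "A j = (\<integral>x. v x * \<phi>'' j j x \<partial>lborel)" and "P = (\<integral>x. v x * \<phi> x \<partial>lborel)"
    and "X j = (\<integral>x. v x * (of_real (x $ j) * \<phi>' j x) \<partial>lborel)"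
    and "Y j = (\<integral>x. v x * (of_real (v_gauss x $ j) * \<phi>' j x) \<partial>lborel)"
    and "Z j = (\<integral>x. v x * (of_real (v_gauss' j j x) * \<phi> x) \<partial>lborel)" for j
  define H where "H = (\<integral>x. nonlocal v x * \<phi> x \<partial>lborel)"
  have iA: "integrable lborel (\<lambda>x. v x * \<phi>'' j j x)" for j
    by (intro int cont) (use r' in auto)
  have iP: "integrable lborel (\<lambda>x. v x * \<phi> x)" by (intro int cont) (use r in auto)
  have iX: "integrable lborel (\<lambda>x. v x * (of_real (x $ j) * \<phi>' j x))" for j
    by (intro int continuous_intros cont cx) (use r' in auto)
  have iY: "integrable lborel (\<lambda>x. v x * (of_real (v_gauss x $ j) * \<phi>' j x))" for j
    by (intro int continuous_intros cont cv) (use r' in auto)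
  have iZ: "integrable lborel (\<lambda>x. v x * (of_real (v_gauss' j j x) * \<phi> x))" for j
    by (intro int continuous_intros cont cv) (use r in auto)
  have Z0: "(\<Sum>j\<in>UNIV. Z j) = 0"
  proof -
    have "(\<Sum>j\<in>UNIV. Z j) = (\<integral>x. (\<Sum>j\<in>UNIV. v x * (of_real (v_gauss' j j x) * \<phi> x)) \<partial>lborel)"
      unfolding Z_def using iZ by (simp add: Bochner_Integration.integral_sum)
    also have "\<dots> = (\<integral>x. v x * (of_real (\<Sum>j\<in>UNIV. v_gauss' j j x) * \<phi> x) \<partial>lborel)"
      by (simp add: sum_distrib_left sum_distrib_right)
    finally show ?thesis by (simp add: v_gauss_divergence_free)
  qed
  have drift: "diffusion_drift w \<phi> = (\<Sum>j\<in>UNIV. A j) - P - (\<Sum>j\<in>UNIV. X j) / 2"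
  proof -
    have "distr_advect (\<lambda>\<xi>. \<xi>) (distr_of w) \<phi> =
      - (\<Sum>j\<in>UNIV. \<integral>x. v x * (of_real (if j = j then 1 else 0) * \<phi> x + of_real (x $ j) * \<phi>' j x) \<partial>lborel)"
      by (rule distr_advect_representative[OF \<phi> gi])
    also have "\<dots> = - (\<Sum>j\<in>(UNIV :: 2 set). P + X j)"
      unfolding P_def X_def using iP iX by (simp add: distrib_left)
    also have "\<dots> = - (2 * P + (\<Sum>j\<in>UNIV. X j))" by (simp add: sum.distrib)
    finally have 1: "distr_advect (\<lambda>\<xi>. \<xi>) (distr_of w) \<phi> = - (2 * P + (\<Sum>j\<in>UNIV. X j))" .
    show ?thesis
      unfolding diffusion_drift_def distr_laplacian_representative[OF \<phi> \<phi>'] A_def 1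
      by (simp add: field_simps)
  qed
  have lam: "op_Lambda w \<phi> = - (\<Sum>j\<in>UNIV. Y j) - H / 2"
  proof -
    have "distr_advect v_gauss (distr_of w) \<phi> =
      - (\<Sum>j\<in>UNIV. \<integral>x. v x * (of_real (v_gauss' j j x) * \<phi> x + of_real (v_gauss x $ j) * \<phi>' j x) \<partial>lborel)"
      by (rule distr_advect_representative[OF \<phi> has_gradient_v_gauss])
    also have "\<dots> = - (\<Sum>j\<in>UNIV. Z j + Y j)"
      unfolding Z_def Y_def using iZ iY by (simp add: distrib_left)
    also have "\<dots> = - (\<Sum>j\<in>UNIV. Y j)" by (simp add: sum.distrib Z0)
    finally have 1: "distr_advect v_gauss (distr_of w) \<phi> = - (\<Sum>j\<in>UNIV. Y j)" .
    have e: "(\<Sum>j\<in>UNIV. velocity w \<xi> $ j * complex_of_real (pderiv_at j gauss \<xi>)) * \<phi> \<xi> = - (1/2) * (nonlocal v \<xi> * \<phi> \<xi>)" for \<xi>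
      by (simp add: velocity_representative has_gradient_pderiv_at[OF has_gradient_gauss] nonlocal_def sum_2 algebra_simps)
    have "distr_of (\<lambda>\<xi>. \<Sum>j\<in>UNIV. velocity w \<xi> $ j * complex_of_real (pderiv_at j gauss \<xi>)) \<phi> =
       (LINT \<xi>|lebesgue. - (1/2) * (nonlocal v \<xi> * \<phi> \<xi>))"
      unfolding distr_of_def e ..
    also have "\<dots> = (\<integral>\<xi>. - (1/2) * (nonlocal v \<xi> * \<phi> \<xi>) \<partial>lborel)"
      using nonlocal_borel[OF v] by (intro integral_completion) measurable
    also have "\<dots> = - H / 2" unfolding H_def by (simp only: integral_mult_right_zero) simp
    finally show ?thesis unfolding op_Lambda_def 1 by simp
  qed
  have "op_L w \<phi> - of_real \<alpha> * op_Lambda w \<phi> = \<mu> * distr_of w \<phi>"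
    using eq test by (simp add: distr_eq_def)
  then have main: "(\<Sum>j\<in>UNIV. A j) - (\<Sum>j\<in>UNIV. X j) / 2 + of_real \<alpha> * (\<Sum>j\<in>UNIV. Y j) + of_real \<alpha> / 2 * H = \<mu> * P"
    unfolding op_L_def drift lam by (simp add: distr_of_representative flip: P_def) (simp add: algebra_simps)
  have "(\<integral>x. v x * (\<Sum>j\<in>UNIV. \<phi>'' j j x + of_real (- (x $ j) / 2 + \<alpha> * v_gauss x $ j) * \<phi>' j x) \<partial>lborel) =
     (\<integral>x. (\<Sum>j\<in>UNIV. v x * \<phi>'' j j x + (- 1/2) * (v x * (of_real (x $ j) * \<phi>' j x)) +
        of_real \<alpha> * (v x * (of_real (v_gauss x $ j) * \<phi>' j x))) \<partial>lborel)"
    by (intro Bochner_Integration.integral_cong refl) (auto simp: sum_distrib_left algebra_simps intro!: sum.cong)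
  also have "\<dots> = (\<Sum>j\<in>UNIV. A j + (- 1/2) * X j + of_real \<alpha> * Y j)"
    unfolding A_def X_def Y_def
    by (subst Bochner_Integration.integral_sum)
      (auto intro!: sum.cong Bochner_Integration.integrable_add integrable_mult_right iA iX iY
        simp: iA iX iY Bochner_Integration.integral_add simp del: integrable_mult_right_iff)
  also have "\<dots> = (\<Sum>j\<in>UNIV. A j) - (\<Sum>j\<in>UNIV. X j) / 2 + of_real \<alpha> * (\<Sum>j\<in>UNIV. Y j)"
    by (simp add: sum_2 algebra_simps)
  finally have 1: "(\<integral>x. v x * (\<Sum>j\<in>UNIV. \<phi>'' j j x + of_real (- (x $ j) / 2 + \<alpha> * v_gauss x $ j) * \<phi>' j x) \<partial>lborel) =
    (\<Sum>j\<in>UNIV. A j) - (\<Sum>j\<in>UNIV. X j) / 2 + of_real \<alpha> * (\<Sum>j\<in>UNIV. Y j)" .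
  have 2: "(\<integral>x. of_real (\<alpha> / 2) * nonlocal v x * \<phi> x \<partial>lborel) = of_real \<alpha> / 2 * H"
    unfolding H_def by (simp only: mult.assoc integral_mult_right_zero) simp
  show "(\<integral>x. v x * (\<Sum>j\<in>UNIV. \<phi>'' j j x + of_real (- (x $ j) / 2 + \<alpha> * v_gauss x $ j) * \<phi>' j x) \<partial>lborel)
     + (\<integral>x. of_real (\<alpha> / 2) * nonlocal v x * \<phi> x \<partial>lborel) = \<mu> * (\<integral>x. v x * \<phi> x \<partial>lborel)"
    unfolding 1 2 using main by (simp add: P_def)
qed

end

section \<open>Gaussian decay of eigenfunctions\<close>

abbreviation lin_drift :: "real \<Rightarrow> 2 \<Rightarrow> real^2 \<Rightarrow> real" where
  "lin_drift \<alpha> j x \<equiv> - (x $ j) / 2 + \<alpha> * v_gauss x $ j"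

lemma has_gradient_lin_drift:
  "has_gradient (lin_drift \<alpha> j) (\<lambda>i x. - (if i = j then 1 else 0) / 2 + \<alpha> * v_gauss' j i x)"
proof -
  have c: "has_gradient (\<lambda>x::real^2. x $ j) (\<lambda>i x. if i = j then 1 else 0)"
    using has_gradient_coord[of j, where 'a=real] by simp
  have "has_gradient (\<lambda>x. (- 1 / 2) * x $ j + \<alpha> * v_gauss x $ j) (\<lambda>i x. (- 1 / 2) * (if i = j then 1 else 0) + \<alpha> * v_gauss' j i x)"
    by (intro has_gradient_add has_gradient_cmult c has_gradient_v_gauss)
  then show ?thesis by (rule has_gradient_cong) auto
qed

lemma powr_exp_bounded:
  fixes p c :: real
  assumes c: "c > 0"
  obtains K where "K \<ge> 0" "\<And>s. s \<ge> 0 \<Longrightarrow> (1 + s) powr p * exp (- c * s) \<le> K"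
proof -
  define N where "N = nat \<lceil>p\<rceil>"
  define K where "K = fact N * (1 / c) ^ N * exp c"
  have "(1 + s) powr p * exp (- c * s) \<le> K" if s: "s \<ge> 0" for s
  proof -
    have "p \<le> real N" unfolding N_def by linarith
    then have "(1 + s) powr p \<le> (1 + s) powr real N" using s by (intro powr_mono) auto
    also have "\<dots> = (1 + s) ^ N" using s by (simp add: powr_realpow)
    also have "\<dots> = (1 / c) ^ N * (c * (1 + s)) ^ N" using c by (simp add: power_mult_distrib[symmetric])
    also have "\<dots> \<le> (1 / c) ^ N * (fact N * exp (c * (1 + s)))"
      using c s by (intro mult_left_mono power_le_fact_exp) auto
    finally have "(1 + s) powr p * exp (- c * s) \<le> (1 / c) ^ N * (fact N * exp (c * (1 + s))) * exp (- c * s)"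
      by (intro mult_right_mono) auto
    also have "\<dots> = K * (exp (c * s) * exp (- c * s))" by (simp add: K_def distrib_left exp_add)
    also have "exp (c * s) * exp (- c * s) = 1" by (simp flip: exp_add)
    finally show ?thesis by simp
  qed
  then show ?thesis using c by (intro that[of K]) (auto simp: K_def)
qed

text \<open>Differentiability of the outer function is asked only at values of f: a power of 1 + t
  has a derivative where 1 + t is positive, which is all that s = |x|^2 requires.\<close>

lemma has_gradient_compose':
  fixes f :: "real^2 \<Rightarrow> real" and g :: "real \<Rightarrow> real"
  assumes f: "has_gradient f f'" and g: "\<And>x. (g has_real_derivative g' (f x)) (at (f x))"
    and g': "continuous_on UNIV (\<lambda>x. g' (f x))"
  shows "has_gradient (\<lambda>x. g (f x)) (\<lambda>j x. g' (f x) * f' j x)"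
proof -
  have "((\<lambda>x. g (f x)) has_derivative (\<lambda>h. \<Sum>j\<in>UNIV. h $ j *\<^sub>R (g' (f x) * f' j x))) (at x)" for x
    using has_derivative_compose[OF has_gradientD(1)[OF f] g[unfolded has_field_derivative_def], of x]
    by (simp add: sum_distrib_left algebra_simps)
  then show ?thesis
    using f g' by (auto simp: has_gradient_def intro!: continuous_intros)
qed

text \<open>For a radial gradient x \<theta> the vortex drops out, as x . v = 0 and div v = 0, so
  the coefficient is the same for every \<alpha>. The summand \<psi>^2 / 2 comes from the divergence
  - 1 of the drift - x/2.\<close>

lemma radial_energy:
  assumes weak: "weak_equation (lin_drift \<alpha>) g \<mu> w"
    and w: "square_integrable w" and xw: "\<And>j. square_integrable (\<lambda>x. of_real (x $ j) * w x)"
    and g: "square_integrable g"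
    and \<psi>: "has_gradient \<psi> (\<lambda>j x. x $ j * \<theta> x)" and supp: "\<And>x. norm x > r \<Longrightarrow> \<psi> x = 0"
  shows "Re \<mu> * (\<integral>x. (\<psi> x)\<^sup>2 * (cmod (w x))\<^sup>2 \<partial>lborel) \<le>
     (\<integral>x. ((norm x)\<^sup>2 * (\<theta> x)\<^sup>2 - \<psi> x * ((norm x)\<^sup>2 * \<theta> x) / 2 + (\<psi> x)\<^sup>2 / 2) * (cmod (w x))\<^sup>2 \<partial>lborel)
     + Re (\<integral>x. (of_real (\<psi> x))\<^sup>2 * cnj (w x) * g x \<partial>lborel)"
proof -
  let ?b' = "\<lambda>j i x. - (if i = j then 1 else 0) / 2 + \<alpha> * v_gauss' j i x"
  define P where "P j x = (x $ j * \<theta> x)\<^sup>2 + \<psi> x * (x $ j * \<theta> x) * lin_drift \<alpha> j x - (\<psi> x)\<^sup>2 * ?b' j j x / 2" for j x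
  have [measurable]: "w \<in> borel_measurable borel" using w by auto
  have bw: "square_integrable (\<lambda>x. of_real (lin_drift \<alpha> j x) * w x)" for j
  proof -
    have "square_integrable (\<lambda>x. (- 1 / 2) * (of_real (x $ j) * w x) + of_real \<alpha> * (of_real (v_gauss x $ j) * w x))"
      using has_gradient_borel(1)[OF has_gradient_v_gauss[of j]]
      by (intro square_integrable_add square_integrable_cmult xw square_integrable_mult_bounded[OF w, of _ 1])
        (auto simp: v_gauss_bounded)
    then show ?thesis by (simp add: algebra_simps)
  qed
  note E = energy_inequality[OF weak w bw g has_gradient_lin_drift \<psi> supp]
  have \<psi>0: "\<psi> x = 0" "x $ j * \<theta> x = 0" if "norm x > r" for j x
    using that supp has_gradient_zero_outside[OF \<psi> supp] by auto
  have iP: "integrable lborel (\<lambda>x. P j x * (cmod (w x))\<^sup>2)" for j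
  proof -
    have cP: "continuous_on UNIV (P j)"
      unfolding P_def[abs_def]
      by (intro continuous_intros has_gradientD(2)[OF \<psi>] has_gradientD(3)[OF \<psi>] has_gradientD(2)[OF has_gradient_lin_drift]
          has_gradientD(3)[OF has_gradient_lin_drift]) auto
    then obtain C where C: "\<And>x. \<bar>P j x\<bar> \<le> C"
      by (rule continuous_support_bound_real[of _ r]) (use \<psi>0 in \<open>auto simp: P_def\<close>)
    have [measurable]: "P j \<in> borel_measurable borel" by (rule borel_measurable_continuous_onI[OF cP])
    show ?thesis
    proof (rule integrable_dominated')
      show "integrable lborel (\<lambda>x. C * (cmod (w x))\<^sup>2)" using w by auto
      show "norm (P j x * (cmod (w x))\<^sup>2) \<le> C * (cmod (w x))\<^sup>2" for x
        using C by (auto simp: abs_mult intro!: mult_right_mono)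
    qed measurable
  qed
  have "(\<Sum>j\<in>UNIV. \<integral>x. P j x * (cmod (w x))\<^sup>2 \<partial>lborel) = (\<integral>x. (\<Sum>j\<in>UNIV. P j x * (cmod (w x))\<^sup>2) \<partial>lborel)"
    using iP by (simp add: Bochner_Integration.integral_sum)
  also have "\<dots> = (\<integral>x. ((norm x)\<^sup>2 * (\<theta> x)\<^sup>2 - \<psi> x * ((norm x)\<^sup>2 * \<theta> x) / 2 + (\<psi> x)\<^sup>2 / 2) * (cmod (w x))\<^sup>2 \<partial>lborel)"
  proof (rule Bochner_Integration.integral_cong[OF refl])
    fix x
    have o: "x $ 1 * v_gauss x $ 1 + x $ 2 * v_gauss x $ 2 = 0" and d: "v_gauss' 1 1 x + v_gauss' 2 2 x = 0"
      using v_gauss_orthogonal[of x] v_gauss_divergence_free[of x] by (auto simp: sum_2)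
    have "P 1 x + P 2 x = ((x $ 1)\<^sup>2 + (x $ 2)\<^sup>2) * (\<theta> x)\<^sup>2 - \<psi> x * (((x $ 1)\<^sup>2 + (x $ 2)\<^sup>2) * \<theta> x) / 2 + (\<psi> x)\<^sup>2 / 2
       + \<alpha> * \<psi> x * \<theta> x * (x $ 1 * v_gauss x $ 1 + x $ 2 * v_gauss x $ 2)
       - \<alpha> * (\<psi> x)\<^sup>2 * (v_gauss' 1 1 x + v_gauss' 2 2 x) / 2"
      by (simp add: P_def field_simps power2_eq_square)
    also have "\<dots> = (norm x)\<^sup>2 * (\<theta> x)\<^sup>2 - \<psi> x * ((norm x)\<^sup>2 * \<theta> x) / 2 + (\<psi> x)\<^sup>2 / 2"
      unfolding o d norm2_sq by simp
    finally show "(\<Sum>j\<in>UNIV. P j x * (cmod (w x))\<^sup>2) =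
      ((norm x)\<^sup>2 * (\<theta> x)\<^sup>2 - \<psi> x * ((norm x)\<^sup>2 * \<theta> x) / 2 + (\<psi> x)\<^sup>2 / 2) * (cmod (w x))\<^sup>2"
      by (simp add: sum_2 flip: distrib_right)
  qed
  finally show ?thesis using E unfolding P_def by simp
qed

section \<open>Radial cutoffs and removal of the support condition\<close>

definition cutoff :: "real \<Rightarrow> real^2 \<Rightarrow> real" where
  "cutoff R x = exp 1 * bump 0 (1 - (norm ((1 / R) *\<^sub>R x))\<^sup>2)"

text \<open>Not the radial derivative: the gradient of \<open>cutoff R\<close> at x is - x times
  this function. It contains \<open>bump 2\<close> because that is the derivative of
  \<open>bump 0\<close>; the factor \<open>exp 1\<close> normalises the cutoff to 1 at the
  origin.\<close>

definition cutoff' :: "real \<Rightarrow> real^2 \<Rightarrow> real" where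
  "cutoff' R x = exp 1 * bump 2 (1 - (norm ((1 / R) *\<^sub>R x))\<^sup>2) * (2 / R\<^sup>2)"

lemma has_gradient_cutoff: "has_gradient (cutoff R) (\<lambda>j x. x $ j * - cutoff' R x)"
proof -
  have n: "has_gradient (\<lambda>x::real^2. 1 + (- 1) * (norm (0 + (1 / R) *\<^sub>R x))\<^sup>2)
      (\<lambda>j x. 0 + (- 1) * ((1 / R) *\<^sub>R (2 * (0 + (1 / R) *\<^sub>R x) $ j)))"
    by (intro has_gradient_add has_gradient_const has_gradient_cmult has_gradient_affine[OF has_gradient_norm_sq])
  have "has_gradient (\<lambda>x. exp 1 * bump 0 (1 + (- 1) * (norm (0 + (1 / R) *\<^sub>R x))\<^sup>2))
     (\<lambda>j x. exp 1 * ((bump (0 + 2) (1 + (- 1) * (norm (0 + (1 / R) *\<^sub>R x))\<^sup>2) - of_nat 0 * bump (0 + 1) (1 + (- 1) * (norm (0 + (1 / R) *\<^sub>R x))\<^sup>2))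
        * (0 + (- 1) * ((1 / R) *\<^sub>R (2 * (0 + (1 / R) *\<^sub>R x) $ j)))))"
    by (intro has_gradient_cmult has_gradient_compose[OF n bump_deriv]) (auto intro!: continuous_intros continuous_on_bump)
  then show ?thesis
    by (rule has_gradient_cong) (auto simp: cutoff_def cutoff'_def power2_eq_square numeral_2_eq_2)
qed

lemma cutoff_outside:
  assumes "R > 0" "norm x > R"
  shows "cutoff R x = 0" "cutoff' R x = 0"
proof -
  have "norm ((1 / R) *\<^sub>R x) > 1" using assms by (simp add: field_simps)
  from bump_outside[OF this] show "cutoff R x = 0" "cutoff' R x = 0"
    unfolding cutoff_def cutoff'_def by simp_all
qed

lemma cutoff_bounds: "0 \<le> cutoff R x" "cutoff R x \<le> 1" "0 \<le> cutoff' R x"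
proof -
  have "bump 0 t \<le> exp (- 1)" if "t \<le> 1" for t
    using that by (auto simp: bump_def field_simps)
  then have "exp 1 * bump 0 (1 - (norm ((1 / R) *\<^sub>R x))\<^sup>2) \<le> exp 1 * exp (- 1 :: real)"
    by (intro mult_left_mono) auto
  then show "cutoff R x \<le> 1" by (simp add: cutoff_def flip: exp_add)
qed (auto simp: cutoff_def cutoff'_def)

lemma bump_2_le: "bump 2 t \<le> 2"
proof (cases "t > 0")
  case True
  have "(1 / t) ^ 2 \<le> fact 2 * exp (1 / t)" using True by (intro power_le_fact_exp) auto
  from mult_right_mono[OF this, of "exp (- (1 / t))"]
  have "exp (- (1 / t)) * (1 / t) ^ 2 \<le> 2 * (exp (1 / t) * exp (- (1 / t)))"
    by (simp add: mult_ac)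
  then show ?thesis using True by (simp add: bump_def power_divide flip: exp_add)
qed (simp add: bump_def)

lemma cutoff'_le: "R > 0 \<Longrightarrow> cutoff' R x \<le> 4 * exp 1 / R\<^sup>2"
  using mult_left_mono[OF bump_2_le[of "1 - (norm ((1 / R) *\<^sub>R x))\<^sup>2"], of "exp 1 * (2 / R\<^sup>2)"]
  by (simp add: cutoff'_def field_simps)

text \<open>On the support |x| is at most R while the function is of size 1 / R^2, so the bound is
  independent of R. This scale invariance is what gives one majorant for all cutoffs.\<close>

lemma cutoff'_norm_le:
  assumes R: "R > 0"
  shows "(norm x)\<^sup>2 * cutoff' R x \<le> 4 * exp 1"
proof (cases "norm x > R")
  case False
  have "(norm x)\<^sup>2 * cutoff' R x \<le> R\<^sup>2 * (4 * exp 1 / R\<^sup>2)"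
    using False R cutoff_bounds by (intro mult_mono cutoff'_le power_mono) auto
  then show ?thesis using R by simp
qed (simp add: cutoff_outside[OF R])

lemma tendsto_inverse_Suc: "(\<lambda>n. 1 / real (Suc n)) \<longlonglongrightarrow> 0"
  using LIMSEQ_inverse_real_of_nat by (simp add: inverse_eq_divide)

lemma cutoff_tendsto: "(\<lambda>n. cutoff (real (Suc n)) x) \<longlonglongrightarrow> 1"
proof -
  have "(\<lambda>n. (1 / real (Suc n)) *\<^sub>R x) \<longlonglongrightarrow> 0 *\<^sub>R x"
    by (rule tendsto_scaleR[OF tendsto_inverse_Suc tendsto_const])
  then have "(\<lambda>n. 1 - (norm ((1 / real (Suc n)) *\<^sub>R x))\<^sup>2) \<longlonglongrightarrow> 1 - (norm (0 *\<^sub>R x))\<^sup>2"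
    by (rule tendsto_diff[OF tendsto_const tendsto_power[OF tendsto_norm]])
  then have "(\<lambda>n. 1 - (norm ((1 / real (Suc n)) *\<^sub>R x))\<^sup>2) \<longlonglongrightarrow> 1" by simp
  moreover have "isCont (bump 0) 1" by (rule DERIV_isCont[OF bump_deriv])
  ultimately have "(\<lambda>n. bump 0 (1 - (norm ((1 / real (Suc n)) *\<^sub>R x))\<^sup>2)) \<longlonglongrightarrow> bump 0 1"
    by (rule isCont_tendsto_compose[rotated])
  then have "(\<lambda>n. exp 1 * bump 0 (1 - (norm ((1 / real (Suc n)) *\<^sub>R x))\<^sup>2)) \<longlonglongrightarrow> exp 1 * bump 0 1"
    by (rule tendsto_mult[OF tendsto_const])
  then show ?thesis by (simp add: cutoff_def bump_def flip: exp_add)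
qed

lemma cutoff'_tendsto: "(\<lambda>n. cutoff' (real (Suc n)) x) \<longlonglongrightarrow> 0"
proof -
  have "(\<lambda>n. 4 * exp 1 * (1 / real (Suc n))\<^sup>2) \<longlonglongrightarrow> 4 * exp 1 * 0\<^sup>2"
    by (rule tendsto_mult[OF tendsto_const tendsto_power[OF tendsto_inverse_Suc]])
  then show ?thesis
    by (rule tendsto_null_squeeze) (use cutoff'_le cutoff_bounds in \<open>auto simp: power_divide\<close>)
qed

text \<open>F need not have bounded support here; y is its logarithmic gradient divided by x. The
  compactly supported weights F times cutoff satisfy the radial inequality, and the bounds on y and
  on |x|^2 y provide the integrable majorant under which the cutoff is removed.\<close>

lemma weighted_energy:
  fixes F :: "real^2 \<Rightarrow> real"
  assumes weak: "weak_equation (lin_drift \<alpha>) g \<mu> w"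
    and w: "square_integrable w" and xw: "\<And>j. square_integrable (\<lambda>x. of_real (x $ j) * w x)"
    and g: "square_integrable g" and F: "has_gradient F (\<lambda>j x. x $ j * (F x * y x))"
    and Fw: "square_integrable (\<lambda>x. of_real (F x) * w x)" and Fg: "square_integrable (\<lambda>x. of_real (F x) * g x)"
    and ym [measurable]: "y \<in> borel_measurable borel"
    and y: "\<And>x. 0 \<le> y x" "\<And>x. y x \<le> C" "\<And>x. (norm x)\<^sup>2 * y x \<le> D"
  shows "Re \<mu> * (\<integral>x. (F x)\<^sup>2 * (cmod (w x))\<^sup>2 \<partial>lborel) \<le>
     (\<integral>x. ((norm x)\<^sup>2 * (y x)\<^sup>2 - (norm x)\<^sup>2 * y x / 2 + 1 / 2) * ((F x)\<^sup>2 * (cmod (w x))\<^sup>2) \<partial>lborel)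
     + Re (\<integral>x. (of_real (F x))\<^sup>2 * cnj (w x) * g x \<partial>lborel)"
proof -
  define \<eta> \<zeta> where "\<eta> n x = cutoff (real (Suc n)) x" and "\<zeta> n x = cutoff' (real (Suc n)) x" for n x
  define \<psi> where "\<psi> n x = F x * \<eta> n x" for n x
  define \<theta> where "\<theta> n x = F x * (y x * \<eta> n x - \<zeta> n x)" for n x
  note [measurable] = has_gradient_borel[OF F]
  have [measurable]: "w \<in> borel_measurable borel" "g \<in> borel_measurable borel" using w g by auto
  have [measurable]: "\<eta> n \<in> borel_measurable borel" for n
    unfolding \<eta>_def[abs_def] using has_gradient_borel(1)[OF has_gradient_cutoff] by simp
  have [measurable]: "\<zeta> n \<in> borel_measurable borel" for n
  proof -
    have "cutoff' R \<in> borel_measurable borel" for R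
      unfolding cutoff'_def[abs_def]
      by (intro borel_measurable_continuous_onI continuous_intros continuous_on_compose2[OF continuous_on_bump[of UNIV]]) auto
    then show ?thesis by (simp add: \<zeta>_def[abs_def])
  qed
  have b: "0 \<le> \<eta> n x" "\<eta> n x \<le> 1" "0 \<le> \<zeta> n x" "\<zeta> n x \<le> 4 * exp 1" "(norm x)\<^sup>2 * \<zeta> n x \<le> 4 * exp 1" for n x
  proof -
    have "\<zeta> n x \<le> 4 * exp 1 / (real (Suc n))\<^sup>2" unfolding \<zeta>_def by (rule cutoff'_le) simp
    also have "\<dots> \<le> 4 * exp 1 / 1" by (intro divide_left_mono one_le_power) auto
    finally show "\<zeta> n x \<le> 4 * exp 1" by simp
  qed (auto simp: \<eta>_def \<zeta>_def cutoff_bounds intro!: cutoff'_norm_le)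
  have lim\<eta>: "(\<lambda>n. \<eta> n x) \<longlonglongrightarrow> 1" "(\<lambda>n. \<zeta> n x) \<longlonglongrightarrow> 0" for x
    unfolding \<eta>_def \<zeta>_def by (rule cutoff_tendsto, rule cutoff'_tendsto)
  have \<psi>: "has_gradient (\<psi> n) (\<lambda>j x. x $ j * \<theta> n x)" for n
    unfolding \<psi>_def[abs_def] \<eta>_def
    by (rule has_gradient_cong[OF has_gradient_mult[OF F has_gradient_cutoff]])
      (auto simp: \<theta>_def \<eta>_def \<zeta>_def algebra_simps)
  have supp: "\<psi> n x = 0" if "norm x > real (Suc n)" for n x
    using that by (simp add: \<psi>_def \<eta>_def cutoff_outside)
  note E = radial_energy[OF weak w xw g \<psi> supp]
  have iF: "integrable lborel (\<lambda>x. (F x)\<^sup>2 * (cmod (w x))\<^sup>2)"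
    using square_integrableD(2)[OF Fw] by (simp add: norm_mult power_mult_distrib)
  have iFg: "integrable lborel (\<lambda>x. (of_real (F x))\<^sup>2 * cnj (w x) * g x)"
    using square_integrable_cauchy_schwarz(1)[OF square_integrable_cnj[OF Fw] Fg] by (simp add: power2_eq_square mult_ac)
  have lim1: "(\<lambda>n. \<integral>x. (\<psi> n x)\<^sup>2 * (cmod (w x))\<^sup>2 \<partial>lborel) \<longlonglongrightarrow> (\<integral>x. (F x)\<^sup>2 * (cmod (w x))\<^sup>2 \<partial>lborel)"
  proof (rule integral_dominated_convergence[OF _ _ iF])
    show "AE x in lborel. (\<lambda>n. (\<psi> n x)\<^sup>2 * (cmod (w x))\<^sup>2) \<longlonglongrightarrow> (F x)\<^sup>2 * (cmod (w x))\<^sup>2"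
    proof (rule AE_I2)
      fix x
      have "(\<lambda>n. (F x * \<eta> n x)\<^sup>2 * (cmod (w x))\<^sup>2) \<longlonglongrightarrow> (F x * 1)\<^sup>2 * (cmod (w x))\<^sup>2"
        by (intro tendsto_mult tendsto_power tendsto_const lim\<eta>)
      then show "(\<lambda>n. (\<psi> n x)\<^sup>2 * (cmod (w x))\<^sup>2) \<longlonglongrightarrow> (F x)\<^sup>2 * (cmod (w x))\<^sup>2" by (simp add: \<psi>_def)
    qed
    show "AE x in lborel. norm ((\<psi> n x)\<^sup>2 * (cmod (w x))\<^sup>2) \<le> (F x)\<^sup>2 * (cmod (w x))\<^sup>2" for n
    proof (rule AE_I2)
      fix x
      have "(\<psi> n x)\<^sup>2 \<le> (F x)\<^sup>2 * 1"
        unfolding \<psi>_def power_mult_distrib using b(1-4)[of n x] by (intro mult_left_mono) (auto simp: power_le_one)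
      then show "norm ((\<psi> n x)\<^sup>2 * (cmod (w x))\<^sup>2) \<le> (F x)\<^sup>2 * (cmod (w x))\<^sup>2"
        by (simp add: mult_right_mono)
    qed
  qed (auto simp: \<psi>_def)
  have lim3: "(\<lambda>n. \<integral>x. (of_real (\<psi> n x))\<^sup>2 * cnj (w x) * g x \<partial>lborel) \<longlonglongrightarrow> (\<integral>x. (of_real (F x))\<^sup>2 * cnj (w x) * g x \<partial>lborel)"
  proof (rule integral_dominated_convergence[OF _ _ integrable_norm[OF iFg]])
    show "AE x in lborel. (\<lambda>n. (of_real (\<psi> n x))\<^sup>2 * cnj (w x) * g x) \<longlonglongrightarrow> (of_real (F x))\<^sup>2 * cnj (w x) * g x"
    proof (rule AE_I2)
      fix x
      have "(\<lambda>n. (of_real (F x * \<eta> n x))\<^sup>2 * cnj (w x) * g x) \<longlonglongrightarrow> (of_real (F x * 1))\<^sup>2 * cnj (w x) * g x"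
        by (intro tendsto_mult tendsto_power tendsto_of_real tendsto_const lim\<eta>)
      then show "(\<lambda>n. (of_real (\<psi> n x))\<^sup>2 * cnj (w x) * g x) \<longlonglongrightarrow> (of_real (F x))\<^sup>2 * cnj (w x) * g x" by (simp add: \<psi>_def)
    qed
    show "AE x in lborel. norm ((of_real (\<psi> n x))\<^sup>2 * cnj (w x) * g x) \<le> norm ((of_real (F x))\<^sup>2 * cnj (w x) * g x)" for n
    proof (rule AE_I2)
      fix x
      have "(\<psi> n x)\<^sup>2 \<le> (F x)\<^sup>2 * 1"
        unfolding \<psi>_def power_mult_distrib using b(1-4)[of n x] by (intro mult_left_mono) (auto simp: power_le_one)
      then show "norm ((of_real (\<psi> n x))\<^sup>2 * cnj (w x) * g x) \<le> norm ((of_real (F x))\<^sup>2 * cnj (w x) * g x)"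
        by (auto simp: norm_mult norm_power intro!: mult_right_mono)
    qed
  qed (auto simp: \<psi>_def)
  have lim2: "(\<lambda>n. \<integral>x. ((norm x)\<^sup>2 * (\<theta> n x)\<^sup>2 - \<psi> n x * ((norm x)\<^sup>2 * \<theta> n x) / 2 + (\<psi> n x)\<^sup>2 / 2) * (cmod (w x))\<^sup>2 \<partial>lborel)
      \<longlonglongrightarrow> (\<integral>x. ((norm x)\<^sup>2 * (y x)\<^sup>2 - (norm x)\<^sup>2 * y x / 2 + 1 / 2) * ((F x)\<^sup>2 * (cmod (w x))\<^sup>2) \<partial>lborel)"
  proof (rule integral_dominated_convergence)
    \<comment> \<open>For t = y \<eta> - \<zeta>, the logarithmic rate of the cut off weight up to a
      factor \<eta>, \<open>?c\<close> bounds |t| and \<open>?d\<close> bounds |x|^2 |t|; the share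
      \<open>4 * exp 1\<close> is the uniform bound for the cutoff. Hence |x|^2 t^2 is at most
      \<open>?d * ?c\<close>.\<close>
    let ?c = "C + 4 * exp 1" and ?d = "D + 4 * exp 1"
    show "integrable lborel (\<lambda>x. (?d * ?c + ?d + 1) * ((F x)\<^sup>2 * (cmod (w x))\<^sup>2))"
      using iF by (rule integrable_mult_right)
    have eq: "((norm x)\<^sup>2 * (\<theta> n x)\<^sup>2 - \<psi> n x * ((norm x)\<^sup>2 * \<theta> n x) / 2 + (\<psi> n x)\<^sup>2 / 2) * (cmod (w x))\<^sup>2 =
       ((norm x)\<^sup>2 * (y x * \<eta> n x - \<zeta> n x)\<^sup>2 - \<eta> n x * ((norm x)\<^sup>2 * (y x * \<eta> n x - \<zeta> n x)) / 2 + (\<eta> n x)\<^sup>2 / 2) *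
         ((F x)\<^sup>2 * (cmod (w x))\<^sup>2)" for n x
      unfolding \<theta>_def \<psi>_def by (simp add: power2_eq_square algebra_simps)
    show "AE x in lborel. (\<lambda>n. ((norm x)\<^sup>2 * (\<theta> n x)\<^sup>2 - \<psi> n x * ((norm x)\<^sup>2 * \<theta> n x) / 2 + (\<psi> n x)\<^sup>2 / 2) * (cmod (w x))\<^sup>2)
      \<longlonglongrightarrow> ((norm x)\<^sup>2 * (y x)\<^sup>2 - (norm x)\<^sup>2 * y x / 2 + 1 / 2) * ((F x)\<^sup>2 * (cmod (w x))\<^sup>2)"
    proof (rule AE_I2)
      fix x
      have "(\<lambda>n. ((norm x)\<^sup>2 * (y x * \<eta> n x - \<zeta> n x)\<^sup>2 - \<eta> n x * ((norm x)\<^sup>2 * (y x * \<eta> n x - \<zeta> n x)) / 2 + (\<eta> n x)\<^sup>2 / 2) *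
         ((F x)\<^sup>2 * (cmod (w x))\<^sup>2)) \<longlonglongrightarrow>
        ((norm x)\<^sup>2 * (y x * 1 - 0)\<^sup>2 - 1 * ((norm x)\<^sup>2 * (y x * 1 - 0)) / 2 + 1\<^sup>2 / 2) * ((F x)\<^sup>2 * (cmod (w x))\<^sup>2)"
        by (intro tendsto_mult tendsto_diff tendsto_add tendsto_divide tendsto_power tendsto_const lim\<eta>) auto
      then show "(\<lambda>n. ((norm x)\<^sup>2 * (\<theta> n x)\<^sup>2 - \<psi> n x * ((norm x)\<^sup>2 * \<theta> n x) / 2 + (\<psi> n x)\<^sup>2 / 2) * (cmod (w x))\<^sup>2)
       \<longlonglongrightarrow> ((norm x)\<^sup>2 * (y x)\<^sup>2 - (norm x)\<^sup>2 * y x / 2 + 1 / 2) * ((F x)\<^sup>2 * (cmod (w x))\<^sup>2)"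
        unfolding eq by simp
    qed
    show "AE x in lborel. norm (((norm x)\<^sup>2 * (\<theta> n x)\<^sup>2 - \<psi> n x * ((norm x)\<^sup>2 * \<theta> n x) / 2 + (\<psi> n x)\<^sup>2 / 2) * (cmod (w x))\<^sup>2)
       \<le> (?d * ?c + ?d + 1) * ((F x)\<^sup>2 * (cmod (w x))\<^sup>2)" for n
    proof (rule AE_I2)
      fix x
      let ?s = "(norm x)\<^sup>2" and ?t = "y x * \<eta> n x - \<zeta> n x"
      have ye: "0 \<le> y x * \<eta> n x" "y x * \<eta> n x \<le> y x"
        using b(1-4)[of n x] y(1)[of x] by (auto simp: mult_left_le)
      then have t: "\<bar>?t\<bar> \<le> y x + \<zeta> n x" using b(3)[of n x] by linarith
      have t1: "\<bar>?t\<bar> \<le> ?c" using t y(2)[of x] b(4)[of n x] by linarith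
      have "?s * \<bar>?t\<bar> \<le> ?s * (y x + \<zeta> n x)" using t by (intro mult_left_mono) auto
      also have "\<dots> \<le> ?d" using y(3)[of x] b(5)[where x=x and n=n] by (simp add: distrib_left)
      finally have t2: "?s * \<bar>?t\<bar> \<le> ?d" .
      have "?s * ?t\<^sup>2 = (?s * \<bar>?t\<bar>) * \<bar>?t\<bar>" by (simp add: power2_eq_square)
      also have "\<dots> \<le> ?d * ?c" using t1 t2 by (intro mult_mono) (auto intro: order_trans[OF _ t2])
      finally have A: "?s * ?t\<^sup>2 \<le> ?d * ?c" .
      have "\<bar>\<eta> n x * (?s * ?t)\<bar> = \<eta> n x * (?s * \<bar>?t\<bar>)" using b(1)[of n x] by (simp add: abs_mult)
      also have "\<dots> \<le> 1 * ?d" using b(1,2)[of n x] t2 by (intro mult_mono) auto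
      finally have B: "\<bar>\<eta> n x * (?s * ?t)\<bar> \<le> ?d" by simp
      have e1: "(\<eta> n x)\<^sup>2 \<le> 1" using b(1,2)[of n x] by (simp add: power_le_one)
      have s0: "0 \<le> ?s * ?t\<^sup>2" by simp
      have arith: "\<bar>p - q / 2 + e / 2\<bar> \<le> a + b + 1"
        if "0 \<le> p" "p \<le> a" "\<bar>q\<bar> \<le> b" "0 \<le> e" "e \<le> 1" for p q e a b :: real
        using that by linarith
      have "\<bar>?s * ?t\<^sup>2 - \<eta> n x * (?s * ?t) / 2 + (\<eta> n x)\<^sup>2 / 2\<bar> \<le> ?d * ?c + ?d + 1"
        by (rule arith[OF s0 A B zero_le_power2 e1])
      then show "norm ((?s * (\<theta> n x)\<^sup>2 - \<psi> n x * (?s * \<theta> n x) / 2 + (\<psi> n x)\<^sup>2 / 2) * (cmod (w x))\<^sup>2)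
        \<le> (?d * ?c + ?d + 1) * ((F x)\<^sup>2 * (cmod (w x))\<^sup>2)"
        unfolding eq by (simp only: real_norm_def abs_mult abs_mult[of "(F x)\<^sup>2"] abs_power2) (intro mult_right_mono, auto)
    qed
  qed (auto simp: \<psi>_def \<theta>_def)
  show ?thesis
    by (rule LIMSEQ_le[OF tendsto_mult[OF tendsto_const lim1] tendsto_add[OF lim2 tendsto_Re[OF lim3]]])
      (use E in auto)
qed


section \<open>Regularised exponential weights\<close>

definition growth :: "real \<Rightarrow> nat \<Rightarrow> real^2 \<Rightarrow> real" where
  "growth m n x = (1 + (norm x)\<^sup>2) powr (m / 2) * exp (1 / 8 * ((norm x)\<^sup>2 / (1 + (norm x)\<^sup>2 / real (Suc n))))"

definition growth_rate :: "real \<Rightarrow> nat \<Rightarrow> real^2 \<Rightarrow> real" where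
  "growth_rate m n x = m / (1 + (norm x)\<^sup>2) + 1 / (4 * (1 + (norm x)\<^sup>2 / real (Suc n))\<^sup>2)"

lemma has_gradient_growth:
  "has_gradient (growth m n) (\<lambda>j x. x $ j * (growth m n x * growth_rate m n x))"
proof -
  define N where "N = real (Suc n)"
  have N: "N > 0" by (simp add: N_def)
  define f where "f t = (1 + t) powr (m / 2) * exp (1 / 8 * (t / (1 + t / N)))" for t :: real
  define f' where "f' t = f t * (m / (2 * (1 + t)) + 1 / (8 * (1 + t / N)\<^sup>2))" for t :: real
  have pos: "1 + t > 0" "1 + t / N > 0" if "t \<ge> 0" for t :: real
    using that N by (auto simp: add_pos_nonneg)
  have d: "(f has_real_derivative f' t) (at t)" if t: "t \<ge> 0" for t
  proof -
    have 1: "((\<lambda>t. (1 + t) powr (m / 2)) has_real_derivative (m / 2) * (1 + t) powr (m / 2 - 1)) (at t)"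
      using pos[OF t] by (auto intro!: derivative_eq_intros)
    have "((\<lambda>t. 1 + t / N) has_real_derivative 1 / N) (at t)"
      using N by (auto intro!: derivative_eq_intros)
    from DERIV_divide[OF DERIV_ident this]
    have "((\<lambda>t. t / (1 + t / N)) has_real_derivative (1 * (1 + t / N) - t * (1 / N)) / ((1 + t / N) * (1 + t / N))) (at t)"
      using pos[OF t] by simp
    then have "((\<lambda>t. t / (1 + t / N)) has_real_derivative 1 / (1 + t / N)\<^sup>2) (at t)"
      by (simp add: power2_eq_square)
    from DERIV_cmult[OF this, of "1 / 8"]
    have 2: "((\<lambda>t. 1 / 8 * (t / (1 + t / N))) has_real_derivative 1 / (8 * (1 + t / N)\<^sup>2)) (at t)"
      by simp
    have "(f has_real_derivative
        (m / 2) * (1 + t) powr (m / 2 - 1) * exp (1 / 8 * (t / (1 + t / N))) +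
        (exp (1 / 8 * (t / (1 + t / N))) * (1 / (8 * (1 + t / N)\<^sup>2))) * (1 + t) powr (m / 2)) (at t)"
      unfolding f_def[abs_def] by (rule DERIV_mult[OF 1 DERIV_chain2[OF DERIV_exp 2]])
    moreover have "(1 + t) powr (m / 2 - 1) = (1 + t) powr (m / 2) / (1 + t)"
      using pos[OF t] by (simp add: powr_diff)
    ultimately show ?thesis by (simp add: f'_def f_def algebra_simps)
  qed
  have c: "continuous_on UNIV (\<lambda>x::real^2. f' ((norm x)\<^sup>2))"
  proof -
    have nz: "1 + (norm x)\<^sup>2 \<noteq> 0" "1 + (norm x)\<^sup>2 / N \<noteq> 0" for x :: "real^2"
      using pos(1)[OF zero_le_power2[of "norm x"]] pos(2)[OF zero_le_power2[of "norm x"]] by linarith+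
    have nz2: "2 + 2 * (norm x)\<^sup>2 \<noteq> 0" for x :: "real^2"
      using zero_le_power2[of "norm x"] by linarith
    have cs: "continuous_on UNIV (\<lambda>x::real^2. (norm x)\<^sup>2)" by (intro continuous_intros)
    have cn: "continuous_on UNIV (\<lambda>x::real^2. 1 + (norm x)\<^sup>2 / N)" "continuous_on UNIV (\<lambda>x::real^2. 1 + (norm x)\<^sup>2)"
      using N by (intro continuous_intros; simp)+
    have "continuous_on UNIV (\<lambda>x::real^2. f ((norm x)\<^sup>2))"
      unfolding f_def
      by (intro continuous_on_mult continuous_on_powr continuous_on_exp continuous_on_divide cn cs continuous_on_const)
        (simp_all add: nz)
    moreover have "continuous_on UNIV (\<lambda>x::real^2. m / (2 * (1 + (norm x)\<^sup>2)) + 1 / (8 * (1 + (norm x)\<^sup>2 / N)\<^sup>2))"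
      by (intro continuous_on_add continuous_on_mult continuous_on_divide cn continuous_on_const
          continuous_on_power) (simp_all add: nz nz2)
    ultimately show ?thesis
      unfolding f'_def by (rule continuous_on_mult)
  qed
  have h: "has_gradient (\<lambda>x::real^2. f ((norm x)\<^sup>2)) (\<lambda>j x. f' ((norm x)\<^sup>2) * (2 * x $ j))"
    by (rule has_gradient_compose'[OF has_gradient_norm_sq d c]) simp
  have half: "m / (2 * A) + 1 / (8 * B) = (m / A + 1 / (4 * B)) / 2" for A B :: real
    by (simp add: add_divide_distrib)
  have "f' ((norm x)\<^sup>2) = growth m n x * growth_rate m n x / 2" for x
    unfolding f'_def half by (simp add: f_def growth_def growth_rate_def N_def)
  then show ?thesis
    by (intro has_gradient_cong[OF h]) (simp_all add: f_def growth_def N_def)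
qed

lemma growth_pos: "growth m n x > 0"
proof -
  have "1 + (norm x)\<^sup>2 > 0" by (simp add: add_pos_nonneg)
  then have "(1 + (norm x)\<^sup>2) powr (m / 2) > 0" by simp
  then show ?thesis by (simp add: growth_def)
qed

text \<open>The regularised exponent s / (1 + s / N) is at most s and at most N. The second bound
  makes the weight comparable, for each n, to the power weight under which w is known to be square
  integrable; the first compares the whole family with its limit, uniformly in n.\<close>

lemma growth_le:
  assumes "m > 0"
  shows "growth m n x \<le> (1 + (norm x)\<^sup>2) powr (m / 2) * exp ((norm x)\<^sup>2 / 8)"
    and "growth m n x \<le> exp (real (Suc n) / 8) * (1 + (norm x)\<^sup>2) powr (m / 2)"
proof -
  let ?s = "(norm x)\<^sup>2" and ?N = "real (Suc n)"
  have eighth: "1 / 8 * a \<le> b / 8" if "a \<le> b" for a b :: real using that by simp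
  have pos: "1 + ?s / ?N > 0" by (auto simp: add_pos_nonneg)
  have "?s / (1 + ?s / ?N) \<le> ?s / 1" by (intro divide_left_mono) (use pos in auto)
  then have "1 / 8 * (?s / (1 + ?s / ?N)) \<le> ?s / 8" by (intro eighth) simp
  then have "exp (1 / 8 * (?s / (1 + ?s / ?N))) \<le> exp (?s / 8)" by (simp only: exp_le_cancel_iff)
  then show "growth m n x \<le> (1 + ?s) powr (m / 2) * exp (?s / 8)"
    unfolding growth_def by (rule mult_left_mono) simp
  have "?s / (1 + ?s / ?N) \<le> ?N" using pos by (simp add: divide_le_eq distrib_left)
  then have "1 / 8 * (?s / (1 + ?s / ?N)) \<le> ?N / 8" by (rule eighth)
  then have "exp (1 / 8 * (?s / (1 + ?s / ?N))) \<le> exp (?N / 8)" by (simp only: exp_le_cancel_iff)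
  then show "growth m n x \<le> exp (?N / 8) * (1 + ?s) powr (m / 2)"
    unfolding growth_def by (subst mult.commute) (rule mult_right_mono, simp_all)
qed

lemma growth_rate_bounds:
  assumes "m > 0"
  shows "0 \<le> growth_rate m n x" "growth_rate m n x \<le> m + 1 / 4"
    "(norm x)\<^sup>2 * growth_rate m n x \<le> m + real (Suc n) / 4"
    "m / (1 + (norm x)\<^sup>2) \<le> growth_rate m n x" "growth_rate m n x \<le> m / (1 + (norm x)\<^sup>2) + 1 / 4"
proof -
  define s N where "s = (norm x)\<^sup>2" and "N = real (Suc n)"
  have s: "s \<ge> 0" "N > 0" by (auto simp: s_def N_def)
  have p: "1 + s > 0" "1 + s / N \<ge> 1" using s by auto
  have q: "1 \<le> (1 + s / N)\<^sup>2" using p by simp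
  have g: "growth_rate m n x = m / (1 + s) + 1 / (4 * (1 + s / N)\<^sup>2)" by (simp add: growth_rate_def s_def N_def)
  have t: "0 \<le> 1 / (4 * (1 + s / N)\<^sup>2)" "1 / (4 * (1 + s / N)\<^sup>2) \<le> 1 / 4"
    using q by (auto simp: divide_le_eq)
  show l: "m / (1 + (norm x)\<^sup>2) \<le> growth_rate m n x" "growth_rate m n x \<le> m / (1 + (norm x)\<^sup>2) + 1 / 4"
    unfolding g using t by (auto simp: s_def)
  have "m / (1 + s) \<ge> 0" using p assms by simp
  then show "0 \<le> growth_rate m n x" using l by (simp add: s_def)
  have "m / (1 + s) \<le> m / 1" using p s assms by (intro divide_left_mono) auto
  then show "growth_rate m n x \<le> m + 1 / 4" using l by (simp add: s_def)
  have "s * m \<le> m * (1 + s)" using p s assms by (simp add: algebra_simps)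
  then have "s * (m / (1 + s)) \<le> m" using p by (simp add: pos_divide_le_eq)
  moreover have "s * (1 / (4 * (1 + s / N)\<^sup>2)) \<le> N / 4"
  proof -
    have "u \<le> (1 + u)\<^sup>2" if "u \<ge> 0" for u :: real
      unfolding power2_sum using that zero_le_power2[of u] by (simp only: mult_1_right one_power2)
    then have "s / N \<le> (1 + s / N)\<^sup>2" using s by simp
    then have "s \<le> N * (1 + s / N)\<^sup>2" using s by (simp add: pos_divide_le_eq mult.commute)
    moreover have "0 < (1 + s / N)\<^sup>2" using q by linarith
    ultimately have "s / (1 + s / N)\<^sup>2 \<le> N" by (simp only: pos_divide_le_eq)
    then show ?thesis by simp
  qed
  ultimately show "(norm x)\<^sup>2 * growth_rate m n x \<le> m + real (Suc n) / 4"
    unfolding g s_def[symmetric] N_def[symmetric] by (simp only: distrib_left)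
qed

lemma growth_rate_borel [measurable]: "growth_rate m n \<in> borel_measurable borel"
  unfolding growth_rate_def[abs_def] by measurable

lemma growth_tendsto:
  "(\<lambda>n. growth m n x) \<longlonglongrightarrow> (1 + (norm x)\<^sup>2) powr (m / 2) * exp ((norm x)\<^sup>2 / 8)"
proof -
  have "(\<lambda>n. (1 + (norm x)\<^sup>2) powr (m / 2) * exp (1 / 8 * ((norm x)\<^sup>2 / (1 + (norm x)\<^sup>2 * (1 / real (Suc n)))))) \<longlonglongrightarrow>
      (1 + (norm x)\<^sup>2) powr (m / 2) * exp (1 / 8 * ((norm x)\<^sup>2 / (1 + (norm x)\<^sup>2 * 0)))"
    by (intro tendsto_mult tendsto_exp tendsto_divide tendsto_add tendsto_const tendsto_inverse_Suc) auto
  then show ?thesis by (simp add: growth_def)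
qed

text \<open>
  Writing \<open>y\<close> for the rate, the coefficient below is \<open>s y (y - 1/2) + 1/2\<close>.  It stays close to
  its limit \<open>(1 - m) / 2\<close> for pure power growth as long as \<open>y\<close> lies between \<open>m / (1 + s)\<close> and
  roughly \<open>1/4\<close>, so the weight may grow up to \<open>exp (s / 8)\<close>.
\<close>

lemma growth_coefficient_bound:
  assumes m: "m > 0" and d: "\<delta> > 0"
  obtains S where "S \<ge> 0" "\<And>n x. (norm x)\<^sup>2 \<ge> S \<Longrightarrow>
    (norm x)\<^sup>2 * (growth_rate m n x)\<^sup>2 - (norm x)\<^sup>2 * growth_rate m n x / 2 + 1 / 2 \<le> (1 - m) / 2 + \<delta>"
proof
  \<comment> \<open>The summand \<open>8 * m\<close> makes y0 = m / (1 + s) at most 1/8, and the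
    second one makes (m + 1) y0 at most \<delta>.\<close>
  define S where "S = 8 * m + (m + m\<^sup>2) / \<delta>"
  show "S \<ge> 0" using m d by (simp add: S_def)
  fix n and x :: "real^2" assume x: "(norm x)\<^sup>2 \<ge> S"
  define s y where "s = (norm x)\<^sup>2" and "y = growth_rate m n x"
  define y0 where "y0 = m / (1 + s)"
  have s: "s \<ge> 0" "1 + s > 0" by (auto simp: s_def add_pos_nonneg)
  have s1: "8 * m \<le> s" "(m + m\<^sup>2) / \<delta> \<le> s"
    using x m d by (auto simp: s_def S_def intro: order_trans[rotated])
  have y: "y0 \<le> y" "y \<le> y0 + 1 / 4"
    using growth_rate_bounds(4,5)[OF m, where x=x and n=n] by (auto simp: y_def y0_def s_def)
  have y08: "y0 \<le> 1 / 8" using s s1 by (simp add: y0_def divide_le_eq)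
  \<comment> \<open>The parabola y^2 - y/2 is symmetric about 1/4, so it does not exceed its value
    at y0 as long as y0 \<le> y and y + y0 \<le> 1/2. The latter follows from y \<le> y0 + 1/4 and
    y0 \<le> 1/8.\<close>
  have "0 \<le> (y - y0) * (1 / 2 - y - y0)" using y y08 by (intro mult_nonneg_nonneg) auto
  then have "y\<^sup>2 - y / 2 \<le> y0\<^sup>2 - y0 / 2" by (simp add: power2_eq_square algebra_simps diff_divide_distrib)
  then have "s * (y\<^sup>2 - y / 2) \<le> s * (y0\<^sup>2 - y0 / 2)" using s by (intro mult_left_mono) auto
  also have "s * (y0\<^sup>2 - y0 / 2) = - m / 2 + (s * y0\<^sup>2 + y0 / 2)"
  proof -
    have "(1 + s) * y0 = m" using s by (simp add: y0_def)
    then have "s * y0 = m - y0" by (simp add: distrib_right)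
    then have "s * y0 / 2 = m / 2 - y0 / 2" by (simp add: diff_divide_distrib)
    then show ?thesis by (simp add: right_diff_distrib diff_divide_distrib)
  qed
  also have "s * y0\<^sup>2 \<le> m * y0"
  proof -
    have "s * m \<le> m * (1 + s)" using s m by (simp add: algebra_simps)
    then have "s * y0 \<le> m" using s by (simp add: y0_def pos_divide_le_eq)
    then have "(s * y0) * y0 \<le> m * y0" using s m by (intro mult_right_mono) (auto simp: y0_def)
    then show ?thesis by (simp add: power2_eq_square mult_ac)
  qed
  also have "m * y0 + y0 / 2 \<le> \<delta>"
  proof -
    have "m + m\<^sup>2 \<le> \<delta> * s" using s1(2) d by (simp add: divide_le_eq mult.commute)
    also have "\<dots> \<le> \<delta> * (1 + s)" using d by (intro mult_left_mono) auto
    finally have "(m + m\<^sup>2) / (1 + s) \<le> \<delta>" using s by (simp add: divide_le_eq)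
    moreover have "(m + m\<^sup>2) / (1 + s) = m * y0 + y0"
      by (simp add: y0_def power2_eq_square add_divide_distrib)
    moreover have "0 \<le> y0" using s m by (simp add: y0_def)
    ultimately show ?thesis by linarith
  qed
  finally have "s * y\<^sup>2 - s * y / 2 \<le> - m / 2 + \<delta>" by (simp add: algebra_simps)
  then show "(norm x)\<^sup>2 * (growth_rate m n x)\<^sup>2 - (norm x)\<^sup>2 * growth_rate m n x / 2 + 1 / 2 \<le> (1 - m) / 2 + \<delta>"
    by (simp add: s_def y_def diff_divide_distrib)
qed

declare has_gradient_borel [measurable del]

lemma borel_measurable_component [measurable]: "(\<lambda>x::real^2. x $ j) \<in> borel_measurable borel"
  by (intro borel_measurable_continuous_onI continuous_intros)

text \<open>The condition \<open>m > 1\<close> enters twice: 1 + |x|^2 is dominated by its m-th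
  power, which gives the first moment in L2, and the reciprocal weight is integrable, which gives w
  in L1 by the inequality between geometric and arithmetic means.\<close>

lemma weighted_L2_facts:
  fixes w :: "real^2 \<Rightarrow> complex"
  assumes m: "m > 1" and w [measurable]: "w \<in> borel_measurable borel"
    and wm: "integrable lborel (\<lambda>x. (1 + (norm x)\<^sup>2) powr m * (cmod (w x))\<^sup>2)"
  shows "square_integrable w" and "square_integrable (\<lambda>x. of_real (x $ j) * w x)" and "integrable lborel w"
    and "square_integrable (\<lambda>x. of_real ((1 + (norm x)\<^sup>2) powr (m / 2)) * w x)"
proof -
  have one: "1 \<le> (1 + (norm x)\<^sup>2) powr m" for x :: "real^2"
    using m by (intro ge_one_powr_ge_zero) auto
  have s: "1 + (norm x)\<^sup>2 \<le> (1 + (norm x)\<^sup>2) powr m" for x :: "real^2"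
    using powr_mono[of 1 m "1 + (norm x)\<^sup>2"] m by (simp add: add_pos_nonneg)
  show "square_integrable w"
    unfolding square_integrable_def
  proof
    show "integrable lborel (\<lambda>x. (cmod (w x))\<^sup>2)"
      by (rule integrable_dominated'[OF wm]) (use one in \<open>auto simp: mult_le_cancel_right1\<close>)
  qed simp
  show "square_integrable (\<lambda>x. of_real (x $ j) * w x)"
    unfolding square_integrable_def
  proof
    show "integrable lborel (\<lambda>x. (cmod (of_real (x $ j) * w x))\<^sup>2)"
    proof (rule integrable_dominated'[OF wm])
      fix x :: "real^2"
      have "(x $ j)\<^sup>2 \<le> (norm x)\<^sup>2" using component_le_norm_cart[of x j] by (metis abs_ge_zero power2_abs power_mono)
      also have "\<dots> \<le> (1 + (norm x)\<^sup>2) powr m" using s[of x] by linarith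
      finally show "norm ((cmod (of_real (x $ j) * w x))\<^sup>2) \<le> (1 + (norm x)\<^sup>2) powr m * (cmod (w x))\<^sup>2"
        by (simp add: norm_mult power_mult_distrib mult_right_mono)
    qed measurable
  qed measurable
  show "integrable lborel w"
  proof (rule integrable_dominated')
    show "integrable lborel (\<lambda>x. (1 + (norm x)\<^sup>2) powr (- m) + (1 + (norm x)\<^sup>2) powr m * (cmod (w x))\<^sup>2)"
      by (intro Bochner_Integration.integrable_add integrable_weight m wm)
    fix x :: "real^2"
    define p where "p = (1 + (norm x)\<^sup>2) powr (m / 2)"
    have s1: "1 + (norm x)\<^sup>2 > 0" by (simp add: add_pos_nonneg)
    then have p: "p > 0" by (simp add: p_def)
    have pm: "(1 + (norm x)\<^sup>2) powr m = p\<^sup>2" "(1 + (norm x)\<^sup>2) powr (- m) = (1 / p)\<^sup>2"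
      by (simp_all add: p_def power2_eq_square powr_minus_divide flip: powr_add)
    have "2 * (1 / p) * (p * cmod (w x)) \<le> (1 / p)\<^sup>2 + (p * cmod (w x))\<^sup>2" by (rule sum_squares_bound)
    then have "2 * cmod (w x) \<le> (1 / p)\<^sup>2 + p\<^sup>2 * (cmod (w x))\<^sup>2" using p by (simp add: power_mult_distrib)
    then show "norm (w x) \<le> (1 + (norm x)\<^sup>2) powr (- m) + (1 + (norm x)\<^sup>2) powr m * (cmod (w x))\<^sup>2"
      unfolding pm using norm_ge_zero[of "w x"] by linarith
  qed measurable
  have "(cmod (of_real ((1 + (norm x)\<^sup>2) powr (m / 2)) * w x))\<^sup>2 = (1 + (norm x)\<^sup>2) powr m * (cmod (w x))\<^sup>2" for x
  proof -
    have "((1 + (norm x)\<^sup>2) powr (m / 2))\<^sup>2 = (1 + (norm x)\<^sup>2) powr m"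
      by (simp add: power2_eq_square flip: powr_add)
    then show ?thesis by (simp add: norm_mult power_mult_distrib)
  qed
  then show "square_integrable (\<lambda>x. of_real ((1 + (norm x)\<^sup>2) powr (m / 2)) * w x)"
    using wm by (simp add: square_integrable_def)
qed

definition decay_weight :: "real \<Rightarrow> real^2 \<Rightarrow> real" where
  "decay_weight m x = (1 + (norm x)\<^sup>2) powr (m / 2) * exp ((norm x)\<^sup>2 / 8)"

lemma decay_weight_borel [measurable]: "decay_weight m \<in> borel_measurable borel"
  unfolding decay_weight_def[abs_def] by measurable

lemma decay_weight_nonneg: "0 \<le> decay_weight m x"
  by (simp add: decay_weight_def)

text \<open>The Gaussian factor exp (- s/4) of the nonlocal term beats the weight's exp (s/8) and
  leaves exp (- s/8), which absorbs any power. Thus the nonlocal term is controlled under the final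
  weight while w itself is only known in L1 and L2.\<close>

lemma nonlocal_decay_weighted:
  assumes [measurable]: "w \<in> borel_measurable borel"
    and w2: "square_integrable w" and w1: "integrable lborel w" and m: "m > 0"
  obtains C where "\<And>p. p \<in> borel_measurable borel \<Longrightarrow> (\<And>x. 0 \<le> p x) \<Longrightarrow> (\<And>x. p x \<le> decay_weight m x) \<Longrightarrow>
     square_integrable (\<lambda>x. of_real (p x) * nonlocal w x) \<and>
     (\<integral>x. (cmod (of_real (p x) * nonlocal w x))\<^sup>2 \<partial>lborel) \<le> C"
proof -
  \<comment> \<open>Beyond the weight's own m/2, one power of 1 + s absorbs the factor
    \<open>2 * norm x\<close>, and one more is spent on the decay of the majorant a = K / (1 + s),
    which makes it square integrable.\<close>
  obtain K where K: "K \<ge> 0" "\<And>s. s \<ge> 0 \<Longrightarrow> (1 + s) powr (m / 2 + 2) * exp (- (1/8) * s) \<le> K"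
    using powr_exp_bounded[of "1/8" "m / 2 + 2"] by auto
  define a where "a x = K * (1 + (norm x)\<^sup>2) powr (- 1)" for x :: "real^2"
  have dw: "decay_weight m x * (2 * norm x * gauss x) \<le> a x" for x
  proof -
    let ?s = "(norm x)\<^sup>2"
    have s: "1 + ?s > 0" by (simp add: add_pos_nonneg)
    have n: "2 * norm x \<le> 1 + ?s" using sum_squares_bound[of 1 "norm x"] by simp
    have g: "gauss x \<le> exp (- ?s / 4)"
    proof -
      have "1 / (4 * pi) \<le> 1" using pi_gt3 by simp
      then show ?thesis unfolding gauss_def using mult_right_mono[of "1 / (4 * pi)" 1 "exp (- ?s / 4)"] by simp
    qed
    have "decay_weight m x * (2 * norm x * gauss x) \<le> decay_weight m x * ((1 + ?s) * exp (- ?s / 4))"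
      using n g gauss_pos[of x] by (intro mult_left_mono mult_mono decay_weight_nonneg) auto
    also have "\<dots> = (1 + ?s) powr (m / 2) * (1 + ?s) * (exp (?s / 8) * exp (- ?s / 4))"
      by (simp add: decay_weight_def mult_ac)
    also have "(1 + ?s) powr (m / 2) * (1 + ?s) = (1 + ?s) powr (m / 2 + 2) * (1 + ?s) powr (- 1)"
    proof -
      have "(1 + ?s) powr (m / 2) * (1 + ?s) powr 1 = (1 + ?s) powr (m / 2 + 2) * (1 + ?s) powr (- 1)"
        unfolding powr_add[symmetric] by (simp add: add.commute)
      then show ?thesis using s by simp
    qed
    also have "exp (?s / 8) * exp (- ?s / 4) = exp (- (1 / 8) * ?s)" by (simp flip: exp_add)
    also have "(1 + ?s) powr (m / 2 + 2) * (1 + ?s) powr (- 1) * exp (- (1 / 8) * ?s) =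
      ((1 + ?s) powr (m / 2 + 2) * exp (- (1 / 8) * ?s)) * (1 + ?s) powr (- 1)" by (simp add: mult_ac)
    also have "\<dots> \<le> a x" unfolding a_def by (intro mult_right_mono K) auto
    finally show ?thesis .
  qed
  have am: "a \<in> borel_measurable borel" unfolding a_def[abs_def] by measurable
  have a0: "0 \<le> a x" for x using K by (simp add: a_def)
  have aK: "a x \<le> K" for x
  proof -
    have "1 + (norm x)\<^sup>2 > 0" by (simp add: add_pos_nonneg)
    then have "(1 + (norm x)\<^sup>2) powr (- 1) \<le> 1" using powr_mono[of "-1" 0 "1 + (norm x)\<^sup>2"] by simp
    from mult_left_mono[OF this K(1)] show ?thesis unfolding a_def by simp
  qed
  have a2: "integrable lborel (\<lambda>x. (a x)\<^sup>2)"
  proof -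
    have "(a x)\<^sup>2 = K\<^sup>2 * (1 + (norm x)\<^sup>2) powr (- 2)" for x
    proof -
      have "((1 + (norm x)\<^sup>2) powr (- 1))\<^sup>2 = (1 + (norm x)\<^sup>2) powr (- 2)"
        unfolding power2_eq_square[of "_ powr _"] powr_add[symmetric] by simp
      then show ?thesis unfolding a_def power_mult_distrib by simp
    qed
    then show ?thesis using integrable_weight[of 2] by simp
  qed
  obtain C where C: "\<And>p. p \<in> borel_measurable borel \<Longrightarrow> (\<And>x. 0 \<le> p x) \<Longrightarrow> (\<And>x. p x * (2 * norm x * gauss x) \<le> a x) \<Longrightarrow>
     square_integrable (\<lambda>x. of_real (p x) * nonlocal w x) \<and>
     (\<integral>x. (cmod (of_real (p x) * nonlocal w x))\<^sup>2 \<partial>lborel) \<le> C"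
    using nonlocal_weighted[OF assms(1) w2 w1 am a0 aK a2] by blast
  show ?thesis
  proof (rule that[of C], rule C)
    fix p :: "real^2 \<Rightarrow> real" and x assume "\<And>x. p x \<le> decay_weight m x" 
    then have "p x * (2 * norm x * gauss x) \<le> decay_weight m x * (2 * norm x * gauss x)"
      using gauss_pos[of x] by (intro mult_right_mono) auto
    then show "p x * (2 * norm x * gauss x) \<le> a x" using dw[of x] by linarith
  qed
qed

text \<open>For each n the weighted mass X n is finite, and the energy inequality bounds Re \<mu> X
  n by a smaller multiple of X n plus terms independent of n. Subtracting the finite quantity X n
  leaves a bound uniform in n, and Fatou's lemma carries it over to the limiting weight.\<close>

theorem eigenfunction_decay:
  fixes w :: "real^2 \<Rightarrow> complex"
  assumes m: "m > 1" and wb [measurable]: "w \<in> borel_measurable borel"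
    and wm: "integrable lborel (\<lambda>x. (1 + (norm x)\<^sup>2) powr m * (cmod (w x))\<^sup>2)"
    and weak: "weak_equation (lin_drift \<alpha>) (\<lambda>x. of_real (\<alpha> / 2) * nonlocal w x) \<mu> w"
    and \<mu>: "Re \<mu> > (1 - m) / 2"
  shows "square_integrable (\<lambda>x. of_real (decay_weight m x) * w x)"
proof -
  note wf = weighted_L2_facts[OF m wb wm]
  let ?g = "\<lambda>x. of_real (\<alpha> / 2) * nonlocal w x"
  obtain C where C: "\<And>p. p \<in> borel_measurable borel \<Longrightarrow> (\<And>x. 0 \<le> p x) \<Longrightarrow> (\<And>x. p x \<le> decay_weight m x) \<Longrightarrow>
     square_integrable (\<lambda>x. of_real (p x) * nonlocal w x) \<and>
     (\<integral>x. (cmod (of_real (p x) * nonlocal w x))\<^sup>2 \<partial>lborel) \<le> C"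
    using nonlocal_decay_weighted[OF wb wf(1,3), of m] m by auto
  have dw1: "1 \<le> decay_weight m x" for x
  proof -
    have "1 * 1 \<le> (1 + (norm x)\<^sup>2) powr (m / 2) * exp ((norm x)\<^sup>2 / 8)"
      using m by (intro mult_mono ge_one_powr_ge_zero) auto
    then show ?thesis by (simp add: decay_weight_def)
  qed
  have g: "square_integrable ?g"
    using C[of "\<lambda>x. 1"] dw1 by (intro square_integrable_cmult) auto
  \<comment> \<open>The gap above (1 - m) / 2 is divided into three: one \<delta> for the
    coefficient near its limit, one for the nonlocal term, and one that survives in front of X
    n.\<close>
  define \<delta> where "\<delta> = (Re \<mu> - (1 - m) / 2) / 3"
  have "3 * \<delta> = Re \<mu> - (1 - m) / 2" by (simp add: \<delta>_def)
  then have \<delta>: "\<delta> > 0" "Re \<mu> = (1 - m) / 2 + 3 * \<delta>" using \<mu> by linarith+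
  obtain S where S: "S \<ge> 0" "\<And>n x. (norm x)\<^sup>2 \<ge> S \<Longrightarrow>
    (norm x)\<^sup>2 * (growth_rate m n x)\<^sup>2 - (norm x)\<^sup>2 * growth_rate m n x / 2 + 1 / 2 \<le> (1 - m) / 2 + \<delta>"
    using growth_coefficient_bound[of m \<delta>] m \<delta> by auto
  \<comment> \<open>In the disc s < S the coefficient is at most S (m + 1/4)^2 + 1/2. The absolute
    value is added because (1 - m) / 2 + \<delta> may be negative, and the disc estimate must hold
    after that number is split off.\<close>
  define K1 where "K1 = S * (m + 1 / 4)\<^sup>2 + 1 / 2 + \<bar>(1 - m) / 2 + \<delta>\<bar>"
  define K where "K = K1 * ((1 + S) powr (m / 2) * exp (S / 8))\<^sup>2"
  have K1: "K1 \<ge> 0" using S by (simp add: K1_def)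
  have coef: "((norm x)\<^sup>2 * (growth_rate m n x)\<^sup>2 - (norm x)\<^sup>2 * growth_rate m n x / 2 + 1 / 2) * (growth m n x)\<^sup>2
      \<le> ((1 - m) / 2 + \<delta>) * (growth m n x)\<^sup>2 + K" for n x
  proof (cases "(norm x)\<^sup>2 \<ge> S")
    case True
    have "K \<ge> 0" using K1 by (simp add: K_def)
    then show ?thesis using mult_right_mono[OF S(2)[OF True, of n], of "(growth m n x)\<^sup>2"] by simp
  next
    case False
    have y: "0 \<le> growth_rate m n x" "growth_rate m n x \<le> m + 1/4" using growth_rate_bounds(1,2)[where m=m and n=n and x=x] m by auto
    have "(norm x)\<^sup>2 * (growth_rate m n x)\<^sup>2 \<le> S * (m + 1 / 4)\<^sup>2"
      using False S y by (intro mult_mono power_mono) auto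
    moreover have "0 \<le> (norm x)\<^sup>2 * growth_rate m n x" using y by simp
    ultimately have "(norm x)\<^sup>2 * (growth_rate m n x)\<^sup>2 - (norm x)\<^sup>2 * growth_rate m n x / 2 + 1 / 2 \<le> ((1 - m) / 2 + \<delta>) + K1"
      unfolding K1_def by linarith
    from mult_right_mono[OF this, of "(growth m n x)\<^sup>2"]
    have "((norm x)\<^sup>2 * (growth_rate m n x)\<^sup>2 - (norm x)\<^sup>2 * growth_rate m n x / 2 + 1 / 2) * (growth m n x)\<^sup>2
      \<le> ((1 - m) / 2 + \<delta>) * (growth m n x)\<^sup>2 + K1 * (growth m n x)\<^sup>2"
      by (simp add: distrib_right)
    also have "K1 * (growth m n x)\<^sup>2 \<le> K"
    proof -
      have "growth m n x \<le> (1 + (norm x)\<^sup>2) powr (m / 2) * exp ((norm x)\<^sup>2 / 8)"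
        using growth_le(1)[of m n x] m by simp
      also have "\<dots> \<le> (1 + S) powr (m / 2) * exp (S / 8)"
        using False m by (intro mult_mono powr_mono2) auto
      finally show ?thesis unfolding K_def using growth_pos[of m n x] K1
        by (intro mult_left_mono power_mono) auto
    qed
    finally show ?thesis by simp
  qed
  define W where "W = (\<integral>x. (cmod (w x))\<^sup>2 \<partial>lborel)"
  define X where "X n = (\<integral>x. (growth m n x)\<^sup>2 * (cmod (w x))\<^sup>2 \<partial>lborel)" for n
  note [measurable] = has_gradient_borel(1)[OF has_gradient_growth[of m]]
  have Fw: "square_integrable (\<lambda>x. of_real (growth m n x) * w x)" for n
  proof (rule square_integrable_bound[OF wf(4), of _ "exp (real (Suc n) / 8)"])
    show "AE x in lborel. cmod (of_real (growth m n x) * w x) \<le>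
      exp (real (Suc n) / 8) * cmod (of_real ((1 + (norm x)\<^sup>2) powr (m / 2)) * w x)"
    proof (rule AE_I2)
      fix x
      have "growth m n x * cmod (w x) \<le> (exp (real (Suc n) / 8) * (1 + (norm x)\<^sup>2) powr (m / 2)) * cmod (w x)"
        using growth_le(2)[of m n x] m by (intro mult_right_mono) auto
      then show "cmod (of_real (growth m n x) * w x) \<le>
        exp (real (Suc n) / 8) * cmod (of_real ((1 + (norm x)\<^sup>2) powr (m / 2)) * w x)"
        using growth_pos[of m n x] by (simp add: norm_mult mult.assoc less_imp_le)
    qed
  qed measurable
  have iX: "integrable lborel (\<lambda>x. (growth m n x)\<^sup>2 * (cmod (w x))\<^sup>2)" for n
    using square_integrableD(2)[OF Fw[of n]] by (simp add: norm_mult power_mult_distrib)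
  have Xnn: "X n \<ge> 0" for n unfolding X_def by (intro integral_nonneg_AE) auto
  have Fn: "square_integrable (\<lambda>x. of_real (growth m n x) * nonlocal w x) \<and>
     (\<integral>x. (cmod (of_real (growth m n x) * nonlocal w x))\<^sup>2 \<partial>lborel) \<le> C" for n
    using growth_pos[of m n] growth_le(1)[of m n] m
    by (intro C) (auto simp: decay_weight_def less_imp_le)
  have Xbound: "\<delta> * X n \<le> K * W + \<alpha>\<^sup>2 * C / (16 * \<delta>)" for n
  proof -
    have Fg: "square_integrable (\<lambda>x. of_real (growth m n x) * ?g x)"
      using square_integrable_cmult[of "\<lambda>x. of_real (growth m n x) * nonlocal w x" "of_real (\<alpha> / 2)"] Fn[of n]
      by (simp add: mult_ac)
    have m0: "m > 0" using m by simp
    have E: "Re \<mu> * X n \<le>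
     (\<integral>x. ((norm x)\<^sup>2 * (growth_rate m n x)\<^sup>2 - (norm x)\<^sup>2 * growth_rate m n x / 2 + 1 / 2) * ((growth m n x)\<^sup>2 * (cmod (w x))\<^sup>2) \<partial>lborel)
     + Re (\<integral>x. (of_real (growth m n x))\<^sup>2 * cnj (w x) * ?g x \<partial>lborel)"
      unfolding X_def
      by (rule weighted_energy[OF weak wf(1,2) g has_gradient_growth Fw Fg growth_rate_borel
            growth_rate_bounds(1)[OF m0] growth_rate_bounds(2)[OF m0] growth_rate_bounds(3)[OF m0]])
    have W0: "W \<ge> 0" unfolding W_def by (intro integral_nonneg_AE) auto
    have "(\<integral>x. ((norm x)\<^sup>2 * (growth_rate m n x)\<^sup>2 - (norm x)\<^sup>2 * growth_rate m n x / 2 + 1 / 2) * ((growth m n x)\<^sup>2 * (cmod (w x))\<^sup>2) \<partial>lborel)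
      \<le> ((1 - m) / 2 + \<delta>) * X n + K * W"
    proof (cases "integrable lborel (\<lambda>x. ((norm x)\<^sup>2 * (growth_rate m n x)\<^sup>2 - (norm x)\<^sup>2 * growth_rate m n x / 2 + 1 / 2) * ((growth m n x)\<^sup>2 * (cmod (w x))\<^sup>2))")
      case True
      have "(\<integral>x. ((norm x)\<^sup>2 * (growth_rate m n x)\<^sup>2 - (norm x)\<^sup>2 * growth_rate m n x / 2 + 1 / 2) * ((growth m n x)\<^sup>2 * (cmod (w x))\<^sup>2) \<partial>lborel)
        \<le> (\<integral>x. ((1 - m) / 2 + \<delta>) * ((growth m n x)\<^sup>2 * (cmod (w x))\<^sup>2) + K * (cmod (w x))\<^sup>2 \<partial>lborel)"
      proof (rule integral_mono[OF True])
        show "integrable lborel (\<lambda>x. ((1 - m) / 2 + \<delta>) * ((growth m n x)\<^sup>2 * (cmod (w x))\<^sup>2) + K * (cmod (w x))\<^sup>2)"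
          using square_integrableD(2)[OF wf(1)] by (intro Bochner_Integration.integrable_add integrable_mult_right iX)
        fix x
        show "((norm x)\<^sup>2 * (growth_rate m n x)\<^sup>2 - (norm x)\<^sup>2 * growth_rate m n x / 2 + 1 / 2) * ((growth m n x)\<^sup>2 * (cmod (w x))\<^sup>2)
          \<le> ((1 - m) / 2 + \<delta>) * ((growth m n x)\<^sup>2 * (cmod (w x))\<^sup>2) + K * (cmod (w x))\<^sup>2"
          using mult_right_mono[OF coef[of x n], of "(cmod (w x))\<^sup>2"] by (simp only: distrib_right mult.assoc zero_le_power2)
      qed
      also have "\<dots> = ((1 - m) / 2 + \<delta>) * X n + K * W"
        unfolding X_def W_def using iX[of n] square_integrableD(2)[OF wf(1)]
        by (subst Bochner_Integration.integral_add) (auto simp del: add_divide_distrib)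
      finally show ?thesis .
    next
      \<comment> \<open>This case is refuted rather than estimated: the bounds on the rate make the
        integrand dominated by a multiple of the finite weighted mass.\<close>
      case False
      have c: "continuous_on UNIV (growth m n)" by (rule has_gradientD(3)[OF has_gradient_growth])
      have "integrable lborel (\<lambda>x. ((norm x)\<^sup>2 * (growth_rate m n x)\<^sup>2 - (norm x)\<^sup>2 * growth_rate m n x / 2 + 1 / 2) * ((growth m n x)\<^sup>2 * (cmod (w x))\<^sup>2))"
      proof (rule integrable_dominated')
        let ?d = "m + real (Suc n) / 4" and ?c = "m + 1 / 4"
        show "integrable lborel (\<lambda>x. (?d * ?c + ?d + 1) * ((growth m n x)\<^sup>2 * (cmod (w x))\<^sup>2))"
          by (intro integrable_mult_right iX)
        fix x
        let ?y = "growth_rate m n x" and ?s = "(norm x)\<^sup>2"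
        have y: "0 \<le> ?y" "?y \<le> ?c" "?s * ?y \<le> ?d" using growth_rate_bounds(1-3)[OF m0, where n=n and x=x] by auto
        have "?s * ?y\<^sup>2 = (?s * ?y) * ?y" by (simp add: power2_eq_square)
        also have "\<dots> \<le> ?d * ?c" using y m0 by (intro mult_mono) auto
        finally have "\<bar>?s * ?y\<^sup>2 - ?s * ?y / 2 + 1 / 2\<bar> \<le> ?d * ?c + ?d + 1"
        proof -
          assume A: "?s * ?y\<^sup>2 \<le> ?d * ?c"
          have arith: "\<bar>p - q / 2 + 1 / 2\<bar> \<le> a + b + 1" if "0 \<le> p" "p \<le> a" "0 \<le> q" "q \<le> b" for p q a b :: real
            using that by linarith
          show ?thesis by (rule arith[OF _ A _ y(3)]) (use y in auto)
        qed
        then show "norm ((?s * ?y\<^sup>2 - ?s * ?y / 2 + 1 / 2) * ((growth m n x)\<^sup>2 * (cmod (w x))\<^sup>2)) \<le>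
          (?d * ?c + ?d + 1) * ((growth m n x)\<^sup>2 * (cmod (w x))\<^sup>2)"
          by (simp only: real_norm_def abs_mult[of _ "(growth m n x)\<^sup>2 * (cmod (w x))\<^sup>2"] abs_mult[of "(growth m n x)\<^sup>2"] abs_power2)
            (intro mult_right_mono, auto)
      qed measurable
      with False show ?thesis by simp
    qed
    moreover have "Re (\<integral>x. (of_real (growth m n x))\<^sup>2 * cnj (w x) * ?g x \<partial>lborel) \<le> \<delta> * X n + \<alpha>\<^sup>2 * C / (16 * \<delta>)"
    proof -
      have "(\<integral>x. (of_real (growth m n x))\<^sup>2 * cnj (w x) * ?g x \<partial>lborel) =
        (\<integral>x. cnj (of_real (growth m n x) * w x) * (of_real (growth m n x) * ?g x) \<partial>lborel)"
        by (intro Bochner_Integration.integral_cong) (auto simp: power2_eq_square)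
      then have "Re (\<integral>x. (of_real (growth m n x))\<^sup>2 * cnj (w x) * ?g x \<partial>lborel) \<le>
        cmod (\<integral>x. cnj (of_real (growth m n x) * w x) * (of_real (growth m n x) * ?g x) \<partial>lborel)"
        by (simp only: complex_Re_le_cmod)
      also have "\<dots> \<le> sqrt (\<integral>x. (cmod (cnj (of_real (growth m n x) * w x)))\<^sup>2 \<partial>lborel) *
         sqrt (\<integral>x. (cmod (of_real (growth m n x) * ?g x))\<^sup>2 \<partial>lborel)"
        by (rule square_integrable_cauchy_schwarz(3)[OF square_integrable_cnj[OF Fw] Fg])
      also have "(\<integral>x. (cmod (cnj (of_real (growth m n x) * w x)))\<^sup>2 \<partial>lborel) = X n"
        unfolding X_def by (simp add: norm_mult power_mult_distrib)
      also have "(\<integral>x. (cmod (of_real (growth m n x) * ?g x))\<^sup>2 \<partial>lborel) =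
         \<alpha>\<^sup>2 / 4 * (\<integral>x. (cmod (of_real (growth m n x) * nonlocal w x))\<^sup>2 \<partial>lborel)"
        by (subst integral_mult_right_zero[symmetric], intro Bochner_Integration.integral_cong refl)
          (auto simp: norm_mult power_mult_distrib power_divide)
      also have "sqrt (X n) * sqrt (\<alpha>\<^sup>2 / 4 * (\<integral>x. (cmod (of_real (growth m n x) * nonlocal w x))\<^sup>2 \<partial>lborel))
         \<le> sqrt (X n) * sqrt (\<alpha>\<^sup>2 / 4 * C)"
        using Fn[of n] Xnn by (intro mult_left_mono real_sqrt_le_mono) auto
      also have "\<dots> \<le> \<delta> * X n + \<alpha>\<^sup>2 * C / (16 * \<delta>)"
      proof -
        have "0 \<le> (\<integral>x. (cmod (of_real (growth m n x) * nonlocal w x))\<^sup>2 \<partial>lborel)"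
          by (intro integral_nonneg_AE) auto
        then have C0: "C \<ge> 0" using Fn[of n] by linarith
        define p q where "p = sqrt (X n)" and "q = sqrt (\<alpha>\<^sup>2 / 4 * C)"
        have pq: "p\<^sup>2 = X n" "q\<^sup>2 = \<alpha>\<^sup>2 / 4 * C" using Xnn C0 by (auto simp: p_def q_def)
        \<comment> \<open>Weighted arithmetic-geometric mean: p q \<le> \<delta> p^2 + q^2 / (4
          \<delta>). With q^2 = \<alpha>^2 C / 4 this is the source of the constant 16
          \<delta>.\<close>
        have "0 \<le> (2 * \<delta> * p - q)\<^sup>2" by simp
        then have "4 * \<delta> * (p * q) \<le> 4 * \<delta>\<^sup>2 * p\<^sup>2 + q\<^sup>2" by (simp add: power2_eq_square algebra_simps)
        then have "p * q \<le> (4 * \<delta>\<^sup>2 * p\<^sup>2 + q\<^sup>2) / (4 * \<delta>)" using \<delta> by (simp add: pos_le_divide_eq mult_ac)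
        also have "\<dots> = \<delta> * p\<^sup>2 + q\<^sup>2 / (4 * \<delta>)" using \<delta> by (simp add: add_divide_distrib power2_eq_square)
        finally show ?thesis unfolding pq by (simp add: p_def q_def)
      qed
      finally show ?thesis .
    qed
    ultimately have "Re \<mu> * X n \<le> ((1 - m) / 2 + \<delta>) * X n + K * W + (\<delta> * X n + \<alpha>\<^sup>2 * C / (16 * \<delta>))"
      using E by linarith
    then show ?thesis unfolding \<delta>(2) by (simp add: algebra_simps)
  qed
  \<comment> \<open>The bound contains no n, as C serves all the regularised weights at once; it
    therefore passes through the liminf below.\<close>
  define B where "B = (K * W + \<alpha>\<^sup>2 * C / (16 * \<delta>)) / \<delta>"
  have XB: "X n \<le> B" for n
    using Xbound[of n] \<delta> by (simp add: B_def pos_le_divide_eq mult.commute)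
  have "(\<integral>\<^sup>+x. ennreal ((cmod (of_real (decay_weight m x) * w x))\<^sup>2) \<partial>lborel) =
    (\<integral>\<^sup>+x. liminf (\<lambda>n. ennreal ((growth m n x)\<^sup>2 * (cmod (w x))\<^sup>2)) \<partial>lborel)"
  proof (rule nn_integral_cong)
    fix x
    have "(\<lambda>n. (growth m n x)\<^sup>2 * (cmod (w x))\<^sup>2) \<longlonglongrightarrow> (decay_weight m x)\<^sup>2 * (cmod (w x))\<^sup>2"
      unfolding decay_weight_def by (intro tendsto_mult tendsto_power tendsto_const growth_tendsto)
    then have "(\<lambda>n. ennreal ((growth m n x)\<^sup>2 * (cmod (w x))\<^sup>2)) \<longlonglongrightarrow> ennreal ((decay_weight m x)\<^sup>2 * (cmod (w x))\<^sup>2)"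
      by (rule tendsto_ennrealI)
    from lim_imp_Liminf[OF _ this]
    show "ennreal ((cmod (of_real (decay_weight m x) * w x))\<^sup>2) = liminf (\<lambda>n. ennreal ((growth m n x)\<^sup>2 * (cmod (w x))\<^sup>2))"
      by (simp add: norm_mult power_mult_distrib)
  qed
  also have "\<dots> \<le> liminf (\<lambda>n. \<integral>\<^sup>+x. ennreal ((growth m n x)\<^sup>2 * (cmod (w x))\<^sup>2) \<partial>lborel)"
    by (rule nn_integral_liminf) measurable
  also have "\<dots> \<le> liminf (\<lambda>n. ennreal B)"
  proof (rule Liminf_mono, rule always_eventually, rule allI)
    fix n
    have "(\<integral>\<^sup>+x. ennreal ((growth m n x)\<^sup>2 * (cmod (w x))\<^sup>2) \<partial>lborel) = ennreal (X n)"
      unfolding X_def by (rule nn_integral_eq_integral[OF iX]) auto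
    then show "(\<integral>\<^sup>+x. ennreal ((growth m n x)\<^sup>2 * (cmod (w x))\<^sup>2) \<partial>lborel) \<le> ennreal B"
      using XB[of n] by (simp add: ennreal_leI)
  qed
  also have "\<dots> = ennreal B" by (simp add: Liminf_const)
  finally show ?thesis by (intro square_integrableI_nn) (auto intro: le_less_trans)
qed

section \<open>Hermite functions\<close>

inductive real_poly :: "(real^2 \<Rightarrow> real) \<Rightarrow> bool" where
  const: "real_poly (\<lambda>x. c)"
| coord: "real_poly (\<lambda>x. x $ i)"
| add: "real_poly f \<Longrightarrow> real_poly g \<Longrightarrow> real_poly (\<lambda>x. f x + g x)"
| mult: "real_poly f \<Longrightarrow> real_poly g \<Longrightarrow> real_poly (\<lambda>x. f x * g x)"

lemma real_poly_cmult: "real_poly f \<Longrightarrow> real_poly (\<lambda>x. c * f x)"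
  by (intro real_poly.intros)

lemma real_poly_minus: "real_poly f \<Longrightarrow> real_poly (\<lambda>x. - f x)"
  using real_poly_cmult[of f "-1"] by simp

lemma real_poly_diff: "real_poly f \<Longrightarrow> real_poly g \<Longrightarrow> real_poly (\<lambda>x. f x - g x)"
  using real_poly.add[of f "\<lambda>x. - g x"] real_poly_minus[of g] by simp

lemma real_poly_sum: "(\<And>i. i \<in> I \<Longrightarrow> real_poly (f i)) \<Longrightarrow> real_poly (\<lambda>x. \<Sum>i\<in>I. f i x)"
  by (induction I rule: infinite_finite_induct) (simp_all add: real_poly.const real_poly.add)

lemma real_poly_power: "real_poly f \<Longrightarrow> real_poly (\<lambda>x. f x ^ n)"
  by (induction n) (simp_all add: real_poly.const real_poly.mult)

lemma real_poly_norm_sq: "real_poly (\<lambda>x. (norm x)\<^sup>2)"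
  unfolding norm2_sq by (intro real_poly.add real_poly_power real_poly.coord)

lemma real_poly_bump_poly: "real_poly f \<Longrightarrow> bump_poly (\<lambda>x. of_real (f x))"
  by (induction rule: real_poly.induct) (simp_all add: bump_poly.intros)

lemma real_poly_gradient:
  assumes "real_poly f"
  obtains f' where "has_gradient f f'" "\<And>j. real_poly (f' j)"
proof -
  have "\<exists>f'. has_gradient f f' \<and> (\<forall>j. real_poly (f' j))"
    using assms
  proof induction
    case (const c)
    show ?case by (intro exI[of _ "\<lambda>j x. 0"] conjI) (auto intro: real_poly.intros)
  next
    case (coord i)
    have "has_gradient (\<lambda>x::real^2. x $ i) (\<lambda>j x. if j = i then 1 else 0)"
      using has_gradient_coord[of i, where 'a=real] by simp
    then show ?case
      by (intro exI[of _ "\<lambda>j x. if j = i then 1 else 0"] conjI allI) (auto intro: real_poly.const)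
  next
    case (add f g)
    then obtain f' g' where "has_gradient f f'" "has_gradient g g'"
      "\<And>j. real_poly (f' j)" "\<And>j. real_poly (g' j)" by auto
    then show ?case
      by (intro exI[of _ "\<lambda>j x. f' j x + g' j x"]) (auto intro: real_poly.intros)
  next
    case (mult f g)
    then obtain f' g' where "has_gradient f f'" "has_gradient g g'"
      "\<And>j. real_poly (f' j)" "\<And>j. real_poly (g' j)" by auto
    with mult show ?case
      by (intro exI[of _ "\<lambda>j x. f' j x * g x + f x * g' j x"] conjI has_gradient_mult allI
            real_poly.add real_poly.mult)
  qed
  then show ?thesis using that by blast
qed

lemma real_poly_continuous: "real_poly f \<Longrightarrow> continuous_on UNIV f"
  by (erule real_poly_gradient) (rule has_gradientD(3))

lemma real_poly_borel: "real_poly f \<Longrightarrow> f \<in> borel_measurable borel"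
  by (rule borel_measurable_continuous_onI[OF real_poly_continuous])

lemma real_poly_growth:
  assumes "real_poly f"
  obtains C k where "C \<ge> 0" "\<And>x. \<bar>f x\<bar> \<le> C * (1 + (norm x)\<^sup>2) ^ k"
proof -
  have "\<exists>C k. C \<ge> 0 \<and> (\<forall>x. \<bar>f x\<bar> \<le> C * (1 + (norm x)\<^sup>2) ^ k)"
    using assms
  proof induction
    case (const c)
    show ?case by (intro exI[of _ "\<bar>c\<bar>"] exI[of _ 0]) auto
  next
    case (coord i)
    have "\<bar>x $ i\<bar> \<le> 1 * (1 + (norm x)\<^sup>2) ^ 1" for x :: "real^2"
    proof -
      have "2 * norm x \<le> 1 + (norm x)\<^sup>2" using sum_squares_bound[of 1 "norm x"] by simp
      then show ?thesis using component_le_norm_cart[of x i] norm_ge_zero[of x] unfolding mult_1 power_one_right by linarith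
    qed
    then show ?case by (intro exI[of _ 1] exI[of _ "1::nat"]) auto
  next
    case (add f g)
    then obtain C k D l where c: "C \<ge> 0" "\<And>x. \<bar>f x\<bar> \<le> C * (1 + (norm x)\<^sup>2) ^ k"
      and d: "D \<ge> 0" "\<And>x. \<bar>g x\<bar> \<le> D * (1 + (norm x)\<^sup>2) ^ l" by blast
    have "\<bar>f x + g x\<bar> \<le> (C + D) * (1 + (norm x)\<^sup>2) ^ (k + l)" for x
    proof -
      have "C * (1 + (norm x)\<^sup>2) ^ k \<le> C * (1 + (norm x)\<^sup>2) ^ (k + l)"
        "D * (1 + (norm x)\<^sup>2) ^ l \<le> D * (1 + (norm x)\<^sup>2) ^ (k + l)"
        using c d by (intro mult_left_mono power_increasing; simp)+
      then show ?thesis using c(2)[of x] d(2)[of x] abs_triangle_ineq[of "f x" "g x"]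
        unfolding distrib_right by linarith
    qed
    then show ?case using c d by (intro exI[of _ "C + D"] exI[of _ "k + l"]) auto
  next
    case (mult f g)
    then obtain C k D l where c: "C \<ge> 0" "\<And>x. \<bar>f x\<bar> \<le> C * (1 + (norm x)\<^sup>2) ^ k"
      and d: "D \<ge> 0" "\<And>x. \<bar>g x\<bar> \<le> D * (1 + (norm x)\<^sup>2) ^ l" by blast
    have "\<bar>f x * g x\<bar> \<le> (C * D) * (1 + (norm x)\<^sup>2) ^ (k + l)" for x
    proof -
      have "\<bar>f x\<bar> * \<bar>g x\<bar> \<le> (C * (1 + (norm x)\<^sup>2) ^ k) * (D * (1 + (norm x)\<^sup>2) ^ l)"
        using c d by (intro mult_mono) auto
      then show ?thesis by (simp add: abs_mult power_add mult_ac)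
    qed
    then show ?case using c d by (intro exI[of _ "C * D"] exI[of _ "k + l"]) auto
  qed
  then show ?thesis using that by blast
qed

lemma real_poly_exp_bound:
  assumes "real_poly f" "c > 0"
  obtains K where "K \<ge> 0" "\<And>x. \<bar>f x\<bar> * exp (- c * (norm x)\<^sup>2) \<le> K * (1 + (norm x)\<^sup>2) powr (- 2)"
proof -
  obtain C k where C: "C \<ge> 0" "\<And>x. \<bar>f x\<bar> \<le> C * (1 + (norm x)\<^sup>2) ^ k"
    using real_poly_growth[OF assms(1)] by blast
  obtain K where K: "K \<ge> 0" "\<And>s. s \<ge> 0 \<Longrightarrow> (1 + s) powr (real k + 2) * exp (- c * s) \<le> K"
    using powr_exp_bounded[OF assms(2), of "real k + 2"] by blast
  have "\<bar>f x\<bar> * exp (- c * (norm x)\<^sup>2) \<le> (C * K) * (1 + (norm x)\<^sup>2) powr (- 2)" for x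
  proof -
    let ?s = "(norm x)\<^sup>2"
    have s: "1 + ?s > 0" by (simp add: add_pos_nonneg)
    have "(1 + ?s) powr (real k + 2) * (1 + ?s) powr (- 2) = (1 + ?s) powr (real k)"
      unfolding powr_add[symmetric] by simp
    then have e: "(1 + ?s) ^ k = (1 + ?s) powr (real k + 2) * (1 + ?s) powr (- 2)"
      using s by (simp add: powr_realpow)
    have "\<bar>f x\<bar> * exp (- c * ?s) \<le> C * (1 + ?s) ^ k * exp (- c * ?s)"
      by (intro mult_right_mono C) auto
    also have "\<dots> = C * (((1 + ?s) powr (real k + 2) * exp (- c * ?s)) * (1 + ?s) powr (- 2))"
      unfolding e by (simp add: mult_ac)
    also have "\<dots> \<le> C * (K * (1 + ?s) powr (- 2))"
      using C K by (intro mult_left_mono mult_right_mono) auto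
    finally show ?thesis by (simp add: mult_ac)
  qed
  then show ?thesis using C K by (intro that[of "C * K"]) auto
qed

lemma real_poly_gauss_integrable:
  assumes f: "real_poly f"
  shows "integrable lborel (\<lambda>x. f x * gauss x)"
proof -
  obtain K where K: "K \<ge> 0" "\<And>x. \<bar>f x\<bar> * exp (- (1/4) * (norm x)\<^sup>2) \<le> K * (1 + (norm x)\<^sup>2) powr (- 2)"
    using real_poly_exp_bound[OF f, of "1/4"] by auto
  note [measurable] = real_poly_borel[OF f]
  show ?thesis
  proof (rule integrable_dominated')
    show "integrable lborel (\<lambda>x::real^2. K * (1 + (norm x)\<^sup>2) powr (- 2))"
      by (intro integrable_mult_right integrable_weight) auto
    fix x
    have "1 / (4 * pi) \<le> 1" using pi_gt3 by simp
    then have "gauss x \<le> exp (- (1/4) * (norm x)\<^sup>2)"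
      unfolding gauss_def using mult_right_mono[of "1 / (4 * pi)" 1 "exp (- (1/4) * (norm x)\<^sup>2)"] by simp
    then have "\<bar>f x\<bar> * gauss x \<le> \<bar>f x\<bar> * exp (- (1/4) * (norm x)\<^sup>2)" by (intro mult_left_mono) auto
    then show "norm (f x * gauss x) \<le> K * (1 + (norm x)\<^sup>2) powr (- 2)"
      using K(2)[of x] gauss_pos[of x] by (simp add: abs_mult)
  qed measurable
qed

text \<open>Monic Hermite polynomials orthogonal for the weight exp (- t^2 / 4); in terms of the
  physicists' polynomials, \<open>he n t\<close> is H_n (t / 2). The factor 2 in the recursion is
  the variance of that weight.\<close>

fun he :: "nat \<Rightarrow> real \<Rightarrow> real" where
  "he 0 t = 1"
| "he (Suc 0) t = t"
| "he (Suc (Suc n)) t = t * he (Suc n) t - 2 * real (Suc n) * he n t"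

text \<open>For n = 0 the truncated index n - 1 is again 0, but the coefficient n vanishes; the same
  convention makes the derivative formulas valid for all indices.\<close>

lemma he_rec: "he (Suc n) t = t * he n t - 2 * real n * he (n - 1) t"
  by (cases n) auto

lemma he_deriv: "(he n has_real_derivative real n * he (n - 1) t) (at t)"
proof (induction n rule: less_induct)
  case (less n)
  consider "n = 0" | "n = 1" | m where "n = Suc (Suc m)"
    by (metis One_nat_def not0_implies_Suc)
  then show ?case
  proof cases
    case 1
    have "he 0 = (\<lambda>t. 1)" by (rule ext) simp
    then show ?thesis using 1 by simp
  next
    case 2
    have "he 1 = (\<lambda>t. t)" by (rule ext) simp
    then show ?thesis using 2 by simp
  next
    case 3
    have eq: "he n = (\<lambda>t. t * he (Suc m) t - 2 * real (Suc m) * he m t)"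
      using 3 by (intro ext) simp
    have "(he n has_real_derivative (1 * he (Suc m) t + real (Suc m) * he (Suc m - 1) t * t)
        - 2 * real (Suc m) * (real m * he (m - 1) t)) (at t)"
      unfolding eq
      by (rule DERIV_diff[OF DERIV_mult[OF DERIV_ident less.IH] DERIV_cmult[OF less.IH]]) (use 3 in auto)
    moreover have "(1 * he (Suc m) t + real (Suc m) * he (Suc m - 1) t * t)
        - 2 * real (Suc m) * (real m * he (m - 1) t) = real n * he (n - 1) t"
    proof -
      have "(1 * he (Suc m) t + real (Suc m) * he (Suc m - 1) t * t) - 2 * real (Suc m) * (real m * he (m - 1) t)
        = he (Suc m) t + real (Suc m) * (t * he m t - 2 * real m * he (m - 1) t)"
        by (simp add: algebra_simps)
      also have "\<dots> = real n * he (n - 1) t" unfolding he_rec[symmetric] using 3 by (simp add: algebra_simps)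
      finally show ?thesis .
    qed
    ultimately show ?thesis by simp
  qed
qed

definition hermite :: "(2 \<Rightarrow> nat) \<Rightarrow> real^2 \<Rightarrow> real" where
  "hermite \<nu> x = he (\<nu> 1) (x $ 1) * he (\<nu> 2) (x $ 2)"

lemma two_neq: "(1::2) \<noteq> 2" "(2::2) \<noteq> 1" by auto

lemma real_poly_he: "real_poly (\<lambda>x. he n (x $ i))"
proof (induction n rule: less_induct)
  case (less n)
  consider "n = 0" | "n = 1" | m where "n = Suc (Suc m)"
    by (metis One_nat_def not0_implies_Suc)
  then show ?case
  proof cases
    case 3
    then show ?thesis using less.IH[of "Suc m"] less.IH[of m]
      by (auto intro!: real_poly_diff real_poly_cmult real_poly.mult real_poly.coord)
  qed (auto intro: real_poly.intros)
qed

lemma real_poly_hermite: "real_poly (hermite \<nu>)"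
  unfolding hermite_def[abs_def] by (intro real_poly.mult real_poly_he)

lemma has_gradient_hermite:
  "has_gradient (hermite \<nu>) (\<lambda>j x. real (\<nu> j) * hermite (\<nu>(j := \<nu> j - 1)) x)"
proof -
  have c: "has_gradient (\<lambda>x::real^2. x $ i) (\<lambda>j x. if j = i then 1 else 0)" for i
    using has_gradient_coord[of i, where 'a=real] by simp
  have h: "has_gradient (\<lambda>x::real^2. he n (x $ i)) (\<lambda>j x. real n * he (n - 1) (x $ i) * (if j = i then 1 else 0))" for n i
    by (rule has_gradient_compose'[OF c he_deriv]) (intro continuous_intros real_poly_continuous real_poly_he)
  show ?thesis
    unfolding hermite_def
  proof (rule has_gradient_cong[OF has_gradient_mult[OF h h]])
    fix j x
    show "real (\<nu> 1) * he (\<nu> 1 - 1) (x $ 1) * (if j = 1 then 1 else 0) * he (\<nu> 2) (x $ 2) +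
        he (\<nu> 1) (x $ 1) * (real (\<nu> 2) * he (\<nu> 2 - 1) (x $ 2) * (if j = 2 then 1 else 0)) =
      real (\<nu> j) * (he ((\<nu>(j := \<nu> j - 1)) 1) (x $ 1) * he ((\<nu>(j := \<nu> j - 1)) 2) (x $ 2))"
      using exhaust_2[of j] two_neq by auto
  qed simp
qed

lemma hermite_raise:
  "x $ j * hermite \<nu> x - 2 * (real (\<nu> j) * hermite (\<nu>(j := \<nu> j - 1)) x) = hermite (\<nu>(j := Suc (\<nu> j))) x"
  using exhaust_2[of j] by (auto simp: hermite_def he_rec algebra_simps)

text \<open>The partial derivative of f times \<open>gauss\<close> has integral 0, and
  differentiating \<open>gauss\<close> brings down - x/2.\<close>

lemma gauss_by_parts:
  assumes f: "has_gradient f f'" "real_poly f" "\<And>j. real_poly (f' j)"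
  shows "(\<integral>x. x $ j * f x * gauss x \<partial>lborel) = 2 * (\<integral>x. f' j x * gauss x \<partial>lborel)"
proof -
  have h: "has_gradient (\<lambda>x. complex_of_real (f x * gauss x))
     (\<lambda>j x. of_real (f' j x * gauss x + f x * (- (x $ j) / 2 * gauss x)))"
    by (intro has_gradient_of_real has_gradient_mult f has_gradient_gauss)
  have i1: "integrable lborel (\<lambda>x. f' j x * gauss x)" by (rule real_poly_gauss_integrable[OF f(3)])
  have i2: "integrable lborel (\<lambda>x. (x $ j * f x) * gauss x)"
    by (intro real_poly_gauss_integrable real_poly.mult real_poly.coord f)
  have e: "f' j x * gauss x + f x * (- (x $ j) / 2 * gauss x) = f' j x * gauss x - 1/2 * ((x $ j * f x) * gauss x)" for x
    by (simp add: algebra_simps)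
  have "(\<integral>x. complex_of_real (f' j x * gauss x + f x * (- (x $ j) / 2 * gauss x)) \<partial>lborel) = 0"
  proof (rule integral_gradient_zero[OF h, of j])
    show "complex_integrable lborel (\<lambda>x. complex_of_real (f x * gauss x))"
      by (rule integrable_of_real[OF real_poly_gauss_integrable[OF f(2)]])
    show "complex_integrable lborel (\<lambda>x. complex_of_real (f' j x * gauss x + f x * (- (x $ j) / 2 * gauss x)))"
      unfolding e by (intro integrable_of_real Bochner_Integration.integrable_diff integrable_mult_right i1 i2)
  qed
  then have "(\<integral>x. f' j x * gauss x - 1/2 * ((x $ j * f x) * gauss x) \<partial>lborel) = 0"
    unfolding e integral_complex_of_real by simp
  then show ?thesis using i1 i2 by simp
qed

text \<open>Gaussian integration by parts applied to the product of a derivative of f with g: the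
  operator f'' - (x/2) f' is symmetric for the Gaussian measure, with the Dirichlet form as its
  negative quadratic form.\<close>

lemma gauss_dirichlet:
  assumes f: "has_gradient f f'" "real_poly f" "\<And>j. real_poly (f' j)" "\<And>j. has_gradient (f' j) (f'' j)" "\<And>i j. real_poly (f'' j i)"
    and g: "has_gradient g g'" "real_poly g" "\<And>j. real_poly (g' j)"
  shows "(\<integral>x. f' j x * g' j x * gauss x \<partial>lborel) = - (\<integral>x. (f'' j j x - x $ j / 2 * f' j x) * g x * gauss x \<partial>lborel)"
proof -
  have h: "has_gradient (\<lambda>x. f' j x * g x) (\<lambda>i x. f'' j i x * g x + f' j x * g' i x)"
    by (intro has_gradient_mult f g)
  have p: "real_poly (\<lambda>x. f' j x * g x)" "real_poly (\<lambda>x. f'' j i x * g x + f' j x * g' i x)" for i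
    by (intro real_poly.add real_poly.mult f g)+
  have i: "integrable lborel (\<lambda>x. (f'' j j x * g x) * gauss x)" "integrable lborel (\<lambda>x. (f' j x * g' j x) * gauss x)"
    "integrable lborel (\<lambda>x. (x $ j * (f' j x * g x)) * gauss x)"
    by (intro real_poly_gauss_integrable real_poly.mult real_poly.coord f g)+
  have "(\<integral>x. (x $ j * (f' j x * g x)) * gauss x \<partial>lborel) = 2 * (\<integral>x. (f'' j j x * g x) * gauss x + (f' j x * g' j x) * gauss x \<partial>lborel)"
    using gauss_by_parts[OF h p] by (simp add: distrib_right)
  also have "\<dots> = 2 * (\<integral>x. (f'' j j x * g x) * gauss x \<partial>lborel) + 2 * (\<integral>x. (f' j x * g' j x) * gauss x \<partial>lborel)"
    using i by simp
  finally have 1: "(\<integral>x. (x $ j * (f' j x * g x)) * gauss x \<partial>lborel) =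
     2 * (\<integral>x. (f'' j j x * g x) * gauss x \<partial>lborel) + 2 * (\<integral>x. (f' j x * g' j x) * gauss x \<partial>lborel)" .
  have "(\<integral>x. (f'' j j x - x $ j / 2 * f' j x) * g x * gauss x \<partial>lborel) =
     (\<integral>x. (f'' j j x * g x) * gauss x - 1/2 * ((x $ j * (f' j x * g x)) * gauss x) \<partial>lborel)"
    by (intro Bochner_Integration.integral_cong) (auto simp: algebra_simps)
  also have "\<dots> = (\<integral>x. (f'' j j x * g x) * gauss x \<partial>lborel) - 1/2 * (\<integral>x. (x $ j * (f' j x * g x)) * gauss x \<partial>lborel)"
    using i by simp
  finally show ?thesis unfolding 1 by (simp add: add_divide_distrib)
qed

lemma hermite_second_gradient:
  "has_gradient (\<lambda>x. real (\<nu> j) * hermite (\<nu>(j := \<nu> j - 1)) x)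
    (\<lambda>i x. real (\<nu> j) * (real ((\<nu>(j := \<nu> j - 1)) i) * hermite ((\<nu>(j := \<nu> j - 1))(i := (\<nu>(j := \<nu> j - 1)) i - 1)) x))"
  by (intro has_gradient_cmult has_gradient_hermite)

text \<open>In each coordinate separately, the Hermite polynomials are eigenfunctions of f'' - (x/2)
  f' with eigenvalue minus half the degree. This is the three-term recursion combined with the rule
  that differentiation lowers the index.\<close>

lemma hermite_eigen:
  "real (\<nu> j) * (real ((\<nu>(j := \<nu> j - 1)) j) * hermite ((\<nu>(j := \<nu> j - 1))(j := (\<nu>(j := \<nu> j - 1)) j - 1)) x)
     - x $ j / 2 * (real (\<nu> j) * hermite (\<nu>(j := \<nu> j - 1)) x) = - (real (\<nu> j) / 2) * hermite \<nu> x"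
proof (cases "\<nu> j")
  case (Suc n)
  have e: "x $ j * hermite (\<nu>(j := n)) x - 2 * (real n * hermite (\<nu>(j := n - 1)) x) = hermite \<nu> x"
    using hermite_raise[of x j "\<nu>(j := n)"] Suc by (metis fun_upd_same fun_upd_triv fun_upd_upd)
  show ?thesis unfolding e[symmetric] using Suc by (simp add: algebra_simps)
qed simp

lemma hermite_dirichlet:
  "(\<integral>x. (real (\<nu> j) * hermite (\<nu>(j := \<nu> j - 1)) x) * (real (\<nu>' j) * hermite (\<nu>'(j := \<nu>' j - 1)) x) * gauss x \<partial>lborel) =
    real (\<nu> j) / 2 * (\<integral>x. hermite \<nu> x * hermite \<nu>' x * gauss x \<partial>lborel)"
proof -
  note pp = real_poly_hermite real_poly_cmult[OF real_poly_hermite] real_poly_cmult[OF real_poly_cmult[OF real_poly_hermite]]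
  have "(\<integral>x. (real (\<nu> j) * hermite (\<nu>(j := \<nu> j - 1)) x) * (real (\<nu>' j) * hermite (\<nu>'(j := \<nu>' j - 1)) x) * gauss x \<partial>lborel) =
    - (\<integral>x. (real (\<nu> j) * (real ((\<nu>(j := \<nu> j - 1)) j) * hermite ((\<nu>(j := \<nu> j - 1))(j := (\<nu>(j := \<nu> j - 1)) j - 1)) x)
     - x $ j / 2 * (real (\<nu> j) * hermite (\<nu>(j := \<nu> j - 1)) x)) * hermite \<nu>' x * gauss x \<partial>lborel)"
    by (rule gauss_dirichlet[OF has_gradient_hermite pp(1) pp(2) hermite_second_gradient pp(3) has_gradient_hermite pp(1) pp(2)])
  also have "\<dots> = real (\<nu> j) / 2 * (\<integral>x. hermite \<nu> x * hermite \<nu>' x * gauss x \<partial>lborel)"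
    unfolding hermite_eigen by (simp add: mult.assoc)
  finally show ?thesis .
qed

text \<open>The Dirichlet form of two Hermite polynomials equals their inner product times half the
  j-th degree of either one. If the degrees differ in coordinate j, the inner product must
  vanish.\<close>

lemma hermite_orthogonal:
  assumes "\<nu> \<noteq> \<nu>'"
  shows "(\<integral>x. hermite \<nu> x * hermite \<nu>' x * gauss x \<partial>lborel) = 0"
proof -
  obtain j where j: "\<nu> j \<noteq> \<nu>' j" using assms by auto
  have "real (\<nu> j) / 2 * (\<integral>x. hermite \<nu> x * hermite \<nu>' x * gauss x \<partial>lborel) =
    real (\<nu>' j) / 2 * (\<integral>x. hermite \<nu>' x * hermite \<nu> x * gauss x \<partial>lborel)"
    unfolding hermite_dirichlet[symmetric] by (simp add: mult_ac)
  then show ?thesis using j by (simp add: mult.commute[of "hermite \<nu>' _"])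
qed

definition hermite_norm :: "(2 \<Rightarrow> nat) \<Rightarrow> real" where
  "hermite_norm \<nu> = (\<integral>x. hermite \<nu> x * hermite \<nu> x * gauss x \<partial>lborel)"

text \<open>One raised factor is rewritten by the recursion and its lower part is orthogonal to the
  other factor; integration by parts then differentiates the product, and again one of the two
  resulting terms vanishes by orthogonality. Positivity of all norms follows by induction from that
  of the Gaussian mass.\<close>

lemma hermite_norm_Suc: "hermite_norm (\<nu>(j := Suc (\<nu> j))) = 2 * real (Suc (\<nu> j)) * hermite_norm \<nu>"
proof -
  let ?\<kappa> = "\<nu>(j := Suc (\<nu> j))"
  define f where "f x = hermite \<nu> x * hermite ?\<kappa> x" for x
  define f' where "f' i x = real (\<nu> i) * hermite (\<nu>(i := \<nu> i - 1)) x * hermite ?\<kappa> x +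
      hermite \<nu> x * (real (?\<kappa> i) * hermite (?\<kappa>(i := ?\<kappa> i - 1)) x)" for i x
  have h: "has_gradient f f'" unfolding f_def[abs_def] f'_def[abs_def]
    by (intro has_gradient_mult has_gradient_hermite)
  have p: "real_poly f" "\<And>i. real_poly (f' i)" unfolding f_def[abs_def] f'_def[abs_def]
    by (intro real_poly.add real_poly.mult real_poly_hermite real_poly.const)+
  have f'j: "f' j x = real (\<nu> j) * hermite (\<nu>(j := \<nu> j - 1)) x * hermite ?\<kappa> x + real (Suc (\<nu> j)) * (hermite \<nu> x * hermite \<nu> x)" for x
    by (simp add: f'_def)
  have i: "integrable lborel (\<lambda>x. (hermite \<nu> x * hermite \<nu> x) * gauss x)"
    "integrable lborel (\<lambda>x. (hermite (\<nu>(j := \<nu> j - 1)) x * hermite ?\<kappa> x) * gauss x)"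
    "integrable lborel (\<lambda>x. x $ j * f x * gauss x)"
    by (intro real_poly_gauss_integrable real_poly.mult real_poly_hermite real_poly.coord p)+
  have ne: "\<nu>(j := \<nu> j - 1) \<noteq> ?\<kappa>" 
  proof
    assume "\<nu>(j := \<nu> j - 1) = ?\<kappa>"
    from fun_cong[OF this, of j] show False by simp
  qed
  have o: "(\<integral>x. (hermite (\<nu>(j := \<nu> j - 1)) x * hermite ?\<kappa> x) * gauss x \<partial>lborel) = 0"
    by (rule hermite_orthogonal[OF ne])
  have "hermite_norm ?\<kappa> = (\<integral>x. x $ j * f x * gauss x - 2 * real (\<nu> j) * ((hermite (\<nu>(j := \<nu> j - 1)) x * hermite ?\<kappa> x) * gauss x) \<partial>lborel)"
    unfolding hermite_norm_def
    by (intro Bochner_Integration.integral_cong refl, subst (1) hermite_raise[symmetric]) (simp add: f_def algebra_simps)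
  also have "\<dots> = (\<integral>x. x $ j * f x * gauss x \<partial>lborel)"
    using i o by simp
  also have "\<dots> = 2 * (\<integral>x. f' j x * gauss x \<partial>lborel)"
    by (rule gauss_by_parts[OF h p])
  also have "(\<integral>x. f' j x * gauss x \<partial>lborel) =
    (\<integral>x. real (\<nu> j) * ((hermite (\<nu>(j := \<nu> j - 1)) x * hermite ?\<kappa> x) * gauss x) + real (Suc (\<nu> j)) * ((hermite \<nu> x * hermite \<nu> x) * gauss x) \<partial>lborel)"
    by (intro Bochner_Integration.integral_cong refl) (simp add: f'j algebra_simps)
  also have "\<dots> = real (Suc (\<nu> j)) * hermite_norm \<nu>"
    unfolding hermite_norm_def using i o by simp
  finally show ?thesis by (simp only: mult.assoc)
qed

lemma integral_gauss_pos: "(\<integral>x. gauss x \<partial>lborel) > 0"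
proof -
  have i: "integrable lborel gauss" using real_poly_gauss_integrable[OF real_poly.const[of 1]] by simp
  have "(\<integral>x. gauss x \<partial>lborel) \<noteq> 0"
  proof
    assume "(\<integral>x. gauss x \<partial>lborel) = 0"
    then have "AE x in lborel. gauss x = 0"
      using integral_nonneg_eq_0_iff_AE[OF i] gauss_pos by (auto simp: less_imp_le)
    moreover have "{x \<in> space lborel. \<not> gauss x = 0} = UNIV" using gauss_pos by (auto simp: less_le)
    ultimately have "emeasure lborel (UNIV :: (real^2) set) = 0"
      by (subst (asm) AE_iff_measurable[of UNIV]) auto
    then show False by (simp add: emeasure_lborel_UNIV)
  qed
  moreover have "(\<integral>x. gauss x \<partial>lborel) \<ge> 0" using gauss_pos by (intro integral_nonneg_AE) (auto simp: less_imp_le)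
  ultimately show ?thesis by simp
qed

lemma hermite_norm_pos: "hermite_norm \<nu> > 0"
proof -
  have "hermite_norm \<nu> > 0" if "\<nu> 1 + \<nu> 2 = n" for n
    using that
  proof (induction n arbitrary: \<nu>)
    case 0
    then show ?case using integral_gauss_pos by (simp add: hermite_norm_def hermite_def)
  next
    case (Suc n)
    then obtain j where j: "\<nu> j > 0" by (metis add_is_0 not_gr_zero nat.distinct(1))
    let ?\<kappa> = "\<nu>(j := \<nu> j - 1)"
    have "?\<kappa> 1 + ?\<kappa> 2 = n" using Suc.prems j exhaust_2[of j] by auto
    then have "hermite_norm ?\<kappa> > 0" by (rule Suc.IH)
    moreover have "?\<kappa>(j := Suc (?\<kappa> j)) = \<nu>" using j by auto
    ultimately show ?case using hermite_norm_Suc[of ?\<kappa> j] by (metis mult_pos_pos of_nat_0_less_iff zero_less_Suc zero_less_numeral)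
  qed
  then show ?thesis by blast
qed

text \<open>The factor \<open>sqrt (gauss x)\<close> moves the Gaussian weight into the functions,
  so they are orthonormal in plain L2 and the expansion concerns W = w / sqrt gauss.\<close>

definition hermite_fun :: "(2 \<Rightarrow> nat) \<Rightarrow> real^2 \<Rightarrow> real" where
  "hermite_fun \<nu> x = hermite \<nu> x * sqrt (gauss x) / sqrt (hermite_norm \<nu>)"

lemma hermite_fun_borel [measurable]: "hermite_fun \<nu> \<in> borel_measurable borel"
  unfolding hermite_fun_def[abs_def] using real_poly_borel[OF real_poly_hermite] by measurable

lemma hermite_fun_mult:
  "hermite_fun \<nu> x * hermite_fun \<nu>' x = 1 / (sqrt (hermite_norm \<nu>) * sqrt (hermite_norm \<nu>')) * (hermite \<nu> x * hermite \<nu>' x * gauss x)"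
  using gauss_pos[of x] by (simp add: hermite_fun_def less_imp_le)

lemma hermite_fun_orthonormal:
  "(\<integral>x. hermite_fun \<nu> x * hermite_fun \<nu>' x \<partial>lborel) = (if \<nu> = \<nu>' then 1 else 0)"
proof -
  have "(\<integral>x. hermite_fun \<nu> x * hermite_fun \<nu>' x \<partial>lborel) =
    1 / (sqrt (hermite_norm \<nu>) * sqrt (hermite_norm \<nu>')) * (\<integral>x. hermite \<nu> x * hermite \<nu>' x * gauss x \<partial>lborel)"
    unfolding hermite_fun_mult by (simp only: integral_mult_right_zero)
  then show ?thesis
    using hermite_orthogonal[of \<nu> \<nu>'] hermite_norm_pos[of \<nu>] by (auto simp flip: hermite_norm_def)
qed

lemma hermite_fun_square_integrable: "square_integrable (\<lambda>x. of_real (hermite_fun \<nu> x))"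
proof -
  have "integrable lborel (\<lambda>x. hermite_fun \<nu> x * hermite_fun \<nu> x)"
    unfolding hermite_fun_mult
    by (intro integrable_mult_right real_poly_gauss_integrable real_poly.mult real_poly_hermite)
  then show ?thesis by (simp add: square_integrable_def power2_eq_square)
qed

section \<open>Completeness of the Hermite functions\<close>

text \<open>Completeness of L2 in the manner of Riesz and Fischer. A subsequence with squared gaps
  at most (1/4)^k still has a finite sum after weighting with 2^k, so almost everywhere the
  increments decay geometrically and the subsequence converges pointwise. Fatou's lemma identifies
  the pointwise limit as the L2 limit of the whole sequence.\<close>

lemma L2_cauchy_tendsto:
  assumes u: "\<And>n. square_integrable (u n)"
    and cauchy: "\<And>e. e > 0 \<Longrightarrow> \<exists>M. \<forall>n\<ge>M. \<forall>k\<ge>M. (\<integral>x. (cmod (u n x - u k x))\<^sup>2 \<partial>lborel) < e"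
  obtains f where "L2_tendsto u f"
proof -
  have ub [measurable]: "u n \<in> borel_measurable borel" for n using u by auto
  have "\<exists>M. \<forall>n\<ge>M. \<forall>k\<ge>M. (\<integral>x. (cmod (u n x - u k x))\<^sup>2 \<partial>lborel) < (1/4) ^ i" for i
    by (rule cauchy) simp
  then obtain M where M: "\<And>i n k. n \<ge> M i \<Longrightarrow> k \<ge> M i \<Longrightarrow> (\<integral>x. (cmod (u n x - u k x))\<^sup>2 \<partial>lborel) < (1/4) ^ i"
    by metis
  \<comment> \<open>The partial sums of the thresholds are at least each earlier threshold, which
    yields a nondecreasing choice of indices.\<close>
  define r where "r k = (\<Sum>i\<le>k. M i)" for k
  have rM: "r k \<ge> M i" if "i \<le> k" for i k
    unfolding r_def using that by (intro member_le_sum) auto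
  define d where "d k x = u (r (Suc k)) x - u (r k) x" for k x
  have d2: "square_integrable (d k)" for k unfolding d_def[abs_def] by (intro square_integrable_diff u)
  have [measurable]: "d k \<in> borel_measurable borel" for k using d2 by auto
  have dk: "(\<integral>x. (cmod (d k x))\<^sup>2 \<partial>lborel) \<le> (1/4) ^ k" for k
    unfolding d_def using M[of k "r (Suc k)" "r k"] rM[of k k] rM[of k "Suc k"] by simp
  have "(\<integral>\<^sup>+x. (\<Sum>k. ennreal (2 ^ k * (cmod (d k x))\<^sup>2)) \<partial>lborel) = (\<Sum>k. \<integral>\<^sup>+x. ennreal (2 ^ k * (cmod (d k x))\<^sup>2) \<partial>lborel)"
    by (rule nn_integral_suminf) measurable
  also have "\<dots> \<le> (\<Sum>k. ennreal ((1/2) ^ k))"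
  proof (rule suminf_le)
    fix k
    have "(\<integral>\<^sup>+x. ennreal (2 ^ k * (cmod (d k x))\<^sup>2) \<partial>lborel) = ennreal (2 ^ k) * ennreal (\<integral>x. (cmod (d k x))\<^sup>2 \<partial>lborel)"
      using nn_square_integrable[OF d2[of k]] by (simp add: ennreal_mult nn_integral_cmult)
    also have "\<dots> \<le> ennreal (2 ^ k) * ennreal ((1/4) ^ k)"
      by (intro mult_left_mono ennreal_leI dk) auto
    also have "\<dots> = ennreal ((1/2) ^ k)"
    proof -
      have "(2::real) ^ k * (1/4) ^ k = (1/2) ^ k" by (simp flip: power_mult_distrib)
      then show ?thesis by (simp add: ennreal_mult[symmetric])
    qed
    finally show "(\<integral>\<^sup>+x. ennreal (2 ^ k * (cmod (d k x))\<^sup>2) \<partial>lborel) \<le> ennreal ((1/2) ^ k)" .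
  qed simp_all
  also have "\<dots> < \<infinity>"
  proof -
    have "(\<Sum>k. ennreal ((1/2) ^ k)) = ennreal (\<Sum>k. (1/2) ^ k)"
      by (rule suminf_ennreal2) (simp_all add: summable_geometric)
    then show ?thesis by simp
  qed
  finally have fin: "(\<integral>\<^sup>+x. (\<Sum>k. ennreal (2 ^ k * (cmod (d k x))\<^sup>2)) \<partial>lborel) < \<infinity>" .
  have dm: "(\<lambda>x. ennreal (2 ^ k * (cmod (d k x))\<^sup>2)) \<in> borel_measurable lborel" for k by measurable
  have "AE x in lborel. (\<Sum>k. ennreal (2 ^ k * (cmod (d k x))\<^sup>2)) \<noteq> \<infinity>"
  proof (rule nn_integral_noteq_infinite)
    show "(\<lambda>x. \<Sum>k. ennreal (2 ^ k * (cmod (d k x))\<^sup>2)) \<in> borel_measurable lborel"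
      by (rule borel_measurable_suminf_order) (rule dm)
    show "(\<integral>\<^sup>+x. (\<Sum>k. ennreal (2 ^ k * (cmod (d k x))\<^sup>2)) \<partial>lborel) \<noteq> \<infinity>"
      using fin by (metis less_irrefl)
  qed
  then have conv: "AE x in lborel. convergent (\<lambda>k. u (r k) x)"
  proof eventually_elim
    case (elim x)
    obtain S where S: "S \<ge> 0" "(\<Sum>k. ennreal (2 ^ k * (cmod (d k x))\<^sup>2)) = ennreal S"
    proof (cases "\<Sum>k. ennreal (2 ^ k * (cmod (d k x))\<^sup>2)" rule: ennreal_cases)
      case (real S)
      then show ?thesis by (intro that[of S])
    next
      case top
      then show ?thesis using elim by (simp only: infinity_ennreal_def)
    qed
    have b: "cmod (d k x) \<le> sqrt S * (sqrt (1/2)) ^ k" for k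
    proof -
      have "(\<Sum>i\<in>{k}. ennreal (2 ^ i * (cmod (d i x))\<^sup>2)) \<le> ennreal S"
        unfolding S(2)[symmetric] by (intro sum_le_suminf) auto
      then have "2 ^ k * (cmod (d k x))\<^sup>2 \<le> S" using S(1) by simp
      then have "(1/2) ^ k * (2 ^ k * (cmod (d k x))\<^sup>2) \<le> (1/2) ^ k * S" by (rule mult_left_mono) simp
      moreover have "(1/2) ^ k * (2::real) ^ k = 1" by (simp flip: power_mult_distrib)
      ultimately have "(cmod (d k x))\<^sup>2 \<le> S * (1/2) ^ k" by (simp only: mult.assoc[symmetric] mult_1_left mult.commute[of S])
      then have "cmod (d k x) \<le> sqrt (S * (1/2) ^ k)" by (rule real_le_rsqrt)
      then show ?thesis by (simp add: real_sqrt_mult real_sqrt_power)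
    qed
    have "sqrt (1/2) < sqrt 1" by (rule real_sqrt_less_mono) simp
    then have "summable (\<lambda>k. sqrt S * (sqrt (1/2)) ^ k)"
      by (intro summable_mult summable_geometric) auto
    then have "summable (\<lambda>k. d k x)"
      by (rule summable_comparison_test'[of _ 0]) (use b in auto)
    then have "convergent (\<lambda>n. u (r 0) x + (\<Sum>k<n. d k x))"
      by (intro convergent_add convergent_const) (auto simp: summable_iff_convergent)
    moreover have "u (r 0) x + (\<Sum>k<n. d k x) = u (r n) x" for n
      using sum_lessThan_telescope[of "\<lambda>k. u (r k) x" n] by (simp add: d_def)
    ultimately show ?case by simp
  qed
  define f where "f x = lim (\<lambda>k. u (r k) x)" for x
  have [measurable]: "f \<in> borel_measurable borel"
    unfolding f_def[abs_def] by (rule borel_measurable_lim_metric) measurable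
  have le: "(\<integral>\<^sup>+x. ennreal ((cmod (u n x - f x))\<^sup>2) \<partial>lborel) \<le> ennreal ((1/4) ^ i)" if n: "n \<ge> M i" for n i
  proof -
    have "(\<integral>\<^sup>+x. ennreal ((cmod (u n x - f x))\<^sup>2) \<partial>lborel) =
      (\<integral>\<^sup>+x. liminf (\<lambda>k. ennreal ((cmod (u n x - u (r k) x))\<^sup>2)) \<partial>lborel)"
    proof (rule nn_integral_cong_AE)
      show "AE x in lborel. ennreal ((cmod (u n x - f x))\<^sup>2) = liminf (\<lambda>k. ennreal ((cmod (u n x - u (r k) x))\<^sup>2))"
        using conv
      proof eventually_elim
        case (elim x)
        then have "(\<lambda>k. u (r k) x) \<longlonglongrightarrow> f x" by (simp add: f_def convergent_LIMSEQ_iff)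
        then have "(\<lambda>k. ennreal ((cmod (u n x - u (r k) x))\<^sup>2)) \<longlonglongrightarrow> ennreal ((cmod (u n x - f x))\<^sup>2)"
          by (intro tendsto_ennrealI tendsto_intros)
        from lim_imp_Liminf[OF _ this] show ?case by simp
      qed
    qed
    also have "\<dots> \<le> liminf (\<lambda>k. \<integral>\<^sup>+x. ennreal ((cmod (u n x - u (r k) x))\<^sup>2) \<partial>lborel)"
      by (rule nn_integral_liminf) measurable
    also have "\<dots> \<le> liminf (\<lambda>k::nat. ennreal ((1/4) ^ i))"
    proof (rule Liminf_mono)
      show "\<forall>\<^sub>F k in sequentially. (\<integral>\<^sup>+x. ennreal ((cmod (u n x - u (r k) x))\<^sup>2) \<partial>lborel) \<le> ennreal ((1/4) ^ i)"
        using eventually_ge_at_top[of i]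
      proof eventually_elim
        case (elim k)
        have "(\<integral>x. (cmod (u n x - u (r k) x))\<^sup>2 \<partial>lborel) \<le> (1/4) ^ i"
          using M[OF n rM[OF elim]] by simp
        then show ?case
          unfolding nn_square_integrable[OF square_integrable_diff[OF u u]] by (rule ennreal_leI)
      qed
    qed
    finally show ?thesis by (simp add: Liminf_const)
  qed
  have diff: "square_integrable (\<lambda>x. u (M 0) x - f x)"
    by (rule square_integrableI_nn) (use le[of 0 "M 0"] in \<open>auto intro: le_less_trans\<close>)
  have f: "square_integrable f"
    using square_integrable_diff[OF u[of "M 0"] diff] by simp
  have "(\<lambda>n. \<integral>x. (cmod (u n x - f x))\<^sup>2 \<partial>lborel) \<longlonglongrightarrow> 0"
  proof (rule LIMSEQ_I)
    fix e :: real assume "e > 0"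
    then obtain i where i: "(1/4) ^ i < e" using real_arch_pow_inv[of e "1/4"] by auto
    have "norm ((\<integral>x. (cmod (u n x - f x))\<^sup>2 \<partial>lborel) - 0) < e" if "n \<ge> M i" for n
    proof -
      have "(\<integral>x. (cmod (u n x - f x))\<^sup>2 \<partial>lborel) \<le> (1/4) ^ i"
        using le[OF that] unfolding nn_square_integrable[OF square_integrable_diff[OF u f]]
        by (subst (asm) ennreal_le_iff) auto
      moreover have "(\<integral>x. (cmod (u n x - f x))\<^sup>2 \<partial>lborel) \<ge> 0" by (intro integral_nonneg_AE) auto
      ultimately show ?thesis using i by simp
    qed
    then show "\<exists>no. \<forall>n\<ge>no. norm ((\<integral>x. (cmod (u n x - f x))\<^sup>2 \<partial>lborel) - 0) < e" by blast
  qed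
  then have "L2_tendsto u f" using u f by (simp add: L2_tendsto_def)
  then show ?thesis by (rule that)
qed

text \<open>Multiplication by a coordinate keeps the span, since x_j times a Hermite polynomial is a
  combination of its two neighbours in direction j. Starting from the constant 1, every polynomial
  is reached.\<close>

inductive hermite_span :: "(real^2 \<Rightarrow> real) \<Rightarrow> bool" where
  base: "hermite_span (hermite \<nu>)"
| cmult: "hermite_span f \<Longrightarrow> hermite_span (\<lambda>x. c * f x)"
| add: "hermite_span f \<Longrightarrow> hermite_span g \<Longrightarrow> hermite_span (\<lambda>x. f x + g x)"

lemma hermite_span_coord:
  assumes "hermite_span f"
  shows "hermite_span (\<lambda>x. x $ j * f x)"
  using assms
proof induction
  case (base \<nu>)
  have "x $ j * hermite \<nu> x = hermite (\<nu>(j := Suc (\<nu> j))) x + 2 * real (\<nu> j) * hermite (\<nu>(j := \<nu> j - 1)) x" for x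
    unfolding hermite_raise[symmetric] by simp
  then show ?case by (simp only:) (intro hermite_span.intros)
next
  case (cmult f c)
  from hermite_span.cmult[OF cmult.IH, of c] show ?case by (simp add: mult_ac)
next
  case (add f g)
  from hermite_span.add[OF add.IH] show ?case by (simp add: distrib_left)
qed

lemma hermite_span_poly_mult:
  assumes "real_poly q" "hermite_span f"
  shows "hermite_span (\<lambda>x. q x * f x)"
  using assms
proof (induction arbitrary: f)
  case (add q1 q2)
  from hermite_span.add[OF add.IH(1)[OF add.prems] add.IH(2)[OF add.prems]] show ?case
    by (simp add: distrib_right)
next
  case (mult q1 q2)
  from mult.IH(1)[OF mult.IH(2)[OF mult.prems]] show ?case by (simp add: mult.assoc)
qed (auto intro: hermite_span.cmult hermite_span_coord)

lemma hermite_span_poly: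
  assumes "real_poly q"
  shows "hermite_span q"
proof -
  have "(\<lambda>x. q x * hermite (\<lambda>_. 0) x) = q" by (auto simp: hermite_def)
  with hermite_span_poly_mult[OF assms hermite_span.base[of "\<lambda>_. 0"]] show ?thesis by simp
qed

lemma exp_partial_sum:
  fixes t :: real
  shows "(\<lambda>M. \<Sum>n<M. t ^ n / fact n) \<longlonglongrightarrow> exp t" and "\<bar>\<Sum>n<M. t ^ n / fact n\<bar> \<le> exp \<bar>t\<bar>"
proof -
  have s: "(\<lambda>n. t ^ n / fact n) sums exp t" for t :: real
    using exp_converges[of t] by (simp add: scaleR_conv_of_real divide_inverse mult.commute)
  show "(\<lambda>M. \<Sum>n<M. t ^ n / fact n) \<longlonglongrightarrow> exp t" using s by (simp add: sums_def)
  have "\<bar>\<Sum>n<M. t ^ n / fact n\<bar> \<le> (\<Sum>n<M. \<bar>t\<bar> ^ n / fact n)"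
    by (rule order_trans[OF sum_abs]) (simp add: abs_divide power_abs)
  also have "\<dots> \<le> (\<Sum>n. \<bar>t\<bar> ^ n / fact n)"
    by (rule sum_le_suminf) (use s[of "\<bar>t\<bar>"] in \<open>auto simp: sums_iff\<close>)
  also have "\<dots> = exp \<bar>t\<bar>" using s[of "\<bar>t\<bar>"] by (simp add: sums_iff)
  finally show "\<bar>\<Sum>n<M. t ^ n / fact n\<bar> \<le> exp \<bar>t\<bar>" .
qed

lemma sqrt_gauss_le: "sqrt (gauss x) \<le> exp (- (1/8) * (norm x)\<^sup>2)"
proof -
  have "1 / (4 * pi) \<le> 1" using pi_gt3 by simp
  then have "gauss x \<le> exp (- (norm x)\<^sup>2 / 4)"
    unfolding gauss_def using mult_right_mono[of "1 / (4 * pi)" 1 "exp (- (norm x)\<^sup>2 / 4)"] by simp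
  also have "\<dots> = (exp (- (1/8) * (norm x)\<^sup>2))\<^sup>2" by (simp add: power2_eq_square flip: exp_add)
  finally show ?thesis by (intro real_le_lsqrt) (auto simp: gauss_pos less_imp_le)
qed

lemma gauss_le_1: "gauss x \<le> 1"
proof -
  have "exp (- (norm x)\<^sup>2 / 4) \<le> 1" by simp
  moreover have "1 / (4 * pi) \<le> 1" using pi_gt3 by simp
  ultimately show ?thesis unfolding gauss_def using mult_mono[of "1 / (4 * pi)" 1 "exp (- (norm x)\<^sup>2 / 4)" 1] by simp
qed

definition gauss_mass :: real where "gauss_mass = (\<integral>x. gauss x \<partial>lborel)"

interpretation gauss_kernel: mollifier "\<lambda>x. gauss x / gauss_mass" "1 / gauss_mass"
proof
  have p: "gauss_mass > 0" unfolding gauss_mass_def by (rule integral_gauss_pos)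
  have i: "integrable lborel gauss" using real_poly_gauss_integrable[OF real_poly.const[of 1]] by simp
  show "(\<lambda>x. gauss x / gauss_mass) \<in> borel_measurable borel" by measurable
  show "0 \<le> gauss x / gauss_mass" "gauss x / gauss_mass \<le> 1 / gauss_mass" for x
    using p gauss_pos[of x] gauss_le_1[of x] by (auto simp: divide_right_mono less_imp_le)
  show "integrable lborel (\<lambda>x. gauss x / gauss_mass)" using i by simp
  show "(\<integral>x. gauss x / gauss_mass \<partial>lborel) = 1" using p by (simp flip: gauss_mass_def)
qed

text \<open>
  A function orthogonal to all polynomials stays so after multiplication by \<open>exp (- s / 16)\<close>,
  because the Taylor series of that factor converges dominatedly.  Iterating makes it orthogonal to
  Gaussians of arbitrarily small width around every point, and these form an approximate identity.
\<close>

theorem hermite_complete: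
  assumes g: "square_integrable g" and orth: "\<And>\<nu>. (\<integral>x. g x * of_real (hermite_fun \<nu> x) \<partial>lborel) = 0"
  shows "AE x in lborel. g x = 0"
proof -
  have gm [measurable]: "g \<in> borel_measurable borel" using g by auto
  \<comment> \<open>Orthogonality of g to all Hermite functions is orthogonality of u to all
    polynomials, without a weight; vanishing of u gives that of g because \<open>gauss\<close> is
    positive.\<close>
  define u where "u x = g x * of_real (sqrt (gauss x))" for x
  have um [measurable]: "u \<in> borel_measurable borel" unfolding u_def[abs_def] by measurable
  have u2: "square_integrable u"
    unfolding u_def[abs_def]
    using square_integrable_mult_bounded[OF g, of "\<lambda>x. of_real (sqrt (gauss x))" 1] gauss_le_1
    by (simp add: mult.commute gauss_pos less_imp_le)
  \<comment> \<open>The factor \<open>sqrt (gauss x)\<close>, of size exp (- s/8), leaves room for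
    an additional exp (s/16). This margin is the majorant for all exponential series below.\<close>
  have int: "integrable lborel (\<lambda>x. u x * of_real (q x * exp ((1/16) * (norm x)\<^sup>2)))" if q: "real_poly q" for q
  proof -
    obtain K where K: "K \<ge> 0" "\<And>x. \<bar>q x\<bar> * exp (- (1/16) * (norm x)\<^sup>2) \<le> K * (1 + (norm x)\<^sup>2) powr (- 2)"
      using real_poly_exp_bound[OF q, of "1/16"] by auto
    have [measurable]: "q \<in> borel_measurable borel" by (rule real_poly_borel[OF q])
    have "square_integrable (\<lambda>x. complex_of_real (sqrt (gauss x) * (q x * exp ((1/16) * (norm x)\<^sup>2))))"
      unfolding square_integrable_def
    proof
      show "integrable lborel (\<lambda>x. (cmod (complex_of_real (sqrt (gauss x) * (q x * exp ((1/16) * (norm x)\<^sup>2)))))\<^sup>2)"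
      proof (rule integrable_dominated')
        show "integrable lborel (\<lambda>x::real^2. K\<^sup>2 * (1 + (norm x)\<^sup>2) powr (- 4))"
          by (intro integrable_mult_right integrable_weight) auto
        fix x
        have "\<bar>sqrt (gauss x) * (q x * exp ((1/16) * (norm x)\<^sup>2))\<bar> = sqrt (gauss x) * (\<bar>q x\<bar> * exp ((1/16) * (norm x)\<^sup>2))"
          using gauss_pos[of x] by (simp add: abs_mult less_imp_le)
        also have "\<dots> \<le> exp (- (1/8) * (norm x)\<^sup>2) * (\<bar>q x\<bar> * exp ((1/16) * (norm x)\<^sup>2))"
          by (intro mult_right_mono sqrt_gauss_le) auto
        also have "\<dots> = \<bar>q x\<bar> * (exp (- (1/8) * (norm x)\<^sup>2) * exp ((1/16) * (norm x)\<^sup>2))" by (simp add: mult_ac)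
        also have "exp (- (1/8) * (norm x)\<^sup>2) * exp ((1/16) * (norm x)\<^sup>2) = exp (- (1/16) * (norm x)\<^sup>2)"
          by (simp flip: exp_add)
        also have "\<bar>q x\<bar> * exp (- (1/16) * (norm x)\<^sup>2) \<le> K * (1 + (norm x)\<^sup>2) powr (- 2)" by (rule K)
        finally have "\<bar>sqrt (gauss x) * (q x * exp ((1/16) * (norm x)\<^sup>2))\<bar>\<^sup>2 \<le> (K * (1 + (norm x)\<^sup>2) powr (- 2))\<^sup>2"
          by (rule power_mono) simp
        also have "\<dots> = K\<^sup>2 * (1 + (norm x)\<^sup>2) powr (- 4)"
        proof -
          have "((1 + (norm x)\<^sup>2) powr (- 2))\<^sup>2 = (1 + (norm x)\<^sup>2) powr (- 4)"
            unfolding power2_eq_square[of "_ powr _"] powr_add[symmetric] by simp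
          then show ?thesis unfolding power_mult_distrib by simp
        qed
        finally show "norm ((cmod (complex_of_real (sqrt (gauss x) * (q x * exp ((1/16) * (norm x)\<^sup>2)))))\<^sup>2) \<le> K\<^sup>2 * (1 + (norm x)\<^sup>2) powr (- 4)"
          by (simp only: norm_of_real power2_abs real_norm_def abs_power2)
      qed measurable
    qed measurable
    from square_integrable_cauchy_schwarz(1)[OF g this] show ?thesis
      by (simp add: u_def mult.assoc)
  qed
  have int_poly: "integrable lborel (\<lambda>x. u x * of_real (q x * e x))"
    if q: "real_poly q" and e [measurable]: "e \<in> borel_measurable borel" and eb: "\<And>x. \<bar>e x\<bar> \<le> C * exp ((1/16) * (norm x)\<^sup>2)" for q e C
  proof (rule integrable_dominated')
    show "integrable lborel (\<lambda>x. C * norm (u x * of_real (q x * exp ((1/16) * (norm x)\<^sup>2))))"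
      by (intro integrable_mult_right integrable_norm int q)
    show "norm (u x * of_real (q x * e x)) \<le> C * norm (u x * of_real (q x * exp ((1/16) * (norm x)\<^sup>2)))" for x
      using mult_left_mono[OF eb[of x], of "cmod (u x) * \<bar>q x\<bar>"] by (simp add: norm_mult abs_mult mult_ac)
    have [measurable]: "q \<in> borel_measurable borel" by (rule real_poly_borel[OF q])
    show "(\<lambda>x. u x * of_real (q x * e x)) \<in> borel_measurable lborel" by measurable
  qed
  \<comment> \<open>With e fixed, the partial sums of the series for exp h are polynomials, so their
    integrals vanish by \<open>z\<close>; they are dominated by exp |h|, and the hypothesis
    \<open>eb\<close> places |e| exp |h| inside the margin.\<close>
  have limit: "(\<integral>x. u x * of_real (q x * exp (h x) * e x) \<partial>lborel) = 0"
    if q: "real_poly q" and h: "real_poly h" and e [measurable]: "e \<in> borel_measurable borel"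
      and eb: "\<And>x. \<bar>exp \<bar>h x\<bar> * e x\<bar> \<le> C * exp ((1/16) * (norm x)\<^sup>2)"
      and z: "\<And>q. real_poly q \<Longrightarrow> (\<integral>x. u x * of_real (q x * e x) \<partial>lborel) = 0" for q h e C
  proof -
    note [measurable] = real_poly_borel[OF q] real_poly_borel[OF h]
    have "(\<lambda>M. \<integral>x. u x * of_real ((q x * (\<Sum>n<M. h x ^ n / fact n)) * e x) \<partial>lborel) \<longlonglongrightarrow>
       (\<integral>x. u x * of_real (q x * exp (h x) * e x) \<partial>lborel)"
    proof (rule integral_dominated_convergence)
      show "integrable lborel (\<lambda>x. C * norm (u x * of_real (q x * exp ((1/16) * (norm x)\<^sup>2))))"
        by (intro integrable_mult_right integrable_norm int q)
      show "AE x in lborel. (\<lambda>M. u x * of_real ((q x * (\<Sum>n<M. h x ^ n / fact n)) * e x)) \<longlonglongrightarrow> u x * of_real (q x * exp (h x) * e x)"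
        by (intro AE_I2 tendsto_mult tendsto_of_real tendsto_const exp_partial_sum)
      show "AE x in lborel. norm (u x * of_real ((q x * (\<Sum>n<M. h x ^ n / fact n)) * e x)) \<le>
         C * norm (u x * of_real (q x * exp ((1/16) * (norm x)\<^sup>2)))" for M
      proof (rule AE_I2)
        fix x
        have "\<bar>\<Sum>n<M. h x ^ n / fact n\<bar> * \<bar>e x\<bar> \<le> exp \<bar>h x\<bar> * \<bar>e x\<bar>"
          by (intro mult_right_mono exp_partial_sum) auto
        also have "\<dots> \<le> C * exp ((1/16) * (norm x)\<^sup>2)" using eb[of x] by (simp add: abs_mult)
        finally have "\<bar>\<Sum>n<M. h x ^ n / fact n\<bar> * \<bar>e x\<bar> \<le> C * exp ((1/16) * (norm x)\<^sup>2)" .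
        from mult_left_mono[OF this, of "cmod (u x) * \<bar>q x\<bar>"]
        show "norm (u x * of_real ((q x * (\<Sum>n<M. h x ^ n / fact n)) * e x)) \<le>
         C * norm (u x * of_real (q x * exp ((1/16) * (norm x)\<^sup>2)))"
          by (simp add: norm_mult abs_mult mult_ac del: of_real_sum)
      qed
    qed measurable
    moreover have "real_poly (\<lambda>x. q x * (\<Sum>n<M. h x ^ n / fact n))" for M
      unfolding divide_inverse
      by (intro real_poly.mult real_poly_sum q real_poly_power h real_poly.const)
    then have "(\<integral>x. u x * of_real ((q x * (\<Sum>n<M. h x ^ n / fact n)) * e x) \<partial>lborel) = 0" for M
      by (rule z)
    ultimately show ?thesis using LIMSEQ_unique[OF _ tendsto_const] by simp
  qed
  have span0: "(\<integral>x. u x * of_real (f x) \<partial>lborel) = 0 \<and> real_poly f" if "hermite_span f" for f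
    using that
  proof induction
    case (base \<nu>)
    have "u x * of_real (hermite \<nu> x) = of_real (sqrt (hermite_norm \<nu>)) * (g x * of_real (hermite_fun \<nu> x))" for x
      using hermite_norm_pos[of \<nu>] by (simp add: u_def hermite_fun_def)
    then show ?case by (simp only: integral_mult_right_zero orth real_poly_hermite mult_zero_right)
  next
    case (cmult f c)
    then have "(\<integral>x. of_real c * (u x * of_real (f x)) \<partial>lborel) = 0" by (simp only: integral_mult_right_zero mult_zero_right)
    then show ?case using cmult real_poly_cmult by (simp add: mult_ac)
  next
    case (add f h)
    have i: "integrable lborel (\<lambda>x. u x * of_real (q x))" if "real_poly q" for q
      using int_poly[OF that, of "\<lambda>x. 1" 1] by simp
    then have "(\<integral>x. u x * of_real (f x) + u x * of_real (h x) \<partial>lborel) = 0"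
      using add by (subst Bochner_Integration.integral_add) auto
    then show ?case using add real_poly.add by (simp add: distrib_left)
  qed
  have zk: "real_poly q \<Longrightarrow> (\<integral>x. u x * of_real (q x * exp (- (real k / 16) * (norm x)\<^sup>2)) \<partial>lborel) = 0" for q k
  proof (induction k arbitrary: q)
    case 0
    then show ?case using span0[OF hermite_span_poly[OF 0]] by simp
  next
    case (Suc k)
    have "(\<integral>x. u x * of_real (q x * exp ((- 1/16) * (norm x)\<^sup>2) * exp (- (real k / 16) * (norm x)\<^sup>2)) \<partial>lborel) = 0"
    proof (rule limit[OF Suc.prems, of _ _ 1])
      show "real_poly (\<lambda>x. (- 1/16) * (norm x)\<^sup>2)" by (intro real_poly_cmult real_poly_norm_sq)
      show "\<bar>exp \<bar>(- 1/16) * (norm x)\<^sup>2\<bar> * exp (- (real k / 16) * (norm x)\<^sup>2)\<bar> \<le> 1 * exp ((1/16) * (norm x)\<^sup>2)" for x :: "real^2"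
        by (simp add: abs_mult flip: exp_add)
    qed (use Suc.IH in \<open>auto simp: algebra_simps\<close>)
    moreover have "q x * exp ((- 1/16) * (norm x)\<^sup>2) * exp (- (real k / 16) * (norm x)\<^sup>2) = q x * exp (- (real (Suc k) / 16) * (norm x)\<^sup>2)" for x
      unfolding mult.assoc exp_add[symmetric] by (simp add: algebra_simps add_divide_distrib)
    ultimately show ?case by (simp only:)
  qed
  \<comment> \<open>Expanding the square about a leaves a constant, the radial Gaussian and exp of a
    multiple of a . x. The last factor comes from the limit step with h linear, whose exponential
    fits into the margin at the price of a constant depending on k and a.\<close>
  have gz: "(\<integral>x. u x * of_real (exp (- (real k / 16) * (norm (a - x))\<^sup>2)) \<partial>lborel) = 0" for k a
  proof -
    let ?h = "\<lambda>x. real k / 8 * (a $ 1 * x $ 1 + a $ 2 * x $ 2)"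
    have "(\<integral>x. u x * of_real (1 * exp (?h x) * exp (- (real k / 16) * (norm x)\<^sup>2)) \<partial>lborel) = 0"
    proof (rule limit[where q="\<lambda>x. 1" and h="?h" and C="exp ((real k)\<^sup>2 * (norm a)\<^sup>2 / 4)"])
      show "real_poly (\<lambda>x. 1)" by (rule real_poly.const)
      show "real_poly ?h" by (intro real_poly_cmult real_poly.add real_poly.coord)
      fix x
      have "\<bar>a $ 1 * x $ 1 + a $ 2 * x $ 2\<bar> = \<bar>a \<bullet> x\<bar>" by (simp add: inner_vec_def sum_2)
      also have "\<dots> \<le> norm a * norm x" by (rule Cauchy_Schwarz_ineq2)
      finally have "\<bar>?h x\<bar> \<le> real k / 8 * (norm a * norm x)" by (simp add: abs_mult mult_left_mono)
      also have "\<dots> \<le> (real k)\<^sup>2 * (norm a)\<^sup>2 / 4 + (1/16) * (norm x)\<^sup>2"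
      proof -
        have "2 * (real k * norm a / 2) * (norm x / 4) \<le> (real k * norm a / 2)\<^sup>2 + (norm x / 4)\<^sup>2" by (rule sum_squares_bound)
        then have "real k * (norm a * norm x) / 4 \<le> (real k)\<^sup>2 * (norm a)\<^sup>2 / 4 + (norm x)\<^sup>2 / 16"
          by (simp add: power_divide power_mult_distrib mult.assoc)
        moreover have "0 \<le> real k * (norm a * norm x)" by simp
        ultimately show ?thesis by linarith
      qed
      finally have h: "\<bar>?h x\<bar> \<le> (real k)\<^sup>2 * (norm a)\<^sup>2 / 4 + (1/16) * (norm x)\<^sup>2" .
      have "exp \<bar>?h x\<bar> * exp (- (real k / 16) * (norm x)\<^sup>2) \<le> exp \<bar>?h x\<bar> * 1"
        by (intro mult_left_mono) auto
      also have "\<dots> \<le> exp ((real k)\<^sup>2 * (norm a)\<^sup>2 / 4 + (1/16) * (norm x)\<^sup>2)" using h by simp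
      finally show "\<bar>exp \<bar>?h x\<bar> * exp (- (real k / 16) * (norm x)\<^sup>2)\<bar> \<le> exp ((real k)\<^sup>2 * (norm a)\<^sup>2 / 4) * exp ((1/16) * (norm x)\<^sup>2)"
        by (simp add: exp_add)
    qed (use zk in auto)
    then have "of_real (exp (- (real k / 16) * (norm a)\<^sup>2)) * (\<integral>x. u x * of_real (1 * exp (?h x) * exp (- (real k / 16) * (norm x)\<^sup>2)) \<partial>lborel) = 0"
      by simp
    then have "(\<integral>x. of_real (exp (- (real k / 16) * (norm a)\<^sup>2)) * (u x * of_real (1 * exp (?h x) * exp (- (real k / 16) * (norm x)\<^sup>2))) \<partial>lborel) = 0"
      by (simp only: integral_mult_right_zero)
    moreover have "of_real (exp (- (real k / 16) * (norm a)\<^sup>2)) * (u x * of_real (1 * exp (?h x) * exp (- (real k / 16) * (norm x)\<^sup>2))) =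
      u x * of_real (exp (- (real k / 16) * (norm (a - x))\<^sup>2))" for x
    proof -
      have "- (real k / 16) * (norm (a - x))\<^sup>2 = - (real k / 16) * (norm a)\<^sup>2 + (?h x + - (real k / 16) * (norm x)\<^sup>2)"
        unfolding norm2_sq by (simp add: power2_eq_square field_simps)
      then have "exp (- (real k / 16) * (norm (a - x))\<^sup>2) =
         exp (- (real k / 16) * (norm a)\<^sup>2) * (exp (?h x) * exp (- (real k / 16) * (norm x)\<^sup>2))"
        by (simp only: exp_add)
      then show ?thesis by (simp only: of_real_mult mult_1_left mult_ac)
    qed
    ultimately show ?thesis by (simp only:)
  qed
  \<comment> \<open>Chosen so that (n + 1)/16 times \<open>(e n)\<^sup>2\<close> is 1/4, the
    exponent in \<open>gauss\<close>: the Gaussians around a then are the Gaussian mollifier at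
    scale e n.\<close>
  define e where "e n = 2 / sqrt (real (Suc n))" for n
  have e: "\<And>n. e n > 0" "e \<longlonglongrightarrow> 0"
  proof -
    have "(\<lambda>n. 2 * sqrt (1 / real (Suc n))) \<longlonglongrightarrow> 2 * sqrt 0"
      by (intro tendsto_mult tendsto_const tendsto_real_sqrt tendsto_inverse_Suc)
    then show "e \<longlonglongrightarrow> 0" by (simp add: e_def[abs_def] real_sqrt_divide)
  qed (simp add: e_def)
  have mz: "mollify (\<lambda>x. gauss x / gauss_mass) (e n) u a = 0" for n a
  proof -
    let ?F = "\<lambda>x. u x * of_real (exp (- (real (Suc n) / 16) * (norm (a - x))\<^sup>2))"
    have "(\<integral>x. ?F x \<partial>lborel) = (- e n)\<^sup>2 *\<^sub>R (\<integral>y. ?F (a + (- e n) *\<^sub>R y) \<partial>lborel)"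
      using e(1)[of n] by (intro integral_affine) simp
    then have "(\<integral>y. ?F (a + (- e n) *\<^sub>R y) \<partial>lborel) = 0" using e(1)[of n] gz[of "Suc n" a] by simp
    then have "of_real (1 / (4 * pi * gauss_mass)) * (\<integral>y. ?F (a + (- e n) *\<^sub>R y) \<partial>lborel) = 0" by simp
    then have "(\<integral>y. of_real (1 / (4 * pi * gauss_mass)) * ?F (a + (- e n) *\<^sub>R y) \<partial>lborel) = 0"
      by (simp only: integral_mult_right_zero)
    moreover have "of_real (1 / (4 * pi * gauss_mass)) * ?F (a + (- e n) *\<^sub>R y) = (gauss y / gauss_mass) *\<^sub>R u (a - e n *\<^sub>R y)" for y
    proof -
      have "real (Suc n) / 16 * (norm (a - (a + (- e n) *\<^sub>R y)))\<^sup>2 = (norm y)\<^sup>2 / 4"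
        by (simp add: e_def power_mult_distrib power_divide del: of_nat_Suc)
      then have "- (real (Suc n) / 16) * (norm (a - (a + (- e n) *\<^sub>R y)))\<^sup>2 = - (norm y)\<^sup>2 / 4" by linarith
      then have "?F (a + (- e n) *\<^sub>R y) = u (a - e n *\<^sub>R y) * of_real (exp (- (norm y)\<^sup>2 / 4))" by simp
      then show ?thesis by (simp add: gauss_def scaleR_conv_of_real)
    qed
    ultimately show ?thesis unfolding mollify_def by (simp only:)
  qed
  have "L2_tendsto (\<lambda>n. mollify (\<lambda>x. gauss x / gauss_mass) (e n) u) u"
    by (rule gauss_kernel.mollify_tendsto[OF u2 e])
  then have "(\<lambda>n::nat. \<integral>x. (cmod (0 - u x))\<^sup>2 \<partial>lborel) \<longlonglongrightarrow> 0"
    unfolding L2_tendsto_def mz by blast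
  then have "(\<integral>x. (cmod (u x))\<^sup>2 \<partial>lborel) = 0"
    using LIMSEQ_unique[OF tendsto_const] by fastforce
  then have "AE x in lborel. (cmod (u x))\<^sup>2 = 0"
    by (subst (asm) integral_nonneg_eq_0_iff_AE[OF square_integrableD(2)[OF u2]]) auto
  then show ?thesis
    by eventually_elim (use gauss_pos in \<open>auto simp: u_def less_le\<close>)
qed

section \<open>Hermite expansion of square integrable functions\<close>

definition hermite_idx :: "nat \<Rightarrow> (2 \<Rightarrow> nat) set" where
  "hermite_idx N = {\<nu>. \<forall>j. \<nu> j \<le> N}"

lemma finite_hermite_idx: "finite (hermite_idx N)"
proof -
  have "hermite_idx N = PiE UNIV (\<lambda>_. {..N})" by (auto simp: hermite_idx_def PiE_def)
  then show ?thesis by (simp add: finite_PiE)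
qed

lemma hermite_idx_mono: "N \<le> M \<Longrightarrow> hermite_idx N \<subseteq> hermite_idx M"
  by (auto simp: hermite_idx_def intro: order_trans)

lemma hermite_idx_eventually:
  obtains N where "\<nu> \<in> hermite_idx N"
proof
  show "\<nu> \<in> hermite_idx (\<nu> 1 + \<nu> 2)"
    unfolding hermite_idx_def mem_Collect_eq
  proof
    fix j
    show "\<nu> j \<le> \<nu> 1 + \<nu> 2" using exhaust_2[of j] by auto
  qed
qed

lemma hermite_fun_inner:
  "(\<integral>x. complex_of_real (hermite_fun \<nu> x) * of_real (hermite_fun \<nu>' x) \<partial>lborel) = (if \<nu> = \<nu>' then 1 else 0)"
  unfolding of_real_mult[symmetric] integral_complex_of_real hermite_fun_orthonormal by simp

lemma hermite_sum_inner:
  assumes A: "finite A"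
  shows "(\<integral>x. (\<Sum>\<nu>\<in>A. a \<nu> * complex_of_real (hermite_fun \<nu> x)) * cnj (\<Sum>\<nu>\<in>A. b \<nu> * of_real (hermite_fun \<nu> x)) \<partial>lborel)
     = (\<Sum>\<nu>\<in>A. a \<nu> * cnj (b \<nu>))"
proof -
  note i = square_integrable_cauchy_schwarz(1)[OF hermite_fun_square_integrable hermite_fun_square_integrable]
  have "(\<integral>x. (\<Sum>\<nu>\<in>A. a \<nu> * complex_of_real (hermite_fun \<nu> x)) * cnj (\<Sum>\<nu>\<in>A. b \<nu> * of_real (hermite_fun \<nu> x)) \<partial>lborel) =
    (\<integral>x. (\<Sum>\<nu>\<in>A. \<Sum>\<kappa>\<in>A. (a \<nu> * cnj (b \<kappa>)) * (of_real (hermite_fun \<nu> x) * of_real (hermite_fun \<kappa> x))) \<partial>lborel)"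
    by (simp add: sum_product mult_ac)
  also have "\<dots> = (\<Sum>\<nu>\<in>A. \<Sum>\<kappa>\<in>A. (a \<nu> * cnj (b \<kappa>)) * (\<integral>x. of_real (hermite_fun \<nu> x) * of_real (hermite_fun \<kappa> x) \<partial>lborel))"
    by (simp add: Bochner_Integration.integral_sum integrable_mult_right i Bochner_Integration.integrable_sum)
  also have "\<dots> = (\<Sum>\<nu>\<in>A. a \<nu> * cnj (b \<nu>))"
    unfolding hermite_fun_inner by (simp add: if_distrib A cong: if_cong)
  finally show ?thesis .
qed

definition hermite_coeff :: "(real^2 \<Rightarrow> complex) \<Rightarrow> (2 \<Rightarrow> nat) \<Rightarrow> complex" where
  "hermite_coeff W \<nu> = (\<integral>x. W x * of_real (hermite_fun \<nu> x) \<partial>lborel)"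

definition hermite_proj :: "(real^2 \<Rightarrow> complex) \<Rightarrow> nat \<Rightarrow> real^2 \<Rightarrow> complex" where
  "hermite_proj W N x = (\<Sum>\<nu>\<in>hermite_idx N. hermite_coeff W \<nu> * of_real (hermite_fun \<nu> x))"

lemma hermite_sum_square_integrable: "square_integrable (\<lambda>x. \<Sum>\<nu>\<in>A. a \<nu> * of_real (hermite_fun \<nu> x))"
  by (intro square_integrable_sum square_integrable_cmult hermite_fun_square_integrable)

lemma norm_sq_integral: "complex_of_real (\<integral>x. (cmod (f x))\<^sup>2 \<partial>lborel) = (\<integral>x. f x * cnj (f x) \<partial>lborel)"
  unfolding integral_complex_of_real[symmetric] complex_norm_square ..

lemma hermite_sum_norm:
  assumes "finite A"
  shows "(\<integral>x. (cmod (\<Sum>\<nu>\<in>A. a \<nu> * of_real (hermite_fun \<nu> x)))\<^sup>2 \<partial>lborel) = (\<Sum>\<nu>\<in>A. (cmod (a \<nu>))\<^sup>2)"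
proof -
  have "complex_of_real (\<integral>x. (cmod (\<Sum>\<nu>\<in>A. a \<nu> * of_real (hermite_fun \<nu> x)))\<^sup>2 \<partial>lborel) = of_real (\<Sum>\<nu>\<in>A. (cmod (a \<nu>))\<^sup>2)"
    unfolding norm_sq_integral hermite_sum_inner[OF assms] of_real_sum complex_norm_square ..
  then show ?thesis by (simp only: of_real_eq_iff)
qed

lemma bessel:
  assumes W: "square_integrable W" and A: "finite A"
  shows "(\<Sum>\<nu>\<in>A. (cmod (hermite_coeff W \<nu>))\<^sup>2) \<le> (\<integral>x. (cmod (W x))\<^sup>2 \<partial>lborel)"
proof -
  define T where "T x = (\<Sum>\<nu>\<in>A. hermite_coeff W \<nu> * of_real (hermite_fun \<nu> x))" for x
  define s where "s = (\<Sum>\<nu>\<in>A. (cmod (hermite_coeff W \<nu>))\<^sup>2)"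
  have T: "square_integrable T" unfolding T_def[abs_def] by (rule hermite_sum_square_integrable)
  note cs = square_integrable_cauchy_schwarz(1)
  have i: "integrable lborel (\<lambda>x. W x * cnj (T x))" by (rule cs[OF W square_integrable_cnj[OF T]])
  define r where "r x = Re (W x * cnj (T x))" for x
  have ir: "integrable lborel r" unfolding r_def[abs_def] by (rule integrable_Re[OF i])
  have WT: "(\<integral>x. W x * cnj (T x) \<partial>lborel) = of_real s"
  proof -
    have "(\<integral>x. W x * cnj (T x) \<partial>lborel) = (\<integral>x. (\<Sum>\<nu>\<in>A. cnj (hermite_coeff W \<nu>) * (W x * of_real (hermite_fun \<nu> x))) \<partial>lborel)"
      by (intro Bochner_Integration.integral_cong refl) (simp add: T_def sum_distrib_left mult_ac)
    also have "\<dots> = (\<Sum>\<nu>\<in>A. cnj (hermite_coeff W \<nu>) * hermite_coeff W \<nu>)"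
      by (simp add: Bochner_Integration.integral_sum cs[OF W hermite_fun_square_integrable] hermite_coeff_def)
    finally show ?thesis by (simp add: s_def complex_norm_square mult.commute del: of_real_power)
  qed
  have TT: "(\<integral>x. (cmod (T x))\<^sup>2 \<partial>lborel) = s" unfolding T_def s_def by (rule hermite_sum_norm[OF A])
  have "0 \<le> (\<integral>x. (cmod (W x - T x))\<^sup>2 \<partial>lborel)" by (intro integral_nonneg_AE) auto
  also have "(\<integral>x. (cmod (W x - T x))\<^sup>2 \<partial>lborel) = (\<integral>x. (cmod (W x))\<^sup>2 + (cmod (T x))\<^sup>2 - 2 * r x \<partial>lborel)"
    unfolding r_def
    by (intro Bochner_Integration.integral_cong refl) (simp only: cmod_power2, simp add: power2_eq_square algebra_simps)
  also have "\<dots> = (\<integral>x. (cmod (W x))\<^sup>2 \<partial>lborel) + (\<integral>x. (cmod (T x))\<^sup>2 \<partial>lborel) - 2 * (\<integral>x. r x \<partial>lborel)"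
    using square_integrableD(2)[OF W] square_integrableD(2)[OF T] ir by simp
  also have "(\<integral>x. r x \<partial>lborel) = Re (\<integral>x. W x * cnj (T x) \<partial>lborel)"
    unfolding r_def by (rule integral_Re[OF i])
  finally show ?thesis unfolding WT TT by (simp add: s_def)
qed

text \<open>Bessel's inequality bounds the increasing sums of squared coefficients, and by
  orthonormality their differences are the squared L2 distances of the projections, which are
  therefore Cauchy. The limit has the same coefficients as W, so the difference is orthogonal to all
  Hermite functions and vanishes by completeness.\<close>

theorem hermite_expansion:
  assumes W: "square_integrable W"
  shows "L2_tendsto (hermite_proj W) W"
proof -
  define s where "s N = (\<Sum>\<nu>\<in>hermite_idx N. (cmod (hermite_coeff W \<nu>))\<^sup>2)" for N
  have smono: "s n \<le> s k" if "n \<le> k" for n k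
    unfolding s_def by (intro sum_mono2 finite_hermite_idx hermite_idx_mono that) auto
  have "convergent s"
    by (rule Bseq_mono_convergent)
      (auto intro!: BseqI'[of _ "\<integral>x. (cmod (W x))\<^sup>2 \<partial>lborel"] simp: smono, auto simp: s_def sum_nonneg intro!: bessel[OF W] finite_hermite_idx)
  then have "Cauchy s" by (rule convergent_Cauchy)
  have diff: "(\<integral>x. (cmod (hermite_proj W k x - hermite_proj W n x))\<^sup>2 \<partial>lborel) = s k - s n" if "n \<le> k" for n k
  proof -
    have sub: "hermite_idx n \<subseteq> hermite_idx k" by (rule hermite_idx_mono[OF that])
    have "hermite_proj W k x - hermite_proj W n x = (\<Sum>\<nu>\<in>hermite_idx k - hermite_idx n. hermite_coeff W \<nu> * of_real (hermite_fun \<nu> x))" for x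
      unfolding hermite_proj_def by (simp add: sum_diff[OF finite_hermite_idx sub])
    then have "(\<integral>x. (cmod (hermite_proj W k x - hermite_proj W n x))\<^sup>2 \<partial>lborel) =
      (\<Sum>\<nu>\<in>hermite_idx k - hermite_idx n. (cmod (hermite_coeff W \<nu>))\<^sup>2)"
      using hermite_sum_norm[of "hermite_idx k - hermite_idx n"] finite_hermite_idx by simp
    then show ?thesis unfolding s_def by (simp add: sum_diff[OF finite_hermite_idx sub])
  qed
  have P: "square_integrable (hermite_proj W n)" for n
    unfolding hermite_proj_def[abs_def] by (rule hermite_sum_square_integrable)
  obtain f where f: "L2_tendsto (hermite_proj W) f"
  proof (rule L2_cauchy_tendsto[OF P])
    fix e :: real assume "e > 0"
    then obtain M where M: "\<And>n k. n \<ge> M \<Longrightarrow> k \<ge> M \<Longrightarrow> \<bar>s n - s k\<bar> < e"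
      using \<open>Cauchy s\<close> unfolding Cauchy_def dist_real_def by meson
    have "(\<integral>x. (cmod (hermite_proj W n x - hermite_proj W k x))\<^sup>2 \<partial>lborel) < e" if "n \<ge> M" "k \<ge> M" for n k
    proof (cases "n \<le> k")
      case True
      then show ?thesis using diff[OF True] M[OF that] by (simp add: norm_minus_commute)
    next
      case False
      then show ?thesis using diff[of k n] M[OF that] by simp
    qed
    then show "\<exists>M. \<forall>n\<ge>M. \<forall>k\<ge>M. (\<integral>x. (cmod (hermite_proj W n x - hermite_proj W k x))\<^sup>2 \<partial>lborel) < e" by blast
  qed
  note f2 = L2_tendsto_square_integrable(2)[OF f]
  have orth: "(\<integral>x. (W x - f x) * of_real (hermite_fun \<nu> x) \<partial>lborel) = 0" for \<nu>
  proof -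
    note cs = square_integrable_cauchy_schwarz(1)
    have hc: "L2_tendsto (\<lambda>n x. of_real (hermite_fun \<nu> x)) (\<lambda>x. of_real (hermite_fun \<nu> x))"
      using hermite_fun_square_integrable by (simp add: L2_tendsto_def)
    obtain N where N: "\<nu> \<in> hermite_idx N" by (rule hermite_idx_eventually)
    have "(\<integral>x. hermite_proj W n x * of_real (hermite_fun \<nu> x) \<partial>lborel) = hermite_coeff W \<nu>" if "n \<ge> N" for n
    proof -
      have n: "\<nu> \<in> hermite_idx n" using N hermite_idx_mono[OF that] by auto
      have "(\<integral>x. hermite_proj W n x * of_real (hermite_fun \<nu> x) \<partial>lborel) =
        (\<integral>x. (\<Sum>\<kappa>\<in>hermite_idx n. hermite_coeff W \<kappa> * (of_real (hermite_fun \<kappa> x) * of_real (hermite_fun \<nu> x))) \<partial>lborel)"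
        by (simp add: hermite_proj_def sum_distrib_right mult.assoc)
      also have "\<dots> = (\<Sum>\<kappa>\<in>hermite_idx n. hermite_coeff W \<kappa> * (\<integral>x. of_real (hermite_fun \<kappa> x) * of_real (hermite_fun \<nu> x) \<partial>lborel))"
        by (simp add: Bochner_Integration.integral_sum cs[OF hermite_fun_square_integrable hermite_fun_square_integrable])
      also have "\<dots> = hermite_coeff W \<nu>"
        unfolding hermite_fun_inner using n by (simp add: if_distrib finite_hermite_idx cong: if_cong)
      finally show ?thesis .
    qed
    then have "\<forall>\<^sub>F n in sequentially. (\<integral>x. hermite_proj W n x * of_real (hermite_fun \<nu> x) \<partial>lborel) = hermite_coeff W \<nu>"
      by (auto simp: eventually_sequentially)
    then have "(\<lambda>n. \<integral>x. hermite_proj W n x * of_real (hermite_fun \<nu> x) \<partial>lborel) \<longlonglongrightarrow> hermite_coeff W \<nu>"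
      by (rule tendsto_eventually)
    from LIMSEQ_unique[OF this L2_tendsto_integral_mult[OF f hc]]
    have "(\<integral>x. f x * of_real (hermite_fun \<nu> x) \<partial>lborel) = hermite_coeff W \<nu>" by simp
    moreover have "(\<integral>x. (W x - f x) * of_real (hermite_fun \<nu> x) \<partial>lborel) =
       (\<integral>x. W x * of_real (hermite_fun \<nu> x) \<partial>lborel) - (\<integral>x. f x * of_real (hermite_fun \<nu> x) \<partial>lborel)"
      unfolding left_diff_distrib
      by (rule Bochner_Integration.integral_diff[OF cs[OF W hermite_fun_square_integrable] cs[OF f2 hermite_fun_square_integrable]])
    ultimately show ?thesis by (simp add: hermite_coeff_def)
  qed
  have ae: "AE x in lborel. W x - f x = 0"
    by (rule hermite_complete[OF square_integrable_diff[OF W f2] orth])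
  have [measurable]: "W \<in> borel_measurable borel" "f \<in> borel_measurable borel" "hermite_proj W n \<in> borel_measurable borel" for n
    using W f2 P by auto
  have "(\<integral>x. (cmod (hermite_proj W n x - W x))\<^sup>2 \<partial>lborel) = (\<integral>x. (cmod (hermite_proj W n x - f x))\<^sup>2 \<partial>lborel)" for n
    by (rule integral_cong_AE, measurable) (use ae in \<open>eventually_elim, simp\<close>)
  then show ?thesis using f W by (simp add: L2_tendsto_def)
qed

section \<open>Antisymmetry of the nonlocal term\<close>

lemma biot_savart_antisym:
  "(\<Sum>j\<in>UNIV. y $ j * biot_savart_kernel (y - x) $ j) = - (\<Sum>j\<in>UNIV. x $ j * biot_savart_kernel (x - y) $ j)"
proof -
  have n: "norm (y - x) = norm (x - y)" by (rule norm_minus_commute)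
  show ?thesis
    \<comment> \<open>Behind the algebra: K is odd and z . K(z) = 0, so y . K(x - y) equals x . K(x
      - y) and the sign comes from reversing the argument.\<close>
    unfolding sum_2 biot_savart_nth n by (simp add: algebra_simps diff_divide_distrib add_divide_distrib)
qed

text \<open>Exchanging the roles of the two variables changes the double integral J into - cnj J, by
  antisymmetry of the kernel x . K(x - y). The exchange needs absolute integrability: the integrand
  is estimated by |x| |w(x)| times the Riesz potential, and the weight a = 1 / (1 + |x|^2) makes
  both factors square integrable, with the compensating 1 + |x|^2 charged to w through
  \<open>xw\<close>.\<close>

lemma nonlocal_antisymmetric:
  assumes wm [measurable]: "w \<in> borel_measurable borel" and w2: "square_integrable w" and w1: "integrable lborel w"
    and xw: "square_integrable (\<lambda>x. of_real (norm x * (1 + (norm x)\<^sup>2)) * w x)"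
  shows "Re (\<integral>x. (\<Sum>j\<in>UNIV. of_real (x $ j) * vel w j x) * cnj (w x) \<partial>lborel) = 0"
proof -
  define M where "M x y = (\<Sum>j\<in>UNIV. x $ j * biot_savart_kernel (x - y) $ j)" for x y
  define H where "H x y = of_real (M x y) * (w y * cnj (w x))" for x y
  have Mm [measurable]: "(\<lambda>(x, y). M x y) \<in> borel_measurable (lborel \<Otimes>\<^sub>M lborel)"
    unfolding M_def by measurable
  have Hm [measurable]: "(\<lambda>(x, y). H x y) \<in> borel_measurable (lborel \<Otimes>\<^sub>M lborel)"
    unfolding H_def M_def by measurable
  define a where "a x = (1 + (norm x)\<^sup>2) powr (- 1)" for x :: "real^2"
  have s: "1 + (norm x)\<^sup>2 > 0" for x :: "real^2" by (simp add: add_pos_nonneg)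
  have [measurable]: "a \<in> borel_measurable borel" unfolding a_def[abs_def] by measurable
  have a1: "a x \<le> 1" for x
    unfolding a_def using powr_mono[of "-1" 0 "1 + (norm x)\<^sup>2"] s[of x] by simp
  have a2: "integrable lborel (\<lambda>x. (a x)\<^sup>2)"
  proof -
    have "(a x)\<^sup>2 = (1 + (norm x)\<^sup>2) powr (- 2)" for x
      unfolding a_def power2_eq_square[of "_ powr _"] powr_add[symmetric] by simp
    then show ?thesis using integrable_weight[of 2] by simp
  qed
  have ar: "(\<integral>\<^sup>+x. (ennreal (a x) * riesz w x)\<^sup>2 \<partial>lborel) < \<infinity>"
    by (rule riesz_weighted[OF wm w2 w1 _ _ a1 a2]) (auto simp: a_def)
  have [measurable]: "riesz w \<in> borel_measurable borel" by (rule riesz_borel[OF wm])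
  have "AE x in lborel. (ennreal (a x) * riesz w x)\<^sup>2 \<noteq> \<infinity>"
  proof (rule nn_integral_noteq_infinite)
    show "(\<lambda>x. (ennreal (a x) * riesz w x)\<^sup>2) \<in> borel_measurable lborel" by measurable
    show "(\<integral>\<^sup>+x. (ennreal (a x) * riesz w x)\<^sup>2 \<partial>lborel) \<noteq> \<infinity>" using ar by (metis less_irrefl)
  qed
  \<comment> \<open>Finiteness almost everywhere is what allows the inner integral to be split into
    the two velocity components; elsewhere those integrals may only have their default
    value.\<close>
  then have rfin: "AE x in lborel. riesz w x < \<infinity>"
  proof eventually_elim
    case (elim x)
    have "a x > 0" using s[of x] by (simp add: a_def)
    then show ?case using elim by (auto simp: less_top power2_eq_square ennreal_mult_eq_top_iff)
  qed
  have Mle: "\<bar>M x y\<bar> \<le> 2 * norm x * (1 / norm (x - y))" for x y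
  proof -
    have "\<bar>M x y\<bar> \<le> (\<Sum>j\<in>(UNIV :: 2 set). norm x * (1 / norm (x - y)))"
      unfolding M_def
    proof (rule order_trans[OF sum_abs sum_mono])
      fix j
      show "\<bar>x $ j * biot_savart_kernel (x - y) $ j\<bar> \<le> norm x * (1 / norm (x - y))"
        unfolding abs_mult by (intro mult_mono component_le_norm_cart biot_savart_le) auto
    qed
    then show ?thesis by simp
  qed
  have intH: "integrable (lborel \<Otimes>\<^sub>M lborel) (\<lambda>(x, y). H x y)"
  proof -
    have "(\<integral>\<^sup>+z. ennreal (norm (case z of (x, y) \<Rightarrow> H x y)) \<partial>(lborel \<Otimes>\<^sub>M lborel)) =
       (\<integral>\<^sup>+x. \<integral>\<^sup>+y. ennreal (norm (H x y)) \<partial>lborel \<partial>lborel)"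
    proof -
      have "(\<lambda>z. ennreal (norm (case z of (x, y) \<Rightarrow> H x y))) \<in> borel_measurable (lborel \<Otimes>\<^sub>M lborel)"
        by (rule measurable_compose[OF Hm]) measurable
      from lborel.nn_integral_fst[OF this, symmetric] show ?thesis by simp
    qed
    also have "\<dots> \<le> (\<integral>\<^sup>+x. ennreal (cmod (of_real (norm x * (1 + (norm x)\<^sup>2)) * w x)) * (2 * (ennreal (a x) * riesz w x)) \<partial>lborel)"
    proof (rule nn_integral_mono)
      fix x
      have "(\<integral>\<^sup>+y. ennreal (norm (H x y)) \<partial>lborel) \<le> (\<integral>\<^sup>+y. ennreal (2 * norm x * cmod (w x)) * ennreal (cmod (w y) / norm (x - y)) \<partial>lborel)"
      proof (rule nn_integral_mono)
        fix y
        have "norm (H x y) = \<bar>M x y\<bar> * (cmod (w y) * cmod (w x))" by (simp add: H_def norm_mult)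
        also have "\<dots> \<le> (2 * norm x * (1 / norm (x - y))) * (cmod (w y) * cmod (w x))"
          by (intro mult_right_mono Mle) auto
        also have "\<dots> = (2 * norm x * cmod (w x)) * (cmod (w y) / norm (x - y))" by simp
        finally show "ennreal (norm (H x y)) \<le> ennreal (2 * norm x * cmod (w x)) * ennreal (cmod (w y) / norm (x - y))"
          by (simp add: ennreal_leI flip: ennreal_mult)
      qed
      also have "\<dots> = ennreal (2 * norm x * cmod (w x)) * riesz w x"
        unfolding riesz_def by (rule nn_integral_cmult) measurable
      also have "ennreal (2 * norm x * cmod (w x)) = ennreal (cmod (of_real (norm x * (1 + (norm x)\<^sup>2)) * w x)) * (2 * ennreal (a x))"
      proof -
        have "(1 + (norm x)\<^sup>2) * a x = 1" using s[of x] by (simp add: a_def powr_minus_divide)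
        moreover have "(norm x * (1 + (norm x)\<^sup>2) * cmod (w x)) * (2 * a x) = (2 * norm x * cmod (w x)) * ((1 + (norm x)\<^sup>2) * a x)"
          by (simp only: mult_ac)
        ultimately have e1: "2 * norm x * cmod (w x) = (norm x * (1 + (norm x)\<^sup>2) * cmod (w x)) * (2 * a x)"
          by (simp only: mult_1_right)
        have e2: "cmod (of_real (norm x * (1 + (norm x)\<^sup>2)) * w x) = norm x * (1 + (norm x)\<^sup>2) * cmod (w x)"
          unfolding norm_mult norm_of_real using s[of x] by (simp add: abs_mult)
        have a0: "0 \<le> a x" by (simp add: a_def)
        have e3: "2 * ennreal (a x) = ennreal (2 * a x)" by (subst ennreal_mult) (simp_all add: a0)
        have b0: "0 \<le> norm x * (1 + (norm x)\<^sup>2) * cmod (w x)" by simp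
        show ?thesis
          unfolding e1 e2 e3 by (rule ennreal_mult[OF b0]) (simp add: a0)
      qed
      finally show "(\<integral>\<^sup>+y. ennreal (norm (H x y)) \<partial>lborel) \<le>
          ennreal (cmod (of_real (norm x * (1 + (norm x)\<^sup>2)) * w x)) * (2 * (ennreal (a x) * riesz w x))"
        by (simp only: mult.assoc)
    qed
    also have "\<dots> < \<infinity>"
    proof -
      let ?f = "\<lambda>x. ennreal (cmod (of_real (norm x * (1 + (norm x)\<^sup>2)) * w x))" and ?g = "\<lambda>x. 2 * (ennreal (a x) * riesz w x)"
      have "(\<integral>\<^sup>+x. ?f x * ?g x \<partial>lborel)\<^sup>2 \<le> (\<integral>\<^sup>+x. (?f x)\<^sup>2 \<partial>lborel) * (\<integral>\<^sup>+x. (?g x)\<^sup>2 \<partial>lborel)"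
        by (rule Cauchy_Schwarz_nn_integral) measurable
      also have "\<dots> < \<infinity>"
      proof -
        have "(\<integral>\<^sup>+x. (?f x)\<^sup>2 \<partial>lborel) < \<infinity>"
          using nn_square_integrable[OF xw] by (simp add: ennreal_power del: of_real_mult of_real_add)
        moreover have "(\<integral>\<^sup>+x. (?g x)\<^sup>2 \<partial>lborel) < \<infinity>"
        proof -
          have "(\<integral>\<^sup>+x. (?g x)\<^sup>2 \<partial>lborel) = (\<integral>\<^sup>+x. 4 * (ennreal (a x) * riesz w x)\<^sup>2 \<partial>lborel)"
            by (simp add: power_mult_distrib)
          also have "\<dots> = 4 * (\<integral>\<^sup>+x. (ennreal (a x) * riesz w x)\<^sup>2 \<partial>lborel)"
            by (rule nn_integral_cmult) measurable
          finally show ?thesis using ar by (simp add: ennreal_mult_less_top)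
        qed
        ultimately show ?thesis by (simp add: ennreal_mult_less_top)
      qed
      finally show ?thesis by (simp add: power_less_top_ennreal)
    qed
    finally show ?thesis using Hm by (simp add: integrable_iff_bounded)
  qed
  define J where "J = (\<integral>x. \<integral>y. H x y \<partial>lborel \<partial>lborel)"
  have "J = (\<integral>y. \<integral>x. H x y \<partial>lborel \<partial>lborel)"
    unfolding J_def using lborel_pair.Fubini_integral[OF intH] by simp
  also have "\<dots> = (\<integral>y. \<integral>x. - cnj (H y x) \<partial>lborel \<partial>lborel)"
  proof -
    have "H x y = - cnj (H y x)" for x y
      using biot_savart_antisym[of x y] by (simp add: H_def M_def mult_ac)
    then show ?thesis by (intro Bochner_Integration.integral_cong refl)
  qed
  also have "\<dots> = - cnj J" unfolding J_def by simp
  finally have "Re J = 0" by (simp add: complex_eq_iff)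
  moreover have "J = (\<integral>x. (\<Sum>j\<in>UNIV. of_real (x $ j) * vel w j x) * cnj (w x) \<partial>lborel)"
    unfolding J_def
  proof (rule integral_cong_AE)
    show "(\<lambda>x. \<integral>y. H x y \<partial>lborel) \<in> borel_measurable lborel" by measurable
    have [measurable]: "vel w j \<in> borel_measurable borel" for j by (rule vel_borel[OF wm])
    show "(\<lambda>x. (\<Sum>j\<in>UNIV. of_real (x $ j) * vel w j x) * cnj (w x)) \<in> borel_measurable lborel" by measurable
    show "AE x in lborel. (\<integral>y. H x y \<partial>lborel) = (\<Sum>j\<in>UNIV. of_real (x $ j) * vel w j x) * cnj (w x)"
      using rfin
    proof eventually_elim
      case (elim x)
      have i: "integrable lborel (\<lambda>y. of_real (biot_savart_kernel (x - y) $ j) * w y)" for j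
      proof -
        have "(\<integral>\<^sup>+y. ennreal (norm (of_real (biot_savart_kernel (x - y) $ j) * w y)) \<partial>lborel) \<le> riesz w x"
          unfolding riesz_def
        proof (rule nn_integral_mono, rule ennreal_leI)
          fix y
          show "norm (of_real (biot_savart_kernel (x - y) $ j) * w y) \<le> cmod (w y) / norm (x - y)"
            using mult_right_mono[OF biot_savart_le[of "x - y" j], of "cmod (w y)"] by (simp add: norm_mult)
        qed
        then show ?thesis using elim by (auto simp: integrable_iff_bounded intro: le_less_trans)
      qed
      have "(\<integral>y. H x y \<partial>lborel) = (\<integral>y. (\<Sum>j\<in>UNIV. (of_real (x $ j) * cnj (w x)) * (of_real (biot_savart_kernel (x - y) $ j) * w y)) \<partial>lborel)"
        by (intro Bochner_Integration.integral_cong refl) (simp add: H_def M_def sum_distrib_left sum_distrib_right mult_ac)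
      also have "\<dots> = (\<Sum>j\<in>UNIV. (of_real (x $ j) * cnj (w x)) * vel w j x)"
        unfolding vel_def by (simp add: Bochner_Integration.integral_sum i)
      also have "\<dots> = (\<Sum>j\<in>UNIV. of_real (x $ j) * vel w j x) * cnj (w x)"
        by (simp add: sum_distrib_left sum_distrib_right mult_ac)
      finally show ?case .
    qed
  qed
  ultimately show ?thesis by simp
qed

section \<open>Galerkin projection\<close>

text \<open>Polynomials become admissible in the weak equation after cutting off at radius \<open>n\<close> and letting \<open>n\<close> tend to infinity.\<close>

lemma weak_equation_poly:
  assumes weak: "weak_equation \<beta> g \<mu> w"
    and wm [measurable]: "w \<in> borel_measurable borel" and gm [measurable]: "g \<in> borel_measurable borel"
    and iw: "\<And>q. real_poly q \<Longrightarrow> integrable lborel (\<lambda>x. of_real (q x) * w x)"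
    and ig: "\<And>q. real_poly q \<Longrightarrow> integrable lborel (\<lambda>x. of_real (q x) * g x)"
    and \<beta>m [measurable]: "\<And>j. \<beta> j \<in> borel_measurable borel"
    and b: "real_poly b" "\<And>j x. \<bar>\<beta> j x\<bar> \<le> b x"
    and f: "real_poly f" "has_gradient f f'" "\<And>j. real_poly (f' j)" "\<And>j. has_gradient (f' j) (f'' j)" "\<And>j i. real_poly (f'' j i)"
  shows "(\<integral>x. w x * of_real (\<Sum>j\<in>UNIV. f'' j j x + \<beta> j x * f' j x) \<partial>lborel)
          + (\<integral>x. g x * of_real (f x) \<partial>lborel) = \<mu> * (\<integral>x. w x * of_real (f x) \<partial>lborel)"
proof -
  define Z where "Z x = complex_of_real (exp 1) * of_real (bump 0 (1 - (norm x)\<^sup>2))" for x :: "real^2"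
  have bZ: "bump_poly Z"
    unfolding Z_def[abs_def] using bump_poly.mult[OF bump_poly.const bump_poly.bump[of 0 0 1]] by simp
  obtain Z' where Z': "has_gradient Z Z'" "\<And>j. bump_poly (Z' j)" by (rule bump_poly_gradient[OF bZ]) blast
  have "\<exists>h. has_gradient (Z' j) h" for j
    by (rule bump_poly_gradient[OF Z'(2)]) blast
  then obtain Z'' where Z'': "\<And>j. has_gradient (Z' j) (Z'' j)" by metis
  have z0: "Z x = 0" if "norm x > 1" for x using bump_outside[OF that] by (simp add: Z_def)
  note z1 = has_gradient_zero_outside[OF Z'(1) z0]
  note z2 = has_gradient_zero_outside[OF Z'' z1]
  obtain C0 where C0: "C0 \<ge> 0" "\<And>x. cmod (Z x) \<le> C0"
    by (rule continuous_support_bound[OF has_gradientD(3)[OF Z'(1)] z0]) blast+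
  have "\<exists>C. \<forall>x. cmod (Z' j x) \<le> C" for j
    by (rule continuous_support_bound[OF has_gradientD(2)[OF Z'(1)] z1]) blast+
  then obtain C1 where C1: "\<And>j x. cmod (Z' j x) \<le> C1 j" by metis
  have "\<exists>C. \<forall>x. cmod (Z'' j j x) \<le> C" for j
    by (rule continuous_support_bound[OF has_gradientD(2)[OF Z''] z2]) blast+
  then obtain C2 where C2: "\<And>j x. cmod (Z'' j j x) \<le> C2 j" by metis
  have C12: "C1 j \<ge> 0" "C2 j \<ge> 0" for j
    using C1[of j 0] C2[of j 0] norm_ge_zero order_trans by blast+
  define C where "C = C0 + (\<Sum>j\<in>UNIV. C1 j + C2 j)"
  have "C1 j + C2 j \<le> (\<Sum>j\<in>UNIV. C1 j + C2 j)" for j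
    by (rule member_le_sum) (auto simp: C12 add_nonneg_nonneg)
  then have CC: "C0 \<le> C" "C1 j \<le> C" "C2 j \<le> C" for j
    using C0(1) C12[of j] C12[of undefined] sum_nonneg[of UNIV "\<lambda>j. C1 j + C2 j"] C12
    by (auto simp: C_def add_nonneg_nonneg intro: order_trans[of _ "C1 j + C2 j"])
      (smt (verit, ccfv_threshold) C12)+
  have C: "C \<ge> 0" using CC(1) C0(1) by simp
  define a where "a n = 1 / real (Suc n)" for n
  have a: "0 < a n" "a n \<le> 1" "\<bar>a n\<bar> \<le> 1" for n by (auto simp: a_def)
  have a0: "a \<longlonglongrightarrow> 0" unfolding a_def[abs_def] by (rule tendsto_inverse_Suc)
  define z where "z n x = Z (0 + a n *\<^sub>R x)" for n x
  define z' where "z' n j x = a n *\<^sub>R Z' j (0 + a n *\<^sub>R x)" for n j x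
  define z'' where "z'' n j i x = a n *\<^sub>R (a n *\<^sub>R Z'' j i (0 + a n *\<^sub>R x))" for n j i x
  have dz: "has_gradient (z n) (z' n)" for n
    unfolding z_def[abs_def] z'_def[abs_def] by (rule has_gradient_affine[OF Z'(1)])
  have dz': "has_gradient (z' n j) (z'' n j)" for n j
  proof -
    have "has_gradient (\<lambda>x. of_real (a n) * Z' j (0 + a n *\<^sub>R x)) (\<lambda>i x. of_real (a n) * (a n *\<^sub>R Z'' j i (0 + a n *\<^sub>R x)))"
      by (intro has_gradient_cmult has_gradient_affine Z'')
    then show ?thesis unfolding z'_def[abs_def] z''_def[abs_def] by (rule has_gradient_cong) (simp_all add: scaleR_conv_of_real)
  qed
  have bz: "bump_poly (z n)" for n
    unfolding z_def[abs_def] Z_def by (intro bump_poly.intros)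
  have zb: "cmod (z n x) \<le> C" "cmod (z' n j x) \<le> C" "cmod (z'' n j j x) \<le> C" for n j x
  proof -
    show "cmod (z n x) \<le> C" unfolding z_def using C0(2) CC(1) order_trans by blast
    show "cmod (z' n j x) \<le> C" unfolding z'_def norm_scaleR
      using mult_mono[OF a(3)[of n] order_trans[OF C1 CC(2)]] C by auto
    show "cmod (z'' n j j x) \<le> C" unfolding z''_def norm_scaleR mult.assoc[symmetric]
      using mult_mono[OF mult_mono[OF a(3)[of n] a(3)[of n]] order_trans[OF C2 CC(3)]] C by auto
  qed
  have ztends: "(\<lambda>n. z n x) \<longlonglongrightarrow> 1" "(\<lambda>n. z' n j x) \<longlonglongrightarrow> 0" "(\<lambda>n. z'' n j j x) \<longlonglongrightarrow> 0" for x j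
  proof -
    have ax: "(\<lambda>n. 0 + a n *\<^sub>R x) \<longlonglongrightarrow> 0"
      using tendsto_scaleR[OF a0 tendsto_const[of x]] by simp
    have c: "(\<lambda>n. k (0 + a n *\<^sub>R x)) \<longlonglongrightarrow> k 0" if "continuous_on UNIV k" for k :: "real^2 \<Rightarrow> complex"
      using that ax by (rule continuous_on_tendsto_compose) auto
    have "Z 0 = 1" by (simp add: Z_def bump_def exp_minus flip: of_real_mult)
    then show "(\<lambda>n. z n x) \<longlonglongrightarrow> 1" using c[OF has_gradientD(3)[OF Z'(1)]] by (simp add: z_def)
    show "(\<lambda>n. z' n j x) \<longlonglongrightarrow> 0"
      using tendsto_scaleR[OF a0 c[OF has_gradientD(2)[OF Z'(1), of j]]] by (simp add: z'_def)
    show "(\<lambda>n. z'' n j j x) \<longlonglongrightarrow> 0"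
      using tendsto_scaleR[OF a0 tendsto_scaleR[OF a0 c[OF has_gradientD(2)[OF Z'', of j j]]]] by (simp add: z''_def)
  qed
  define F where "F n x = of_real (f x) * z n x" for n x
  define F' where "F' n j x = of_real (f' j x) * z n x + of_real (f x) * z' n j x" for n j x
  define F'' where "F'' n j i x = (of_real (f'' j i x) * z n x + of_real (f' j x) * z' n i x)
      + (of_real (f' i x) * z' n j x + of_real (f x) * z'' n j i x)" for n j i x
  have dF: "has_gradient (F n) (F' n)" for n
    unfolding F_def[abs_def] F'_def[abs_def] by (intro has_gradient_mult has_gradient_of_real f dz)
  have dF': "has_gradient (F' n j) (F'' n j)" for n j
    unfolding F'_def[abs_def] F''_def[abs_def]
    by (intro has_gradient_add has_gradient_mult has_gradient_of_real f dz dz')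
  have eq: "(\<integral>x. w x * (\<Sum>j\<in>UNIV. F'' n j j x + of_real (\<beta> j x) * F' n j x) \<partial>lborel)
          + (\<integral>x. g x * F n x \<partial>lborel) = \<mu> * (\<integral>x. w x * F n x \<partial>lborel)" for n
  proof (rule weak_equationD[OF weak _ dF dF', where r = "real (Suc n)"])
    show "bump_poly (F n)"
      unfolding F_def[abs_def] by (intro bump_poly.mult real_poly_bump_poly f bz)
    fix x :: "real^2" assume "norm x > real (Suc n)"
    then have "norm (0 + a n *\<^sub>R x) > 1" by (simp add: a_def field_simps)
    then show "F n x = 0" by (simp add: F_def z_def z0)
  qed
  \<comment> \<open>The absolute value of a polynomial is not a polynomial, but 1 + h^2 is one and
    dominates |h|; integrability against w and g is assumed for polynomials only.\<close>
  define q where "q h x = 1 + h x * h x" for h :: "real^2 \<Rightarrow> real" and x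
  have pq: "real_poly (q h)" if "real_poly h" for h
    unfolding q_def[abs_def] by (intro real_poly.intros that)
  have q: "\<bar>h x\<bar> \<le> q h x" for h x
    unfolding q_def using sum_squares_bound[of 1 "\<bar>h x\<bar>"] by (simp add: power2_eq_square abs_mult_self_eq)
  define Q where "Q x = C * (\<Sum>j\<in>UNIV. (q (f'' j j) x + 2 * q (f' j) x + q f x) + b x * (q (f' j) x + q f x))" for x
  have pQ: "real_poly Q"
    unfolding Q_def[abs_def] by (intro real_poly_cmult real_poly_sum real_poly.add real_poly.mult pq f b)
  have pR: "real_poly (\<lambda>x. C * q f x)" by (intro real_poly_cmult pq f)
  note [measurable] = has_gradient_borel[OF dF] has_gradient_borel[OF dF'] real_poly_borel[OF f(1)] real_poly_borel[OF f(3)] real_poly_borel[OF f(5)]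
  have F_le: "cmod (F n x) \<le> C * q f x" for n x
  proof -
    have "cmod (F n x) \<le> q f x * C"
      unfolding F_def norm_mult norm_of_real by (intro mult_mono q zb) (use q[of f x] in linarith, simp)
    then show ?thesis by (simp only: mult.commute)
  qed
  have F'_le: "cmod (F' n j x) \<le> C * (q (f' j) x + q f x)" for n j x
  proof -
    have "cmod (F' n j x) \<le> \<bar>f' j x\<bar> * cmod (z n x) + \<bar>f x\<bar> * cmod (z' n j x)"
      unfolding F'_def by (rule order_trans[OF norm_triangle_ineq]) (simp add: norm_mult)
    also have "\<dots> \<le> q (f' j) x * C + q f x * C"
      by (intro add_mono mult_mono q zb) (use q[of f x] q[of "f' j" x] in \<open>auto\<close>)
    finally show ?thesis by (simp add: algebra_simps)
  qed
  have F''_le: "cmod (F'' n j j x) \<le> C * (q (f'' j j) x + 2 * q (f' j) x + q f x)" for n j x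
  proof -
    have "cmod (F'' n j j x) \<le> (\<bar>f'' j j x\<bar> * cmod (z n x) + \<bar>f' j x\<bar> * cmod (z' n j x)) + (\<bar>f' j x\<bar> * cmod (z' n j x) + \<bar>f x\<bar> * cmod (z'' n j j x))"
      unfolding F''_def by (intro order_trans[OF norm_triangle_ineq] add_mono) (simp_all add: norm_mult)
    also have "\<dots> \<le> (q (f'' j j) x * C + q (f' j) x * C) + (q (f' j) x * C + q f x * C)"
      by (intro add_mono mult_mono q zb) (use q[of f x] q[of "f' j" x] q[of "f'' j j" x] in \<open>auto\<close>)
    finally show ?thesis by (simp add: algebra_simps)
  qed
  have S_le: "cmod (\<Sum>j\<in>UNIV. F'' n j j x + of_real (\<beta> j x) * F' n j x) \<le> Q x" for n x
  proof -
    have "cmod (\<Sum>j\<in>UNIV. F'' n j j x + of_real (\<beta> j x) * F' n j x) \<le>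
      (\<Sum>j\<in>UNIV. C * (q (f'' j j) x + 2 * q (f' j) x + q f x) + b x * (C * (q (f' j) x + q f x)))"
    proof (rule order_trans[OF norm_sum sum_mono], rule order_trans[OF norm_triangle_ineq add_mono])
      fix j
      show "cmod (of_real (\<beta> j x) * F' n j x) \<le> b x * (C * (q (f' j) x + q f x))"
        unfolding norm_mult norm_of_real using b(2)[of j x]
        by (intro mult_mono b F'_le) auto
    qed (rule F''_le)
    then show ?thesis unfolding Q_def sum_distrib_left by (simp add: algebra_simps)
  qed
  have L1: "(\<lambda>n. \<integral>x. w x * (\<Sum>j\<in>UNIV. F'' n j j x + of_real (\<beta> j x) * F' n j x) \<partial>lborel)
     \<longlonglongrightarrow> (\<integral>x. w x * of_real (\<Sum>j\<in>UNIV. f'' j j x + \<beta> j x * f' j x) \<partial>lborel)"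
  proof (rule integral_dominated_convergence[where w = "\<lambda>x. cmod (of_real (Q x) * w x)"])
    show "integrable lborel (\<lambda>x. cmod (of_real (Q x) * w x))" by (intro integrable_norm iw pQ)
    show "AE x in lborel. (\<lambda>n. w x * (\<Sum>j\<in>UNIV. F'' n j j x + of_real (\<beta> j x) * F' n j x))
        \<longlonglongrightarrow> w x * of_real (\<Sum>j\<in>UNIV. f'' j j x + \<beta> j x * f' j x)"
    proof (rule AE_I2)
      fix x
      have "(\<lambda>n. w x * (\<Sum>j\<in>UNIV. F'' n j j x + of_real (\<beta> j x) * F' n j x)) \<longlonglongrightarrow>
         w x * (\<Sum>j\<in>UNIV. ((of_real (f'' j j x) * 1 + of_real (f' j x) * 0) + (of_real (f' j x) * 0 + of_real (f x) * 0))
           + of_real (\<beta> j x) * (of_real (f' j x) * 1 + of_real (f x) * 0))"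
        unfolding F''_def F'_def by (intro tendsto_intros ztends)
      then show "(\<lambda>n. w x * (\<Sum>j\<in>UNIV. F'' n j j x + of_real (\<beta> j x) * F' n j x))
        \<longlonglongrightarrow> w x * of_real (\<Sum>j\<in>UNIV. f'' j j x + \<beta> j x * f' j x)" by simp
    qed
    fix n
    show "AE x in lborel. norm (w x * (\<Sum>j\<in>UNIV. F'' n j j x + of_real (\<beta> j x) * F' n j x)) \<le> cmod (of_real (Q x) * w x)"
    proof (rule AE_I2)
      fix x
      show "norm (w x * (\<Sum>j\<in>UNIV. F'' n j j x + of_real (\<beta> j x) * F' n j x)) \<le> cmod (of_real (Q x) * w x)"
        unfolding norm_mult norm_of_real
        using mult_left_mono[OF order_trans[OF S_le[of n x] abs_ge_self], of "cmod (w x)"] by (simp only: mult.commute norm_ge_zero)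
    qed
  qed measurable
  have LF: "(\<lambda>n. \<integral>x. u x * F n x \<partial>lborel) \<longlonglongrightarrow> (\<integral>x. u x * of_real (f x) \<partial>lborel)"
    if [measurable]: "u \<in> borel_measurable borel" and iu: "\<And>q. real_poly q \<Longrightarrow> integrable lborel (\<lambda>x. of_real (q x) * u x)" for u
  proof (rule integral_dominated_convergence[where w = "\<lambda>x. cmod (of_real (C * q f x) * u x)"])
    show "integrable lborel (\<lambda>x. cmod (of_real (C * q f x) * u x))" by (intro integrable_norm iu pR)
    show "AE x in lborel. (\<lambda>n. u x * F n x) \<longlonglongrightarrow> u x * of_real (f x)"
    proof (rule AE_I2)
      fix x
      have "(\<lambda>n. u x * F n x) \<longlonglongrightarrow> u x * (of_real (f x) * 1)"
        unfolding F_def by (intro tendsto_intros ztends)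
      then show "(\<lambda>n. u x * F n x) \<longlonglongrightarrow> u x * of_real (f x)" by simp
    qed
    fix n
    show "AE x in lborel. norm (u x * F n x) \<le> cmod (of_real (C * q f x) * u x)"
    proof (rule AE_I2)
      fix x
      show "norm (u x * F n x) \<le> cmod (of_real (C * q f x) * u x)"
        unfolding norm_mult norm_of_real
        using mult_left_mono[OF order_trans[OF F_le[of n x] abs_ge_self], of "cmod (u x)"] by (simp only: mult.commute norm_ge_zero)
    qed
  qed measurable
  have l: "(\<lambda>n. \<mu> * (\<integral>x. w x * F n x \<partial>lborel)) \<longlonglongrightarrow> \<mu> * (\<integral>x. w x * of_real (f x) \<partial>lborel)"
    by (intro tendsto_mult_left LF wm iw)
  have r: "(\<lambda>n. (\<integral>x. w x * (\<Sum>j\<in>UNIV. F'' n j j x + of_real (\<beta> j x) * F' n j x) \<partial>lborel) + (\<integral>x. g x * F n x \<partial>lborel))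
     \<longlonglongrightarrow> (\<integral>x. w x * of_real (\<Sum>j\<in>UNIV. f'' j j x + \<beta> j x * f' j x) \<partial>lborel) + (\<integral>x. g x * of_real (f x) \<partial>lborel)"
    by (intro tendsto_add L1 LF gm ig)
  show ?thesis by (rule LIMSEQ_unique[OF r[unfolded eq] l])
qed

section \<open>Antisymmetry of the vortex advection\<close>

lemma swirl'_bounded:
  obtains K where "K \<ge> 0" "\<And>s. s \<ge> 0 \<Longrightarrow> \<bar>swirl' s\<bar> \<le> K"
proof -
  have "bounded (swirl' ` {0..1})"
    by (intro compact_imp_bounded compact_continuous_image continuous_on_subset[OF continuous_swirl']) auto
  then obtain C where C: "\<And>s. s \<in> {0..1} \<Longrightarrow> \<bar>swirl' s\<bar> \<le> C"
    by (metis bounded_iff imageI real_norm_def)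
  have big: "\<bar>swirl' s\<bar> \<le> 2" if s: "s > 1" for s
  proof -
    let ?e = "exp (- s / 4)"
    have e: "0 < ?e" "?e \<le> 1" using s by auto
    have "s / 4 * ?e \<le> 1"
    proof -
      have "s / 4 \<le> exp (s / 4)" using exp_ge_add_one_self[of "s / 4"] by linarith
      then have "s / 4 * ?e \<le> exp (s / 4) * ?e" using e by (intro mult_right_mono) auto
      then show ?thesis by (simp flip: exp_add)
    qed
    moreover have "0 \<le> s / 4 * ?e" using s e by (intro mult_nonneg_nonneg) auto
    moreover have "s * ?e / 4 = s / 4 * ?e" by simp
    ultimately have n: "\<bar>s * ?e / 4 - (1 - ?e)\<bar> \<le> 2" using e by linarith
    have s2: "1 \<le> s\<^sup>2" using s by (simp add: one_le_power)
    have "\<bar>s * ?e / 4 - (1 - ?e)\<bar> / s\<^sup>2 \<le> 2 / 1"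
      using n s2 by (intro frac_le) auto
    then show ?thesis using s by (simp add: swirl'_def)
  qed
  have "\<bar>swirl' s\<bar> \<le> max \<bar>C\<bar> 2" if "s \<ge> 0" for s
    using C[of s] big[of s] that by (cases "s \<le> 1") auto
  then show ?thesis using that[of "max \<bar>C\<bar> 2"] by auto
qed

lemma swirl_le: "s \<ge> 0 \<Longrightarrow> \<bar>swirl s\<bar> \<le> 1"
proof -
  assume s: "s \<ge> 0"
  have "1 - exp (- s / 4) \<le> s / 4" using exp_ge_add_one_self[of "- s / 4"] by linarith
  moreover have "0 \<le> 1 - exp (- s / 4)" using s by simp
  ultimately have "s > 0 \<Longrightarrow> \<bar>(1 - exp (- s / 4)) / s\<bar> \<le> 1" using s by (simp add: divide_le_eq)
  then show ?thesis using s by (auto simp: swirl_def)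
qed

text \<open>A polynomial majorant is enough for integrability against the Gaussian. It follows from
  boundedness of \<open>swirl\<close> and \<open>swirl'\<close>, the two coordinates in the product
  rule supplying the factor |x|^2.\<close>

lemma v_gauss'_growth:
  obtains b where "real_poly b" "\<And>j i x. \<bar>v_gauss' j i x\<bar> \<le> b x"
proof -
  obtain K where K: "K \<ge> 0" "\<And>s. s \<ge> 0 \<Longrightarrow> \<bar>swirl' s\<bar> \<le> K" by (rule swirl'_bounded) blast
  have p: "1 / (2 * pi) \<le> 1" using pi_ge_two by simp
  have "\<bar>v_gauss' j i x\<bar> \<le> 1 + 2 * K * (norm x)\<^sup>2" for j i x
  proof -
    let ?s = "(norm x)\<^sup>2"
    have c: "\<bar>x $ l\<bar> \<le> norm x" for l by (rule component_le_norm_cart)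
    have t: "\<bar>(if P then 1 else 0) * swirl ?s + x $ l * (swirl' ?s * (2 * x $ i))\<bar> \<le> 1 + 2 * K * ?s" for P l
    proof -
      have "\<bar>x $ l * (swirl' ?s * (2 * x $ i))\<bar> \<le> norm x * (K * (2 * norm x))"
        unfolding abs_mult by (intro mult_mono c K) (auto simp: K)
      also have "\<dots> = 2 * K * ?s" by (simp add: power2_eq_square)
      finally have "\<bar>x $ l * (swirl' ?s * (2 * x $ i))\<bar> \<le> 2 * K * ?s" .
      moreover have "\<bar>(if P then 1 else 0) * swirl ?s\<bar> \<le> 1" using swirl_le[of ?s] by auto
      ultimately show ?thesis by linarith
    qed
    have "\<exists>P l \<epsilon>. \<bar>\<epsilon>\<bar> \<le> 1 \<and> v_gauss' j i x = \<epsilon> * ((if P then 1 else 0) * swirl ?s + x $ l * (swirl' ?s * (2 * x $ i)))"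
    proof (cases "j = 1")
      case True
      show ?thesis
        by (rule exI[of _ "i = 2"], rule exI[of _ 2], rule exI[of _ "- (1 / (2 * pi))"])
          (use True p in \<open>auto simp: v_gauss'_def field_simps\<close>)
    next
      case False
      then have "j = 2" using exhaust_2[of j] by auto
      then show ?thesis
        by (intro exI[of _ "i = 1"] exI[of _ 1] exI[of _ "1 / (2 * pi)"])
          (use False p in \<open>auto simp: v_gauss'_def\<close>)
    qed
    then obtain P l \<epsilon> where *: "\<bar>\<epsilon>\<bar> \<le> 1" "v_gauss' j i x = \<epsilon> * ((if P then 1 else 0) * swirl ?s + x $ l * (swirl' ?s * (2 * x $ i)))" by blast
    show ?thesis
      unfolding *(2) abs_mult[of \<epsilon>] using mult_mono[OF *(1) t[of P l]] by simp
  qed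
  moreover have "real_poly (\<lambda>x. 1 + 2 * K * (norm x)\<^sup>2)"
    by (intro real_poly.add real_poly.const real_poly_cmult real_poly_norm_sq)
  ultimately show ?thesis using that by blast
qed

text \<open>The vortex field is divergence free and tangential to the circles on which the Gaussian is constant.\<close>

lemma advection_integral_zero:
  assumes r: "real_poly r" "has_gradient r r'" "\<And>j. real_poly (r' j)"
  shows "(\<integral>x. (\<Sum>j\<in>UNIV. v_gauss x $ j * r' j x) * gauss x \<partial>lborel) = 0"
proof -
  obtain b where b: "real_poly b" "\<And>j i x. \<bar>v_gauss' j i x\<bar> \<le> b x" by (rule v_gauss'_growth) blast
  define R where "R j i x = v_gauss' j i x * (r x * gauss x) + v_gauss x $ j * (r' i x * gauss x + r x * (- (x $ i) / 2 * gauss x))" for j i x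
  have dR: "has_gradient (\<lambda>x. v_gauss x $ j * (r x * gauss x)) (R j)" for j
    unfolding R_def[abs_def] by (intro has_gradient_mult has_gradient_v_gauss r has_gradient_gauss)
  note [measurable] = has_gradient_borel[OF dR] has_gradient_borel[OF has_gradient_v_gauss]
  have gi: "integrable lborel (\<lambda>x. \<bar>p x * gauss x\<bar>)" if "real_poly p" for p
    using real_poly_gauss_integrable[OF that] by (rule integrable_abs)
  have p: "real_poly (\<lambda>x. b x * r x)" "real_poly (\<lambda>x. x $ i / 2 * r x)" for i
    unfolding divide_inverse mult.commute[of _ "inverse 2"] mult.assoc
    by (intro real_poly.mult real_poly_cmult real_poly.coord b r)+
  have v: "\<bar>v_gauss x $ j * t\<bar> \<le> \<bar>t\<bar>" for x j t
    unfolding abs_mult using mult_right_mono[OF v_gauss_bounded[of x j], of "\<bar>t\<bar>"] by simp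
  have i0: "integrable lborel (\<lambda>x. v_gauss x $ j * (r x * gauss x))" for j
    by (rule integrable_dominated'[OF gi[OF r(1)]]) (simp_all add: v del: abs_mult)
  have i1: "integrable lborel (R j i)" for j i
  proof (rule integrable_dominated')
    show "integrable lborel (\<lambda>x. \<bar>(b x * r x) * gauss x\<bar> + (\<bar>r' i x * gauss x\<bar> + \<bar>(x $ i / 2 * r x) * gauss x\<bar>))"
      by (intro Bochner_Integration.integrable_add gi p r)
    fix x
    have "\<bar>v_gauss' j i x * (r x * gauss x)\<bar> \<le> \<bar>(b x * r x) * gauss x\<bar>"
      unfolding mult.assoc abs_mult[of _ "r x * gauss x"]
      by (rule mult_right_mono[OF order_trans[OF b(2) abs_ge_self]]) simp
    moreover have "\<bar>v_gauss x $ j * (r' i x * gauss x + r x * (- (x $ i) / 2 * gauss x))\<bar> \<le> \<bar>r' i x * gauss x\<bar> + \<bar>(x $ i / 2 * r x) * gauss x\<bar>"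
    proof -
      have "r x * (- (x $ i) / 2 * gauss x) = - ((x $ i / 2 * r x) * gauss x)" by simp
      then show ?thesis using v[of x j "r' i x * gauss x + r x * (- (x $ i) / 2 * gauss x)"] by linarith
    qed
    ultimately show "norm (R j i x) \<le> \<bar>(b x * r x) * gauss x\<bar> + (\<bar>r' i x * gauss x\<bar> + \<bar>(x $ i / 2 * r x) * gauss x\<bar>)"
      unfolding R_def real_norm_def by linarith
  qed simp
  have z: "(\<integral>x. R j j x \<partial>lborel) = 0" for j
  proof -
    have "(\<integral>x. complex_of_real (R j j x) \<partial>lborel) = 0"
      by (rule integral_gradient_zero[OF has_gradient_of_real[OF dR]]) (intro integrable_of_real i0 i1)+
    then show ?thesis by simp
  qed
  have "(\<Sum>j\<in>UNIV. v_gauss x $ j * r' j x) * gauss x = (\<Sum>j\<in>UNIV. R j j x)" for x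
  proof -
    have "(\<Sum>j\<in>UNIV. R j j x) = (\<Sum>j\<in>UNIV. v_gauss' j j x) * (r x * gauss x)
       + (\<Sum>j\<in>UNIV. v_gauss x $ j * r' j x) * gauss x - (\<Sum>j\<in>UNIV. x $ j * v_gauss x $ j) * (r x * gauss x / 2)"
      unfolding R_def sum_2 by (simp add: algebra_simps)
    then show ?thesis unfolding v_gauss_divergence_free v_gauss_orthogonal by simp
  qed
  then have "(\<integral>x. (\<Sum>j\<in>UNIV. v_gauss x $ j * r' j x) * gauss x \<partial>lborel) = (\<integral>x. (\<Sum>j\<in>UNIV. R j j x) \<partial>lborel)" by simp
  also have "\<dots> = 0" by (simp add: Bochner_Integration.integral_sum[OF i1] z)
  finally show ?thesis .
qed

text \<open>\<open>sqrt gauss\<close> times the \<open>j\<close>-th partial derivative of \<open>hermite_fun \<nu> / sqrt gauss\<close>.\<close>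

definition hermite_deriv :: "2 \<Rightarrow> (2 \<Rightarrow> nat) \<Rightarrow> real^2 \<Rightarrow> real" where
  "hermite_deriv j \<nu> x = real (\<nu> j) * hermite (\<nu>(j := \<nu> j - 1)) x * sqrt (gauss x) / sqrt (hermite_norm \<nu>)"

lemma hermite_deriv_borel [measurable]: "hermite_deriv j \<nu> \<in> borel_measurable borel"
  unfolding hermite_deriv_def[abs_def] using real_poly_borel[OF real_poly_hermite] by measurable

lemma hermite_deriv_mult:
  "hermite_deriv j \<nu> x * hermite_deriv j \<nu>' x = 1 / (sqrt (hermite_norm \<nu>) * sqrt (hermite_norm \<nu>')) *
    ((real (\<nu> j) * hermite (\<nu>(j := \<nu> j - 1)) x) * (real (\<nu>' j) * hermite (\<nu>'(j := \<nu>' j - 1)) x) * gauss x)"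
  using gauss_pos[of x] by (simp add: hermite_deriv_def less_imp_le)

lemma hermite_deriv_orthogonal:
  "(\<integral>x. hermite_deriv j \<nu> x * hermite_deriv j \<nu>' x \<partial>lborel) = (if \<nu> = \<nu>' then real (\<nu> j) / 2 else 0)"
proof -
  have "(\<integral>x. hermite_deriv j \<nu> x * hermite_deriv j \<nu>' x \<partial>lborel) =
    1 / (sqrt (hermite_norm \<nu>) * sqrt (hermite_norm \<nu>')) * (real (\<nu> j) / 2 * (\<integral>x. hermite \<nu> x * hermite \<nu>' x * gauss x \<partial>lborel))"
    unfolding hermite_deriv_mult hermite_dirichlet[symmetric] by (simp only: integral_mult_right_zero)
  then show ?thesis
    using hermite_orthogonal[of \<nu> \<nu>'] hermite_norm_pos[of \<nu>] by (auto simp flip: hermite_norm_def)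
qed

lemma hermite_deriv_square_integrable: "square_integrable (\<lambda>x. of_real (hermite_deriv j \<nu> x))"
proof -
  have "integrable lborel (\<lambda>x. hermite_deriv j \<nu> x * hermite_deriv j \<nu> x)"
    unfolding hermite_deriv_mult
    by (intro integrable_mult_right real_poly_gauss_integrable real_poly.mult real_poly.const real_poly_hermite)
  then show ?thesis by (simp add: square_integrable_def power2_eq_square)
qed

lemma hermite_deriv_sum_norm:
  assumes A: "finite A"
  shows "(\<integral>x. (cmod (\<Sum>\<nu>\<in>A. a \<nu> * of_real (hermite_deriv j \<nu> x)))\<^sup>2 \<partial>lborel) = (\<Sum>\<nu>\<in>A. real (\<nu> j) / 2 * (cmod (a \<nu>))\<^sup>2)"
proof -
  note i = square_integrable_cauchy_schwarz(1)[OF hermite_deriv_square_integrable hermite_deriv_square_integrable]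
  have inner: "(\<integral>x. complex_of_real (hermite_deriv j \<nu> x) * of_real (hermite_deriv j \<kappa> x) \<partial>lborel) = of_real (if \<nu> = \<kappa> then real (\<nu> j) / 2 else 0)" for \<nu> \<kappa>
    unfolding of_real_mult[symmetric] integral_complex_of_real hermite_deriv_orthogonal ..
  have "complex_of_real (\<integral>x. (cmod (\<Sum>\<nu>\<in>A. a \<nu> * of_real (hermite_deriv j \<nu> x)))\<^sup>2 \<partial>lborel) =
    (\<integral>x. (\<Sum>\<nu>\<in>A. \<Sum>\<kappa>\<in>A. (a \<nu> * cnj (a \<kappa>)) * (of_real (hermite_deriv j \<nu> x) * of_real (hermite_deriv j \<kappa> x))) \<partial>lborel)"
    unfolding norm_sq_integral by (simp add: sum_product mult_ac)
  also have "\<dots> = (\<Sum>\<nu>\<in>A. \<Sum>\<kappa>\<in>A. (a \<nu> * cnj (a \<kappa>)) * (\<integral>x. of_real (hermite_deriv j \<nu> x) * of_real (hermite_deriv j \<kappa> x) \<partial>lborel))"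
    by (simp add: Bochner_Integration.integral_sum integrable_mult_right i Bochner_Integration.integrable_sum)
  also have "\<dots> = (\<Sum>\<nu>\<in>A. (a \<nu> * cnj (a \<nu>)) * of_real (real (\<nu> j) / 2))"
    unfolding inner by (simp add: if_distrib A cong: if_cong)
  also have "\<dots> = of_real (\<Sum>\<nu>\<in>A. real (\<nu> j) / 2 * (cmod (a \<nu>))\<^sup>2)"
    unfolding complex_norm_square[symmetric] of_real_sum of_real_mult by (simp only: mult.commute)
  finally show ?thesis by (simp only: of_real_eq_iff)
qed

text \<open>Writing S as P sqrt gauss with a complex polynomial P, the real part of the integrand is
  half of v . grad |P|^2 times \<open>gauss\<close>, which integrates to 0. Re and Im of the
  coefficients are separated because |P|^2 has to be presented as a real polynomial.\<close>

lemma hermite_sum_advection_antisymmetric: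
  assumes A: "finite A"
  shows "Re (\<integral>x. (\<Sum>\<nu>\<in>A. c \<nu> * of_real (hermite_fun \<nu> x)) *
      cnj (\<Sum>j\<in>UNIV. of_real (v_gauss x $ j) * (\<Sum>\<nu>\<in>A. c \<nu> * of_real (hermite_deriv j \<nu> x))) \<partial>lborel) = 0"
    (is "Re (\<integral>x. ?S x * cnj (?V x) \<partial>lborel) = 0")
proof -
  define e where "e \<nu> x = 1 / sqrt (hermite_norm \<nu>) * hermite \<nu> x" for \<nu> x
  define e' where "e' \<nu> j x = 1 / sqrt (hermite_norm \<nu>) * (real (\<nu> j) * hermite (\<nu>(j := \<nu> j - 1)) x)" for \<nu> j x
  have de: "has_gradient (e \<nu>) (e' \<nu>)" for \<nu>
    unfolding e_def[abs_def] e'_def[abs_def] by (intro has_gradient_cmult has_gradient_hermite)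
  have pe: "real_poly (e \<nu>)" "real_poly (e' \<nu> j)" for \<nu> j
    unfolding e_def[abs_def] e'_def[abs_def] by (intro real_poly_cmult real_poly_hermite)+
  define p where "p a x = (\<Sum>\<nu>\<in>A. a \<nu> * e \<nu> x)" for a :: "(2 \<Rightarrow> nat) \<Rightarrow> real" and x
  define p' where "p' a j x = (\<Sum>\<nu>\<in>A. a \<nu> * e' \<nu> j x)" for a :: "(2 \<Rightarrow> nat) \<Rightarrow> real" and j x
  have dp: "has_gradient (p a) (p' a)" for a
    unfolding p_def[abs_def] p'_def[abs_def] by (intro has_gradient_sum has_gradient_cmult de)
  have pp: "real_poly (p a)" "real_poly (p' a j)" for a j
    unfolding p_def[abs_def] p'_def[abs_def] by (intro real_poly_sum real_poly_cmult pe)+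
  define a b where "a \<nu> = Re (c \<nu>)" and "b \<nu> = Im (c \<nu>)" for \<nu>
  define r where "r x = p a x * p a x + p b x * p b x" for x
  define r' where "r' j x = (p' a j x * p a x + p a x * p' a j x) + (p' b j x * p b x + p b x * p' b j x)" for j x
  have dr: "has_gradient r r'" unfolding r_def[abs_def] r'_def[abs_def]
    by (intro has_gradient_add has_gradient_mult dp)
  have pr: "real_poly r" "real_poly (r' j)" for j
    unfolding r_def[abs_def] r'_def[abs_def] by (intro real_poly.add real_poly.mult pp)+
  have tS: "c \<nu> * of_real (hermite_fun \<nu> x) = Complex (a \<nu> * e \<nu> x * sqrt (gauss x)) (b \<nu> * e \<nu> x * sqrt (gauss x))" for \<nu> x
    by (simp add: complex_eq_iff a_def b_def e_def hermite_fun_def)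
  have tG: "c \<nu> * of_real (hermite_deriv j \<nu> x) = Complex (a \<nu> * e' \<nu> j x * sqrt (gauss x)) (b \<nu> * e' \<nu> j x * sqrt (gauss x))" for j \<nu> x
    by (simp add: complex_eq_iff a_def b_def e'_def hermite_deriv_def)
  have S: "?S x = Complex (p a x * sqrt (gauss x)) (p b x * sqrt (gauss x))" for x
    unfolding tS by (simp add: complex_eq_iff p_def sum_distrib_right)
  have G: "(\<Sum>\<nu>\<in>A. c \<nu> * of_real (hermite_deriv j \<nu> x)) = Complex (p' a j x * sqrt (gauss x)) (p' b j x * sqrt (gauss x))" for j x
    unfolding tG by (simp add: complex_eq_iff p'_def sum_distrib_right)
  have Re: "Re (?S x * cnj (?V x)) = 1 / 2 * ((\<Sum>j\<in>UNIV. v_gauss x $ j * r' j x) * gauss x)" for x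
  proof -
    define y where "y = sqrt (gauss x)"
    have y: "gauss x = y * y" using gauss_pos[of x] by (simp add: y_def)
    show ?thesis unfolding S G sum_2 r'_def y_def[symmetric] unfolding y by (simp add: algebra_simps)
  qed
  have int: "integrable lborel (\<lambda>x. ?S x * cnj (?V x))"
  proof (rule square_integrable_cauchy_schwarz(1)[OF hermite_sum_square_integrable square_integrable_cnj])
    show "square_integrable ?V"
    proof (rule square_integrable_sum)
      fix j
      have [measurable]: "(\<lambda>x. v_gauss x $ j) \<in> borel_measurable borel" by (rule has_gradient_borel(1)[OF has_gradient_v_gauss])
      show "square_integrable (\<lambda>x. of_real (v_gauss x $ j) * (\<Sum>\<nu>\<in>A. c \<nu> * of_real (hermite_deriv j \<nu> x)))"
        by (rule square_integrable_mult_bounded[where C = 1], intro square_integrable_sum square_integrable_cmult hermite_deriv_square_integrable)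
          (simp_all add: v_gauss_bounded)
    qed
  qed
  have "Re (\<integral>x. ?S x * cnj (?V x) \<partial>lborel) = (\<integral>x. Re (?S x * cnj (?V x)) \<partial>lborel)"
    by (rule integral_Re[OF int, symmetric])
  also have "\<dots> = 0"
    unfolding Re integral_mult_right_zero advection_integral_zero[OF pr(1) dr pr(2)] by simp
  finally show ?thesis .
qed

lemma gauss_sqrt_decay_bound:
  assumes "m > 1"
  shows "1 / sqrt (gauss x) \<le> sqrt (4 * pi) * decay_weight m x"
proof -
  have e: "exp (- (norm x)\<^sup>2 / 4) = exp (- ((norm x)\<^sup>2 / 8)) * exp (- ((norm x)\<^sup>2 / 8))"
    by (simp flip: exp_add)
  have "sqrt (gauss x) = exp (- ((norm x)\<^sup>2 / 8)) / sqrt (4 * pi)"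
    unfolding gauss_def e real_sqrt_mult real_sqrt_divide by simp
  then have "1 / sqrt (gauss x) = sqrt (4 * pi) * exp ((norm x)\<^sup>2 / 8)"
    by (simp add: exp_minus inverse_eq_divide)
  moreover have "1 \<le> (1 + (norm x)\<^sup>2) powr (m / 2)" using assms by (intro ge_one_powr_ge_zero) auto
  then have "exp ((norm x)\<^sup>2 / 8) \<le> decay_weight m x"
    unfolding decay_weight_def using mult_right_mono[of 1 "(1 + (norm x)\<^sup>2) powr (m / 2)" "exp ((norm x)\<^sup>2 / 8)"] by simp
  ultimately show ?thesis by (simp add: mult_left_mono)
qed

text \<open>The weight is at least exp (s/8) and so dominates every polynomial with a factor (1 +
  s)^2 to spare; that factor is square integrable when inverted, which gives L1 as well as L2. The
  lemma is applied both to w and to its nonlocal term.\<close>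

lemma decay_poly_integrable:
  assumes m: "m > 1" and wm [measurable]: "w \<in> borel_measurable borel"
    and dw: "square_integrable (\<lambda>x. of_real (decay_weight m x) * w x)" and q: "real_poly q"
  shows "integrable lborel (\<lambda>x. of_real (q x) * w x)" and "square_integrable (\<lambda>x. of_real (q x) * w x)"
proof -
  note [measurable] = real_poly_borel[OF q]
  obtain K where K: "K \<ge> 0" "\<And>x. \<bar>q x\<bar> * exp (- (1/8) * (norm x)\<^sup>2) \<le> K * (1 + (norm x)\<^sup>2) powr (- 2)"
    by (rule real_poly_exp_bound[OF q, of "1/8"]) auto
  have le: "\<bar>q x\<bar> \<le> K * (1 + (norm x)\<^sup>2) powr (- 2) * decay_weight m x" for x
  proof -
    have "\<bar>q x\<bar> = (\<bar>q x\<bar> * exp (- (1/8) * (norm x)\<^sup>2)) * exp ((norm x)\<^sup>2 / 8)"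
      by (simp add: mult.assoc flip: exp_add)
    also have "\<dots> \<le> (K * (1 + (norm x)\<^sup>2) powr (- 2)) * exp ((norm x)\<^sup>2 / 8)"
      by (intro mult_right_mono K) simp
    also have "\<dots> \<le> (K * (1 + (norm x)\<^sup>2) powr (- 2)) * decay_weight m x"
    proof (rule mult_left_mono)
      have "1 \<le> (1 + (norm x)\<^sup>2) powr (m / 2)" using m by (intro ge_one_powr_ge_zero) auto
      then show "exp ((norm x)\<^sup>2 / 8) \<le> decay_weight m x"
        unfolding decay_weight_def using mult_right_mono[of 1 "(1 + (norm x)\<^sup>2) powr (m / 2)" "exp ((norm x)\<^sup>2 / 8)"] by simp
    qed (use K in simp)
    finally show ?thesis .
  qed
  have s: "1 \<le> 1 + (norm x)\<^sup>2" for x :: "real^2" by simp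
  have p1: "(1 + (norm x)\<^sup>2) powr (- 2) \<le> 1" for x :: "real^2"
    using powr_mono[of "-2" 0 "1 + (norm x)\<^sup>2"] s[of x] by (simp add: add_pos_nonneg)
  define k where "k x = complex_of_real ((1 + (norm x)\<^sup>2) powr (- 2))" for x :: "real^2"
  have km [measurable]: "k \<in> borel_measurable borel" unfolding k_def[abs_def] by measurable
  have k2: "square_integrable k"
  proof -
    have "(cmod (k x))\<^sup>2 = (1 + (norm x)\<^sup>2) powr (- 4)" for x
      unfolding k_def norm_of_real power2_abs power2_eq_square[of "_ powr _"] powr_add[symmetric] by simp
    then show ?thesis using integrable_weight[of 4] by (simp add: square_integrable_def)
  qed
  have cle: "cmod (of_real (q x) * w x) \<le> K * cmod (k x * (of_real (decay_weight m x) * w x))" for x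
    using mult_right_mono[OF le[of x], of "cmod (w x)"] by (simp add: norm_mult k_def decay_weight_nonneg mult_ac)
  show "integrable lborel (\<lambda>x. of_real (q x) * w x)"
    by (rule integrable_dominated'[OF integrable_mult_right[OF integrable_norm[OF square_integrable_cauchy_schwarz(1)[OF k2 dw]], of K] cle]) simp
  show "square_integrable (\<lambda>x. of_real (q x) * w x)"
  proof (rule square_integrable_bound[OF square_integrable_mult_bounded[OF dw km, of 1]])
    show "cmod (k x) \<le> 1" for x using p1[of x] by (simp add: k_def)
  qed (use cle in auto)
qed

text \<open>D n may be unbounded. The inequality 2 a y \<le> y^2 + a^2 with y^2 = 2 D n turns the
  mixed error into \<delta> n times D n plus \<delta> n times a constant; for \<delta> n < 1 the
  negative term absorbs the first part, and what is left, (1 - \<delta> n) D n, is still at least (1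
  - \<delta> n) \<kappa> s n.\<close>

lemma galerkin_limit:
  fixes s D \<delta> :: "nat \<Rightarrow> real"
  assumes ineq: "\<And>n. M * s n \<le> - D n + a * (\<delta> n * sqrt (2 * D n)) + b * \<delta> n"
    and D: "\<And>n. \<kappa> * s n \<le> D n" "\<And>n. 0 \<le> D n" and s: "\<And>n. 0 \<le> s n" "s \<longlonglongrightarrow> S"
    and \<delta>: "\<And>n. 0 \<le> \<delta> n" "\<delta> \<longlonglongrightarrow> 0"
  shows "(M + \<kappa>) * S \<le> 0"
proof -
  have "\<forall>\<^sub>F n in sequentially. \<delta> n < 1" using \<delta>(2) by (rule order_tendstoD) simp
  then have "\<forall>\<^sub>F n in sequentially. (M + \<kappa>) * s n \<le> \<delta> n * (\<kappa> * s n + a\<^sup>2 / 2 + b)"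
  proof eventually_elim
    case (elim n)
    define y where "y = sqrt (2 * D n)"
    have y: "y\<^sup>2 = 2 * D n" unfolding y_def using D(2)[of n] by simp
    have "0 \<le> (y - a)\<^sup>2" by simp
    then have "2 * (a * y) \<le> 2 * D n + a\<^sup>2" using y by (simp add: power2_diff mult.commute)
    then have 1: "\<delta> n * (a * y) \<le> \<delta> n * (D n + a\<^sup>2 / 2)" by (intro mult_left_mono \<delta>) linarith
    have 2: "(1 - \<delta> n) * (\<kappa> * s n) \<le> (1 - \<delta> n) * D n" using elim by (intro mult_left_mono D) simp
    have "M * s n \<le> - D n + \<delta> n * (a * y) + b * \<delta> n" using ineq[of n] by (simp add: y_def mult.left_commute)
    with 1 2 show ?case by (simp add: algebra_simps)
  qed
  moreover have "(\<lambda>n. (M + \<kappa>) * s n) \<longlonglongrightarrow> (M + \<kappa>) * S" by (intro tendsto_intros s)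
  moreover have "(\<lambda>n. \<delta> n * (\<kappa> * s n + a\<^sup>2 / 2 + b)) \<longlonglongrightarrow> 0 * (\<kappa> * S + a\<^sup>2 / 2 + b)" by (intro tendsto_intros s \<delta>)
  ultimately show ?thesis by (intro tendsto_le[where f = "\<lambda>n. \<delta> n * (\<kappa> * s n + a\<^sup>2 / 2 + b)" and F = sequentially]) auto
qed

text \<open>
  Testing with the Hermite partial sums of \<open>w\<close> makes the diffusion diagonal, while the advection and
  the nonlocal term only see the truncation error, being antisymmetric.
\<close>

theorem galerkin_vanishing:
  fixes w :: "real^2 \<Rightarrow> complex"
  assumes m: "m > 1" and wm [measurable]: "w \<in> borel_measurable borel"
    and w2: "square_integrable w" and w1: "integrable lborel w"
    and dw: "square_integrable (\<lambda>x. of_real (decay_weight m x) * w x)"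
    and weak: "weak_equation (lin_drift \<alpha>) (\<lambda>x. of_real (\<alpha> / 2) * nonlocal w x) \<mu> w"
    and low: "\<And>\<nu>. \<nu> 1 + \<nu> 2 < k \<Longrightarrow> (\<integral>x. w x * of_real (hermite \<nu> x) \<partial>lborel) = 0"
    and \<mu>: "Re \<mu> > - (real k / 2)"
  shows "AE x in lborel. w x = 0"
proof -
  \<comment> \<open>The decay weight dominates a constant multiple of 1 / E, so dividing by E keeps
    w and its nonlocal term in L2.\<close>
  define E where "E x = sqrt (gauss x)" for x
  have E: "E x > 0" "E x * E x = gauss x" for x using gauss_pos[of x] by (simp_all add: E_def)
  have Em [measurable]: "E \<in> borel_measurable borel" unfolding E_def[abs_def] by measurable
  have nm [measurable]: "nonlocal w \<in> borel_measurable borel" by (rule nonlocal_borel[OF wm])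
  have vm [measurable]: "(\<lambda>x. v_gauss x $ j) \<in> borel_measurable borel" for j
    by (rule has_gradient_borel(1)[OF has_gradient_v_gauss])
  have hm [measurable]: "hermite \<nu> \<in> borel_measurable borel" for \<nu> by (rule real_poly_borel[OF real_poly_hermite])
  have dn: "square_integrable (\<lambda>x. of_real (decay_weight m x) * nonlocal w x)"
  proof -
    obtain C where C: "\<And>p. p \<in> borel_measurable borel \<Longrightarrow> (\<And>x. 0 \<le> p x) \<Longrightarrow> (\<And>x. p x \<le> decay_weight m x) \<Longrightarrow>
       square_integrable (\<lambda>x. of_real (p x) * nonlocal w x) \<and>
       (\<integral>x. (cmod (of_real (p x) * nonlocal w x))\<^sup>2 \<partial>lborel) \<le> C"
      using nonlocal_decay_weighted[OF wm w2 w1, of m] m by auto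
    show ?thesis by (rule conjunct1[OF C]) (auto simp: decay_weight_nonneg)
  qed
  have div: "square_integrable (\<lambda>x. f x / of_real (E x))"
    if [measurable]: "f \<in> borel_measurable borel" and f: "square_integrable (\<lambda>x. of_real (decay_weight m x) * f x)" for f
  proof (rule square_integrable_bound[OF f])
    have "cmod (f x / of_real (E x)) \<le> sqrt (4 * pi) * cmod (of_real (decay_weight m x) * f x)" for x
      using mult_right_mono[OF gauss_sqrt_decay_bound[OF m, of x], of "cmod (f x)"] E(1)[of x]
      by (simp add: norm_mult norm_divide decay_weight_nonneg E_def mult.assoc)
    then show "AE x in lborel. cmod (f x / of_real (E x)) \<le> sqrt (4 * pi) * cmod (of_real (decay_weight m x) * f x)" by simp
  qed measurable
  define W where "W x = w x / of_real (E x)" for x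
  \<comment> \<open>Since \<open>nonlocal\<close> contains the factor E^2, Q times cnj W is x . v
    times cnj w: the Gaussian cancels and the antisymmetric kernel is exposed.\<close>
  define Q where "Q x = nonlocal w x / of_real (E x)" for x
  have W2: "square_integrable W" unfolding W_def[abs_def] by (rule div[OF wm dw])
  have Q2: "square_integrable Q" unfolding Q_def[abs_def] by (rule div[OF nm dn])
  note Wm [measurable] = square_integrableD(1)[OF W2] and Qm [measurable] = square_integrableD(1)[OF Q2]
  note cs = square_integrable_cauchy_schwarz(1)
  define c where "c \<nu> = hermite_coeff W \<nu>" for \<nu>
  define deg where "deg \<nu> = real (\<nu> 1 + \<nu> 2) / 2" for \<nu> :: "2 \<Rightarrow> nat"
  define vd where "vd \<nu> x = (\<Sum>j\<in>UNIV. v_gauss x $ j * hermite_deriv j \<nu> x)" for \<nu> x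
  have vd2: "square_integrable (\<lambda>x. of_real (vd \<nu> x))" for \<nu>
    unfolding vd_def of_real_sum of_real_mult
    by (intro square_integrable_sum square_integrable_mult_bounded[where C = 1] hermite_deriv_square_integrable)
      (simp_all add: v_gauss_bounded)
  define t where "t \<nu> = (\<integral>x. W x * of_real (vd \<nu> x) \<partial>lborel)" for \<nu>
  define u where "u \<nu> = (\<integral>x. Q x * of_real (hermite_fun \<nu> x) \<partial>lborel)" for \<nu>
  have nr: "sqrt (hermite_norm \<nu>) > 0" for \<nu> using hermite_norm_pos[of \<nu>] by simp
  have WE: "w x = W x * of_real (E x)" "nonlocal w x = Q x * of_real (E x)" for x
    using E(1)[of x] by (simp_all add: W_def Q_def)
  have hr: "E x * hermite \<nu> x = sqrt (hermite_norm \<nu>) * hermite_fun \<nu> x" for \<nu> x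
    using nr[of \<nu>] by (simp add: hermite_fun_def E_def)
  have hf: "of_real (E x) * of_real (hermite \<nu> x) = (of_real (sqrt (hermite_norm \<nu>)) * of_real (hermite_fun \<nu> x) :: complex)" for \<nu> x
    unfolding of_real_mult[symmetric] hr ..
  have wc: "(\<integral>x. w x * of_real (hermite \<nu> x) \<partial>lborel) = of_real (sqrt (hermite_norm \<nu>)) * c \<nu>" for \<nu>
  proof -
    have "w x * of_real (hermite \<nu> x) = of_real (sqrt (hermite_norm \<nu>)) * (W x * of_real (hermite_fun \<nu> x))" for x
      using hf[of x \<nu>] unfolding WE by (simp only: mult.assoc mult.left_commute[of _ "W x"])
    then show ?thesis unfolding c_def hermite_coeff_def by (simp only: integral_mult_right_zero)
  qed
  have c0: "c \<nu> = 0" if "\<nu> 1 + \<nu> 2 < k" for \<nu>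
    using wc[of \<nu>] low[OF that] nr[of \<nu>] by simp
  \<comment> \<open>The equation tested with the polynomial \<open>hermite \<nu>\<close> and divided
    by its norm. By \<open>hermite_eigen\<close>, diffusion and linear drift together multiply the
    coefficient by minus half the degree; t and u are the coefficients of advection and
    source.\<close>
  have I: "\<mu> * c \<nu> = - (of_real (deg \<nu>) * c \<nu>) + of_real \<alpha> * t \<nu> + of_real (\<alpha> / 2) * u \<nu>" for \<nu>
  proof -
    let ?f' = "\<lambda>j x. real (\<nu> j) * hermite (\<nu>(j := \<nu> j - 1)) x"
    let ?f'' = "\<lambda>j i x. real (\<nu> j) * (real ((\<nu>(j := \<nu> j - 1)) i) * hermite ((\<nu>(j := \<nu> j - 1))(i := (\<nu>(j := \<nu> j - 1)) i - 1)) x)"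
    let ?N = "sqrt (hermite_norm \<nu>)"
    have "(\<integral>x. w x * of_real (\<Sum>j\<in>UNIV. ?f'' j j x + lin_drift \<alpha> j x * ?f' j x) \<partial>lborel)
          + (\<integral>x. (of_real (\<alpha> / 2) * nonlocal w x) * of_real (hermite \<nu> x) \<partial>lborel) = \<mu> * (\<integral>x. w x * of_real (hermite \<nu> x) \<partial>lborel)"
    proof (rule weak_equation_poly[where f = "hermite \<nu>" and f' = ?f' and f'' = ?f'', OF weak wm])
      show "(\<lambda>x. of_real (\<alpha> / 2) * nonlocal w x) \<in> borel_measurable borel" by measurable
      show "integrable lborel (\<lambda>x. of_real (q x) * w x)" if "real_poly q" for q
        by (rule decay_poly_integrable(1)[OF m wm dw that])
      show "integrable lborel (\<lambda>x. of_real (q x) * (of_real (\<alpha> / 2) * nonlocal w x))" if "real_poly q" for q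
        using integrable_mult_right[OF decay_poly_integrable(1)[OF m nm dn that], of "of_real (\<alpha> / 2)"]
        by (simp only: mult.left_commute)
      show "lin_drift \<alpha> j \<in> borel_measurable borel" for j by (rule has_gradient_borel(1)[OF has_gradient_lin_drift])
      show "real_poly (\<lambda>x. (norm x)\<^sup>2 + (1 + \<bar>\<alpha>\<bar>))" by (intro real_poly.add real_poly_norm_sq real_poly.const)
      show "\<bar>lin_drift \<alpha> j x\<bar> \<le> (norm x)\<^sup>2 + (1 + \<bar>\<alpha>\<bar>)" for j x
      proof -
        have "\<bar>\<alpha> * v_gauss x $ j\<bar> \<le> \<bar>\<alpha>\<bar>"
          unfolding abs_mult using mult_left_mono[OF v_gauss_bounded[of x j], of "\<bar>\<alpha>\<bar>"] by simp
        moreover have "\<bar>x $ j\<bar> \<le> 1 + (norm x)\<^sup>2"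
          using component_le_norm_cart[of x j] sum_squares_bound[of 1 "norm x"] norm_ge_zero[of x] by simp
        moreover have "\<bar>- (x $ j) / 2\<bar> \<le> \<bar>x $ j\<bar>" by simp
        ultimately show ?thesis by linarith
      qed
    qed (intro real_poly_hermite real_poly_cmult has_gradient_hermite hermite_second_gradient)+
    moreover have "w x * of_real (\<Sum>j\<in>UNIV. ?f'' j j x + lin_drift \<alpha> j x * ?f' j x) =
      of_real ?N * (of_real (- deg \<nu>) * (W x * of_real (hermite_fun \<nu> x)) + of_real \<alpha> * (W x * of_real (vd \<nu> x)))" for x
    proof -
      have "?f'' j j x + lin_drift \<alpha> j x * ?f' j x = - (real (\<nu> j) / 2) * hermite \<nu> x + \<alpha> * (v_gauss x $ j * ?f' j x)" for j
        unfolding hermite_eigen[symmetric] by (simp add: algebra_simps)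
      then have "(\<Sum>j\<in>UNIV. ?f'' j j x + lin_drift \<alpha> j x * ?f' j x) =
         - deg \<nu> * hermite \<nu> x + \<alpha> * (\<Sum>j\<in>UNIV. v_gauss x $ j * ?f' j x)"
        unfolding sum_2 deg_def by (simp only: of_nat_add) (simp add: algebra_simps add_divide_distrib)
      moreover have "E x * hermite \<nu> x = ?N * hermite_fun \<nu> x"
        using nr[of \<nu>] by (simp add: hermite_fun_def E_def)
      moreover have "E x * (\<Sum>j\<in>UNIV. v_gauss x $ j * ?f' j x) = ?N * vd \<nu> x"
        unfolding vd_def hermite_deriv_def sum_2 E_def using nr[of \<nu>] by (simp add: algebra_simps)
      ultimately have "E x * (\<Sum>j\<in>UNIV. ?f'' j j x + lin_drift \<alpha> j x * ?f' j x) = ?N * (- deg \<nu> * hermite_fun \<nu> x + \<alpha> * vd \<nu> x)"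
        by (simp only: distrib_left mult.left_commute[of "E x"] mult.left_commute[of ?N])
      then have "of_real (E x) * of_real (\<Sum>j\<in>UNIV. ?f'' j j x + lin_drift \<alpha> j x * ?f' j x) = complex_of_real (?N * (- deg \<nu> * hermite_fun \<nu> x + \<alpha> * vd \<nu> x))"
        unfolding of_real_mult[symmetric] by (simp only:)
      then show ?thesis unfolding WE mult.assoc by (simp only:) (simp add: algebra_simps)
    qed
    moreover have "(of_real (\<alpha> / 2) * nonlocal w x) * of_real (hermite \<nu> x) = of_real ?N * (of_real (\<alpha> / 2) * (Q x * of_real (hermite_fun \<nu> x)))" for x
      using hf[of x \<nu>] unfolding WE mult.assoc by (simp only: mult.left_commute[of "complex_of_real ?N"])
    moreover have "(\<integral>x. of_real (- deg \<nu>) * (W x * of_real (hermite_fun \<nu> x)) + of_real \<alpha> * (W x * of_real (vd \<nu> x)) \<partial>lborel) =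
       of_real (- deg \<nu>) * c \<nu> + of_real \<alpha> * t \<nu>"
      unfolding c_def t_def hermite_coeff_def
      by (simp add: cs[OF W2 hermite_fun_square_integrable] cs[OF W2 vd2] integrable_mult_right del: of_real_minus)
    ultimately have "of_real ?N * (of_real (- deg \<nu>) * c \<nu> + of_real \<alpha> * t \<nu>) + of_real ?N * (of_real (\<alpha> / 2) * u \<nu>) = \<mu> * (of_real ?N * c \<nu>)"
      unfolding wc u_def by (simp only: integral_mult_right_zero)
    then have "complex_of_real ?N * ((of_real (- deg \<nu>) * c \<nu> + of_real \<alpha> * t \<nu>) + (of_real (\<alpha> / 2) * u \<nu>)) = of_real ?N * (\<mu> * c \<nu>)"
      by (simp only: distrib_left mult.left_commute)
    then have "(of_real (- deg \<nu>) * c \<nu> + of_real \<alpha> * t \<nu>) + (of_real (\<alpha> / 2) * u \<nu>) = \<mu> * c \<nu>"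
      using nr[of \<nu>] by (simp only: mult_cancel_left) auto
    then show ?thesis by (simp only: of_real_minus mult_minus_left)
  qed
  define S where "S n = hermite_proj W n" for n
  define V where "V n x = (\<Sum>j\<in>UNIV. of_real (v_gauss x $ j) * (\<Sum>\<nu>\<in>hermite_idx n. c \<nu> * of_real (hermite_deriv j \<nu> x)))" for n x
  have S_eq: "S n x = (\<Sum>\<nu>\<in>hermite_idx n. c \<nu> * of_real (hermite_fun \<nu> x))" for n x
    by (simp add: S_def hermite_proj_def c_def)
  have V_eq: "V n x = (\<Sum>\<nu>\<in>hermite_idx n. c \<nu> * of_real (vd \<nu> x))" for n x
    unfolding V_def vd_def sum_2 of_real_add of_real_mult by (simp add: sum_distrib_left sum.distrib algebra_simps)
  have LS: "L2_tendsto S W" using hermite_expansion[OF W2] unfolding S_def[abs_def] .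
  have S2: "square_integrable (S n)" for n by (rule L2_tendsto_square_integrable(1)[OF LS])
  have V2: "square_integrable (V n)" for n
    unfolding V_eq[abs_def] by (intro square_integrable_sum square_integrable_cmult vd2)
  define s where "s n = (\<Sum>\<nu>\<in>hermite_idx n. (cmod (c \<nu>))\<^sup>2)" for n
  define D where "D n = (\<Sum>\<nu>\<in>hermite_idx n. deg \<nu> * (cmod (c \<nu>))\<^sup>2)" for n
  define \<delta> where "\<delta> n = sqrt (\<integral>x. (cmod (W x - S n x))\<^sup>2 \<partial>lborel)" for n
  define H where "H = sqrt (\<integral>x. (cmod (Q x))\<^sup>2 \<partial>lborel)"
  have deg0: "deg \<nu> \<ge> 0" for \<nu> by (simp add: deg_def)
  have D0: "D n \<ge> 0" for n unfolding D_def by (intro sum_nonneg mult_nonneg_nonneg deg0) auto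
  have WV: "(\<integral>x. W x * cnj (V n x) \<partial>lborel) = (\<Sum>\<nu>\<in>hermite_idx n. cnj (c \<nu>) * t \<nu>)" for n
  proof -
    have "(\<integral>x. W x * cnj (V n x) \<partial>lborel) = (\<integral>x. (\<Sum>\<nu>\<in>hermite_idx n. cnj (c \<nu>) * (W x * of_real (vd \<nu> x))) \<partial>lborel)"
      unfolding V_eq by (simp add: sum_distrib_left mult_ac)
    then show ?thesis by (simp add: Bochner_Integration.integral_sum cs[OF W2 vd2] t_def)
  qed
  have QS: "(\<integral>x. Q x * cnj (S n x) \<partial>lborel) = (\<Sum>\<nu>\<in>hermite_idx n. cnj (c \<nu>) * u \<nu>)" for n
  proof -
    have "(\<integral>x. Q x * cnj (S n x) \<partial>lborel) = (\<integral>x. (\<Sum>\<nu>\<in>hermite_idx n. cnj (c \<nu>) * (Q x * of_real (hermite_fun \<nu> x))) \<partial>lborel)"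
      unfolding S_eq by (simp add: sum_distrib_left mult_ac)
    then show ?thesis by (simp add: Bochner_Integration.integral_sum cs[OF Q2 hermite_fun_square_integrable] u_def)
  qed
  \<comment> \<open>The coefficient equations are multiplied by \<open>cnj (c \<nu>)\<close> and
    summed over the box, so that the sums become pairings of W and Q with the partial sum and its
    advection.\<close>
  have id: "\<mu> * of_real (s n) = - of_real (D n) + of_real \<alpha> * (\<integral>x. W x * cnj (V n x) \<partial>lborel)
     + of_real (\<alpha> / 2) * (\<integral>x. Q x * cnj (S n x) \<partial>lborel)" for n
  proof -
    have "\<mu> * of_real (s n) = (\<Sum>\<nu>\<in>hermite_idx n. cnj (c \<nu>) * (\<mu> * c \<nu>))"
      unfolding s_def of_real_sum complex_norm_square sum_distrib_left by (simp add: mult_ac)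
    also have "\<dots> = (\<Sum>\<nu>\<in>hermite_idx n. - (of_real (deg \<nu>) * (c \<nu> * cnj (c \<nu>))) + of_real \<alpha> * (cnj (c \<nu>) * t \<nu>) + of_real (\<alpha> / 2) * (cnj (c \<nu>) * u \<nu>))"
      unfolding I by (intro sum.cong refl) (simp only: distrib_left mult_minus_right mult_ac)
    also have "\<dots> = - of_real (D n) + of_real \<alpha> * (\<Sum>\<nu>\<in>hermite_idx n. cnj (c \<nu>) * t \<nu>) + of_real (\<alpha> / 2) * (\<Sum>\<nu>\<in>hermite_idx n. cnj (c \<nu>) * u \<nu>)"
      unfolding D_def of_real_sum of_real_mult complex_norm_square sum.distrib sum_negf sum_distrib_left ..
    finally show ?thesis unfolding WV QS .
  qed
  \<comment> \<open>The vortex field is bounded by 1 in each component, so |V|^2 is at most twice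
    the sum of the squared derivatives; these derivatives are again orthogonal, and their total
    squared norm is D n.\<close>
  have Vn: "sqrt (\<integral>x. (cmod (V n x))\<^sup>2 \<partial>lborel) \<le> sqrt (2 * D n)" for n
  proof -
    define G where "G j x = (\<Sum>\<nu>\<in>hermite_idx n. c \<nu> * of_real (hermite_deriv j \<nu> x))" for j x
    have G2: "square_integrable (G j)" for j
      unfolding G_def[abs_def] by (intro square_integrable_sum square_integrable_cmult hermite_deriv_square_integrable)
    have pt: "(cmod (V n x))\<^sup>2 \<le> (\<Sum>j\<in>UNIV. 2 * (cmod (G j x))\<^sup>2)" for x
    proof -
      have g: "cmod (of_real (v_gauss x $ j) * G j x) \<le> cmod (G j x)" for j
        unfolding norm_mult norm_of_real using mult_right_mono[OF v_gauss_bounded[of x j], of "cmod (G j x)"] by simp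
      have "cmod (V n x) \<le> cmod (G 1 x) + cmod (G 2 x)"
        unfolding V_def G_def[symmetric] sum_2 by (rule order_trans[OF norm_triangle_ineq add_mono[OF g g]])
      then have "(cmod (V n x))\<^sup>2 \<le> (cmod (G 1 x) + cmod (G 2 x))\<^sup>2" by (rule power_mono) simp
      then show ?thesis unfolding sum_2 power2_sum using sum_squares_bound[of "cmod (G 1 x)" "cmod (G 2 x)"] by linarith
    qed
    have "(\<integral>x. (cmod (V n x))\<^sup>2 \<partial>lborel) \<le> (\<integral>x. (\<Sum>j\<in>UNIV. 2 * (cmod (G j x))\<^sup>2) \<partial>lborel)"
      by (rule integral_mono[OF square_integrableD(2)[OF V2] _ pt])
        (intro Bochner_Integration.integrable_sum integrable_mult_right square_integrableD(2)[OF G2])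
    also have "\<dots> = (\<Sum>j\<in>UNIV. 2 * (\<integral>x. (cmod (G j x))\<^sup>2 \<partial>lborel))"
      by (simp add: Bochner_Integration.integral_sum integrable_mult_right square_integrableD(2)[OF G2])
    also have "\<dots> = 2 * D n"
      unfolding G_def hermite_deriv_sum_norm[OF finite_hermite_idx] D_def deg_def sum_2
      by (simp add: sum.distrib[symmetric] sum_distrib_left add_divide_distrib algebra_simps)
    finally show ?thesis by simp
  qed
  \<comment> \<open>The pairing of S with its own advection has real part 0, so only W - S is paired
    with the advection, and Cauchy-Schwarz applies.\<close>
  have T1: "\<bar>Re (\<integral>x. W x * cnj (V n x) \<partial>lborel)\<bar> \<le> \<delta> n * sqrt (2 * D n)" for n
  proof -
    have z: "Re (\<integral>x. S n x * cnj (V n x) \<partial>lborel) = 0"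
      unfolding S_eq V_def by (rule hermite_sum_advection_antisymmetric[OF finite_hermite_idx])
    have d: "(\<integral>x. (W x - S n x) * cnj (V n x) \<partial>lborel) = (\<integral>x. W x * cnj (V n x) \<partial>lborel) - (\<integral>x. S n x * cnj (V n x) \<partial>lborel)"
      unfolding left_diff_distrib by (rule Bochner_Integration.integral_diff[OF cs[OF W2 square_integrable_cnj[OF V2]] cs[OF S2 square_integrable_cnj[OF V2]]])
    have "cmod (\<integral>x. (W x - S n x) * cnj (V n x) \<partial>lborel) \<le> \<delta> n * sqrt (\<integral>x. (cmod (V n x))\<^sup>2 \<partial>lborel)"
      using square_integrable_cauchy_schwarz(3)[OF square_integrable_diff[OF W2 S2] square_integrable_cnj[OF V2]] by (simp add: \<delta>_def)
    also have "\<dots> \<le> \<delta> n * sqrt (2 * D n)" by (intro mult_left_mono Vn) (simp add: \<delta>_def)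
    finally show ?thesis using abs_Re_le_cmod[of "\<integral>x. (W x - S n x) * cnj (V n x) \<partial>lborel"] z unfolding d by simp
  qed
  \<comment> \<open>Here the real part vanishes for W rather than for S: antisymmetry holds for the
    full function w that generates the velocity. The error is again the pairing with W - S.\<close>
  have T2: "\<bar>Re (\<integral>x. Q x * cnj (S n x) \<partial>lborel)\<bar> \<le> H * \<delta> n" for n
  proof -
    have z: "Re (\<integral>x. Q x * cnj (W x) \<partial>lborel) = 0"
    proof -
      have "Q x * cnj (W x) = (\<Sum>j\<in>UNIV. of_real (x $ j) * vel w j x) * cnj (w x)" for x
      proof -
        have "nonlocal w x = of_real (E x) * of_real (E x) * (\<Sum>j\<in>UNIV. of_real (x $ j) * vel w j x)"
          unfolding nonlocal_def E(2)[symmetric] of_real_mult ..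
        then show ?thesis using E(1)[of x] by (simp add: Q_def W_def)
      qed
      moreover have "square_integrable (\<lambda>x. of_real (norm x * (1 + (norm x)\<^sup>2)) * w x)"
      proof (rule square_integrable_bound)
        have "real_poly (\<lambda>x. (1 + (norm x)\<^sup>2) * (1 + (norm x)\<^sup>2))"
          by (intro real_poly.mult real_poly.add real_poly.const real_poly_norm_sq)
        from decay_poly_integrable(2)[OF m wm dw this]
        show "square_integrable (\<lambda>x. of_real ((1 + (norm x)\<^sup>2) * (1 + (norm x)\<^sup>2)) * w x)" .
        have "cmod (of_real (norm x * (1 + (norm x)\<^sup>2)) * w x) \<le> 1 * cmod (of_real ((1 + (norm x)\<^sup>2) * (1 + (norm x)\<^sup>2)) * w x)" for x
        proof -
          have p: "0 \<le> 1 + (norm x)\<^sup>2" by simp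
          have "2 * norm x \<le> 1 + (norm x)\<^sup>2" using sum_squares_bound[of 1 "norm x"] by simp
          then have "norm x \<le> 1 + (norm x)\<^sup>2" using norm_ge_zero[of x] by linarith
          then have "norm x * (1 + (norm x)\<^sup>2) \<le> (1 + (norm x)\<^sup>2) * (1 + (norm x)\<^sup>2)" by (rule mult_right_mono[OF _ p])
          then show ?thesis unfolding norm_mult norm_of_real abs_mult abs_of_nonneg[OF p] abs_norm_cancel mult_1
            by (rule mult_right_mono) simp
        qed
        then show "AE x in lborel. cmod (of_real (norm x * (1 + (norm x)\<^sup>2)) * w x) \<le> 1 * cmod (of_real ((1 + (norm x)\<^sup>2) * (1 + (norm x)\<^sup>2)) * w x)"
          by (intro AE_I2)
      qed measurable
      ultimately show ?thesis using nonlocal_antisymmetric[OF wm w2 w1] by (simp only:)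
    qed
    have d: "(\<integral>x. Q x * cnj (W x - S n x) \<partial>lborel) = (\<integral>x. Q x * cnj (W x) \<partial>lborel) - (\<integral>x. Q x * cnj (S n x) \<partial>lborel)"
      unfolding complex_cnj_diff right_diff_distrib
      by (rule Bochner_Integration.integral_diff[OF cs[OF Q2 square_integrable_cnj[OF W2]] cs[OF Q2 square_integrable_cnj[OF S2]]])
    have "cmod (\<integral>x. Q x * cnj (W x - S n x) \<partial>lborel) \<le> H * \<delta> n"
      using square_integrable_cauchy_schwarz(3)[OF Q2 square_integrable_cnj[OF square_integrable_diff[OF W2 S2]]]
      unfolding complex_mod_cnj H_def \<delta>_def .
    then show ?thesis using abs_Re_le_cmod[of "\<integral>x. Q x * cnj (W x - S n x) \<partial>lborel"] z unfolding d by simp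
  qed
  have ineq: "Re \<mu> * s n \<le> - D n + \<bar>\<alpha>\<bar> * (\<delta> n * sqrt (2 * D n)) + \<bar>\<alpha>\<bar> / 2 * H * \<delta> n" for n
  proof -
    let ?A = "Re (\<integral>x. W x * cnj (V n x) \<partial>lborel)" and ?B = "Re (\<integral>x. Q x * cnj (S n x) \<partial>lborel)"
    have "Re \<mu> * s n = - D n + \<alpha> * ?A + \<alpha> / 2 * ?B"
      using arg_cong[OF id[of n], of Re] by simp
    moreover have "\<alpha> * ?A \<le> \<bar>\<alpha>\<bar> * (\<delta> n * sqrt (2 * D n))"
      by (rule order_trans[OF abs_ge_self]) (unfold abs_mult, intro mult_left_mono T1 abs_ge_zero)
    moreover have "\<alpha> / 2 * ?B \<le> \<bar>\<alpha> / 2\<bar> * (H * \<delta> n)"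
      by (rule order_trans[OF abs_ge_self]) (unfold abs_mult[of "\<alpha> / 2"], intro mult_left_mono T2 abs_ge_zero)
    ultimately show ?thesis by (simp add: mult.assoc)
  qed
  \<comment> \<open>The vanishing moments act here: coefficients of degree below k are 0, and on the
    remaining indices the degree weight is at least k / 2.\<close>
  have Dk: "real k / 2 * s n \<le> D n" for n
    unfolding s_def D_def sum_distrib_left
  proof (rule sum_mono)
    fix \<nu>
    show "real k / 2 * (cmod (c \<nu>))\<^sup>2 \<le> deg \<nu> * (cmod (c \<nu>))\<^sup>2"
    proof (cases "\<nu> 1 + \<nu> 2 < k")
      case False
      then have "real k / 2 \<le> deg \<nu>" unfolding deg_def by (intro divide_right_mono of_nat_mono) auto
      then show ?thesis by (rule mult_right_mono) simp
    qed (simp add: c0)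
  qed
  have s_lim: "s \<longlonglongrightarrow> (\<integral>x. (cmod (W x))\<^sup>2 \<partial>lborel)"
  proof -
    have "of_real (s n) = (\<integral>x. S n x * cnj (S n x) \<partial>lborel)" for n
      unfolding norm_sq_integral[symmetric] S_eq hermite_sum_norm[OF finite_hermite_idx] s_def ..
    then have "(\<lambda>n. complex_of_real (s n)) \<longlonglongrightarrow> of_real (\<integral>x. (cmod (W x))\<^sup>2 \<partial>lborel)"
      using L2_tendsto_integral_mult[OF LS L2_tendsto_cnj[OF LS]] unfolding norm_sq_integral by simp
    then show ?thesis by (simp only: tendsto_of_real_iff)
  qed
  have "\<delta> \<longlonglongrightarrow> sqrt 0"
    unfolding \<delta>_def[abs_def] norm_minus_commute[of "W _"] using LS by (intro tendsto_real_sqrt) (simp add: L2_tendsto_def)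
  then have "\<delta> \<longlonglongrightarrow> 0" by simp
  moreover have "0 \<le> \<delta> n" "0 \<le> s n" for n by (simp_all add: \<delta>_def s_def sum_nonneg)
  ultimately have "(Re \<mu> + real k / 2) * (\<integral>x. (cmod (W x))\<^sup>2 \<partial>lborel) \<le> 0"
    by (intro galerkin_limit[OF ineq Dk D0 _ s_lim])
  then have "(\<integral>x. (cmod (W x))\<^sup>2 \<partial>lborel) \<le> 0"
    using \<mu> by (simp add: mult_le_0_iff)
  moreover have "0 \<le> (\<integral>x. (cmod (W x))\<^sup>2 \<partial>lborel)" by (intro integral_nonneg_AE) auto
  ultimately have "(\<integral>x. (cmod (W x))\<^sup>2 \<partial>lborel) = 0" by simp
  then have "AE x in lborel. (cmod (W x))\<^sup>2 = 0"
    using integral_nonneg_eq_0_iff_AE[OF square_integrableD(2)[OF W2]] by simp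
  then show ?thesis by eventually_elim (use E(1) in \<open>auto simp: W_def less_le\<close>)
qed

text \<open>An eigenvalue above the maximum exceeds both of its entries: exceeding (1 - m) / 2 gives
  the Gaussian decay, and exceeding - k / 2 then forces the eigenfunction to vanish. The number k
  says below which degree the Hermite moments are 0.\<close>

lemma eigenvalue_bound:
  assumes m: "m > 1" and w: "w \<in> L2 m" and nz: "\<not> (AE \<xi> in lebesgue. w \<xi> = 0)"
    and eq: "distr_eq (\<lambda>\<phi>. op_L w \<phi> - complex_of_real \<alpha> * op_Lambda w \<phi>) (\<lambda>\<phi>. \<mu> * distr_of w \<phi>)"
    and low: "\<And>\<nu>. \<nu> 1 + \<nu> 2 < k \<Longrightarrow> (LINT \<xi>|lebesgue. of_real (hermite \<nu> \<xi>) * w \<xi>) = 0"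
  shows "Re \<mu> \<le> max (- (real k / 2)) ((1 - m) / 2)"
proof (rule ccontr)
  assume "\<not> ?thesis"
  then have \<mu>: "Re \<mu> > - (real k / 2)" "Re \<mu> > (1 - m) / 2"
    by (simp_all only: not_le max_less_iff_conj)
  have wm: "w \<in> borel_measurable lebesgue" and wL: "integrable lebesgue (\<lambda>\<xi>. (1 + (norm \<xi>)\<^sup>2) powr m * (cmod (w \<xi>))\<^sup>2)"
    using w by (auto simp: L2_def)
  obtain v where v [measurable]: "v \<in> borel_measurable borel" and wv: "AE x in lborel. w x = v x"
    by (rule lebesgue_borel_representative[OF wm])
  note rep = lebesgue_integral_representative[OF wm v wv]
  have "(\<lambda>(z, x). (1 + (norm x)\<^sup>2) powr m * (cmod z)\<^sup>2) \<in> borel_measurable (borel \<Otimes>\<^sub>M (borel :: (real^2) measure))"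
    by measurable
  from iffD1[OF rep(2)[where F = "\<lambda>z x. (1 + (norm x)\<^sup>2) powr m * (cmod z)\<^sup>2", OF this] wL]
  have vL: "integrable lborel (\<lambda>x. (1 + (norm x)\<^sup>2) powr m * (cmod (v x))\<^sup>2)" .
  note vf = weighted_L2_facts[OF m v vL]
  have hv: "square_integrable (nonlocal v)"
  proof -
    obtain C where C: "\<And>p. p \<in> borel_measurable borel \<Longrightarrow> (\<And>x. 0 \<le> p x) \<Longrightarrow> (\<And>x. p x \<le> decay_weight m x) \<Longrightarrow>
       square_integrable (\<lambda>x. of_real (p x) * nonlocal v x) \<and>
       (\<integral>x. (cmod (of_real (p x) * nonlocal v x))\<^sup>2 \<partial>lborel) \<le> C"
      using nonlocal_decay_weighted[OF v vf(1,3), of m] m by auto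
    have "1 \<le> decay_weight m x" for x
      unfolding decay_weight_def using m mult_mono[of 1 "(1 + (norm x)\<^sup>2) powr (m / 2)" 1 "exp ((norm x)\<^sup>2 / 8)"]
      by (simp add: ge_one_powr_ge_zero)
    then show ?thesis using C[of "\<lambda>x. 1"] by simp
  qed
  have weak: "weak_equation (lin_drift \<alpha>) (\<lambda>x. of_real (\<alpha> / 2) * nonlocal v x) \<mu> v"
    by (rule eigen_weak_equation[OF wm v wv eq vf(1) hv])
  have "AE x in lborel. v x = 0"
  proof (rule galerkin_vanishing[OF m v vf(1,3) eigenfunction_decay[OF m v vL weak \<mu>(2)] weak _ \<mu>(1)])
    fix \<nu> :: "2 \<Rightarrow> nat" assume "\<nu> 1 + \<nu> 2 < k"
    have [measurable]: "hermite \<nu> \<in> borel_measurable borel" by (rule real_poly_borel[OF real_poly_hermite])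
    have "(\<integral>x. of_real (hermite \<nu> x) * v x \<partial>lborel) = 0"
      using low[OF \<open>\<nu> 1 + \<nu> 2 < k\<close>] rep(1)[of "\<lambda>z x. of_real (hermite \<nu> x) * z"] by simp
    then show "(\<integral>x. v x * of_real (hermite \<nu> x) \<partial>lborel) = 0" by (simp only: mult.commute)
  qed
  with wv have "AE x in lborel. w x = 0" by eventually_elim simp
  then show False using nz AE_completion by blast
qed

theorem proposition4p1:
  fixes m \<alpha> :: real
  assumes "m > 1"
  shows "(\<forall>\<mu>. is_eigenvalue m \<alpha> (L2_0 m) \<mu> \<longrightarrow> Re \<mu> \<le> max (- 1 / 2) ((1 - m) / 2)) \<and>
         (m > 2 \<longrightarrow>
           (\<forall>\<mu>. is_eigenvalue m \<alpha> (L2_1 m) \<mu> \<longrightarrow> Re \<mu> \<le> max (- 1) ((1 - m) / 2)))"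
proof (intro conjI allI impI)
  fix \<mu> assume "is_eigenvalue m \<alpha> (L2_0 m) \<mu>"
  then obtain w where w: "w \<in> L2_0 m" "\<not> (AE \<xi> in lebesgue. w \<xi> = 0)"
    "distr_eq (\<lambda>\<phi>. op_L w \<phi> - complex_of_real \<alpha> * op_Lambda w \<phi>) (\<lambda>\<phi>. \<mu> * distr_of w \<phi>)"
    unfolding is_eigenvalue_def by blast
  have "Re \<mu> \<le> max (- (real 1 / 2)) ((1 - m) / 2)"
  proof (rule eigenvalue_bound[OF assms _ w(2,3)])
    show "w \<in> L2 m" using w(1) by (simp add: L2_0_def)
    show "(LINT \<xi>|lebesgue. of_real (hermite \<nu> \<xi>) * w \<xi>) = 0" if "\<nu> 1 + \<nu> 2 < 1" for \<nu>
      using w(1) that by (simp add: L2_0_def hermite_def)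
  qed
  then show "Re \<mu> \<le> max (- 1 / 2) ((1 - m) / 2)" by simp
next
  fix \<mu> assume "is_eigenvalue m \<alpha> (L2_1 m) \<mu>"
  then obtain w where w: "w \<in> L2_1 m" "\<not> (AE \<xi> in lebesgue. w \<xi> = 0)"
    "distr_eq (\<lambda>\<phi>. op_L w \<phi> - complex_of_real \<alpha> * op_Lambda w \<phi>) (\<lambda>\<phi>. \<mu> * distr_of w \<phi>)"
    unfolding is_eigenvalue_def by blast
  have "Re \<mu> \<le> max (- (real 2 / 2)) ((1 - m) / 2)"
  proof (rule eigenvalue_bound[OF assms _ w(2,3)])
    show "w \<in> L2 m" using w(1) by (simp add: L2_1_def L2_0_def)
    fix \<nu> :: "2 \<Rightarrow> nat" assume "\<nu> 1 + \<nu> 2 < 2"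
    \<comment> \<open>The Hermite polynomials of degree at most 1 are the constant 1 and the two
      coordinates, so mass and first moments are exactly the moments demanded.\<close>
    then consider "\<nu> 1 = 0" "\<nu> 2 = 0" | "\<nu> 1 = 1" "\<nu> 2 = 0" | "\<nu> 1 = 0" "\<nu> 2 = 1" by linarith
    then show "(LINT \<xi>|lebesgue. of_real (hermite \<nu> \<xi>) * w \<xi>) = 0"
      using w(1) by cases (simp_all add: L2_1_def L2_0_def hermite_def)
  qed
  then show "Re \<mu> \<le> max (- 1) ((1 - m) / 2)" by simp
qed

end
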